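(* Let $r$ be an integer with $1\le r<2n$, let $\rho_1\in\mathrm{Alg}(G_r)$, $\rho_2\in\mathrm{Alg}(G_{2n-r})$ and put $\pi=i_{P_{r,2n-r}}^{G_{2n}}(\rho_1\otimes\rho_2)$. Then $\pi_{N,\psi}$ is non-zero if and only if there exists an integer $k$ with $\max\{0,r-n\}\le k\le\lfloor\frac r2\rfloor$ for which the twisted Jacquet modules $(\rho_1)_{N(k,1),\psi_{k,1}}$ and $(\rho_2)_{N(k,2),\psi_{k,2}}$ are both non-zero.
   Context: $F$ is a non-archimedean local field, $\mathcal M_{m,n}$ is the space of $m\times n$ matrices over $F$, $\mathcal M_n=\mathcal M_{n,n}$, $G_n=GL_n(F)$; blocks of size $0$ are omitted. $\mathrm{Alg}(G)$ is the category of smooth complex representations of $G$. $P_{r,2n-r}$ is the standard block upper triangular parabolic of $G_{2n}$; $i_{P_{r,2n-r}}^{G_{2n}}$ denotes normalized parabolic induction (the inducing representation of the Levi $G_r\times G_{2n-r}$ being extended trivially on the unipotent radical). $\psi_0$ is a fixed non-trivial additive character of $F$; $N=\left\{\begin{pmatrix} I_n&x\\0&I_n\end{pmatrix}:x\in\mathcal M_n\right\}\subset G_{2n}$ and $\psi\begin{pmatrix} I_n&x\\0&I_n\end{pmatrix}=\psi_0(\mathrm{tr}(x))$. For each $k$, $$N(k,1)=\left\{\begin{pmatrix} I_k&x&y\\0&I_k&0\\0&0&I_{r-2k}\end{pmatrix}:x\in\mathcal M_k,\ y\in\mathcal M_{k,r-2k}\right\}\subset G_r,\qquad N(k,2)=\left\{\begin{pmatrix}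 I_{r-2k}&0&w\\0&I_{n-r+k}&z\\0&0&I_{n-r+k}\end{pmatrix}:w\in\mathcal M_{r-2k,n-r+k},\ z\in\mathcal M_{n-r+k}\right\}\subset G_{2n-r},$$ with characters $\psi_{k,1}=\psi_0(\mathrm{tr}(x))$ and $\psi_{k,2}=\psi_0(\mathrm{tr}(z))$ on these elements. For a smooth representation $(\pi,V)$ of $G$, a closed subgroup $U$ that is a union of its compact open subgroups and a character $\theta$ of $U$, the twisted Jacquet module $\pi_{U,\theta}$ is the space $V/\langle\pi(u)v-\theta(u)v:u\in U,v\in V\rangle$. *)

theory Defs
  imports
    "HOL-Analysis.Abstract_Metric_Spaces"
    "HOL-Analysis.Function_Topology"
    "HOL-Library.Poly_Mapping"
    "HOL-Library.Function_Algebras"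
    "HOL-Algebra.Coset"
    "Jordan_Normal_Form.Determinant"
begin

class complex_vector = ab_group_add +
  fixes scaleC :: "complex \<Rightarrow> 'a \<Rightarrow> 'a"  (infixr \<open>*\<^sub>C\<close> 75)
  assumes scaleC_add_right: "c *\<^sub>C (x + y) = c *\<^sub>C x + c *\<^sub>C y"
    and scaleC_add_left: "(c + d) *\<^sub>C x = c *\<^sub>C x + d *\<^sub>C x"
    and scaleC_scaleC: "c *\<^sub>C d *\<^sub>C x = (c * d) *\<^sub>C x"
    and scaleC_one: "1 *\<^sub>C x = x"

global_interpretation complex_vector: vector_space "scaleC :: complex \<Rightarrow> 'a \<Rightarrow> 'a::complex_vector"
  by standard (simp_all add: scaleC_add_right scaleC_add_left scaleC_scaleC scaleC_one)

abbreviation clinear :: "('v::complex_vector \<Rightarrow> 'w::complex_vector) \<Rightarrow> bool"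
  where "clinear \<equiv> Vector_Spaces.linear scaleC scaleC"

instantiation complex :: complex_vector
begin
definition scaleC_complex :: "complex \<Rightarrow> complex \<Rightarrow> complex" where "scaleC_complex = (*)"
instance by standard (simp_all add: scaleC_complex_def algebra_simps)
end

instantiation "fun" :: (type, complex_vector) complex_vector
begin
definition scaleC_fun :: "complex \<Rightarrow> ('a \<Rightarrow> 'b) \<Rightarrow> 'a \<Rightarrow> 'b"
  where "scaleC_fun c f = (\<lambda>x. c *\<^sub>C f x)"
instance
  by standard (simp_all add: scaleC_fun_def fun_eq_iff scaleC_add_right scaleC_add_left
      scaleC_scaleC)
end

instantiation poly_mapping :: (type, complex_vector) complex_vector
begin
definition scaleC_poly_mapping :: "complex \<Rightarrow> ('a \<Rightarrow>\<^sub>0 'b) \<Rightarrow> 'a \<Rightarrow>\<^sub>0 'b"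
  where "scaleC_poly_mapping c = Poly_Mapping.map (scaleC c)"
lemma lookup_scaleC:
  "Poly_Mapping.lookup (c *\<^sub>C p) k = c *\<^sub>C Poly_Mapping.lookup (p :: 'a \<Rightarrow>\<^sub>0 'b) k"
  by (simp add: scaleC_poly_mapping_def map.rep_eq when_def)
instance
  by standard (rule poly_mapping_eqI,
    simp add: lookup_scaleC lookup_add scaleC_add_right scaleC_add_left scaleC_scaleC)+
end

text \<open>The underlying set of the quotient space \<open>V / W\<close>; its zero element is the coset \<open>W\<close>.\<close>

definition quotient_space :: "'v::complex_vector set \<Rightarrow> 'v set \<Rightarrow> 'v set set"
  where "quotient_space V W = V // {(x, y). x \<in> V \<and> y \<in> V \<and> x - y \<in> W}"

text \<open>The quotient of the free complex vector space on \<open>V \<times> W\<close> by the bilinearity relations.\<close>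

definition tensor_relations :: "(('v::complex_vector \<times> 'w::complex_vector) \<Rightarrow>\<^sub>0 complex) set" where
  "tensor_relations =
     {Poly_Mapping.single (v + v', w) 1 - Poly_Mapping.single (v, w) 1
        - Poly_Mapping.single (v', w) 1 | v v' w. True}
   \<union> {Poly_Mapping.single (v, w + w') 1 - Poly_Mapping.single (v, w) 1
        - Poly_Mapping.single (v, w') 1 | v w w'. True}
   \<union> {Poly_Mapping.single (c *\<^sub>C v, w) 1 - Poly_Mapping.single (v, w) c | c v w. True}
   \<union> {Poly_Mapping.single (v, c *\<^sub>C w) 1 - Poly_Mapping.single (v, w) c | c v w. True}"

quotient_type (overloaded) ('v, 'w) tensor =
  "('v::complex_vector \<times> 'w::complex_vector) \<Rightarrow>\<^sub>0 complex" /
  "\<lambda>p q. p - q \<in> complex_vector.span tensor_relations"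
proof (intro equivpI reflpI sympI transpI)
  fix p q s :: "('v \<times> 'w) \<Rightarrow>\<^sub>0 complex"
  show "p - p \<in> complex_vector.span tensor_relations"
    by (simp add: complex_vector.span_zero)
  show "q - p \<in> complex_vector.span tensor_relations"
    if "p - q \<in> complex_vector.span tensor_relations"
    using complex_vector.span_neg[OF that] by simp
  show "p - s \<in> complex_vector.span tensor_relations"
    if "p - q \<in> complex_vector.span tensor_relations"
      and "q - s \<in> complex_vector.span tensor_relations"
    using complex_vector.span_add[OF that] by simp
qed

instantiation tensor :: (complex_vector, complex_vector) complex_vector
begin

lift_definition zero_tensor :: "('a, 'b) tensor" is 0 .

lift_definition plus_tensor :: "('a, 'b) tensor \<Rightarrow> ('a, 'b) tensor \<Rightarrow> ('a, 'b) tensor" is "(+)"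
  by (simp add: add_diff_add complex_vector.span_add)

lift_definition uminus_tensor :: "('a, 'b) tensor \<Rightarrow> ('a, 'b) tensor" is uminus
  by (drule complex_vector.span_neg) (simp add: algebra_simps)

lift_definition minus_tensor :: "('a, 'b) tensor \<Rightarrow> ('a, 'b) tensor \<Rightarrow> ('a, 'b) tensor" is "(-)"
  by (drule (1) complex_vector.span_diff) (simp add: algebra_simps)

lift_definition scaleC_tensor :: "complex \<Rightarrow> ('a, 'b) tensor \<Rightarrow> ('a, 'b) tensor" is scaleC
  by (simp add: complex_vector.span_scale flip: complex_vector.scale_right_diff_distrib)

instance
proof
  fix x y z :: "('a, 'b) tensor" and c d
  show "x + y + z = x + (y + z)" by transfer (simp add: add.assoc complex_vector.span_zero)
  show "x + y = y + x" by transfer (simp add: add.commute complex_vector.span_zero)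
  show "0 + x = x" by transfer (simp add: complex_vector.span_zero)
  show "- x + x = 0" by transfer (simp add: complex_vector.span_zero)
  show "x - y = x + - y" by transfer (simp add: complex_vector.span_zero)
  show "c *\<^sub>C (x + y) = c *\<^sub>C x + c *\<^sub>C y"
    by transfer (simp add: scaleC_add_right complex_vector.span_zero)
  show "(c + d) *\<^sub>C x = c *\<^sub>C x + d *\<^sub>C x"
    by transfer (simp add: scaleC_add_left complex_vector.span_zero)
  show "c *\<^sub>C d *\<^sub>C x = (c * d) *\<^sub>C x"
    by transfer (simp add: scaleC_scaleC complex_vector.span_zero)
  show "1 *\<^sub>C x = x" by transfer (simp add: complex_vector.span_zero)
qed

end

lift_definition pure_tensor :: "'v::complex_vector \<Rightarrow> 'w::complex_vector \<Rightarrow> ('v, 'w) tensor"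
    (infixr \<open>\<otimes>\<^sub>t\<close> 76)
  is "\<lambda>v w. Poly_Mapping.single (v, w) 1" .

lemma scaleC_single:
  "c *\<^sub>C Poly_Mapping.single k d = Poly_Mapping.single k (c *\<^sub>C d)"
  by (rule poly_mapping_eqI) (simp add: lookup_scaleC lookup_single when_def)

lemma tensor_bilinear:
  "(v + v') \<otimes>\<^sub>t w = v \<otimes>\<^sub>t w + v' \<otimes>\<^sub>t w"
  "v \<otimes>\<^sub>t (w + w') = v \<otimes>\<^sub>t w + v \<otimes>\<^sub>t w'"
  "(c *\<^sub>C v) \<otimes>\<^sub>t w = c *\<^sub>C (v \<otimes>\<^sub>t w)"
  "v \<otimes>\<^sub>t (c *\<^sub>C w) = c *\<^sub>C (v \<otimes>\<^sub>t w)"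
  by (transfer, rule complex_vector.span_base,
      fastforce simp: tensor_relations_def diff_diff_eq scaleC_single scaleC_complex_def)+

definition free_extend :: "('b \<Rightarrow> 'x::complex_vector) \<Rightarrow> ('b \<Rightarrow>\<^sub>0 complex) \<Rightarrow> 'x"
  where "free_extend F p = (\<Sum>k\<in>Poly_Mapping.keys p. Poly_Mapping.lookup p k *\<^sub>C F k)"

lemma free_extend_superset:
  assumes "finite A" and "Poly_Mapping.keys p \<subseteq> A"
  shows "free_extend F p = (\<Sum>k\<in>A. Poly_Mapping.lookup p k *\<^sub>C F k)"
  unfolding free_extend_def
  by (rule sum.mono_neutral_left) (use assms in \<open>auto simp: in_keys_iff\<close>)

lemma clinear_iff:
  "clinear f \<longleftrightarrow> (\<forall>x y. f (x + y) = f x + f y) \<and> (\<forall>c x. f (c *\<^sub>C x) = c *\<^sub>C f x)"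
  by (simp add: Vector_Spaces.linear_iff complex_vector.vector_space_axioms)

lemma clinearI:
  assumes "\<And>x y. f (x + y) = f x + f y" and "\<And>c x. f (c *\<^sub>C x) = c *\<^sub>C f x"
  shows "clinear f"
  using assms by (simp add: clinear_iff)

lemma clinear_free_extend: "clinear (free_extend F)"
proof (rule clinearI)
  fix p q :: "'a \<Rightarrow>\<^sub>0 complex"
  let ?A = "Poly_Mapping.keys p \<union> Poly_Mapping.keys q"
  have "Poly_Mapping.keys (p + q) \<subseteq> ?A" by (rule Poly_Mapping.keys_add)
  then show "free_extend F (p + q) = free_extend F p + free_extend F q"
    by (simp add: free_extend_superset[of ?A] lookup_add scaleC_add_left sum.distrib)
next
  fix c and p :: "'a \<Rightarrow>\<^sub>0 complex"
  have "Poly_Mapping.keys (c *\<^sub>C p) \<subseteq> Poly_Mapping.keys p"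
    by (auto simp: in_keys_iff lookup_scaleC scaleC_complex_def)
  then show "free_extend F (c *\<^sub>C p) = c *\<^sub>C free_extend F p"
    by (simp add: free_extend_superset[of "Poly_Mapping.keys p"] lookup_scaleC scaleC_complex_def
        complex_vector.scale_sum_right)
qed

lemma free_extend_single: "free_extend F (Poly_Mapping.single k c) = c *\<^sub>C F k"
  by (subst free_extend_superset[of "{k}"]) auto

lemma linear_free_unique:
  assumes "clinear L" and "clinear M"
    and eq: "\<And>k. L (Poly_Mapping.single k (1::complex)) = M (Poly_Mapping.single k 1)"
  shows "L p = M p"
proof (induction p rule: update_induct)
  case const
  have "L 0 = 0" "M 0 = 0"
    using assms(1,2) by (metis add_cancel_right_right add_0 clinear_iff)+
  then show ?case by simp
next
  case (update p k c)
  have "Poly_Mapping.update k c p = p + c *\<^sub>C Poly_Mapping.single k 1"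
    using update.hyps
    by (intro poly_mapping_eqI)
      (auto simp: lookup_update lookup_add lookup_scaleC lookup_single when_def in_keys_iff
        scaleC_complex_def)
  then show ?case using assms update by (simp add: clinear_iff)
qed

lemma ex1_tensor_lift:
  fixes B :: "'v::complex_vector \<Rightarrow> 'w::complex_vector \<Rightarrow> 'x::complex_vector"
  assumes B: "\<And>v. clinear (B v)" "\<And>w. clinear (\<lambda>v. B v w)"
  shows "\<exists>!L. clinear L \<and> (\<forall>v w. L (v \<otimes>\<^sub>t w) = B v w)"
proof -
  define F where "F = free_extend (\<lambda>(v, w). B v w)"
  have F: "clinear F" unfolding F_def by (rule clinear_free_extend)
  note F' = F[unfolded clinear_iff] and B' = B[unfolded clinear_iff]
  have F_diff: "F (p - q) = F p - F q" for p q
    using F' by (metis add_diff_cancel_right' diff_add_cancel)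
  have "complex_vector.subspace {p. F p = 0}"
    using F' by (auto simp: complex_vector.subspace_def) (metis add_cancel_right_right)
  moreover have "tensor_relations \<subseteq> {p. F p = 0}"
    using B' by (auto simp: tensor_relations_def F_diff)
      (auto simp: F_def free_extend_single)
  ultimately have F0: "F p = 0" if "p \<in> complex_vector.span tensor_relations" for p
    using complex_vector.span_minimal[of tensor_relations "{p. F p = 0}"] that by blast
  define L where "L t = F (rep_tensor t)" for t
  have L_abs: "L (abs_tensor p) = F p" for p
  proof -
    have "rep_tensor (abs_tensor p) - p \<in> complex_vector.span tensor_relations"
      using Quotient3_rep_abs[OF Quotient3_tensor, of p]
      by (simp add: complex_vector.span_zero)
    from F0[OF this] show ?thesis by (simp add: L_def F_diff)
  qed
  have surj: "\<exists>p. t = abs_tensor p" for t :: "('v, 'w) tensor"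
    by (metis Quotient3_abs_rep[OF Quotient3_tensor])
  have "clinear L"
  proof (rule clinearI)
    fix s t :: "('v, 'w) tensor" and c
    obtain p q where "s = abs_tensor p" "t = abs_tensor q" using surj by metis
    then show "L (s + t) = L s + L t" "L (c *\<^sub>C s) = c *\<^sub>C L s"
      using F' by (auto simp: L_abs plus_tensor.abs_eq scaleC_tensor.abs_eq)
  qed
  moreover have "L (v \<otimes>\<^sub>t w) = B v w" for v w
    by (simp add: pure_tensor.abs_eq L_abs F_def free_extend_single)
  moreover have "M = L" if M: "clinear M" "\<forall>v w. M (v \<otimes>\<^sub>t w) = B v w" for M
  proof
    fix t :: "('v, 'w) tensor"
    obtain p where p: "t = abs_tensor p" using surj by metis
    have "clinear (\<lambda>p. M (abs_tensor p))"
      using M(1) by (intro clinearI)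
        (simp_all add: clinear_iff flip: plus_tensor.abs_eq scaleC_tensor.abs_eq)
    from linear_free_unique[OF this F, of p] show "M t = L t"
      using M(2) by (force simp: p L_abs F_def free_extend_single pure_tensor.abs_eq)
  qed
  ultimately show ?thesis by blast
qed

text \<open>\<open>tensor_map f g\<close> is the map usually written \<open>f \<otimes> g\<close>. For linear \<open>f\<close> and \<open>g\<close> the
  description is satisfied by exactly one map, see \<open>ex1_tensor_map\<close>.\<close>

definition tensor_map :: "('v::complex_vector \<Rightarrow> 'v'::complex_vector) \<Rightarrow>
    ('w::complex_vector \<Rightarrow> 'w'::complex_vector) \<Rightarrow> ('v, 'w) tensor \<Rightarrow> ('v', 'w') tensor"
  where "tensor_map f g =
    (THE L. clinear L \<and> (\<forall>v w. L (v \<otimes>\<^sub>t w) = f v \<otimes>\<^sub>t g w))"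

lemma ex1_tensor_map:
  assumes "clinear f" and "clinear g"
  shows "\<exists>!L. clinear L \<and> (\<forall>v w. L (v \<otimes>\<^sub>t w) = f v \<otimes>\<^sub>t g w)"
  using assms by (intro ex1_tensor_lift)
    (auto intro!: clinearI simp: clinear_iff tensor_bilinear)

definition field_topology :: "('a::field \<Rightarrow> real) \<Rightarrow> 'a topology"
  where "field_topology absv = Metric_space.mtopology UNIV (\<lambda>x y. absv (x - y))"

text \<open>Complete discretely valued fields with finite residue field, with the absolute value
  normalized: a generator of the maximal ideal has absolute value \<open>1 / q\<close>, where \<open>q\<close> is the
  cardinality of the residue field. The modulus character below relies on this normalization.\<close>

definition residue_field :: "('a::field \<Rightarrow> real) \<Rightarrow> 'a set set"
  where "residue_field absv =
    {x. absv x \<le> 1} // {(x, y). absv x \<le> 1 \<and> absv y \<le> 1 \<and> absv (x - y) < 1}"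

locale nonarchimedean_local_field =
  fixes absv :: "'a::field \<Rightarrow> real"
  assumes absv_nonneg: "0 \<le> absv x"
    and absv_eq_0_iff: "absv x = 0 \<longleftrightarrow> x = 0"
    and absv_mult: "absv (x * y) = absv x * absv y"
    and absv_ultrametric: "absv (x + y) \<le> max (absv x) (absv y)"
    and complete: "Metric_space.mcomplete UNIV (\<lambda>x y. absv (x - y))"
    and finite_residue_field: "finite (residue_field absv)"
    and uniformizer: "\<exists>\<pi>. absv \<pi> = 1 / real (card (residue_field absv)) \<and>
          {x. absv x < 1} = {\<pi> * y | y. absv y \<le> 1}"

definition nontrivial_additive_character :: "('a::field \<Rightarrow> real) \<Rightarrow> ('a \<Rightarrow> complex) \<Rightarrow> bool"
  where "nontrivial_additive_character absv \<psi> \<longleftrightarrow>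
    (\<forall>x y. \<psi> (x + y) = \<psi> x * \<psi> y) \<and> (\<forall>x. cmod (\<psi> x) = 1) \<and>
    continuous_map (field_topology absv) euclidean \<psi> \<and> (\<exists>x. \<psi> x \<noteq> 1)"

definition GL :: "nat \<Rightarrow> 'a::field mat monoid"
  where "GL n = units_of (ring_mat TYPE('a) n ())"

text \<open>\<open>GL n\<close> as a subspace of \<open>n \<times> n\<close> matrices with the product topology of the entries.\<close>

definition GL_topology :: "('a::field \<Rightarrow> real) \<Rightarrow> nat \<Rightarrow> 'a mat topology"
  where "GL_topology absv n =
    pullback_topology (carrier (GL n)) (\<lambda>A. \<lambda>ij\<in>{..<n} \<times> {..<n}. A $$ ij)
      (product_topology (\<lambda>_. field_topology absv) ({..<n} \<times> {..<n}))"

definition smooth_rep ::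
    "('a::field \<Rightarrow> real) \<Rightarrow> nat \<Rightarrow> ('a mat \<Rightarrow> 'v::complex_vector \<Rightarrow> 'v) \<Rightarrow> bool"
  where "smooth_rep absv n \<rho> \<longleftrightarrow>
    (\<forall>g \<in> carrier (GL n). clinear (\<rho> g)) \<and>
    \<rho> (1\<^sub>m n) = id \<and>
    (\<forall>g \<in> carrier (GL n). \<forall>h \<in> carrier (GL n). \<rho> (g * h) = \<rho> g \<circ> \<rho> h) \<and>
    (\<forall>v. openin (GL_topology absv n) {g \<in> carrier (GL n). \<rho> g v = v})"

text \<open>Twisted Jacquet modules of a representation \<open>\<pi>\<close> whose space is the subspace \<open>V\<close>.\<close>

definition jacquet_kernel :: "'v::complex_vector set \<Rightarrow> ('g \<Rightarrow> 'v \<Rightarrow> 'v) \<Rightarrow> 'g set \<Rightarrow>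
    ('g \<Rightarrow> complex) \<Rightarrow> 'v set"
  where "jacquet_kernel V \<pi> U \<theta> =
    complex_vector.span {\<pi> u v - \<theta> u *\<^sub>C v | u v. u \<in> U \<and> v \<in> V}"

definition twisted_jacquet_module :: "'v::complex_vector set \<Rightarrow> ('g \<Rightarrow> 'v \<Rightarrow> 'v) \<Rightarrow> 'g set \<Rightarrow>
    ('g \<Rightarrow> complex) \<Rightarrow> 'v set set"
  where "twisted_jacquet_module V \<pi> U \<theta> = quotient_space V (jacquet_kernel V \<pi> U \<theta>)"

definition twisted_jacquet_nonzero :: "'v::complex_vector set \<Rightarrow> ('g \<Rightarrow> 'v \<Rightarrow> 'v) \<Rightarrow> 'g set \<Rightarrow>
    ('g \<Rightarrow> complex) \<Rightarrow> bool"
  where "twisted_jacquet_nonzero V \<pi> U \<theta> \<longleftrightarrow>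
    (\<exists>C \<in> twisted_jacquet_module V \<pi> U \<theta>. C \<noteq> jacquet_kernel V \<pi> U \<theta>)"

text \<open>The modulus character of the standard parabolic with Levi \<open>GL r \<times> GL m\<close> at an element with
  diagonal blocks \<open>a\<close>, \<open>d\<close>: the module of \<open>x \<mapsto> a x d\<^sup>-\<^sup>1\<close> on \<open>r \<times> m\<close> matrices.\<close>

definition parabolic_modulus :: "('a::field \<Rightarrow> real) \<Rightarrow> nat \<Rightarrow> nat \<Rightarrow> 'a mat \<Rightarrow> 'a mat \<Rightarrow> real"
  where "parabolic_modulus absv r m a d = absv (det a) ^ m / absv (det d) ^ r"

text \<open>Functions on \<open>GL (r + m)\<close> are encoded as functions on all matrices vanishing elsewhere.\<close>

definition parabolic_induction_space :: "('a::field \<Rightarrow> real) \<Rightarrow> nat \<Rightarrow> nat \<Rightarrow>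
    ('a mat \<Rightarrow> 'v::complex_vector \<Rightarrow> 'v) \<Rightarrow> ('a mat \<Rightarrow> 'w::complex_vector \<Rightarrow> 'w) \<Rightarrow>
    ('a mat \<Rightarrow> ('v, 'w) tensor) set"
  where "parabolic_induction_space absv r m \<rho>\<^sub>1 \<rho>\<^sub>2 = {f.
    (\<forall>g. g \<notin> carrier (GL (r + m)) \<longrightarrow> f g = 0) \<and>
    (\<forall>a \<in> carrier (GL r). \<forall>d \<in> carrier (GL m). \<forall>x \<in> carrier_mat r m. \<forall>g \<in> carrier (GL (r + m)).
       f (four_block_mat a x (0\<^sub>m m r) d * g) =
         complex_of_real (sqrt (parabolic_modulus absv r m a d)) *\<^sub>C
           tensor_map (\<rho>\<^sub>1 a) (\<rho>\<^sub>2 d) (f g)) \<and>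
    (\<exists>K. subgroup K (GL (r + m)) \<and> openin (GL_topology absv (r + m)) K \<and>
       (\<forall>g \<in> carrier (GL (r + m)). \<forall>k \<in> K. f (g * k) = f g))}"

definition right_translation :: "nat \<Rightarrow> 'a::field mat \<Rightarrow> ('a mat \<Rightarrow> 'v::zero) \<Rightarrow> 'a mat \<Rightarrow> 'v"
  where "right_translation n g f = (\<lambda>x. if x \<in> carrier (GL n) then f (x * g) else 0)"

definition mat_trace :: "'a::comm_monoid_add mat \<Rightarrow> 'a"
  where "mat_trace A = (\<Sum>i<dim_row A. A $$ (i, i))"

definition N_group :: "nat \<Rightarrow> 'a::field mat set"
  where "N_group n = {four_block_mat (1\<^sub>m n) x (0\<^sub>m n n) (1\<^sub>m n) | x. x \<in> carrier_mat n n}"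

definition N_char :: "('a::field \<Rightarrow> complex) \<Rightarrow> nat \<Rightarrow> 'a mat \<Rightarrow> complex"
  where "N_char \<psi>\<^sub>0 n u = \<psi>\<^sub>0 (mat_trace (mat n n (\<lambda>(i, j). u $$ (i, n + j))))"

text \<open>The \<open>3 \<times> 3\<close> block matrix with rows \<open>(1, A, B)\<close>, \<open>(0, 1, C)\<close>, \<open>(0, 0, 1)\<close> and diagonal blocks
  of sizes \<open>p\<close>, \<open>q\<close>, \<open>s\<close>, each of which may be \<open>0\<close>.\<close>

definition unipotent_block3 :: "nat \<Rightarrow> nat \<Rightarrow> nat \<Rightarrow> 'a::field mat \<Rightarrow> 'a mat \<Rightarrow> 'a mat \<Rightarrow> 'a mat"
  where "unipotent_block3 p q s A B C =
    four_block_mat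
      (four_block_mat (1\<^sub>m p) A (0\<^sub>m q p) (1\<^sub>m q)) (B @\<^sub>r C)
      (0\<^sub>m s (p + q)) (1\<^sub>m s)"

definition N1_group :: "nat \<Rightarrow> nat \<Rightarrow> 'a::field mat set"
  where "N1_group r k =
    {unipotent_block3 k k (r - 2 * k) x y (0\<^sub>m k (r - 2 * k)) | x y.
       x \<in> carrier_mat k k \<and> y \<in> carrier_mat k (r - 2 * k)}"

definition N1_char :: "('a::field \<Rightarrow> complex) \<Rightarrow> nat \<Rightarrow> 'a mat \<Rightarrow> complex"
  where "N1_char \<psi>\<^sub>0 k u = \<psi>\<^sub>0 (mat_trace (mat k k (\<lambda>(i, j). u $$ (i, k + j))))"

text \<open>The block size \<open>n - r + k\<close> is written \<open>n + k - r\<close>, as subtraction truncates.\<close>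

definition N2_group :: "nat \<Rightarrow> nat \<Rightarrow> nat \<Rightarrow> 'a::field mat set"
  where "N2_group n r k =
    (let p = r - 2 * k; m = n + k - r in
      {unipotent_block3 p m m (0\<^sub>m p m) w z | w z. w \<in> carrier_mat p m \<and> z \<in> carrier_mat m m})"

definition N2_char :: "('a::field \<Rightarrow> complex) \<Rightarrow> nat \<Rightarrow> nat \<Rightarrow> nat \<Rightarrow> 'a mat \<Rightarrow> complex"
  where "N2_char \<psi>\<^sub>0 n r k u =
    (let p = r - 2 * k; m = n + k - r in
      \<psi>\<^sub>0 (mat_trace (mat m m (\<lambda>(i, j). u $$ (p + i, p + m + j)))))"

end

theory Submission
  imports Defs
begin

text \<open>The quotient of \<open>G\<^bsub>2n\<^esub>\<close> by the parabolic \<open>P\<close> with blocks \<open>r\<close> and \<open>m = 2n - r\<close> is the Grassmannian: the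
  coset \<open>P g\<close> corresponds to the space \<open>W \<subseteq> F\<^sup>n \<oplus> F\<^sup>n\<close> spanned by the last \<open>m\<close> rows of \<open>g\<close>. The group \<open>N\<close>
  fixes the projection \<open>A\<close> of \<open>W\<close> to the first summand and the intersection \<open>B\<close> of \<open>W\<close> with the second
  one, and its orbits are exactly the sets of all \<open>W\<close> with given \<open>A\<close> and \<open>B\<close>. Such an orbit is a torsor
  under \<open>Hom(A, F\<^sup>n/B)\<close>. The stabilizer of a point consists of the \<open>x\<close> that map \<open>A\<close> into \<open>B\<close>; it acts on
  the fibre \<open>\<rho>\<^sub>1 \<otimes> \<rho>\<^sub>2\<close> through its components \<open>F\<^sup>n/A \<rightarrow> F\<^sup>n/B\<close> (inside \<open>G\<^sub>r\<close>) and \<open>A \<rightarrow> B\<close> (inside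
  \<open>G\<^sub>m\<close>), whereas its component \<open>F\<^sup>n/A \<rightarrow> B\<close> acts trivially. Put \<open>k = n - dim A\<close>. If \<open>B\<close> is not contained in
  \<open>A\<close>, then \<open>\<psi>\<close> is non-trivial on \<open>Hom(F\<^sup>n/A, B)\<close> and the orbit contributes nothing to the twisted
  coinvariants. If \<open>B \<subseteq> A\<close>, then up to conjugation the stabilizer acts through \<open>N(k,1) \<times> N(k,2)\<close> with the
  characters \<open>\<psi>\<^bsub>k,1\<^esub>\<close> and \<open>\<psi>\<^bsub>k,2\<^esub>\<close>, and the orbit contributes exactly when both Jacquet modules are
  non-zero. The inequalities \<open>0 \<le> dim B \<le> dim A \<le> n\<close>, with \<open>dim B = n + k - r\<close>, are the bounds on \<open>k\<close>.

  Everything is made elementary by averages: an element of the kernel of the projection to a twisted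
  Jacquet module is killed by the twisted averages over all large compact subgroups of the unipotent
  group (\<open>average_eq_0_if_in_span\<close>). These averages are finite sums over the representatives \<open>reps\<close> of one
  ball of matrices modulo a smaller one.

  If both Jacquet modules are non-zero for some \<open>k\<close>, choose functionals on \<open>\<rho>\<^sub>1\<close> and \<open>\<rho>\<^sub>2\<close> that transform by
  the two characters. A function in the induced space that is supported near one point \<open>P w\<close> of the
  corresponding orbit, composed with the product of the two functionals, has non-zero averages along
  \<open>N\<close>, because it is supported on a ball of the orbit (\<open>x12_small_if_near_base_point\<close>). So it does not
  lie in the kernel (\<open>not_Ind_subset_Ker\<close>).

  Conversely, suppose that no \<open>k\<close> is admissible, and remove a given function from the strata \<open>dim A = a\<close>
  one by one, beginning with the smallest \<open>a\<close>. A function that vanishes on all smaller strata has compact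
  support modulo the stabilizer on each orbit in stratum \<open>a\<close>, as points far out on such an orbit are close
  to a smaller stratum (\<open>large_x12_near_smaller_cell\<close>). It therefore takes only finitely many values up to
  the action of the stabilizer, and some average kills them all (\<open>averages_vanish_pointwise\<close>). The orbits in
  the stratum are parametrized by the compact group \<open>GL\<^sub>n(O) \<times> GL\<^sub>n(O)\<close>, since the normal form of a
  matrix can be reached with integral column operations (\<open>rank_normal_form\<close>, \<open>bruhat_decomposition\<close>), and a
  compactness argument makes the average uniform (\<open>averages_vanish_uniformly\<close>). Subtracting an element of
  the kernel then yields a function that vanishes on stratum \<open>a\<close> as well
  (\<open>exists_representative_vanishing_on_cell\<close>), and in the end nothing remains (\<open>Ind_subset_Ker\<close>).\<close>

section \<open>Sums over representatives of the classes of an equivalence relation\<close>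

definition transversal :: "('u \<Rightarrow> 'u \<Rightarrow> bool) \<Rightarrow> 'u set \<Rightarrow> 'u set \<Rightarrow> bool" where
  "transversal R L T \<longleftrightarrow> finite T \<and> T \<subseteq> L \<and> (\<forall>x\<in>L. \<exists>t\<in>T. R x t) \<and> (\<forall>s\<in>T. \<forall>t\<in>T. R s t \<longrightarrow> s = t)"

text \<open>A covering set of least cardinality meets every class only once.\<close>

lemma transversal_exists:
  assumes sym: "\<And>x y. x \<in> L \<Longrightarrow> y \<in> L \<Longrightarrow> R x y \<Longrightarrow> R y x"
    and trans: "\<And>x y z. x \<in> L \<Longrightarrow> y \<in> L \<Longrightarrow> z \<in> L \<Longrightarrow> R x y \<Longrightarrow> R y z \<Longrightarrow> R x z"
    and fin: "finite F" and F: "F \<subseteq> L" and cover: "\<And>x. x \<in> L \<Longrightarrow> \<exists>y\<in>F. R x y"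
  shows "\<exists>T. transversal R L T"
proof -
  define P where "P T \<longleftrightarrow> T \<subseteq> F \<and> (\<forall>x\<in>L. \<exists>t\<in>T. R x t)" for T
  have "P F" using cover by (auto simp: P_def)
  then obtain T where T: "P T" and least: "\<And>S. P S \<Longrightarrow> card T \<le> card S"
    using ex_has_least_nat[of P F card] by blast
  have fT: "finite T" "T \<subseteq> L" using T fin F by (auto simp: P_def intro: finite_subset)
  have "s = t" if st: "s \<in> T" "t \<in> T" "R s t" for s t
  proof (rule ccontr)
    assume "s \<noteq> t"
    have "P (T - {s})" unfolding P_def
    proof (intro conjI ballI)
      show "T - {s} \<subseteq> F" using T by (auto simp: P_def)
      fix x assume x: "x \<in> L"
      then obtain y where y: "y \<in> T" "R x y" using T by (auto simp: P_def)
      show "\<exists>t\<in>T - {s}. R x t"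
      proof (cases "y = s")
        case True
        then have "R x t" using trans[of x s t] x st y fT by auto
        then show ?thesis using st \<open>s \<noteq> t\<close> by auto
      qed (use y in auto)
    qed
    from least[OF this] st fT show False
      by (metis card_Diff1_less_iff not_le)
  qed
  then show ?thesis using T fT unfolding transversal_def P_def by blast
qed

text \<open>The map that \<open>\<alpha>\<close> induces on the classes is injective, hence a permutation, as there are
  finitely many classes.\<close>

lemma transversal_sum_reindex:
  assumes T: "transversal R L T"
    and sym: "\<And>x y. x \<in> L \<Longrightarrow> y \<in> L \<Longrightarrow> R x y \<Longrightarrow> R y x"
    and trans: "\<And>x y z. x \<in> L \<Longrightarrow> y \<in> L \<Longrightarrow> z \<in> L \<Longrightarrow> R x y \<Longrightarrow> R y z \<Longrightarrow> R x z"
    and \<alpha>: "\<And>x. x \<in> L \<Longrightarrow> \<alpha> x \<in> L"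
    and \<alpha>R: "\<And>x y. x \<in> L \<Longrightarrow> y \<in> L \<Longrightarrow> R (\<alpha> x) (\<alpha> y) \<Longrightarrow> R x y"
    and \<phi>: "\<And>x y. x \<in> L \<Longrightarrow> y \<in> L \<Longrightarrow> R x y \<Longrightarrow> \<phi> x = \<phi> y"
  shows "(\<Sum>t\<in>T. \<phi> (\<alpha> t)) = (\<Sum>t\<in>T. \<phi> t)"
proof -
  note T' = T[unfolded transversal_def]
  have TL: "t \<in> L" if "t \<in> T" for t using T' that by blast
  define \<beta> where "\<beta> t = (SOME s. s \<in> T \<and> R (\<alpha> t) s)" for t
  have \<beta>: "\<beta> t \<in> T \<and> R (\<alpha> t) (\<beta> t)" if "t \<in> T" for t
    unfolding \<beta>_def by (rule someI_ex) (use T' that \<alpha> TL in blast)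
  have inj: "inj_on \<beta> T"
  proof (rule inj_onI)
    fix s t assume st: "s \<in> T" "t \<in> T" "\<beta> s = \<beta> t"
    have 1: "R (\<alpha> s) (\<beta> t)" using \<beta>[OF st(1)] st(3) by simp
    have 2: "R (\<beta> t) (\<alpha> t)" using \<beta>[OF st(2)] sym \<alpha> TL st by blast
    have "R (\<alpha> s) (\<alpha> t)" using trans[OF _ _ _ 1 2] \<beta>[OF st(2)] \<alpha> TL st by blast
    then have "R s t" using \<alpha>R TL st by blast
    then show "s = t" using T' st by blast
  qed
  have "\<beta> ` T = T" using inj \<beta> T' by (intro card_subset_eq) (auto simp: card_image)
  then have bij: "bij_betw \<beta> T T" using inj by (simp add: bij_betw_def)
  have "(\<Sum>t\<in>T. \<phi> (\<alpha> t)) = (\<Sum>t\<in>T. \<phi> (\<beta> t))"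
    by (rule sum.cong) (use \<beta> \<phi> \<alpha> TL in auto)
  also have "\<dots> = (\<Sum>t\<in>T. \<phi> t)" by (rule sum.reindex_bij_betw[OF bij])
  finally show ?thesis .
qed

section \<open>Matrices over a local field\<close>

context nonarchimedean_local_field
begin

lemma absv_0 [simp]: "absv 0 = 0" using absv_eq_0_iff by simp

lemma absv_1 [simp]: "absv 1 = 1"
proof -
  have "absv 1 * absv 1 = absv 1" using absv_mult[of 1 1] by simp
  moreover have "absv 1 \<noteq> 0" using absv_eq_0_iff by simp
  ultimately show ?thesis by simp
qed

lemma absv_minus [simp]: "absv (- x) = absv x"
proof -
  have "absv (-1) * absv (-1) = 1" using absv_mult[of "-1" "-1"] by simp
  then have "absv (-1) = 1" using absv_nonneg[of "-1"]
    by (metis abs_of_nonneg real_sqrt_abs2 real_sqrt_one)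
  then show ?thesis using absv_mult[of "-1" x] by simp
qed

lemma absv_add_le: "absv x \<le> c \<Longrightarrow> absv y \<le> c \<Longrightarrow> absv (x + y) \<le> c"
  using absv_ultrametric[of x y] by simp

lemma absv_diff_le: "absv x \<le> c \<Longrightarrow> absv y \<le> c \<Longrightarrow> absv (x - y) \<le> c"
  using absv_add_le[of x c "-y"] by simp

lemma absv_diff_commute: "absv (x - y) = absv (y - x)"
  using absv_minus[of "x - y"] by simp

lemma absv_sum_le: "0 \<le> c \<Longrightarrow> (\<And>i. i \<in> I \<Longrightarrow> absv (f i) \<le> c) \<Longrightarrow> absv (\<Sum>i\<in>I. f i) \<le> c"
  by (induction I rule: infinite_finite_induct) (auto intro: absv_add_le)

lemma absv_prod_le_1: "(\<And>i. i \<in> I \<Longrightarrow> absv (f i) \<le> 1) \<Longrightarrow> absv (\<Prod>i\<in>I. f i) \<le> 1"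
  by (induction I rule: infinite_finite_induct)
    (auto simp: absv_mult intro: mult_le_one absv_nonneg)

lemma absv_mult_le: "absv x \<le> c \<Longrightarrow> absv y \<le> d \<Longrightarrow> absv (x * y) \<le> c * d"
  unfolding absv_mult using absv_nonneg by (intro mult_mono) (auto intro: order_trans)

lemma absv_inverse: "absv (inverse x) = inverse (absv x)"
proof (cases "x = 0")
  case False
  then have "absv x * absv (inverse x) = 1" using absv_mult[of x "inverse x"] by simp
  then show ?thesis by (metis inverse_unique)
qed simp

lemma absv_divide: "absv (x / y) = absv x / absv y"
  by (simp add: divide_inverse absv_mult absv_inverse)

lemma absv_power: "absv (x ^ k) = absv x ^ k"
  by (induction k) (auto simp: absv_mult)

lemma metric: "Metric_space UNIV (\<lambda>x y. absv (x - y))"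
proof
  fix x y z
  show "0 \<le> absv (x - y)" by (rule absv_nonneg)
  show "absv (x - y) = absv (y - x)" by (rule absv_diff_commute)
  show "absv (x - y) = 0 \<longleftrightarrow> x = y" by (simp add: absv_eq_0_iff)
  have "absv (x - z) \<le> max (absv (x - y)) (absv (y - z))"
    using absv_ultrametric[of "x - y" "y - z"] by simp
  then show "absv (x - z) \<le> absv (x - y) + absv (y - z)"
    using absv_nonneg[of "x - y"] absv_nonneg[of "y - z"] by linarith
qed

lemma uniformizer_obtain:
  obtains \<pi> where "0 < absv \<pi>" "absv \<pi> < 1" "\<And>x. absv x < 1 \<Longrightarrow> \<exists>y. absv y \<le> 1 \<and> x = \<pi> * y"
proof -
  obtain \<pi> where \<pi>: "absv \<pi> = 1 / real (card (residue_field absv))"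
    "{x. absv x < 1} = {\<pi> * y | y. absv y \<le> 1}" using uniformizer by blast
  have "residue_field absv \<noteq> {}"
    unfolding residue_field_def by (auto simp: quotient_def intro!: exI[of _ 0])
  then have "0 < card (residue_field absv)" using finite_residue_field by (simp add: card_gt_0_iff)
  then have 0: "0 < absv \<pi>" using \<pi>(1) by simp
  have "\<pi> * 1 \<in> {\<pi> * y | y. absv y \<le> 1}" by (intro CollectI exI[of _ 1]) simp
  then have 1: "absv \<pi> < 1" unfolding \<pi>(2)[symmetric] by simp
  show ?thesis by (rule that[OF 0 1]) (use \<pi>(2) in blast)
qed

lemma residue_representatives: "\<exists>D. finite D \<and> (\<forall>x. absv x \<le> 1 \<longrightarrow> (\<exists>d\<in>D. absv (x - d) < 1))"
proof (intro exI conjI allI impI)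
  let ?D = "(\<lambda>C. SOME x. x \<in> C) ` residue_field absv"
  show "finite ?D" using finite_residue_field by simp
  fix x assume x: "absv x \<le> 1"
  let ?C = "{y. absv x \<le> 1 \<and> absv y \<le> 1 \<and> absv (x - y) < 1}"
  have "?C \<in> residue_field absv"
    unfolding residue_field_def quotient_def using x by auto
  moreover have "(SOME y. y \<in> ?C) \<in> ?C" by (rule someI[of "\<lambda>y. y \<in> ?C" x]) (use x in simp)
  ultimately show "\<exists>d\<in>?D. absv (x - d) < 1" by blast
qed

text \<open>One more digit: a ball of radius \<open>\<bar>\<pi>\<bar>\<^sup>i\<close> splits into translates of balls of radius \<open>\<bar>\<pi>\<bar>\<^bsup>i+1\<^esup>\<close>, one for
  each element of the finite residue field.\<close>

lemma finite_cover_unit_ball: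
  assumes \<pi>: "0 < absv \<pi>" "absv \<pi> < 1" "\<And>x. absv x < 1 \<Longrightarrow> \<exists>y. absv y \<le> 1 \<and> x = \<pi> * y"
  shows "\<exists>F. finite F \<and> (\<forall>x. absv x \<le> 1 \<longrightarrow> (\<exists>y\<in>F. absv (x - y) \<le> absv \<pi> ^ i))"
proof (induction i)
  case 0
  show ?case by (rule exI[of _ "{0}"]) simp
next
  case (Suc i)
  then obtain F where F: "finite F" "\<And>x. absv x \<le> 1 \<Longrightarrow> \<exists>y\<in>F. absv (x - y) \<le> absv \<pi> ^ i" by blast
  obtain D where D: "finite D" "\<And>x. absv x \<le> 1 \<Longrightarrow> \<exists>d\<in>D. absv (x - d) < 1"
    using residue_representatives by blast
  have \<pi>0: "\<pi> \<noteq> 0" using \<pi>(1) by auto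
  show ?case
  proof (intro exI[of _ "(\<lambda>(y, d). y + \<pi> ^ i * d) ` (F \<times> D)"] conjI allI impI)
    show "finite ((\<lambda>(y, d). y + \<pi> ^ i * d) ` (F \<times> D))" using F D by simp
    fix x assume "absv x \<le> 1"
    then obtain y where y: "y \<in> F" "absv (x - y) \<le> absv \<pi> ^ i" using F by blast
    define z where "z = (x - y) / \<pi> ^ i"
    have "absv z \<le> 1" using y(2) \<pi>(1) by (simp add: z_def absv_divide absv_power)
    then obtain d where d: "d \<in> D" "absv (z - d) < 1" using D by blast
    obtain t where t: "absv t \<le> 1" "z - d = \<pi> * t" using \<pi>(3)[OF d(2)] by blast
    have "x - (y + \<pi> ^ i * d) = \<pi> ^ i * (z - d)" using \<pi>0 by (simp add: z_def field_simps)
    then have "absv (x - (y + \<pi> ^ i * d)) = absv \<pi> ^ Suc i * absv t"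
      using t by (simp add: absv_mult absv_power)
    also have "\<dots> \<le> absv \<pi> ^ Suc i * 1" by (intro mult_left_mono) (use t \<pi> in auto)
    finally show "\<exists>y'\<in>(\<lambda>(y, d). y + \<pi> ^ i * d) ` (F \<times> D). absv (x - y') \<le> absv \<pi> ^ Suc i"
      using y d by force
  qed
qed

text \<open>Multiplication by a power of the uniformizer scales the ball into the unit ball.\<close>

lemma finite_cover_ball:
  assumes "0 < e"
  shows "\<exists>F. finite F \<and> (\<forall>x. absv x \<le> c \<longrightarrow> (\<exists>y\<in>F. absv (x - y) \<le> e))"
proof -
  obtain \<pi> where \<pi>: "0 < absv \<pi>" "absv \<pi> < 1" "\<And>x. absv x < 1 \<Longrightarrow> \<exists>y. absv y \<le> 1 \<and> x = \<pi> * y"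
    using uniformizer_obtain by blast
  have small: "\<exists>k. absv \<pi> ^ k < d" if "0 < d" for d
    using real_arch_pow_inv[OF that \<pi>(2)] .
  obtain N where N: "absv \<pi> ^ N < 1 / (\<bar>c\<bar> + 1)" using small[of "1 / (\<bar>c\<bar> + 1)"] by (auto simp: add_nonneg_pos)
  have pN: "0 < absv \<pi> ^ N" using \<pi> by simp
  obtain i where i: "absv \<pi> ^ i < e * absv \<pi> ^ N" using small[of "e * absv \<pi> ^ N"] assms pN by auto
  obtain F where F: "finite F" "\<And>x. absv x \<le> 1 \<Longrightarrow> \<exists>y\<in>F. absv (x - y) \<le> absv \<pi> ^ i"
    using finite_cover_unit_ball[OF \<pi>] by blast
  have \<pi>0: "\<pi> \<noteq> 0" using \<pi>(1) by auto
  show ?thesis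
  proof (intro exI[of _ "(\<lambda>y. y / \<pi> ^ N) ` F"] conjI allI impI)
    show "finite ((\<lambda>y. y / \<pi> ^ N) ` F)" using F by simp
    fix x assume x: "absv x \<le> c"
    have "absv (x * \<pi> ^ N) \<le> \<bar>c\<bar> * (1 / (\<bar>c\<bar> + 1))"
      unfolding absv_mult absv_power by (intro mult_mono) (use x N pN in auto)
    also have "\<dots> \<le> 1" by (simp add: field_simps)
    finally obtain y where y: "y \<in> F" "absv (x * \<pi> ^ N - y) \<le> absv \<pi> ^ i" using F by blast
    have "x - y / \<pi> ^ N = (x * \<pi> ^ N - y) / \<pi> ^ N" using \<pi>0 by (simp add: field_simps)
    then have "absv (x - y / \<pi> ^ N) = absv (x * \<pi> ^ N - y) / absv \<pi> ^ N"
      by (simp add: absv_divide absv_power)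
    also have "\<dots> \<le> e" using y i pN by (simp add: divide_le_eq)
    finally show "\<exists>y\<in>(\<lambda>y. y / \<pi> ^ N) ` F. absv (x - y) \<le> e" using y by blast
  qed
qed

definition matball :: "nat \<Rightarrow> nat \<Rightarrow> real \<Rightarrow> 'a mat set" where
  "matball p q c = {A \<in> carrier_mat p q. \<forall>i<p. \<forall>j<q. absv (A $$ (i, j)) \<le> c}"

lemma matballI: "A \<in> carrier_mat p q \<Longrightarrow> (\<And>i j. i < p \<Longrightarrow> j < q \<Longrightarrow> absv (A $$ (i, j)) \<le> c) \<Longrightarrow> A \<in> matball p q c"
  by (simp add: matball_def)

lemma matball_carrier: "A \<in> matball p q c \<Longrightarrow> A \<in> carrier_mat p q" by (simp add: matball_def)

lemma matball_entry: "A \<in> matball p q c \<Longrightarrow> i < p \<Longrightarrow> j < q \<Longrightarrow> absv (A $$ (i, j)) \<le> c"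
  by (simp add: matball_def)

lemma matball_mono: "A \<in> matball p q c \<Longrightarrow> c \<le> d \<Longrightarrow> A \<in> matball p q d"
  by (fastforce simp: matball_def)

lemma matball_add: "A \<in> matball p q c \<Longrightarrow> B \<in> matball p q c \<Longrightarrow> A + B \<in> matball p q c"
  by (intro matballI) (auto simp: matball_def intro!: absv_add_le)

lemma matball_diff: "A \<in> matball p q c \<Longrightarrow> B \<in> matball p q c \<Longrightarrow> A - B \<in> matball p q c"
  by (intro matballI) (auto simp: matball_def intro!: absv_diff_le)

lemma matball_uminus: "A \<in> matball p q c \<Longrightarrow> - A \<in> matball p q c"
  by (auto simp: matball_def)

lemma matball_diff_commute: "A \<in> carrier_mat p q \<Longrightarrow> B \<in> carrier_mat p q \<Longrightarrow> A - B \<in> matball p q c \<Longrightarrow> B - A \<in> matball p q c"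
proof (rule matballI)
  fix i j assume *: "A \<in> carrier_mat p q" "B \<in> carrier_mat p q" "A - B \<in> matball p q c" "i < p" "j < q"
  have "absv ((A - B) $$ (i, j)) \<le> c" using * matball_entry by blast
  then show "absv ((B - A) $$ (i, j)) \<le> c"
    using * absv_diff_commute[of "A $$ (i, j)" "B $$ (i, j)"] by simp
qed auto

lemma matball_diff_trans:
  assumes "A \<in> carrier_mat p q" "B \<in> carrier_mat p q" "C \<in> carrier_mat p q"
    and "A - B \<in> matball p q c" "B - C \<in> matball p q c"
  shows "A - C \<in> matball p q c"
proof -
  have "A - C = (A - B) + (B - C)" using assms by (intro eq_matI) auto
  then show ?thesis using assms matball_add by metis
qed

lemma matball_zero: "0 \<le> c \<Longrightarrow> 0\<^sub>m p q \<in> matball p q c" by (auto simp: matball_def)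

lemma matball_one: "1\<^sub>m n \<in> matball n n 1" by (auto simp: matball_def)

lemma matball_mult:
  assumes "A \<in> matball p q c" "B \<in> matball q s d" "0 \<le> c" "0 \<le> d"
  shows "A * B \<in> matball p s (c * d)"
proof (rule matballI)
  show "A * B \<in> carrier_mat p s" using assms matball_carrier by (metis mult_carrier_mat)
  fix i j assume ij: "i < p" "j < s"
  have "(A * B) $$ (i, j) = (\<Sum>k = 0..<q. A $$ (i, k) * B $$ (k, j))"
    using assms ij by (auto simp: scalar_prod_def matball_def)
  also have "absv \<dots> \<le> c * d"
    using assms ij by (intro absv_sum_le absv_mult_le) (auto intro: matball_entry)
  finally show "absv ((A * B) $$ (i, j)) \<le> c * d" .
qed

lemma matball_exhaust: "A \<in> carrier_mat p q \<Longrightarrow> \<exists>c. A \<in> matball p q c"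
proof -
  assume A: "A \<in> carrier_mat p q"
  let ?S = "(\<lambda>(i, j). absv (A $$ (i, j))) ` ({..<p} \<times> {..<q})"
  have "absv (A $$ (i, j)) \<le> Max (insert 0 ?S)" if "i < p" "j < q" for i j
    by (rule Max_ge) (use that in auto)
  then have "A \<in> matball p q (Max (insert 0 ?S))" using A by (intro matballI)
  then show ?thesis ..
qed

lemma finite_cover_matball:
  assumes "0 < e"
  shows "\<exists>F. finite F \<and> F \<subseteq> carrier_mat p q \<and> (\<forall>A\<in>matball p q c. \<exists>B\<in>F. A - B \<in> matball p q e)"
proof -
  obtain F where F: "finite F" "\<And>x. absv x \<le> c \<Longrightarrow> \<exists>y\<in>F. absv (x - y) \<le> e"
    using finite_cover_ball[OF assms, of c] by blast
  let ?I = "{..<p} \<times> {..<q}"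
  show ?thesis
  proof (intro exI[of _ "mat p q ` PiE ?I (\<lambda>_. F)"] conjI ballI)
    show "finite (mat p q ` PiE ?I (\<lambda>_. F))" using F by (intro finite_imageI finite_PiE) auto
    show "mat p q ` PiE ?I (\<lambda>_. F) \<subseteq> carrier_mat p q" by auto
    fix A assume A: "A \<in> matball p q c"
    define g where "g = (\<lambda>x\<in>?I. SOME y. y \<in> F \<and> absv (A $$ x - y) \<le> e)"
    have g: "g x \<in> F \<and> absv (A $$ x - g x) \<le> e" if "x \<in> ?I" for x
    proof -
      have "absv (A $$ x) \<le> c" using A that by (auto simp: matball_def)
      then have "\<exists>y. y \<in> F \<and> absv (A $$ x - y) \<le> e" using F(2) by blast
      from someI_ex[OF this] show ?thesis using that unfolding g_def by simp
    qed
    show "\<exists>B\<in>mat p q ` PiE ?I (\<lambda>_. F). A - B \<in> matball p q e"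
    proof (rule bexI[of _ "mat p q g"])
      show "A - mat p q g \<in> matball p q e" using g A by (auto simp: matball_def)
      have "g \<in> PiE ?I (\<lambda>_. F)" using g by (auto simp: g_def)
      then show "mat p q g \<in> mat p q ` PiE ?I (\<lambda>_. F)" by blast
    qed
  qed
qed

definition reps :: "nat \<Rightarrow> nat \<Rightarrow> real \<Rightarrow> real \<Rightarrow> 'a mat set" where
  "reps p q c e = (SOME T. transversal (\<lambda>A B. A - B \<in> matball p q e) (matball p q c) T)"

lemma reps_transversal:
  assumes e: "0 < e"
  shows "transversal (\<lambda>A B. A - B \<in> matball p q e) (matball p q c) (reps p q c e)"
proof -
  obtain F where F: "finite F" "F \<subseteq> carrier_mat p q" "\<And>A. A \<in> matball p q c \<Longrightarrow> \<exists>B\<in>F. A - B \<in> matball p q e"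
    using finite_cover_matball[OF e, of p q c] by blast
  \<comment> \<open>The centres of the covering balls may lie outside; replace them by points inside.\<close>
  define h where "h B = (SOME A. A \<in> matball p q c \<and> A - B \<in> matball p q e)" for B
  define F' where "F' = h ` {B\<in>F. \<exists>A. A \<in> matball p q c \<and> A - B \<in> matball p q e}"
  have h: "h B \<in> matball p q c \<and> h B - B \<in> matball p q e"
    if "\<exists>A. A \<in> matball p q c \<and> A - B \<in> matball p q e" for B
    using someI_ex[OF that] by (simp only: h_def)
  have "\<exists>T. transversal (\<lambda>A B. A - B \<in> matball p q e) (matball p q c) T"
  proof (rule transversal_exists)
    show "finite F'" unfolding F'_def by (intro finite_imageI) (simp add: F(1))
    show "F' \<subseteq> matball p q c" using h by (auto simp: F'_def)
    fix A assume A: "A \<in> matball p q c"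
    obtain B where B: "B \<in> F" "A - B \<in> matball p q e" using F(3)[OF A] by blast
    have hB: "h B \<in> matball p q c" "h B - B \<in> matball p q e" using h[of B] A B by blast+
    have "A - h B \<in> matball p q e"
      by (rule matball_diff_trans[of _ _ _ B])
        (use matball_diff_commute[of "h B" p q B e] A B hB F(2) matball_carrier in auto)
    then show "\<exists>y\<in>F'. A - y \<in> matball p q e" using A B by (auto simp: F'_def)
  next
    show "y - x \<in> matball p q e" if "x \<in> matball p q c" "y \<in> matball p q c" "x - y \<in> matball p q e" for x y
      using that matball_diff_commute matball_carrier by metis
    show "x - z \<in> matball p q e" if "x \<in> matball p q c" "y \<in> matball p q c" "z \<in> matball p q c"
      "x - y \<in> matball p q e" "y - z \<in> matball p q e" for x y z
      by (rule matball_diff_trans[of _ _ _ y]) (use that matball_carrier in auto)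
  qed
  from someI_ex[OF this] show ?thesis by (simp only: reps_def)
qed

lemma reps_finite: "0 < e \<Longrightarrow> finite (reps p q c e)"
  using reps_transversal[of e p q c] by (auto simp: transversal_def)

lemma reps_subset: "0 < e \<Longrightarrow> t \<in> reps p q c e \<Longrightarrow> t \<in> matball p q c"
  using reps_transversal[of e p q c] by (auto simp: transversal_def)

lemma reps_cover: "0 < e \<Longrightarrow> x \<in> matball p q c \<Longrightarrow> \<exists>t\<in>reps p q c e. x - t \<in> matball p q e"
  using reps_transversal[of e p q c] by (auto simp: transversal_def)

lemma reps_nonempty: "0 < e \<Longrightarrow> 0 \<le> c \<Longrightarrow> reps p q c e \<noteq> {}"
  using reps_cover[of e "0\<^sub>m p q" p q c] matball_zero[of c p q] by blast

lemma reps_sum_reindex: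
  fixes \<phi> :: "'a mat \<Rightarrow> 'v::comm_monoid_add"
  assumes e: "0 < e"
    and \<alpha>: "\<And>x. x \<in> matball p q c \<Longrightarrow> \<alpha> x \<in> matball p q c"
    and \<alpha>R: "\<And>x y. x \<in> matball p q c \<Longrightarrow> y \<in> matball p q c \<Longrightarrow> \<alpha> x - \<alpha> y \<in> matball p q e \<Longrightarrow> x - y \<in> matball p q e"
    and \<phi>: "\<And>x y. x \<in> matball p q c \<Longrightarrow> y \<in> matball p q c \<Longrightarrow> x - y \<in> matball p q e \<Longrightarrow> \<phi> x = \<phi> y"
  shows "(\<Sum>t\<in>reps p q c e. \<phi> (\<alpha> t)) = (\<Sum>t\<in>reps p q c e. \<phi> t)"
proof (rule transversal_sum_reindex[OF reps_transversal[OF e], where \<alpha> = \<alpha> and \<phi> = \<phi>])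
  show "y - x \<in> matball p q e" if "x \<in> matball p q c" "y \<in> matball p q c" "x - y \<in> matball p q e" for x y
    using that matball_diff_commute matball_carrier by metis
  show "x - z \<in> matball p q e" if "x \<in> matball p q c" "y \<in> matball p q c" "z \<in> matball p q c"
    "x - y \<in> matball p q e" "y - z \<in> matball p q e" for x y z
    by (rule matball_diff_trans[of _ _ _ y]) (use that matball_carrier in auto)
qed (use assms in auto)

lemma reps_sum_translate:
  fixes \<phi> :: "'a mat \<Rightarrow> 'v::comm_monoid_add"
  assumes e: "0 < e" and y: "y \<in> matball p q c"
    and \<phi>: "\<And>x y. x \<in> matball p q c \<Longrightarrow> y \<in> matball p q c \<Longrightarrow> x - y \<in> matball p q e \<Longrightarrow> \<phi> x = \<phi> y"
  shows "(\<Sum>t\<in>reps p q c e. \<phi> (t + y)) = (\<Sum>t\<in>reps p q c e. \<phi> t)"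
proof -
  have \<alpha>: "x + y \<in> matball p q c" if "x \<in> matball p q c" for x
    using that y by (rule matball_add)
  have \<alpha>R: "x - x' \<in> matball p q e"
    if x: "x \<in> matball p q c" and x': "x' \<in> matball p q c" and d: "x + y - (x' + y) \<in> matball p q e" for x x'
  proof -
    have "x + y - (x' + y) = x - x'"
      using matball_carrier[OF x] matball_carrier[OF x'] matball_carrier[OF y] by (intro eq_matI) auto
    then show ?thesis using d by simp
  qed
  show ?thesis
    by (rule reps_sum_reindex[where \<alpha> = "\<lambda>t. t + y" and \<phi> = \<phi>, OF e \<alpha> \<alpha>R \<phi>])
qed

text \<open>By translation invariance, the sum over the larger group is, up to the factor \<open>card D\<close>, the
  sum of the sums over the translates of \<open>D\<close>. In this way the vanishing of one finite sum, at all
  base points, passes to averages over arbitrarily large balls.\<close>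

lemma reps_sum_eq_0_if_subsums_eq_0:
  fixes \<phi> :: "'a mat \<Rightarrow> 'v::complex_vector"
  assumes e: "0 < e"
    and D: "finite D" "D \<noteq> {}" "D \<subseteq> matball p q c"
    and \<phi>: "\<And>x y. x \<in> matball p q c \<Longrightarrow> y \<in> matball p q c \<Longrightarrow> x - y \<in> matball p q e \<Longrightarrow> \<phi> x = \<phi> y"
    and zero: "\<And>x. x \<in> matball p q c \<Longrightarrow> (\<Sum>y\<in>D. \<phi> (x + y)) = 0"
  shows "(\<Sum>t\<in>reps p q c e. \<phi> t) = 0"
proof -
  have "of_nat (card D) *\<^sub>C (\<Sum>t\<in>reps p q c e. \<phi> t) = (\<Sum>y\<in>D. \<Sum>t\<in>reps p q c e. \<phi> t)"
    by (simp add: complex_vector.sum_constant_scale)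
  also have "\<dots> = (\<Sum>y\<in>D. \<Sum>t\<in>reps p q c e. \<phi> (t + y))"
  proof (rule sum.cong[OF refl])
    fix y assume "y \<in> D"
    then have "y \<in> matball p q c" using D by blast
    from reps_sum_translate[of e y p q c \<phi>, OF e this \<phi>]
    show "(\<Sum>t\<in>reps p q c e. \<phi> t) = (\<Sum>t\<in>reps p q c e. \<phi> (t + y))" by simp
  qed
  also have "\<dots> = (\<Sum>t\<in>reps p q c e. \<Sum>y\<in>D. \<phi> (t + y))" by (rule sum.swap)
  also have "\<dots> = 0" using zero reps_subset[OF e] by (intro sum.neutral) auto
  finally show ?thesis using D by simp
qed

section \<open>Compactness of the integral matrices\<close>

text \<open>By the ultrametric inequality a bound for a tail of the sequence passes to the limit without loss.\<close>

lemma limit_of_geometric_cauchy_sequence: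
  assumes x: "\<And>m k. k \<le> m \<Longrightarrow> absv (x m - x k) \<le> (1 / 2) ^ k"
  shows "\<exists>l. \<forall>k. absv (x k - l) \<le> (1 / 2) ^ k"
proof -
  interpret Metric_space UNIV "\<lambda>x y. absv (x - y)" by (rule metric)
  have "MCauchy x" unfolding MCauchy_def
  proof (intro conjI allI impI)
    fix e :: real assume "0 < e"
    then obtain N where N: "(1 / 2) ^ N < e" using real_arch_pow_inv[of e "1 / 2"] by auto
    have "absv (x k - x m) < e" if "N \<le> k" "N \<le> m" for k m
    proof -
      have "absv ((x k - x N) - (x m - x N)) \<le> (1 / 2) ^ N" by (rule absv_diff_le) (use x that in auto)
      then show ?thesis using N by simp
    qed
    then show "\<exists>N. \<forall>n n'. N \<le> n \<longrightarrow> N \<le> n' \<longrightarrow> absv (x n - x n') < e" by blast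
  qed simp
  then obtain l where "limitin mtopology x l sequentially"
    using complete unfolding mcomplete_def by blast
  then have l: "\<exists>N. \<forall>n\<ge>N. absv (x n - l) < e" if "0 < e" for e
    using that by (auto simp: limitin_metric eventually_sequentially)
  have "absv (x k - l) \<le> (1 / 2) ^ k" for k
  proof -
    obtain N where N: "\<forall>n\<ge>N. absv (x n - l) < (1 / 2) ^ k" using l[of "(1 / 2) ^ k"] by auto
    let ?m = "max N k"
    have "absv ((x ?m - l) - (x ?m - x k)) \<le> (1 / 2) ^ k"
      by (rule absv_diff_le) (use N x in \<open>auto intro: less_imp_le\<close>)
    then show ?thesis by (simp add: absv_diff_commute)
  qed
  then show ?thesis by blast
qed

text \<open>A set on which no bound works contains an arbitrarily small one of the same kind, since finitely
  many small balls cover it; a point in the intersection of a shrinking sequence of such sets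
  contradicts local boundedness.\<close>

lemma locally_bounded_imp_bounded:
  fixes Q :: "real \<Rightarrow> 'a mat \<Rightarrow> bool"
  assumes mono: "\<And>c d Y. Q c Y \<Longrightarrow> c \<le> d \<Longrightarrow> Q d Y"
    and loc: "\<And>X. X \<in> matball p q 1 \<Longrightarrow>
      \<exists>c e. 0 < e \<and> (\<forall>Y\<in>matball p q 1. Y - X \<in> matball p q e \<longrightarrow> Q c Y)"
  shows "\<exists>c. \<forall>Y\<in>matball p q 1. Q c Y"
proof (rule ccontr)
  assume contr: "\<not> ?thesis"
  define bad where "bad S \<longleftrightarrow> S \<subseteq> matball p q 1 \<and> (\<forall>c. \<exists>Y\<in>S. \<not> Q c Y)" for S
  have bad0: "bad (matball p q 1)" using contr by (auto simp: bad_def)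
  have step: "\<exists>S'. (bad S' \<and> (\<forall>Y\<in>S'. \<forall>Z\<in>S'. Y - Z \<in> matball p q e)) \<and> S' \<subseteq> S"
    if S: "bad S" and e: "0 < e" for S and e
  proof -
    obtain F where F: "finite F" "F \<subseteq> carrier_mat p q" "\<forall>A\<in>matball p q 1. \<exists>B\<in>F. A - B \<in> matball p q e"
      using finite_cover_matball[OF e, of p q 1] by blast
    define part where "part B = {Y\<in>S. Y - B \<in> matball p q e}" for B
    have "\<exists>B\<in>F. bad (part B)"
    proof (rule ccontr)
      assume "\<not> (\<exists>B\<in>F. bad (part B))"
      moreover have "part B \<subseteq> matball p q 1" for B using S by (auto simp: bad_def part_def)
      ultimately have "\<forall>B\<in>F. \<exists>c. \<forall>Y\<in>part B. Q c Y" unfolding bad_def by blast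
      then obtain c where c: "\<And>B Y. B \<in> F \<Longrightarrow> Y \<in> part B \<Longrightarrow> Q (c B) Y" by metis
      have "Q (Max (c ` F)) Y" if Y: "Y \<in> S" for Y
      proof -
        obtain B where B: "B \<in> F" "Y - B \<in> matball p q e" using F(3) Y S unfolding bad_def by blast
        then have "Q (c B) Y" using c Y by (auto simp: part_def)
        then show ?thesis by (rule mono) (use F B in auto)
      qed
      then show False using S by (auto simp: bad_def)
    qed
    then obtain B where B: "B \<in> F" "bad (part B)" by blast
    have "Y - Z \<in> matball p q e" if YZ: "Y \<in> part B" "Z \<in> part B" for Y Z
    proof (rule matball_diff_trans[of _ _ _ B])
      show c: "Y \<in> carrier_mat p q" "Z \<in> carrier_mat p q"
        using YZ S matball_carrier by (auto simp: part_def bad_def)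
      show c': "B \<in> carrier_mat p q" using F B by blast
      show "Y - B \<in> matball p q e" using YZ by (simp add: part_def)
      show "B - Z \<in> matball p q e"
        by (rule matball_diff_commute[OF c(2) c']) (use YZ in \<open>simp add: part_def\<close>)
    qed
    then show ?thesis using B by (intro exI[of _ "part B"]) (auto simp: part_def)
  qed
  have "\<exists>S. \<forall>k. (bad (S k) \<and> (\<forall>Y\<in>S k. \<forall>Z\<in>S k. Y - Z \<in> matball p q ((1 / 2) ^ k))) \<and> S (Suc k) \<subseteq> S k"
  proof (rule dependent_nat_choice)
    show "\<exists>S. bad S \<and> (\<forall>Y\<in>S. \<forall>Z\<in>S. Y - Z \<in> matball p q ((1 / 2) ^ 0))"
      using bad0 matball_diff by (intro exI[of _ "matball p q 1"]) simp
    show "\<exists>S'. (bad S' \<and> (\<forall>Y\<in>S'. \<forall>Z\<in>S'. Y - Z \<in> matball p q ((1 / 2) ^ Suc k))) \<and> S' \<subseteq> S"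
      if "bad S \<and> (\<forall>Y\<in>S. \<forall>Z\<in>S. Y - Z \<in> matball p q ((1 / 2) ^ k))" for S k
      by (rule step) (use that in auto)
  qed
  then obtain S where S: "\<And>k. bad (S k)" "\<And>k Y Z. Y \<in> S k \<Longrightarrow> Z \<in> S k \<Longrightarrow> Y - Z \<in> matball p q ((1 / 2) ^ k)"
    "\<And>k. S (Suc k) \<subseteq> S k" by blast
  have dec: "S m \<subseteq> S k" if "k \<le> m" for k m
    using that by (rule lift_Suc_antimono_le[of S, rotated]) (rule S(3))
  have "\<exists>Y. Y \<in> S k" for k using S(1)[of k] by (auto simp: bad_def)
  then obtain X where X: "\<And>k. X k \<in> S k" by metis
  have Xb: "X k \<in> matball p q 1" for k using X[of k] S(1)[of k] by (auto simp: bad_def)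
  have "\<exists>l. \<forall>k. absv (X k $$ (i, j) - l) \<le> (1 / 2) ^ k" if ij: "i < p" "j < q" for i j
  proof (rule limit_of_geometric_cauchy_sequence)
    fix m k :: nat assume "k \<le> m"
    then have "X m - X k \<in> matball p q ((1 / 2) ^ k)" using S(2) dec X by blast
    from matball_entry[OF this ij] show "absv (X m $$ (i, j) - X k $$ (i, j)) \<le> (1 / 2) ^ k"
      using ij matball_carrier[OF Xb, of m] matball_carrier[OF Xb, of k] by auto
  qed
  then obtain L where L: "\<And>i j k. i < p \<Longrightarrow> j < q \<Longrightarrow> absv (X k $$ (i, j) - L i j) \<le> (1 / 2) ^ k"
    by metis
  define Z where "Z = mat p q (\<lambda>(i, j). L i j)"
  have XZ: "X k - Z \<in> matball p q ((1 / 2) ^ k)" for k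
    by (rule matballI) (use L matball_carrier[OF Xb, of k] in \<open>auto simp: Z_def\<close>)
  have Zc: "Z \<in> carrier_mat p q" by (simp add: Z_def)
  have "Z \<in> matball p q 1"
  proof -
    have "X 0 - (X 0 - Z) \<in> matball p q 1" by (rule matball_diff[OF Xb]) (use XZ[of 0] in simp)
    moreover have "X 0 - (X 0 - Z) = Z" using Zc matball_carrier[OF Xb, of 0] by (intro eq_matI) auto
    ultimately show ?thesis by simp
  qed
  from loc[OF this] obtain c e where ce: "0 < e" "\<And>Y. Y \<in> matball p q 1 \<Longrightarrow> Y - Z \<in> matball p q e \<Longrightarrow> Q c Y"
    by blast
  obtain k where k: "(1 / 2) ^ k < e" using real_arch_pow_inv[of e "1 / 2"] ce by auto
  have "Q c Y" if Y: "Y \<in> S k" for Y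
  proof (rule ce(2))
    show Yb: "Y \<in> matball p q 1" using S(1)[of k] Y by (auto simp: bad_def)
    have "Y - Z \<in> matball p q ((1 / 2) ^ k)"
      by (rule matball_diff_trans[of _ _ _ "X k"])
        (use matball_carrier[OF Yb] matball_carrier[OF Xb, of k] Zc S(2)[OF Y X] XZ in auto)
    then show "Y - Z \<in> matball p q e" by (rule matball_mono) (use k in simp)
  qed
  then show False using S(1)[of k] by (auto simp: bad_def)
qed

section \<open>General linear groups over the field and over its ring of integers\<close>

lemma GL_iff: "A \<in> carrier (GL n) \<longleftrightarrow> A \<in> carrier_mat n n \<and> (\<exists>B\<in>carrier_mat n n. A * B = 1\<^sub>m n \<and> B * A = 1\<^sub>m n)"
  by (auto simp: GL_def units_of_def Units_def ring_mat_def)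

lemma GL_I: "A \<in> carrier_mat n n \<Longrightarrow> B \<in> carrier_mat n n \<Longrightarrow> A * B = 1\<^sub>m n \<Longrightarrow> A \<in> carrier (GL n)"
  using mat_mult_left_right_inverse[of A n B] by (auto simp: GL_iff)

lemma GL_carrier: "A \<in> carrier (GL n) \<Longrightarrow> A \<in> carrier_mat n n" by (simp add: GL_iff)

lemma GL_obtain_inverse:
  assumes "A \<in> carrier (GL n)"
  obtains B where "B \<in> carrier (GL n)" "A * B = 1\<^sub>m n" "B * A = 1\<^sub>m n"
  using assms by (auto simp: GL_iff)

lemma GL_mult_eq [simp]: "x \<otimes>\<^bsub>GL n\<^esub> y = x * y" by (simp add: GL_def units_of_def ring_mat_def)

lemma GL_one_eq [simp]: "\<one>\<^bsub>GL n\<^esub> = 1\<^sub>m n" by (simp add: GL_def units_of_def ring_mat_def)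

lemma GL_group: "group (GL n :: 'a mat monoid)"
  unfolding GL_def by (rule monoid.units_group) (rule ring.axioms(2)[OF ring_mat])

lemma GL_one: "1\<^sub>m n \<in> carrier (GL n)" by (rule GL_I[of _ _ "1\<^sub>m n"]) auto

lemma GL_mult: "A \<in> carrier (GL n) \<Longrightarrow> B \<in> carrier (GL n) \<Longrightarrow> A * B \<in> carrier (GL (n::nat) :: 'a mat monoid)"
  using monoid.m_closed[OF group.is_monoid[OF GL_group[of n]], of A B] by simp

text \<open>The group \<open>GL\<^sub>n(O)\<close> over the ring of integers \<open>O\<close>.\<close>

definition GLO :: "nat \<Rightarrow> 'a mat set" where
  "GLO n = {A \<in> matball n n 1. \<exists>B\<in>matball n n 1. A * B = 1\<^sub>m n \<and> B * A = 1\<^sub>m n}"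

lemma GLO_subset_GL: "A \<in> GLO n \<Longrightarrow> A \<in> carrier (GL n)"
  using matball_carrier by (fastforce simp: GLO_def GL_iff)

lemma GLO_matball: "A \<in> GLO n \<Longrightarrow> A \<in> matball n n 1" by (simp add: GLO_def)

lemma GLO_carrier: "A \<in> GLO n \<Longrightarrow> A \<in> carrier_mat n n" using GLO_matball matball_carrier by blast

lemma GLO_I: "A \<in> matball n n 1 \<Longrightarrow> B \<in> matball n n 1 \<Longrightarrow> A * B = 1\<^sub>m n \<Longrightarrow> A \<in> GLO n"
  using mat_mult_left_right_inverse[of A n B] matball_carrier by (auto simp: GLO_def)

lemma GLO_obtain_inverse:
  assumes "A \<in> GLO n"
  obtains B where "B \<in> GLO n" "A * B = 1\<^sub>m n" "B * A = 1\<^sub>m n"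
  using assms by (auto simp: GLO_def)

lemma GLO_one: "1\<^sub>m n \<in> GLO n" by (rule GLO_I[OF matball_one matball_one]) simp

lemma matball_mult_1: "A \<in> matball p q 1 \<Longrightarrow> B \<in> matball q s 1 \<Longrightarrow> A * B \<in> matball p s 1"
  using matball_mult[of A p q 1 B s 1] by simp

lemma mult_inverses:
  fixes A :: "'a mat"
  assumes "A \<in> carrier_mat n n" "A' \<in> carrier_mat n n" "B \<in> carrier_mat n n" "B' \<in> carrier_mat n n"
    and "A * A' = 1\<^sub>m n" "B * B' = 1\<^sub>m n"
  shows "(A * B) * (B' * A') = 1\<^sub>m n"
proof -
  have "(A * B) * (B' * A') = A * (B * (B' * A'))"
    using assms by (intro assoc_mult_mat[of _ n n _ n _ n]) auto
  also have "B * (B' * A') = (B * B') * A'"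
    using assms by (intro assoc_mult_mat[of _ n n _ n _ n, symmetric]) auto
  finally show ?thesis using assms by simp
qed

lemma GLO_mult:
  assumes "A \<in> GLO n" "B \<in> GLO n" shows "A * B \<in> GLO n"
proof -
  obtain A' where A': "A' \<in> GLO n" "A * A' = 1\<^sub>m n" using assms GLO_obtain_inverse by blast
  obtain B' where B': "B' \<in> GLO n" "B * B' = 1\<^sub>m n" using assms GLO_obtain_inverse by blast
  show ?thesis
    by (rule GLO_I[of _ _ "B' * A'"])
      (use assms A' B' GLO_matball GLO_carrier in \<open>auto intro!: matball_mult_1 mult_inverses\<close>)
qed

text \<open>A vector in the kernel of \<open>1 + Z\<close> with \<open>Z\<close> small is zero, as its largest entry is smaller than
  itself. The inverse \<open>B = 1 - (A - 1) B\<close> is bounded by \<open>1\<close>, since each bound \<open>c > 1\<close> improves to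
  \<open>max 1 (e c)\<close>.\<close>

lemma near_one_inverse:
  assumes A: "A \<in> carrier_mat n n" "A - 1\<^sub>m n \<in> matball n n e" and e: "0 \<le> e" "e < 1"
  obtains B where "B \<in> matball n n 1" "A * B = 1\<^sub>m n" "B * A = 1\<^sub>m n" "B - 1\<^sub>m n \<in> matball n n e"
proof -
  have "det A \<noteq> 0"
  proof
    assume "det A = 0"
    then obtain v where v: "v \<in> carrier_vec n" "v \<noteq> 0\<^sub>v n" "A *\<^sub>v v = 0\<^sub>v n"
      using det_0_iff_vec_prod_zero[OF A(1)] by blast
    let ?M = "Max ((\<lambda>i. absv (v $ i)) ` {..<n})"
    from v obtain i0 where i0: "i0 < n" "v $ i0 \<noteq> 0"
      by (metis carrier_vecD eq_vecI index_zero_vec(1) index_zero_vec(2))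
    then have ne: "(\<lambda>i. absv (v $ i)) ` {..<n} \<noteq> {}" by auto
    have "?M \<in> (\<lambda>i. absv (v $ i)) ` {..<n}" by (rule Max_in) (use ne in auto)
    then obtain i where i: "i < n" "absv (v $ i) = ?M" by auto
    have max: "absv (v $ j) \<le> absv (v $ i)" if "j < n" for j
      unfolding i(2) by (rule Max_ge) (use that in auto)
    have pos: "0 < absv (v $ i)"
      using max[OF i0(1)] i0(2) absv_nonneg[of "v $ i0"] absv_eq_0_iff[of "v $ i0"] by linarith
    have "0 = (A *\<^sub>v v) $ i" using v i by simp
    also have "(A *\<^sub>v v) $ i = (\<Sum>j = 0..<n. A $$ (i, j) * v $ j)"
      using A(1) v(1) i(1) by (auto simp: scalar_prod_def simp del: v(3))
    also have "\<dots> = (\<Sum>j = 0..<n. (A - 1\<^sub>m n) $$ (i, j) * v $ j + (if j = i then v $ i else 0))"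
      using A i by (intro sum.cong) (auto simp: algebra_simps)
    also have "\<dots> = (\<Sum>j = 0..<n. (A - 1\<^sub>m n) $$ (i, j) * v $ j) + v $ i"
      using i by (simp add: sum.distrib)
    finally have "v $ i = - (\<Sum>j = 0..<n. (A - 1\<^sub>m n) $$ (i, j) * v $ j)"
      by (simp add: eq_neg_iff_add_eq_0 add.commute)
    then have "absv (v $ i) = absv (\<Sum>j = 0..<n. (A - 1\<^sub>m n) $$ (i, j) * v $ j)" by simp
    also have "\<dots> \<le> e * absv (v $ i)"
      by (intro absv_sum_le absv_mult_le matball_entry[OF A(2)] max mult_nonneg_nonneg e absv_nonneg i) auto
    also have "\<dots> < absv (v $ i)" using e pos by simp
    finally show False by simp
  qed
  then have "A \<in> carrier (GL n)"
    using det_non_zero_imp_unit[OF A(1), where b = "()"] by (simp add: GL_def units_of_def)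
  then obtain B where B: "B \<in> carrier (GL n)" "A * B = 1\<^sub>m n" "B * A = 1\<^sub>m n" by (rule GL_obtain_inverse)
  note Bc = GL_carrier[OF B(1)]
  have rec: "B = 1\<^sub>m n - (A - 1\<^sub>m n) * B"
  proof -
    have "(A - 1\<^sub>m n) * B = 1\<^sub>m n - B" using A Bc B by (simp add: minus_mult_distrib_mat)
    then show ?thesis using Bc by (intro eq_matI) auto
  qed
  obtain c where c: "B \<in> matball n n c" using matball_exhaust[OF Bc] by blast
  have "B \<in> matball n n (max 1 (e ^ k * c))" for k
  proof (induction k)
    case 0
    then show ?case using c by (auto intro: matball_mono)
  next
    case (Suc k)
    have "(A - 1\<^sub>m n) * B \<in> matball n n (e * max 1 (e ^ k * c))"
      by (rule matball_mult[OF A(2) Suc]) (use e in auto)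
    then have "1\<^sub>m n - (A - 1\<^sub>m n) * B \<in> matball n n (max 1 (e * max 1 (e ^ k * c)))"
      by (intro matball_diff matball_mono[OF matball_one]) (auto intro: matball_mono)
    then have "B \<in> matball n n (max 1 (e * max 1 (e ^ k * c)))" using rec by simp
    then show ?case by (rule matball_mono) (use e in \<open>auto simp: max_def mult.assoc mult_le_one\<close>)
  qed
  moreover have "\<exists>k. e ^ k * c \<le> 1"
  proof -
    obtain k where "e ^ k < 1 / (\<bar>c\<bar> + 1)" using real_arch_pow_inv[of "1 / (\<bar>c\<bar> + 1)" e] e by (auto simp: add_nonneg_pos)
    then have "e ^ k * \<bar>c\<bar> \<le> 1 / (\<bar>c\<bar> + 1) * \<bar>c\<bar>" using e by (intro mult_mono) auto
    moreover have "e ^ k * c \<le> e ^ k * \<bar>c\<bar>" using e by (intro mult_left_mono) auto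
    ultimately have "e ^ k * c \<le> 1 / (\<bar>c\<bar> + 1) * \<bar>c\<bar>" by linarith
    also have "\<dots> \<le> 1" by (simp add: field_simps)
    finally show ?thesis by blast
  qed
  ultimately have Bb: "B \<in> matball n n 1" by (metis max.absorb1)
  have "(A - 1\<^sub>m n) * B \<in> matball n n e" using matball_mult[OF A(2) Bb] e by simp
  then have "- ((A - 1\<^sub>m n) * B) \<in> matball n n e" by (rule matball_uminus)
  moreover have "- ((A - 1\<^sub>m n) * B) = B - 1\<^sub>m n"
  proof -
    have "(A - 1\<^sub>m n) * B = 1\<^sub>m n - B" using A Bc B by (simp add: minus_mult_distrib_mat)
    then show ?thesis using Bc by (intro eq_matI) auto
  qed
  ultimately show ?thesis using that B Bb by auto
qed

lemma det_matball: "A \<in> matball n n 1 \<Longrightarrow> absv (det A) \<le> 1"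
proof -
  assume A: "A \<in> matball n n 1"
  have "absv (\<Sum>p\<in>{p. p permutes {0..<n}}. signof p * (\<Prod>i = 0..<n. A $$ (i, p i))) \<le> 1"
  proof (rule absv_sum_le)
    fix p assume p: "p \<in> {p. p permutes {0..<n}}"
    have "absv (\<Prod>i = 0..<n. A $$ (i, p i)) \<le> 1"
      using p A by (intro absv_prod_le_1) (auto intro: matball_entry permutes_in_image[THEN iffD2])
    then show "absv (signof p * (\<Prod>i = 0..<n. A $$ (i, p i))) \<le> 1"
      by (auto simp: sign_def)
  qed simp
  then show ?thesis using matball_carrier[OF A] by (simp add: det_def)
qed

lemma det_GLO: "A \<in> GLO n \<Longrightarrow> absv (det A) = 1"
proof -
  assume A: "A \<in> GLO n"
  then obtain B where B: "B \<in> GLO n" "A * B = 1\<^sub>m n" using GLO_obtain_inverse by blast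
  have "absv (det A) * absv (det B) = 1"
    using det_mult[OF GLO_carrier[OF A] GLO_carrier[OF B(1)]] B(2) by (simp flip: absv_mult)
  moreover have "absv (det A) \<le> 1" "absv (det B) \<le> 1" using A B det_matball GLO_matball by blast+
  ultimately show ?thesis using absv_nonneg[of "det A"] absv_nonneg[of "det B"]
    by (metis mult_left_le mult.commute order_antisym mult_right_le_one_le)
qed

lemma openin_field_topology_ball: "openin (field_topology absv) {x. absv (x - a) < e}"
proof -
  interpret Metric_space UNIV "\<lambda>x y. absv (x - y)" by (rule metric)
  have "{x. absv (x - a) < e} = mball a e" by (auto simp: absv_diff_commute)
  then show ?thesis unfolding field_topology_def by simp
qed

lemma openin_field_topology_obtain:
  assumes "openin (field_topology absv) U" "a \<in> U"
  obtains e where "0 < e" "\<And>x. absv (x - a) < e \<Longrightarrow> x \<in> U"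
proof -
  interpret Metric_space UNIV "\<lambda>x y. absv (x - y)" by (rule metric)
  obtain r where r: "0 < r" "mball a r \<subseteq> U" using assms unfolding field_topology_def openin_mtopology by blast
  show ?thesis by (rule that[OF r(1)]) (use r(2) in \<open>auto simp: absv_diff_commute subset_iff\<close>)
qed

text \<open>The product has finitely many factors, so the smallest of the radii in the factors serves for all
  entries.\<close>

lemma openin_GL_topology_iff:
  "openin (GL_topology absv n) S \<longleftrightarrow>
    S \<subseteq> carrier (GL n) \<and> (\<forall>g\<in>S. \<exists>e>0. \<forall>h\<in>carrier (GL n). h - g \<in> matball n n e \<longrightarrow> h \<in> S)"
    (is "?L \<longleftrightarrow> ?R")
proof
  let ?I = "{..<n} \<times> {..<n}"
  let ?f = "\<lambda>A::'a mat. \<lambda>ij\<in>?I. A $$ ij"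
  let ?T = "product_topology (\<lambda>_. field_topology absv) ?I"
  {
    assume ?L
    then obtain U where U: "openin ?T U" "S = ?f -` U \<inter> carrier (GL n)"
      unfolding GL_topology_def openin_pullback_topology by blast
    have "\<exists>e>0. \<forall>h\<in>carrier (GL n). h - g \<in> matball n n e \<longrightarrow> h \<in> S" if g: "g \<in> S" for g
    proof -
      from g U have gU: "?f g \<in> U" and gG: "g \<in> carrier (GL n)" by auto
      obtain X where X: "?f g \<in> PiE ?I X" "\<And>i. openin (field_topology absv) (X i)" "PiE ?I X \<subseteq> U"
        using product_topology_open_contains_basis[OF U(1) gU] by metis
      have "\<exists>e>0. \<forall>x. absv (x - g $$ ij) < e \<longrightarrow> x \<in> X ij" if "ij \<in> ?I" for ij
      proof -
        have "g $$ ij \<in> X ij" using X(1) that by (auto simp: PiE_iff)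
        from openin_field_topology_obtain[OF X(2) this] show ?thesis by metis
      qed
      then obtain e where e: "\<And>ij. ij \<in> ?I \<Longrightarrow> 0 < e ij"
        "\<And>ij x. ij \<in> ?I \<Longrightarrow> absv (x - g $$ ij) < e ij \<Longrightarrow> x \<in> X ij" by metis
      define d where "d = Min (insert 1 (e ` ?I)) / 2"
      have m: "0 < Min (insert 1 (e ` ?I))" using e(1) by (subst Min_gr_iff) auto
      have d: "0 < d" "d < e ij" if "ij \<in> ?I" for ij
      proof -
        have "Min (insert 1 (e ` ?I)) \<le> e ij" using that by (intro Min_le) auto
        then show "0 < d" "d < e ij" using m unfolding d_def by linarith+
      qed
      have "h \<in> S" if h: "h \<in> carrier (GL n)" "h - g \<in> matball n n d" for h
      proof -
        have "h $$ ij \<in> X ij" if ij: "ij \<in> ?I" for ij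
        proof (rule e(2)[OF ij])
          obtain i j where ij': "ij = (i, j)" "i < n" "j < n" using ij by auto
          have "absv ((h - g) $$ (i, j)) \<le> d" using h ij' by (auto intro: matball_entry)
          then show "absv (h $$ ij - g $$ ij) < e ij"
            using GL_carrier[OF h(1)] GL_carrier[OF gG] ij' d(2)[OF ij] by auto
        qed
        then have "?f h \<in> PiE ?I X" by (auto simp: PiE_iff)
        then have "?f h \<in> U" using X(3) by blast
        then show ?thesis using U(2) h(1) by simp
      qed
      moreover have "0 < d" using m by (simp add: d_def)
      ultimately show ?thesis by blast
    qed
    moreover have "S \<subseteq> carrier (GL n)" using U by auto
    ultimately show ?R by blast
  }
  {
    assume R: ?R
    then obtain e where e: "\<And>g. g \<in> S \<Longrightarrow> 0 < e g"
      "\<And>g h. g \<in> S \<Longrightarrow> h \<in> carrier (GL n) \<Longrightarrow> h - g \<in> matball n n (e g) \<Longrightarrow> h \<in> S" by metis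
    define X where "X g ij = (if ij \<in> ?I then {x. absv (x - g $$ ij) < e g} else topspace (field_topology absv))"
      for g ij
    have "openin ?T (PiE ?I (X g))" for g
    proof (rule product_topology_basis)
      show "openin (field_topology absv) (X g ij)" for ij
        unfolding X_def using openin_field_topology_ball openin_topspace by auto
      have "{ij. X g ij \<noteq> topspace (field_topology absv)} \<subseteq> ?I" by (auto simp: X_def)
      then show "finite {ij. X g ij \<noteq> topspace (field_topology absv)}" by (rule finite_subset) simp
    qed
    then have "openin ?T (\<Union>g\<in>S. PiE ?I (X g))" by blast
    moreover have "S = ?f -` (\<Union>g\<in>S. PiE ?I (X g)) \<inter> carrier (GL n)"
    proof (intro equalityI subsetI)
      fix g assume g: "g \<in> S"
      then have "?f g \<in> PiE ?I (X g)" using e(1)[OF g] by (auto simp: PiE_iff X_def)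
      then show "g \<in> ?f -` (\<Union>g\<in>S. PiE ?I (X g)) \<inter> carrier (GL n)" using g R by auto
    next
      fix h assume "h \<in> ?f -` (\<Union>g\<in>S. PiE ?I (X g)) \<inter> carrier (GL n)"
      then obtain g where g: "g \<in> S" "?f h \<in> PiE ?I (X g)" and h: "h \<in> carrier (GL n)" by auto
      have gc: "g \<in> carrier_mat n n" using g R GL_carrier by blast
      have "absv ((h - g) $$ (i, j)) \<le> e g" if ij: "i < n" "j < n" for i j
      proof -
        have "h $$ (i, j) \<in> X g (i, j)" using PiE_mem[OF g(2), of "(i, j)"] ij by simp
        then show ?thesis using GL_carrier[OF h] gc ij by (auto simp: X_def)
      qed
      then have "h - g \<in> matball n n (e g)" using gc by (intro matballI) auto
      then show "h \<in> S" using e(2) g h by blast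
    qed
    ultimately show ?L unfolding GL_topology_def openin_pullback_topology by blast
  }
qed

text \<open>For \<open>0 < e < 1\<close> this is a principal congruence subgroup of \<open>GL\<^sub>n(O)\<close>. These subgroups form a
  neighbourhood basis of the identity.\<close>

definition congruence_group :: "nat \<Rightarrow> real \<Rightarrow> 'a mat set" where
  "congruence_group n e = {A \<in> carrier_mat n n. A - 1\<^sub>m n \<in> matball n n e}"

lemma congruence_group_carrier: "A \<in> congruence_group n e \<Longrightarrow> A \<in> carrier_mat n n"
  by (simp add: congruence_group_def)

lemma congruence_group_mono: "A \<in> congruence_group n e \<Longrightarrow> e \<le> d \<Longrightarrow> A \<in> congruence_group n d"
  by (auto simp: congruence_group_def intro: matball_mono)

lemma congruence_group_obtain_inverse:
  assumes A: "A \<in> congruence_group n e" and e: "0 < e" "e < 1"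
  obtains B where "B \<in> congruence_group n e" "A * B = 1\<^sub>m n" "B * A = 1\<^sub>m n"
proof -
  have "A \<in> carrier_mat n n" "A - 1\<^sub>m n \<in> matball n n e" using A by (auto simp: congruence_group_def)
  then obtain B where B: "B \<in> matball n n 1" "A * B = 1\<^sub>m n" "B * A = 1\<^sub>m n" "B - 1\<^sub>m n \<in> matball n n e"
    by (rule near_one_inverse) (use e in auto)
  show ?thesis by (rule that[of B]) (use B matball_carrier[OF B(1)] in \<open>auto simp: congruence_group_def\<close>)
qed

lemma congruence_group_matball:
  assumes A: "A \<in> congruence_group n e" and e: "0 < e" "e < 1"
  shows "A \<in> matball n n 1"
proof -
  have "(A - 1\<^sub>m n) + 1\<^sub>m n \<in> matball n n 1"
    using A e by (intro matball_add matball_one) (auto simp: congruence_group_def intro: matball_mono)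
  moreover have "(A - 1\<^sub>m n) + 1\<^sub>m n = A" using congruence_group_carrier[OF A] by (intro eq_matI) auto
  ultimately show ?thesis by simp
qed

lemma congruence_group_GLO: "A \<in> congruence_group n e \<Longrightarrow> 0 < e \<Longrightarrow> e < 1 \<Longrightarrow> A \<in> GLO n"
  by (meson GLO_I congruence_group_matball congruence_group_obtain_inverse)

lemma one_in_congruence_group: "0 < e \<Longrightarrow> 1\<^sub>m n \<in> congruence_group n e"
  by (auto simp: congruence_group_def matball_def)

lemma congruence_group_mult:
  assumes A: "A \<in> congruence_group n e" and B: "B \<in> congruence_group n e" and e: "0 < e" "e < 1"
  shows "A * B \<in> congruence_group n e"
proof -
  note c = congruence_group_carrier[OF A] congruence_group_carrier[OF B]
  have "A * B - 1\<^sub>m n = (A - 1\<^sub>m n) * B + (B - 1\<^sub>m n)"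
    using c by (subst minus_mult_distrib_mat[of _ n n _ _ n]) (auto intro!: eq_matI)
  moreover have "(A - 1\<^sub>m n) * B \<in> matball n n (e * 1)"
    by (rule matball_mult) (use A congruence_group_matball[OF B e] e in \<open>auto simp: congruence_group_def\<close>)
  ultimately show ?thesis using c B by (auto simp: congruence_group_def intro: matball_add)
qed

lemma congruence_group_conj:
  assumes L: "L \<in> matball n n 1" "L' \<in> matball n n 1" "L' * L = 1\<^sub>m n" and A: "A \<in> congruence_group n e" and e: "0 < e"
  shows "L' * A * L \<in> congruence_group n e"
proof -
  note c = congruence_group_carrier[OF A] matball_carrier[OF L(1)] matball_carrier[OF L(2)]
  have "L' * (A - 1\<^sub>m n) * L = L' * A * L - 1\<^sub>m n"
    using c L(3) mult_minus_distrib_mat[of L' n n A n "1\<^sub>m n"] minus_mult_distrib_mat[of "L' * A" n n L' L n] by simp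
  moreover have "L' * (A - 1\<^sub>m n) * L \<in> matball n n (1 * e * 1)"
    by (intro matball_mult) (use A e L in \<open>auto simp: congruence_group_def\<close>)
  ultimately show ?thesis using c by (simp add: congruence_group_def)
qed

lemma congruence_group_subgroup:
  assumes e: "0 < e" "e < 1" shows "subgroup (congruence_group n e) (GL n)"
proof (rule group.subgroupI[OF GL_group])
  show sub: "congruence_group n e \<subseteq> carrier (GL n)" using congruence_group_GLO GLO_subset_GL e by blast
  show "congruence_group n e \<noteq> {}" using one_in_congruence_group e by blast
  show "a \<otimes>\<^bsub>GL n\<^esub> b \<in> congruence_group n e" if "a \<in> congruence_group n e" "b \<in> congruence_group n e" for a b
    using congruence_group_mult that e by simp
  show "inv\<^bsub>GL n\<^esub> a \<in> congruence_group n e" if a: "a \<in> congruence_group n e" for a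
  proof -
    obtain b where b: "b \<in> congruence_group n e" "a * b = 1\<^sub>m n" "b * a = 1\<^sub>m n"
      using congruence_group_obtain_inverse[OF a e] .
    then have "inv\<^bsub>GL n\<^esub> a = b"
      by (intro group.inv_equality[OF GL_group]) (use sub a in auto)
    then show ?thesis using b by simp
  qed
qed

lemma congruence_group_open:
  assumes e: "0 < e" "e < 1" shows "openin (GL_topology absv n) (congruence_group n e)"
  unfolding openin_GL_topology_iff
proof (intro conjI ballI)
  show "congruence_group n e \<subseteq> carrier (GL n)" using congruence_group_GLO GLO_subset_GL e by blast
  fix g assume g: "g \<in> congruence_group n e"
  have "h \<in> congruence_group n e" if h: "h \<in> carrier (GL n)" "h - g \<in> matball n n e" for h
  proof -
    have "h - 1\<^sub>m n \<in> matball n n e"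
      by (rule matball_diff_trans[of _ _ _ g])
        (use GL_carrier[OF h(1)] h(2) congruence_group_carrier[OF g] g in \<open>auto simp: congruence_group_def\<close>)
    then show ?thesis using GL_carrier[OF h(1)] by (simp add: congruence_group_def)
  qed
  then show "\<exists>e'>0. \<forall>h\<in>carrier (GL n). h - g \<in> matball n n e' \<longrightarrow> h \<in> congruence_group n e"
    using e by blast
qed

lemma open_contains_congruence_group:
  assumes "openin (GL_topology absv n) S" "1\<^sub>m n \<in> S"
  obtains e where "0 < e" "e < 1" "congruence_group n e \<subseteq> S"
proof -
  obtain d where d: "0 < d" "\<And>h. h \<in> carrier (GL n) \<Longrightarrow> h - 1\<^sub>m n \<in> matball n n d \<Longrightarrow> h \<in> S"
    using assms unfolding openin_GL_topology_iff by blast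
  let ?e = "min d (1 / 2)"
  have e: "0 < ?e" "?e < 1" using d by auto
  have "congruence_group n ?e \<subseteq> S"
  proof
    fix h assume h: "h \<in> congruence_group n ?e"
    then have "h \<in> carrier (GL n)" using congruence_group_GLO GLO_subset_GL e by blast
    moreover have "h - 1\<^sub>m n \<in> matball n n d"
      using h by (auto simp: congruence_group_def intro: matball_mono)
    ultimately show "h \<in> S" using d(2) by blast
  qed
  then show ?thesis using that e by blast
qed

section \<open>Normal forms of rectangular matrices\<close>

definition rank_form :: "nat \<Rightarrow> nat \<Rightarrow> nat \<Rightarrow> 'a mat" where
  "rank_form p q c = mat p q (\<lambda>(i, j). if i = j \<and> i < c then 1 else 0)"

lemma rank_form_carrier [simp]: "rank_form p q c \<in> carrier_mat p q" by (simp add: rank_form_def)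

lemma four_block_matball:
  assumes "A \<in> matball p q c" "B \<in> matball p q' c" "C \<in> matball p' q c" "D \<in> matball p' q' c"
  shows "four_block_mat A B C D \<in> matball (p + p') (q + q') c"
proof -
  note c = assms[THEN matball_carrier]
  show ?thesis
    by (rule matballI) (use c assms in \<open>auto intro: matball_entry\<close>)
qed

lemma diag_inverse:
  assumes "A \<in> carrier_mat p p" "A' \<in> carrier_mat p p" "B \<in> carrier_mat q q" "B' \<in> carrier_mat q q"
    and "A * A' = 1\<^sub>m p" "B * B' = 1\<^sub>m q"
  shows "four_block_mat A (0\<^sub>m p q) (0\<^sub>m q p) B * four_block_mat A' (0\<^sub>m p q) (0\<^sub>m q p) B' = (1\<^sub>m (p + q) :: 'a mat)"
  using assms by (subst mult_four_block_mat[of _ p p _ q _ q _ _ p _ q]) auto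

lemma diag_GL:
  assumes "A \<in> carrier (GL p)" "B \<in> carrier (GL q)"
  shows "four_block_mat A (0\<^sub>m p q) (0\<^sub>m q p) B \<in> carrier (GL (p + q) :: 'a mat monoid)"
proof -
  obtain A' where A': "A' \<in> carrier (GL p)" "A * A' = 1\<^sub>m p" using assms(1) by (rule GL_obtain_inverse)
  obtain B' where B': "B' \<in> carrier (GL q)" "B * B' = 1\<^sub>m q" using assms(2) by (rule GL_obtain_inverse)
  show ?thesis
    by (rule GL_I[OF _ _ diag_inverse[of A p A' B q B']])
      (use A' B' assms[THEN GL_carrier] GL_carrier[OF A'(1)] GL_carrier[OF B'(1)] in auto)
qed

lemma diag_GLO:
  assumes "A \<in> GLO p" "B \<in> GLO q"
  shows "four_block_mat A (0\<^sub>m p q) (0\<^sub>m q p) B \<in> GLO (p + q)"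
proof -
  obtain A' where A': "A' \<in> GLO p" "A * A' = 1\<^sub>m p" using assms(1) by (rule GLO_obtain_inverse)
  obtain B' where B': "B' \<in> GLO q" "B * B' = 1\<^sub>m q" using assms(2) by (rule GLO_obtain_inverse)
  show ?thesis
    by (rule GLO_I[OF _ _ diag_inverse[of A p A' B q B']])
      (use A' B' assms GLO_carrier GLO_matball in \<open>auto intro!: four_block_matball matball_zero\<close>)
qed

lemma swap_GLO: "k < n \<Longrightarrow> l < n \<Longrightarrow> swaprows_mat n k l \<in> GLO n"
  by (rule GLO_I[of _ _ "swaprows_mat n k l"]) (auto simp: matball_def swaprows_mat_inv)

definition unip :: "nat \<Rightarrow> nat \<Rightarrow> 'a mat \<Rightarrow> 'a mat" where
  "unip p q y = four_block_mat (1\<^sub>m p) y (0\<^sub>m q p) (1\<^sub>m q)"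

lemma unip_carrier [simp]: "unip p q y \<in> carrier_mat (p + q) (p + q)" by (simp add: unip_def)

lemma unip_mult:
  "x \<in> carrier_mat p q \<Longrightarrow> y \<in> carrier_mat p q \<Longrightarrow> unip p q x * unip p q y = unip p q (x + y)"
  unfolding unip_def
  by (subst mult_four_block_mat[of _ p p _ q _ q _ _ p _ q]) (auto simp: comm_add_mat[of x p q y])

lemma unip_zero: "unip p q (0\<^sub>m p q) = 1\<^sub>m (p + q)" by (simp add: unip_def)

lemma unip_inverse: "y \<in> carrier_mat p q \<Longrightarrow> unip p q y * unip p q (- y) = 1\<^sub>m (p + q)"
  by (simp add: unip_mult flip: unip_zero) (simp add: uminus_l_inv_mat comm_add_mat[of y p q])

lemma unip_GL: "y \<in> carrier_mat p q \<Longrightarrow> unip p q y \<in> carrier (GL (p + q))"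
  by (rule GL_I[OF _ _ unip_inverse]) auto

lemma unip_congruence_group: "y \<in> matball p q e \<Longrightarrow> 0 < e \<Longrightarrow> unip p q y \<in> congruence_group (p + q) e"
proof -
  assume y: "y \<in> matball p q e" and e: "0 < e"
  have "unip p q y - 1\<^sub>m (p + q) = four_block_mat (0\<^sub>m p p) y (0\<^sub>m q p) (0\<^sub>m q q)"
    unfolding unip_def using matball_carrier[OF y] by (intro eq_matI) auto
  also have "\<dots> \<in> matball (p + q) (p + q) e"
    using y e by (intro four_block_matball matball_zero) auto
  finally show ?thesis by (simp add: congruence_group_def)
qed

text \<open>Pivot on an entry of largest absolute value: the column operations that clear the row are then
  integral.\<close>

lemma row_normal_form:
  assumes c: "c \<in> carrier_mat 1 (Suc q)" and nz: "j < Suc q" "c $$ (0, j) \<noteq> 0"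
  shows "\<exists>Y\<in>GLO (Suc q). \<exists>s. s \<noteq> 0 \<and> c * Y = four_block_mat (mat 1 1 (\<lambda>_. s)) (0\<^sub>m 1 q) (0\<^sub>m 0 1) (0\<^sub>m 0 q)"
proof -
  let ?M = "Max ((\<lambda>j. absv (c $$ (0, j))) ` {..q})"
  have "?M \<in> (\<lambda>j. absv (c $$ (0, j))) ` {..q}" by (rule Max_in) auto
  then obtain k where "k \<in> {..q}" "?M = absv (c $$ (0, k))" by (rule imageE)
  then have k: "k \<le> q" "absv (c $$ (0, k)) = ?M" by simp_all
  have max: "absv (c $$ (0, j)) \<le> absv (c $$ (0, k))" if "j \<le> q" for j
    unfolding k(2) by (rule Max_ge) (use that in auto)
  have pos: "0 < absv (c $$ (0, k))"
    using max[of j] nz absv_nonneg[of "c $$ (0, j)"] absv_eq_0_iff[of "c $$ (0, j)"] by linarith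
  define s where "s = c $$ (0, k)"
  have s0: "s \<noteq> 0" using pos by (auto simp: s_def)
  define S where "S = (swaprows_mat (Suc q) 0 k :: 'a mat)"
  define d where "d = c * S"
  have S: "S \<in> GLO (Suc q)" unfolding S_def by (rule swap_GLO) (use k in auto)
  have d_eq: "d = swapcols 0 k c" unfolding d_def S_def using swapcols_mat[OF c, of 0 k] k by simp
  have dc: "d \<in> carrier_mat 1 (Suc q)" unfolding d_def using c GLO_carrier[OF S] by auto
  have d0: "d $$ (0, 0) = s" using c k by (auto simp: d_eq s_def)
  have db: "absv (d $$ (0, j)) \<le> absv s" if "j < Suc q" for j
    using c k that max[of j] max[of 0] by (auto simp: d_eq s_def)
  define y where "y = mat 1 q (\<lambda>(i, j). - d $$ (0, Suc j) / s)"
  have y: "y \<in> matball 1 q 1"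
    by (rule matballI) (use db s0 absv_nonneg[of s] in \<open>auto simp: y_def absv_divide divide_le_eq_1 order_less_le\<close>)
  have U: "unip 1 q y \<in> GLO (Suc q)"
  proof -
    have ub: "unip 1 q z \<in> matball (1 + q) (1 + q) 1" if "z \<in> matball 1 q 1" for z
      unfolding unip_def using that by (intro four_block_matball matball_one matball_zero) auto
    have "unip 1 q y \<in> GLO (1 + q)"
      by (rule GLO_I[OF ub[OF y] ub[OF matball_uminus[OF y]] unip_inverse[OF matball_carrier[OF y]]])
    then show ?thesis by simp
  qed
  have d_block: "d = four_block_mat (mat 1 1 (\<lambda>_. s)) (mat 1 q (\<lambda>(i, j). d $$ (0, Suc j))) (0\<^sub>m 0 1) (0\<^sub>m 0 q)"
    using dc d0 by (intro eq_matI) (auto simp: less_Suc_eq_0_disj)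
  have z: "mat 1 1 (\<lambda>_. s) * y + mat 1 q (\<lambda>(i, j). d $$ (0, Suc j)) = 0\<^sub>m 1 q"
    using s0 by (intro eq_matI) (auto simp: y_def scalar_prod_def)
  have "d * unip 1 q y = four_block_mat (mat 1 1 (\<lambda>_. s)) (0\<^sub>m 1 q) (0\<^sub>m 0 1) (0\<^sub>m 0 q)"
    unfolding unip_def
    by (subst d_block, subst mult_four_block_mat[of _ 1 1 _ q _ 0 _ _ 1 _ q])
      (use matball_carrier[OF y] z in auto)
  moreover have "d * unip 1 q y = c * (S * unip 1 q y)"
    unfolding d_def
    using c GLO_carrier[OF S] GLO_carrier[OF U] by (intro assoc_mult_mat[of _ 1 "Suc q" _ "Suc q" _ "Suc q"]) auto
  ultimately show ?thesis using GLO_mult[OF S U] s0 by (intro bexI[of _ "S * unip 1 q y"] exI[of _ s]) simp_all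
qed

lemma rank_form_Suc:
  "rank_form (Suc p) (Suc q) (Suc c) = four_block_mat (1\<^sub>m 1) (0\<^sub>m 1 q) (0\<^sub>m p 1) (rank_form p q c)"
  unfolding rank_form_def by (intro eq_matI) auto

text \<open>Gaussian elimination with integral column operations. The rows may be transformed by any invertible
  matrix, as row operations are absorbed by the parabolic subgroup, but the column operations have to
  range over a compact group.\<close>

lemma rank_normal_form:
  assumes "C \<in> carrier_mat p q"
  shows "\<exists>X\<in>carrier (GL p). \<exists>Y\<in>GLO q. \<exists>c. c \<le> p \<and> c \<le> q \<and> X * C * Y = rank_form p q c"
  using assms
proof (induction p arbitrary: q C)
  case 0
  show ?case
    by (rule bexI[OF _ GL_one], rule bexI[OF _ GLO_one], rule exI[of _ 0])
      (use 0 in \<open>auto intro!: eq_matI simp: rank_form_def\<close>)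
next
  case (Suc p)
  show ?case
  proof (cases "C = 0\<^sub>m (Suc p) q")
    case True
    show ?thesis
      by (rule bexI[OF _ GL_one], rule bexI[OF _ GLO_one], rule exI[of _ 0])
        (use True in \<open>auto intro!: eq_matI simp: rank_form_def\<close>)
  next
    case False
    have "\<exists>i<Suc p. \<exists>j<q. C $$ (i, j) \<noteq> 0"
    proof (rule ccontr)
      assume "\<not> (\<exists>i<Suc p. \<exists>j<q. C $$ (i, j) \<noteq> 0)"
      then have "C = 0\<^sub>m (Suc p) q" using Suc.prems by (intro eq_matI) auto
      then show False using False by simp
    qed
    then obtain i j where ij: "i < Suc p" "j < q" "C $$ (i, j) \<noteq> 0" by blast
    then obtain q' where q': "q = Suc q'" by (cases q) auto
    define S where "S = (swaprows_mat (Suc p) 0 i :: 'a mat)"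
    define C1 where "C1 = S * C"
    have S: "S \<in> carrier (GL (Suc p))" unfolding S_def using swap_GLO[of 0 "Suc p" i] ij GLO_subset_GL by auto
    have C1_eq: "C1 = swaprows 0 i C" unfolding C1_def S_def using swaprows_mat[OF Suc.prems, of 0 i] ij by simp
    have C1c: "C1 \<in> carrier_mat (Suc p) (Suc q')" using Suc.prems C1_eq q' by simp
    define c where "c = mat 1 (Suc q') (\<lambda>(_, j). C1 $$ (0, j))"
    have cc: "c \<in> carrier_mat 1 (Suc q')" by (simp add: c_def)
    have "c $$ (0, j) \<noteq> 0" using ij Suc.prems q' by (auto simp: c_def C1_eq)
    with row_normal_form[OF cc, of j] ij q' obtain Y s where Y: "Y \<in> GLO (Suc q')" and s: "s \<noteq> 0"
      and cY: "c * Y = four_block_mat (mat 1 1 (\<lambda>_. s)) (0\<^sub>m 1 q') (0\<^sub>m 0 1) (0\<^sub>m 0 q')" by auto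
    note Yc = GLO_carrier[OF Y]
    define C2 where "C2 = C1 * Y"
    have C2c: "C2 \<in> carrier_mat (Suc p) (Suc q')" unfolding C2_def using C1c Yc by auto
    have row0: "C2 $$ (0, j) = (if j = 0 then s else 0)" if "j < Suc q'" for j
    proof -
      have "C2 $$ (0, j) = (c * Y) $$ (0, j)"
        using that C1c Yc by (simp add: C2_def c_def scalar_prod_def)
      then show ?thesis using that by (auto simp: cY)
    qed
    define V where "V = mat p 1 (\<lambda>(i, _). C2 $$ (Suc i, 0))"
    define D where "D = mat p q' (\<lambda>(i, j). C2 $$ (Suc i, Suc j))"
    have C2_block: "C2 = four_block_mat (mat 1 1 (\<lambda>_. s)) (0\<^sub>m 1 q') V D"
      using C2c row0 by (intro eq_matI) (auto simp: V_def D_def)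
    have VD: "V \<in> carrier_mat p 1" "D \<in> carrier_mat p q'" by (auto simp: V_def D_def)
    obtain X2 Y2 r where X2: "X2 \<in> carrier (GL p)" and Y2: "Y2 \<in> GLO q'" and r: "r \<le> p" "r \<le> q'"
      and IH: "X2 * D * Y2 = rank_form p q' r" using Suc.IH[OF VD(2)] by blast
    note X2c = GL_carrier[OF X2] and Y2c = GLO_carrier[OF Y2]
    define X1 where "X1 = four_block_mat (mat 1 1 (\<lambda>_. 1 / s)) (0\<^sub>m 1 p) (- (1 / s) \<cdot>\<^sub>m V) (1\<^sub>m p)"
    have X1c: "X1 \<in> carrier_mat (1 + p) (1 + p)" unfolding X1_def by (intro four_block_carrier_mat) auto
    have X1: "X1 \<in> carrier (GL (1 + p))"
    proof (rule GL_I[OF X1c])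
      let ?W = "four_block_mat (mat 1 1 (\<lambda>_. s)) (0\<^sub>m 1 p) V (1\<^sub>m p)"
      show "?W \<in> carrier_mat (1 + p) (1 + p)" by (intro four_block_carrier_mat) auto
      have 1: "mat 1 1 (\<lambda>_. 1 / s) * mat 1 1 (\<lambda>_. s) = (1\<^sub>m 1 :: 'a mat)"
        using s by (intro eq_matI) (auto simp: scalar_prod_def)
      have 2: "- (1 / s) \<cdot>\<^sub>m V * mat 1 1 (\<lambda>_. s) + V = 0\<^sub>m p 1"
        using VD s by (intro eq_matI) (auto simp: scalar_prod_def)
      show "X1 * ?W = 1\<^sub>m (1 + p)" unfolding X1_def
        by (subst mult_four_block_mat[of _ 1 1 _ p _ p _ _ 1 _ p]) (use VD 1 2 in auto)
    qed
    have "X1 * C2 = four_block_mat (1\<^sub>m 1) (0\<^sub>m 1 q') (0\<^sub>m p 1) D"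
    proof -
      have 1: "mat 1 1 (\<lambda>_. 1 / s) * mat 1 1 (\<lambda>_. s) = (1\<^sub>m 1 :: 'a mat)"
        using s by (intro eq_matI) (auto simp: scalar_prod_def)
      have 2: "- (1 / s) \<cdot>\<^sub>m V * mat 1 1 (\<lambda>_. s) + V = 0\<^sub>m p 1"
        using VD s by (intro eq_matI) (auto simp: scalar_prod_def)
      have 3: "mat 1 1 (\<lambda>_. 1 / s) * 0\<^sub>m 1 q' = (0\<^sub>m 1 q' :: 'a mat)" "(- (1 / s) \<cdot>\<^sub>m V) * 0\<^sub>m 1 q' = 0\<^sub>m p q'"
        using VD by auto
      show ?thesis unfolding X1_def C2_block
        by (subst mult_four_block_mat[of _ 1 1 _ p _ p _ _ 1 _ q']) (use VD 1 2 3 in auto)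
    qed
    define X3 where "X3 = four_block_mat (1\<^sub>m 1) (0\<^sub>m 1 p) (0\<^sub>m p 1) X2"
    define Y3 where "Y3 = four_block_mat (1\<^sub>m 1) (0\<^sub>m 1 q') (0\<^sub>m q' 1) Y2"
    have X3: "X3 \<in> carrier (GL (1 + p))" unfolding X3_def by (intro diag_GL GL_one X2)
    have Y3: "Y3 \<in> GLO (1 + q')" unfolding Y3_def by (intro diag_GLO GLO_one Y2)
    note X3c = GL_carrier[OF X3] and Y3c = GLO_carrier[OF Y3] and Sc = GL_carrier[OF S]
    have X3D: "X3 * (X1 * C2) = four_block_mat (1\<^sub>m 1) (0\<^sub>m 1 q') (0\<^sub>m p 1) (X2 * D)"
      unfolding X3_def \<open>X1 * C2 = _\<close>
      by (subst mult_four_block_mat[of _ 1 1 _ p _ p _ _ 1 _ q']) (use VD X2c in auto)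
    have XDc: "X2 * D \<in> carrier_mat p q'" using VD X2c by auto
    have final: "X3 * (X1 * C2) * Y3 = rank_form (Suc p) (Suc q') (Suc r)"
      unfolding X3D Y3_def rank_form_Suc
      by (subst mult_four_block_mat[of _ 1 1 _ q' _ p _ _ 1 _ q']) (use XDc Y2c IH right_mult_zero_mat[OF XDc, of 1] in auto)
    have assoc: "(X3 * (X1 * S)) * C * (Y * Y3) = X3 * (X1 * C2) * Y3"
    proof -
      have dims: "X3 \<in> carrier_mat (Suc p) (Suc p)" "X1 \<in> carrier_mat (Suc p) (Suc p)"
        "S \<in> carrier_mat (Suc p) (Suc p)" "C \<in> carrier_mat (Suc p) (Suc q')" "Y \<in> carrier_mat (Suc q') (Suc q')"
        "Y3 \<in> carrier_mat (Suc q') (Suc q')" using X3c X1c Sc Suc.prems q' Yc Y3c by auto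
      show ?thesis unfolding C2_def C1_def
        using dims by (simp add: assoc_mult_mat[of _ "Suc p" "Suc p" _ "Suc p" _ "Suc q'"]
            assoc_mult_mat[of _ "Suc p" "Suc p" _ "Suc p" _ "Suc p"]
            assoc_mult_mat[of _ "Suc p" "Suc p" _ "Suc q'" _ "Suc q'"]
            assoc_mult_mat[of _ "Suc p" "Suc q'" _ "Suc q'" _ "Suc q'"])
    qed
    show ?thesis unfolding q'
    proof (intro bexI exI conjI)
      show "(X3 * (X1 * S)) * C * (Y * Y3) = rank_form (Suc p) (Suc q') (Suc r)" using final assoc by simp
      show "X3 * (X1 * S) \<in> carrier (GL (Suc p))" using X3 X1 S by (intro GL_mult) auto
      show "Y * Y3 \<in> GLO (Suc q')" using Y Y3 by (intro GLO_mult) auto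
    qed (use r in auto)
  qed
qed

section \<open>Double cosets of the block unipotent group\<close>

definition blk :: "'a mat \<Rightarrow> nat \<Rightarrow> nat \<Rightarrow> nat \<Rightarrow> nat \<Rightarrow> 'a mat" where
  "blk A i j p q = mat p q (\<lambda>(k, l). A $$ (i + k, j + l))"

lemma blk_carrier [simp]: "blk A i j p q \<in> carrier_mat p q" by (simp add: blk_def)

lemma blk_dim [simp]: "dim_row (blk A i j p q) = p" "dim_col (blk A i j p q) = q" by (simp_all add: blk_def)

lemma blk_index [simp]: "k < p \<Longrightarrow> l < q \<Longrightarrow> blk A i j p q $$ (k, l) = A $$ (i + k, j + l)" by (simp add: blk_def)

lemma blk_matball: "A \<in> matball P Q c \<Longrightarrow> i + p \<le> P \<Longrightarrow> j + q \<le> Q \<Longrightarrow> blk A i j p q \<in> matball p q c"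
  by (rule matballI) (auto intro!: matball_entry)

lemma blk_add: "A \<in> carrier_mat P Q \<Longrightarrow> B \<in> carrier_mat P Q \<Longrightarrow> i + p \<le> P \<Longrightarrow> j + q \<le> Q \<Longrightarrow>
    blk (A + B) i j p q = blk A i j p q + blk B i j p q"
  by (intro eq_matI) auto

lemma blk_diff: "A \<in> carrier_mat P Q \<Longrightarrow> B \<in> carrier_mat P Q \<Longrightarrow> i + p \<le> P \<Longrightarrow> j + q \<le> Q \<Longrightarrow>
    blk (A - B) i j p q = blk A i j p q - blk B i j p q"
  by (intro eq_matI) auto

lemma four_block_blk:
  "A \<in> carrier_mat (p + p') (q + q') \<Longrightarrow>
    A = four_block_mat (blk A 0 0 p q) (blk A 0 q p q') (blk A p 0 p' q) (blk A p q p' q')"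
  by (intro eq_matI) auto

lemma blk_four_block:
  assumes "A \<in> carrier_mat p q" "B \<in> carrier_mat p q'" "C \<in> carrier_mat p' q" "D \<in> carrier_mat p' q'"
  shows "blk (four_block_mat A B C D) 0 0 p q = A" "blk (four_block_mat A B C D) 0 q p q' = B"
    "blk (four_block_mat A B C D) p 0 p' q = C" "blk (four_block_mat A B C D) p q p' q' = D"
  using assms by (auto intro!: eq_matI)

lemma four_block_eq_iff:
  fixes A :: "'a mat"
  assumes "A \<in> carrier_mat p q" "B \<in> carrier_mat p q'" "C \<in> carrier_mat p' q" "D \<in> carrier_mat p' q'"
    and "A' \<in> carrier_mat p q" "B' \<in> carrier_mat p q'" "C' \<in> carrier_mat p' q" "D' \<in> carrier_mat p' q'"
  shows "four_block_mat A B C D = four_block_mat A' B' C' D' \<longleftrightarrow> A = A' \<and> B = B' \<and> C = C' \<and> D = D'"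
  using blk_four_block[OF assms(1-4)] blk_four_block[OF assms(5-8)] by auto

definition para :: "nat \<Rightarrow> nat \<Rightarrow> 'a mat \<Rightarrow> 'a mat \<Rightarrow> 'a mat \<Rightarrow> 'a mat" where
  "para r m A X D = four_block_mat A X (0\<^sub>m m r) D"

lemma para_carrier: "A \<in> carrier_mat r r \<Longrightarrow> D \<in> carrier_mat m m \<Longrightarrow> para r m A X D \<in> carrier_mat (r + m) (r + m)"
  by (simp add: para_def)

lemma para_mult:
  assumes "A \<in> carrier_mat r r" "X \<in> carrier_mat r m" "D \<in> carrier_mat m m"
    "A' \<in> carrier_mat r r" "X' \<in> carrier_mat r m" "D' \<in> carrier_mat m m"
  shows "para r m A X D * para r m A' X' D' = para r m (A * A') (A * X' + X * D') (D * D')"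
  unfolding para_def
  using assms left_mult_zero_mat[of A' r r m] right_mult_zero_mat[of D m m r] right_mult_zero_mat[of X r m r]
    left_mult_zero_mat[of X' r m m]
  by (subst mult_four_block_mat[of _ r r _ m _ m _ _ r _ m]) auto

lemma para_obtain_inverse:
  assumes A: "A \<in> carrier (GL r)" and X: "X \<in> carrier_mat r m" and D: "D \<in> carrier (GL m)"
  obtains A' X' D' where "A' \<in> carrier (GL r)" "X' \<in> carrier_mat r m" "D' \<in> carrier (GL m)"
    "para r m A' X' D' * para r m A X D = 1\<^sub>m (r + m)"
proof -
  obtain A' where A': "A' \<in> carrier (GL r)" "A * A' = 1\<^sub>m r" using A by (rule GL_obtain_inverse)
  obtain D' where D': "D' \<in> carrier (GL m)" "D * D' = 1\<^sub>m m" using D by (rule GL_obtain_inverse)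
  note c = A[THEN GL_carrier] D[THEN GL_carrier] A'(1)[THEN GL_carrier] D'(1)[THEN GL_carrier]
  define X' where "X' = - (A' * (X * D'))"
  have XD: "X * D' \<in> carrier_mat r m" using X c by auto
  have X': "X' \<in> carrier_mat r m" using XD c by (simp add: X'_def)
  have "A * (A' * (X * D')) = X * D'"
    using assoc_mult_mat[of A r r A' r "X * D'" m] c XD A' left_mult_one_mat[OF XD] by simp
  moreover have "A * X' = - (A * (A' * (X * D')))"
    unfolding X'_def using c XD by (intro uminus_mult_right_mat) auto
  ultimately have "A * X' = - (X * D')" by simp
  then have "A * X' + X * D' = 0\<^sub>m r m" using XD by (simp add: uminus_l_inv_mat)
  then have "para r m A X D * para r m A' X' D' = 1\<^sub>m (r + m)"
    using para_mult[of A r X m D A' X' D'] c X X' A' D' by (simp add: para_def)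
  then have "para r m A' X' D' * para r m A X D = 1\<^sub>m (r + m)"
    by (rule mat_mult_left_right_inverse[rotated 2]) (use c X X' in \<open>auto intro: para_carrier\<close>)
  then show ?thesis using that A' X' D' by blast
qed

lemma para_GL:
  assumes A: "A \<in> carrier (GL r)" and X: "X \<in> carrier_mat r m" and D: "D \<in> carrier (GL m)"
  shows "para r m A X D \<in> carrier (GL (r + m))"
proof -
  obtain A' X' D' where inv: "A' \<in> carrier (GL r)" "X' \<in> carrier_mat r m" "D' \<in> carrier (GL m)"
    "para r m A' X' D' * para r m A X D = 1\<^sub>m (r + m)" using A X D by (rule para_obtain_inverse)
  note c = para_carrier[OF A[THEN GL_carrier] D[THEN GL_carrier]]
    para_carrier[OF inv(1)[THEN GL_carrier] inv(3)[THEN GL_carrier]]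
  show ?thesis by (rule GL_I[OF c(1) c(2) mat_mult_left_right_inverse[OF c(2) c(1) inv(4)]])
qed

lemma para_GL_D:
  assumes P: "para r m A X D \<in> carrier (GL (r + m))"
    and c: "A \<in> carrier_mat r r" "X \<in> carrier_mat r m" "D \<in> carrier_mat m m"
  shows "A \<in> carrier (GL r)" "D \<in> carrier (GL m)"
proof -
  have "det (para r m A X D) \<noteq> 0"
    by (rule unit_imp_det_non_zero[where n = "r + m" and b = "()"]) (use P in \<open>simp add: GL_def units_of_def\<close>)
  moreover have "det (para r m A X D) = det A * det D"
    unfolding para_def by (rule det_four_block_mat_lower_left_zero) (use c in auto)
  ultimately have "det A \<noteq> 0" "det D \<noteq> 0" by auto
  then show "A \<in> carrier (GL r)" "D \<in> carrier (GL m)"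
    using det_non_zero_imp_unit[OF c(1), where b = "()"] det_non_zero_imp_unit[OF c(3), where b = "()"]
    by (auto simp: GL_def units_of_def)
qed

text \<open>The last \<open>m\<close> rows determine the coset of a matrix modulo the parabolic subgroup: they span the
  subspace that the coset corresponds to.\<close>

lemma same_lower_rows_imp_same_coset:
  assumes g: "g \<in> carrier (GL (r + m))" and h: "h \<in> carrier (GL (r + m))" and D: "D \<in> carrier_mat m m"
    and eq: "blk g r 0 m (r + m) = D * blk h r 0 m (r + m)"
  shows "\<exists>A\<in>carrier (GL r). \<exists>X\<in>carrier_mat r m. g = para r m A X D * h \<and> D \<in> carrier (GL m)"
proof -
  obtain k where k: "k \<in> carrier (GL (r + m))" "h * k = 1\<^sub>m (r + m)" "k * h = 1\<^sub>m (r + m)"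
    using h by (rule GL_obtain_inverse)
  note c = g[THEN GL_carrier] h[THEN GL_carrier] k(1)[THEN GL_carrier]
  define p where "p = g * k"
  have pG: "p \<in> carrier (GL (r + m))" unfolding p_def by (rule GL_mult[OF g k(1)])
  note pc = GL_carrier[OF pG]
  have low: "blk (A * B) r 0 m (r + m) = blk A r 0 m (r + m) * B"
    if "A \<in> carrier_mat (r + m) (r + m)" "B \<in> carrier_mat (r + m) (r + m)" for A B
    using that by (intro eq_matI) (auto simp: scalar_prod_def)
  have "blk p r 0 m (r + m) = D * blk h r 0 m (r + m) * k" unfolding p_def using low[OF c(1,3)] eq by simp
  also have "\<dots> = D * (blk h r 0 m (r + m) * k)"
    by (rule assoc_mult_mat[of _ m m _ "r + m" _ "r + m"]) (use D c in auto)
  also have "\<dots> = D * blk (1\<^sub>m (r + m)) r 0 m (r + m)" using low[OF c(2,3)] k by simp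
  finally have lowp: "blk p r 0 m (r + m) = D * blk (1\<^sub>m (r + m)) r 0 m (r + m)" .
  have pe: "p $$ (r + i, j) = (if j < r then 0 else D $$ (i, j - r))" if ij: "i < m" "j < r + m" for i j
  proof -
    have "p $$ (r + i, j) = blk p r 0 m (r + m) $$ (i, j)" using ij by simp
    also have "\<dots> = (\<Sum>l = 0..<m. D $$ (i, l) * (if r + l = j then 1 else 0))"
      unfolding lowp using ij D by (auto simp: scalar_prod_def intro!: sum.cong)
    also have "\<dots> = (\<Sum>l = 0..<m. if l = j - r \<and> r \<le> j then D $$ (i, l) else 0)"
      by (intro sum.cong) auto
    also have "\<dots> = (if j < r then 0 else D $$ (i, j - r))" using ij by auto
    finally show ?thesis .
  qed
  have p_eq: "p = para r m (blk p 0 0 r r) (blk p 0 r r m) D"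
    unfolding para_def
    by (subst four_block_blk[of p r m r m, OF pc], intro cong_four_block_mat refl)
      (use D pe in \<open>auto intro!: eq_matI\<close>)
  have "p * h = g * (k * h)" unfolding p_def using c by (intro assoc_mult_mat[of _ "r + m" "r + m" _ "r + m" _ "r + m"]) auto
  then have "g = p * h" using k c by simp
  moreover have "blk p 0 0 r r \<in> carrier (GL r)" "D \<in> carrier (GL m)"
    using para_GL_D[of r m "blk p 0 0 r r" "blk p 0 r r m" D] pG p_eq D by auto
  ultimately show ?thesis using p_eq by (metis blk_carrier)
qed

text \<open>A zero row of the normal form would stay zero in all products with matrices from the right.\<close>

lemma rank_of_right_invertible:
  assumes H: "H \<in> carrier_mat b q" "Q \<in> carrier_mat q b" "H * Q = 1\<^sub>m b"
  shows "b \<le> q \<and> (\<exists>X\<in>carrier (GL b). \<exists>Y\<in>GLO q. X * H * Y = rank_form b q b)"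
proof -
  obtain X Y c where XY: "X \<in> carrier (GL b)" "Y \<in> GLO q" "c \<le> b" "c \<le> q" "X * H * Y = rank_form b q c"
    using rank_normal_form[OF H(1)] by blast
  obtain X' where X': "X' \<in> carrier (GL b)" "X * X' = 1\<^sub>m b" using XY(1) by (rule GL_obtain_inverse)
  obtain Y' where Y': "Y' \<in> GLO q" "Y * Y' = 1\<^sub>m q" using XY(2) by (rule GLO_obtain_inverse)
  note cc = XY(1)[THEN GL_carrier] X'(1)[THEN GL_carrier] XY(2)[THEN GLO_carrier] Y'(1)[THEN GLO_carrier] H(1,2)
  define Z where "Z = Y' * (Q * X')"
  have Zc: "Z \<in> carrier_mat q b" unfolding Z_def using cc by auto
  have "(X * H * Y) * Z = X * H * (Y * Z)"
    by (rule assoc_mult_mat[of _ b q _ q _ b]) (use cc Zc in auto)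
  also have "Y * Z = Y * Y' * (Q * X')"
    unfolding Z_def by (rule assoc_mult_mat[of _ q q _ q _ b, symmetric]) (use cc in auto)
  also have "\<dots> = Q * X'" using Y' cc by simp
  also have "X * H * (Q * X') = X * (H * (Q * X'))"
    by (rule assoc_mult_mat[of _ b b _ q _ b]) (use cc in auto)
  also have "H * (Q * X') = H * Q * X'"
    by (rule assoc_mult_mat[of _ b q _ b _ b, symmetric]) (use cc in auto)
  also have "\<dots> = X'" using H cc by simp
  finally have E: "rank_form b q c * Z = 1\<^sub>m b" using XY(5) X' by simp
  have "c = b"
  proof (rule ccontr)
    assume "c \<noteq> b"
    then have cb: "c < b" using XY(3) by simp
    have "(rank_form b q c * Z) $$ (c, c) = 0"
      using Zc cb by (auto simp: scalar_prod_def rank_form_def intro!: sum.neutral)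
    then show False using E cb by simp
  qed
  then show ?thesis using XY by blast
qed

lemma rank_of_left_invertible:
  assumes H: "H \<in> carrier_mat q b" "Q \<in> carrier_mat b q" "Q * H = 1\<^sub>m b"
  shows "b \<le> q \<and> (\<exists>X\<in>carrier (GL q). \<exists>Y\<in>GLO b. X * H * Y = rank_form q b b)"
proof -
  obtain X Y c where XY: "X \<in> carrier (GL q)" "Y \<in> GLO b" "c \<le> q" "c \<le> b" "X * H * Y = rank_form q b c"
    using rank_normal_form[OF H(1)] by blast
  obtain X' where X': "X' \<in> carrier (GL q)" "X' * X = 1\<^sub>m q" using XY(1) by (rule GL_obtain_inverse)
  obtain Y' where Y': "Y' \<in> GLO b" "Y' * Y = 1\<^sub>m b" using XY(2) by (rule GLO_obtain_inverse)
  note cc = XY(1)[THEN GL_carrier] X'(1)[THEN GL_carrier] XY(2)[THEN GLO_carrier] Y'(1)[THEN GLO_carrier] H(1,2)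
  define Z where "Z = Y' * Q * X'"
  have Zc: "Z \<in> carrier_mat b q" unfolding Z_def using cc by auto
  have "Z * (X * (H * Y)) = Z * X * (H * Y)"
    by (rule assoc_mult_mat[of _ b q _ q _ b, symmetric]) (use cc Zc in auto)
  also have "Z * X = Y' * Q * (X' * X)"
    unfolding Z_def by (rule assoc_mult_mat[of _ b q _ q _ q]) (use cc in auto)
  also have "\<dots> = Y' * Q" using X' cc by simp
  also have "Y' * Q * (H * Y) = Y' * (Q * (H * Y))"
    by (rule assoc_mult_mat[of _ b b _ q _ b]) (use cc in auto)
  also have "Q * (H * Y) = Q * H * Y"
    by (rule assoc_mult_mat[of _ b q _ b _ b, symmetric]) (use cc in auto)
  also have "\<dots> = Y" using H cc by simp
  also have "X * (H * Y) = X * H * Y"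
    by (rule assoc_mult_mat[of _ q q _ b _ b, symmetric]) (use cc in auto)
  finally have E: "Z * rank_form q b c = 1\<^sub>m b" using XY(5) Y' by simp
  have "c = b"
  proof (rule ccontr)
    assume "c \<noteq> b"
    then have cb: "c < b" using XY(4) by simp
    have "(Z * rank_form q b c) $$ (c, c) = 0"
      using Zc cb by (auto simp: scalar_prod_def rank_form_def intro!: sum.neutral)
    then show False using E cb by simp
  qed
  then show ?thesis using XY by blast
qed

definition levi :: "nat \<Rightarrow> 'a mat \<Rightarrow> 'a mat \<Rightarrow> 'a mat" where
  "levi n h1 h2 = four_block_mat h1 (0\<^sub>m n n) (0\<^sub>m n n) h2"

lemma levi_carrier: "h1 \<in> carrier_mat n n \<Longrightarrow> h2 \<in> carrier_mat n n \<Longrightarrow> levi n h1 h2 \<in> carrier_mat (n + n) (n + n)"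
  by (simp add: levi_def)

lemma levi_GLO: "h1 \<in> GLO n \<Longrightarrow> h2 \<in> GLO n \<Longrightarrow> levi n h1 h2 \<in> GLO (n + n)"
  unfolding levi_def by (rule diag_GLO)

lemma levi_mult:
  "h1 \<in> carrier_mat n n \<Longrightarrow> h2 \<in> carrier_mat n n \<Longrightarrow> k1 \<in> carrier_mat n n \<Longrightarrow> k2 \<in> carrier_mat n n \<Longrightarrow>
    levi n h1 h2 * levi n k1 k2 = levi n (h1 * k1) (h2 * k2)"
  unfolding levi_def by (subst mult_four_block_mat[of _ n n _ n _ n _ _ n _ n]) auto

lemma levi_unip:
  assumes h: "h1 \<in> carrier_mat n n" "h2 \<in> carrier_mat n n" "h2' \<in> carrier_mat n n" "h2' * h2 = 1\<^sub>m n"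
    and t: "t \<in> carrier_mat n n"
  shows "levi n h1 h2 * unip n n t = unip n n (h1 * t * h2') * levi n h1 h2"
proof -
  have "h1 * t * h2' * h2 = h1 * t * (h2' * h2)"
    by (rule assoc_mult_mat[of _ n n _ n _ n]) (use h t in auto)
  then have "h1 * t * h2' * h2 = h1 * t" using h t by simp
  then show ?thesis unfolding levi_def unip_def using h t
    by (simp add: mult_four_block_mat[of _ n n _ n _ n _ _ n _ n] left_add_zero_mat right_add_zero_mat)
qed

lemma blk_mult_rows:
  assumes "A \<in> carrier_mat P k" "B \<in> carrier_mat k q" "i + p \<le> P"
  shows "blk (A * B) i 0 p q = blk A i 0 p k * B"
  using assms by (intro eq_matI) (auto simp: scalar_prod_def)

lemma blk_mult_cols:
  assumes "A \<in> carrier_mat p k" "B \<in> carrier_mat k Q" "j + q \<le> Q"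
  shows "blk (A * B) 0 j p q = A * blk B 0 j k q"
  using assms by (intro eq_matI) (auto simp: scalar_prod_def)

lemma eq_if_row_blocks_eq:
  assumes A: "A \<in> carrier_mat (p + p') q" and B: "B \<in> carrier_mat (p + p') q"
    and top: "blk A 0 0 p q = blk B 0 0 p q" and bot: "blk A p 0 p' q = blk B p 0 p' q"
  shows "A = B"
proof (rule eq_matI)
  fix i j assume "i < dim_row B" "j < dim_col B"
  then have ij: "i < p + p'" "j < q" using B by auto
  show "A $$ (i, j) = B $$ (i, j)"
  proof (cases "i < p")
    case True
    then show ?thesis using arg_cong[OF top, of "\<lambda>M. M $$ (i, j)"] ij by simp
  next
    case False
    then show ?thesis using arg_cong[OF bot, of "\<lambda>M. M $$ (i - p, j)"] ij by simp
  qed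
qed (use A B in auto)

lemma blk_diag_mult:
  assumes D: "D \<in> carrier_mat b b" and B: "B \<in> carrier_mat (a + b) n"
  shows "blk (four_block_mat (1\<^sub>m a) (0\<^sub>m a b) (0\<^sub>m b a) D * B) 0 0 a n = blk B 0 0 a n"
    and "blk (four_block_mat (1\<^sub>m a) (0\<^sub>m a b) (0\<^sub>m b a) D * B) a 0 b n = D * blk B a 0 b n"
proof -
  let ?B1 = "blk B 0 0 a n" and ?B2 = "blk B a 0 b n"
  have B': "B = four_block_mat ?B1 (0\<^sub>m a 0) ?B2 (0\<^sub>m b 0)"
    using B by (intro eq_matI) auto
  have c: "D * ?B2 \<in> carrier_mat b n" using D by auto
  have "four_block_mat (1\<^sub>m a) (0\<^sub>m a b) (0\<^sub>m b a) D * B =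
      four_block_mat (1\<^sub>m a * ?B1 + 0\<^sub>m a b * ?B2) (1\<^sub>m a * 0\<^sub>m a 0 + 0\<^sub>m a b * 0\<^sub>m b 0)
        (0\<^sub>m b a * ?B1 + D * ?B2) (0\<^sub>m b a * 0\<^sub>m a 0 + D * 0\<^sub>m b 0)"
    by (subst (1) B', rule mult_four_block_mat) (use D in auto)
  also have "\<dots> = four_block_mat ?B1 (0\<^sub>m a 0) (D * ?B2) (0\<^sub>m b 0)"
    using D c by (intro cong_four_block_mat eq_matI) auto
  finally have eq: "four_block_mat (1\<^sub>m a) (0\<^sub>m a b) (0\<^sub>m b a) D * B = four_block_mat ?B1 (0\<^sub>m a 0) (D * ?B2) (0\<^sub>m b 0)" .
  show "blk (four_block_mat (1\<^sub>m a) (0\<^sub>m a b) (0\<^sub>m b a) D * B) 0 0 a n = ?B1"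
    and "blk (four_block_mat (1\<^sub>m a) (0\<^sub>m a b) (0\<^sub>m b a) D * B) a 0 b n = D * ?B2"
    unfolding eq using c by (auto intro!: blk_four_block)
qed

lemma rank_form_blocks: "rank_form (a + b) (a + a') a = four_block_mat (1\<^sub>m a) (0\<^sub>m a a') (0\<^sub>m b a) (0\<^sub>m b a')"
  unfolding rank_form_def by (intro eq_matI) auto

lemma same_lower_blocks_imp_same_coset:
  assumes g: "g \<in> carrier (GL (r + m))" and h: "h \<in> carrier (GL (r + m))" and D: "D \<in> carrier_mat m m"
    and rm: "r + m = n + n"
    and eq: "blk g r 0 m n = D * blk h r 0 m n" "blk g r n m n = D * blk h r n m n"
  shows "\<exists>A\<in>carrier (GL r). \<exists>X\<in>carrier_mat r m. g = para r m A X D * h \<and> D \<in> carrier (GL m)"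
proof (rule same_lower_rows_imp_same_coset[OF g h D], rule eq_matI)
  note c = GL_carrier[OF g] GL_carrier[OF h]
  fix i j assume "i < dim_row (D * blk h r 0 m (r + m))" "j < dim_col (D * blk h r 0 m (r + m))"
  then have ij: "i < m" "j < n + n" using D rm by auto
  show "blk g r 0 m (r + m) $$ (i, j) = (D * blk h r 0 m (r + m)) $$ (i, j)"
  proof (cases "j < n")
    case True
    have "blk g r 0 m n $$ (i, j) = (D * blk h r 0 m n) $$ (i, j)" using eq(1) by simp
    then show ?thesis using True ij D rm c by (simp add: scalar_prod_def)
  next
    case False
    have "blk g r n m n $$ (i, j - n) = (D * blk h r n m n) $$ (i, j - n)" using eq(2) by simp
    then show ?thesis using False ij D rm c by (simp add: scalar_prod_def)
  qed
qed (use D in auto)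

text \<open>Otherwise the upper left block of the normal form is an identity matrix, which makes \<open>M\<close> invertible
  in spite of its zero row.\<close>

lemma rank_lt_if_zero_row:
  assumes M: "M \<in> carrier_mat a a" and i: "i < a" and row: "\<And>j. j < a \<Longrightarrow> M $$ (i, j) = 0"
    and X: "X \<in> carrier_mat (a + b) (a + b)" and Y: "Y \<in> carrier_mat (a + a') (a + a')"
    and eq: "X * four_block_mat M (0\<^sub>m a a') (0\<^sub>m b a) (0\<^sub>m b a') * Y = rank_form (a + b) (a + a') c"
  shows "c < a"
proof (rule ccontr)
  assume ca: "\<not> c < a"
  let ?X1 = "blk X 0 0 a a" and ?Y1 = "blk Y 0 0 a a"
  have XMc: "?X1 * M \<in> carrier_mat a a" using M by auto
  have "X * four_block_mat M (0\<^sub>m a a') (0\<^sub>m b a) (0\<^sub>m b a') =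
      four_block_mat (?X1 * M) (0\<^sub>m a a') (blk X a 0 b a * M) (0\<^sub>m b a')"
    using M XMc
    by (subst four_block_blk[OF X], subst mult_four_block_mat[of _ a a _ b _ b _ _ a _ a'])
      (auto simp: right_mult_zero_mat[of _ a b] right_mult_zero_mat[of _ b b] right_mult_zero_mat[of _ a a] right_mult_zero_mat[of _ b a]
        right_add_zero_mat[of _ a a] right_add_zero_mat[of _ b a])
  then have "X * four_block_mat M (0\<^sub>m a a') (0\<^sub>m b a) (0\<^sub>m b a') * Y =
      four_block_mat (?X1 * M * ?Y1 + 0\<^sub>m a a' * blk Y a 0 a' a) (?X1 * M * blk Y 0 a a a' + 0\<^sub>m a a' * blk Y a a a' a')
        (blk X a 0 b a * M * ?Y1 + 0\<^sub>m b a' * blk Y a 0 a' a) (blk X a 0 b a * M * blk Y 0 a a a' + 0\<^sub>m b a' * blk Y a a a' a')"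
    using M XMc by (simp, subst four_block_blk[OF Y], subst mult_four_block_mat[of _ a a _ a' _ b _ _ a _ a']) auto
  then have "blk (rank_form (a + b) (a + a') c) 0 0 a a = ?X1 * M * ?Y1 + 0\<^sub>m a a' * blk Y a 0 a' a"
    unfolding eq using M
    by (simp only:) (intro blk_four_block, auto)
  moreover have "blk (rank_form (a + b) (a + a') c) 0 0 a a = 1\<^sub>m a"
    using ca by (intro eq_matI) (auto simp: rank_form_def)
  moreover have "?X1 * M * ?Y1 + 0\<^sub>m a a' * blk Y a 0 a' a = ?X1 * M * ?Y1"
  proof -
    have z: "0\<^sub>m a a' * blk Y a 0 a' a = 0\<^sub>m a a" by (rule left_mult_zero_mat) simp
    show ?thesis unfolding z by (rule right_add_zero_mat[of _ a a]) (use XMc in auto)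
  qed
  ultimately have "?X1 * M * ?Y1 = 1\<^sub>m a" by simp
  then have "?X1 * (M * ?Y1) = 1\<^sub>m a" using M assoc_mult_mat[of ?X1 a a M a ?Y1 a] by simp
  then have "(M * ?Y1) * ?X1 = 1\<^sub>m a"
    by (rule mat_mult_left_right_inverse[rotated 2]) (use M in auto)
  then have 1: "((M * ?Y1) * ?X1) $$ (i, i) = 1" using i by simp
  have "(M * ?Y1) $$ (i, k) = 0" if "k < a" for k
    using M i row that by (auto simp: scalar_prod_def intro!: sum.neutral)
  then have "((M * ?Y1) * ?X1) $$ (i, i) = 0"
    using M i by (subst index_mult_mat(1)) (auto simp: scalar_prod_def simp del: index_mult_mat(1) intro!: sum.neutral)
  then show False using 1 by simp
qed

text \<open>The quotient \<open>A\<^sup>-\<^sup>1 B\<close> is close to the identity.\<close>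

lemma GLO_open:
  assumes A: "A \<in> GLO n" and B: "B \<in> carrier_mat n n" "B - A \<in> matball n n (1/2)"
  shows "B \<in> GLO n"
proof -
  obtain A' where A': "A' \<in> GLO n" "A * A' = 1\<^sub>m n" "A' * A = 1\<^sub>m n" using A by (rule GLO_obtain_inverse)
  note c = GLO_carrier[OF A] GLO_carrier[OF A'(1)] B(1)
  have "A' * (B - A) \<in> matball n n (1 * (1/2))"
    by (rule matball_mult[OF GLO_matball[OF A'(1)] B(2)]) auto
  moreover have "A' * (B - A) = A' * B - 1\<^sub>m n"
    using mult_minus_distrib_mat[OF c(2) c(3) c(1)] A'(3) by simp
  ultimately have "A' * B \<in> congruence_group n (1/2)" using c by (simp add: congruence_group_def)
  then have "A' * B \<in> GLO n" by (rule congruence_group_GLO) auto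
  then have "A * (A' * B) \<in> GLO n" by (rule GLO_mult[OF A])
  moreover have "A * (A' * B) = B"
    unfolding assoc_mult_mat[OF c(1,2,3), symmetric] A'(2) using c by simp
  ultimately show ?thesis by simp
qed

end

text \<open>The four numbers are the dimensions of \<open>A\<close>, \<open>F\<^sup>n/A\<close>, \<open>B\<close>, \<open>F\<^sup>n/B\<close>, where \<open>A\<close> is the projection to the
  first summand of \<open>F\<^sup>n \<oplus> F\<^sup>n\<close> of the space spanned by the last rows of a matrix, and \<open>B\<close> is the
  intersection of this space with the second summand.\<close>

locale bruhat_cell = nonarchimedean_local_field absv for absv :: "'a::field \<Rightarrow> real" +
  fixes n a a' b b' :: nat
  assumes na: "n = a + a'" and nb: "n = b + b'"
begin

text \<open>The permutation matrix \<open>w\<close> represents the coset of \<open>A \<oplus> B\<close>, where \<open>A\<close> and \<open>B\<close> are spanned by the first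
  basis vectors of the two summands. Its inverse is \<open>v\<close>.\<close>

definition w11 :: "'a mat" where "w11 = four_block_mat (0\<^sub>m a' a) (1\<^sub>m a') (0\<^sub>m b' a) (0\<^sub>m b' a')"
definition w12 :: "'a mat" where "w12 = four_block_mat (0\<^sub>m a' b) (0\<^sub>m a' b') (0\<^sub>m b' b) (1\<^sub>m b')"
definition w21 :: "'a mat" where "w21 = four_block_mat (1\<^sub>m a) (0\<^sub>m a a') (0\<^sub>m b a) (0\<^sub>m b a')"
definition w22 :: "'a mat" where "w22 = four_block_mat (0\<^sub>m a b) (0\<^sub>m a b') (1\<^sub>m b) (0\<^sub>m b b')"

definition v11 :: "'a mat" where "v11 = four_block_mat (0\<^sub>m a a') (0\<^sub>m a b') (1\<^sub>m a') (0\<^sub>m a' b')"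
definition v12 :: "'a mat" where "v12 = four_block_mat (1\<^sub>m a) (0\<^sub>m a b) (0\<^sub>m a' a) (0\<^sub>m a' b)"
definition v21 :: "'a mat" where "v21 = four_block_mat (0\<^sub>m b a') (0\<^sub>m b b') (0\<^sub>m b' a') (1\<^sub>m b')"
definition v22 :: "'a mat" where "v22 = four_block_mat (0\<^sub>m b a) (1\<^sub>m b) (0\<^sub>m b' a) (0\<^sub>m b' b)"

definition w :: "'a mat" where "w = four_block_mat w11 w12 w21 w22"
definition v :: "'a mat" where "v = four_block_mat v11 v12 v21 v22"

lemma w_carriers:
  "w11 \<in> carrier_mat (a' + b') n" "w12 \<in> carrier_mat (a' + b') n"
  "w21 \<in> carrier_mat (a + b) n" "w22 \<in> carrier_mat (a + b) n"
proof -
  have "w11 \<in> carrier_mat (a' + b') (a + a')" "w21 \<in> carrier_mat (a + b) (a + a')"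
    "w12 \<in> carrier_mat (a' + b') (b + b')" "w22 \<in> carrier_mat (a + b) (b + b')"
    unfolding w11_def w12_def w21_def w22_def by simp_all
  then show "w11 \<in> carrier_mat (a' + b') n" "w12 \<in> carrier_mat (a' + b') n"
    "w21 \<in> carrier_mat (a + b) n" "w22 \<in> carrier_mat (a + b) n"
    unfolding na[symmetric] nb[symmetric] by simp_all
qed

lemma v_carriers:
  "v11 \<in> carrier_mat n (a' + b')" "v12 \<in> carrier_mat n (a + b)"
  "v21 \<in> carrier_mat n (a' + b')" "v22 \<in> carrier_mat n (a + b)"
proof -
  have "v11 \<in> carrier_mat (a + a') (a' + b')" "v12 \<in> carrier_mat (a + a') (a + b)"
    "v21 \<in> carrier_mat (b + b') (a' + b')" "v22 \<in> carrier_mat (b + b') (a + b)"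
    unfolding v11_def v12_def v21_def v22_def by simp_all
  then show "v11 \<in> carrier_mat n (a' + b')" "v12 \<in> carrier_mat n (a + b)"
    "v21 \<in> carrier_mat n (a' + b')" "v22 \<in> carrier_mat n (a + b)"
    unfolding na[symmetric] nb[symmetric] by simp_all
qed

lemma total: "(a' + b') + (a + b) = n + n" using na nb by simp

lemma w_carrier: "w \<in> carrier_mat (n + n) (n + n)"
proof -
  have "w \<in> carrier_mat ((a' + b') + (a + b)) (n + n)" unfolding w_def using w_carriers by simp
  then show ?thesis by (simp add: total)
qed

lemma v_carrier: "v \<in> carrier_mat (n + n) (n + n)"
proof -
  have "v \<in> carrier_mat (n + n) ((a' + b') + (a + b))" unfolding v_def using v_carriers by simp
  then show ?thesis by (simp add: total)
qed

lemma w_v_blocks: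
  "w11 * v11 + w12 * v21 = 1\<^sub>m (a' + b')" "w11 * v12 + w12 * v22 = 0\<^sub>m (a' + b') (a + b)"
  "w21 * v11 + w22 * v21 = 0\<^sub>m (a + b) (a' + b')" "w21 * v12 + w22 * v22 = 1\<^sub>m (a + b)"
proof -
  have "w11 * v11 = four_block_mat (1\<^sub>m a') (0\<^sub>m a' b') (0\<^sub>m b' a') (0\<^sub>m b' b')"
    unfolding w11_def v11_def by (subst mult_four_block_mat[of _ a' a _ a' _ b' _ _ a' _ b']) auto
  moreover have "w12 * v21 = four_block_mat (0\<^sub>m a' a') (0\<^sub>m a' b') (0\<^sub>m b' a') (1\<^sub>m b')"
    unfolding w12_def v21_def by (subst mult_four_block_mat[of _ a' b _ b' _ b' _ _ a' _ b']) auto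
  ultimately show "w11 * v11 + w12 * v21 = 1\<^sub>m (a' + b')"
    by (simp add: add_four_block_mat[of _ a' a' _ b' _ b'])
  have "w11 * v12 = four_block_mat (0\<^sub>m a' a) (0\<^sub>m a' b) (0\<^sub>m b' a) (0\<^sub>m b' b)"
    unfolding w11_def v12_def by (subst mult_four_block_mat[of _ a' a _ a' _ b' _ _ a _ b]) auto
  moreover have "w12 * v22 = four_block_mat (0\<^sub>m a' a) (0\<^sub>m a' b) (0\<^sub>m b' a) (0\<^sub>m b' b)"
    unfolding w12_def v22_def by (subst mult_four_block_mat[of _ a' b _ b' _ b' _ _ a _ b]) auto
  ultimately show "w11 * v12 + w12 * v22 = 0\<^sub>m (a' + b') (a + b)" by simp
  have "w21 * v11 = four_block_mat (0\<^sub>m a a') (0\<^sub>m a b') (0\<^sub>m b a') (0\<^sub>m b b')"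
    unfolding w21_def v11_def by (subst mult_four_block_mat[of _ a a _ a' _ b _ _ a' _ b']) auto
  moreover have "w22 * v21 = four_block_mat (0\<^sub>m a a') (0\<^sub>m a b') (0\<^sub>m b a') (0\<^sub>m b b')"
    unfolding w22_def v21_def by (subst mult_four_block_mat[of _ a b _ b' _ b _ _ a' _ b']) auto
  ultimately show "w21 * v11 + w22 * v21 = 0\<^sub>m (a + b) (a' + b')" by simp
  have "w21 * v12 = four_block_mat (1\<^sub>m a) (0\<^sub>m a b) (0\<^sub>m b a) (0\<^sub>m b b)"
    unfolding w21_def v12_def by (subst mult_four_block_mat[of _ a a _ a' _ b _ _ a _ b]) auto
  moreover have "w22 * v22 = four_block_mat (0\<^sub>m a a) (0\<^sub>m a b) (0\<^sub>m b a) (1\<^sub>m b)"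
    unfolding w22_def v22_def by (subst mult_four_block_mat[of _ a b _ b' _ b _ _ a _ b]) auto
  ultimately show "w21 * v12 + w22 * v22 = 1\<^sub>m (a + b)"
    by (simp add: add_four_block_mat[of _ a a _ b _ b])
qed

lemma w_v: "w * v = 1\<^sub>m (n + n)"
proof -
  have "w * v = four_block_mat (1\<^sub>m (a' + b')) (0\<^sub>m (a' + b') (a + b)) (0\<^sub>m (a + b) (a' + b')) (1\<^sub>m (a + b))"
    unfolding w_def v_def
    by (subst mult_four_block_mat[OF w_carriers v_carriers]) (simp only: w_v_blocks)
  then show ?thesis by (simp add: total)
qed

lemma w_GLO: "w \<in> GLO (n + n)"
proof (rule GLO_I[OF _ _ w_v])
  have w: "w11 \<in> matball (a' + b') (a + a') 1" "w12 \<in> matball (a' + b') (b + b') 1"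
    "w21 \<in> matball (a + b) (a + a') 1" "w22 \<in> matball (a + b) (b + b') 1"
    unfolding w11_def w12_def w21_def w22_def
    by (intro four_block_matball matball_one matball_zero; simp)+
  have v: "v11 \<in> matball (a + a') (a' + b') 1" "v12 \<in> matball (a + a') (a + b) 1"
    "v21 \<in> matball (b + b') (a' + b') 1" "v22 \<in> matball (b + b') (a + b) 1"
    unfolding v11_def v12_def v21_def v22_def
    by (intro four_block_matball matball_one matball_zero; simp)+
  from four_block_matball[OF w[folded na nb]] show "w \<in> matball (n + n) (n + n) 1"
    unfolding w_def by (simp add: total)
  from four_block_matball[OF v[folded na nb]] show "v \<in> matball (n + n) (n + n) 1"
    unfolding v_def by (simp add: total)
qed

lemma v_w: "v * w = 1\<^sub>m (n + n)"
  by (rule mat_mult_left_right_inverse[OF w_carrier v_carrier w_v])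

lemma v_matball: "v \<in> matball (n + n) (n + n) 1"
proof -
  obtain B where B: "B \<in> GLO (n + n)" "w * B = 1\<^sub>m (n + n)" "B * w = 1\<^sub>m (n + n)" using w_GLO by (rule GLO_obtain_inverse)
  have "v = (B * w) * v" using B v_carrier by simp
  also have "\<dots> = B * (w * v)" using GLO_carrier[OF B(1)] v_carrier w_carrier by (intro assoc_mult_mat) auto
  also have "\<dots> = B" using w_v GLO_carrier[OF B(1)] by simp
  finally show ?thesis using B GLO_matball by simp
qed

text \<open>The components of \<open>x\<close>, acting on row vectors: \<open>A \<rightarrow> B\<close>, \<open>A \<rightarrow> F\<^sup>n/B\<close>, \<open>F\<^sup>n/A \<rightarrow> B\<close> and
  \<open>F\<^sup>n/A \<rightarrow> F\<^sup>n/B\<close>. The second one is the coordinate on the orbit of \<open>w\<close> under \<open>N\<close>.\<close>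

abbreviation "x11 x \<equiv> blk x 0 0 a b"
abbreviation "x12 x \<equiv> blk x 0 b a b'"
abbreviation "x21 x \<equiv> blk x a 0 a' b"
abbreviation "x22 x \<equiv> blk x a b a' b'"

lemma x_blocks: "x \<in> carrier_mat n n \<Longrightarrow> x = four_block_mat (x11 x) (x12 x) (x21 x) (x22 x)"
  by (rule four_block_blk) (use na nb in auto)

lemma w_mult_x:
  assumes x: "x \<in> carrier_mat n n"
  shows "w11 * x + w12 = four_block_mat (x21 x) (x22 x) (0\<^sub>m b' b) (1\<^sub>m b')"
    and "w21 * x + w22 = four_block_mat (x11 x) (x12 x) (1\<^sub>m b) (0\<^sub>m b b')"
proof -
  have z: "0\<^sub>m p q * blk x i j q s = 0\<^sub>m p s" for p q s i j by (rule left_mult_zero_mat) simp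
  have o: "1\<^sub>m p * blk x i j p s = blk x i j p s" for p s i j by (rule left_mult_one_mat[of _ p s]) simp
  have al: "0\<^sub>m p s + blk x i j p s = blk x i j p s" for p s i j by (rule left_add_zero_mat) simp
  have ar: "blk x i j p s + 0\<^sub>m p s = blk x i j p s" for p s i j by (rule right_add_zero_mat) simp
  have "w11 * x = four_block_mat (x21 x) (x22 x) (0\<^sub>m b' b) (0\<^sub>m b' b')"
    unfolding w11_def
    by (subst x_blocks[OF x], subst mult_four_block_mat[of _ a' a _ a' _ b' _ _ b _ b']) (simp_all add: z o al ar)
  then show "w11 * x + w12 = four_block_mat (x21 x) (x22 x) (0\<^sub>m b' b) (1\<^sub>m b')"
    unfolding w12_def by (simp add: add_four_block_mat[of _ a' b _ b' _ b'] al ar)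
  have "w21 * x = four_block_mat (x11 x) (x12 x) (0\<^sub>m b b) (0\<^sub>m b b')"
    unfolding w21_def
    by (subst x_blocks[OF x], subst mult_four_block_mat[of _ a a _ a' _ b _ _ b _ b']) (simp_all add: z o al ar)
  then show "w21 * x + w22 = four_block_mat (x11 x) (x12 x) (1\<^sub>m b) (0\<^sub>m b b')"
    unfolding w22_def by (simp add: add_four_block_mat[of _ a b _ b' _ b] al ar)
qed

lemma w_unip:
  assumes x: "x \<in> carrier_mat n n"
  shows "w * unip n n x = four_block_mat w11 (four_block_mat (x21 x) (x22 x) (0\<^sub>m b' b) (1\<^sub>m b'))
     w21 (four_block_mat (x11 x) (x12 x) (1\<^sub>m b) (0\<^sub>m b b'))"
proof -
  have "w * unip n n x = four_block_mat (w11 * 1\<^sub>m n + w12 * 0\<^sub>m n n) (w11 * x + w12 * 1\<^sub>m n)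
      (w21 * 1\<^sub>m n + w22 * 0\<^sub>m n n) (w21 * x + w22 * 1\<^sub>m n)"
    unfolding w_def unip_def by (rule mult_four_block_mat[OF w_carriers]) (use x in auto)
  then show ?thesis using w_carriers w_mult_x[OF x]
    by (simp add: right_mult_zero_mat[OF w_carriers(2)] right_mult_zero_mat[OF w_carriers(4)] right_add_zero_mat)
qed

text \<open>The elements with \<open>x12 = 0\<close> stabilize \<open>P w\<close>. They act on the inducing representation through \<open>x22\<close> and
  \<open>x11\<close> only, as \<open>x21\<close> lands in the unipotent radical of \<open>P\<close>.\<close>

lemma w_unip_stabilizer:
  assumes s: "s \<in> carrier_mat n n" "x12 s = 0\<^sub>m a b'"
  shows "w * unip n n s = para (a' + b') (a + b) (unip a' b' (x22 s))
     (four_block_mat (0\<^sub>m a' a) (x21 s) (0\<^sub>m b' a) (0\<^sub>m b' b)) (unip a b (x11 s)) * w"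
    (is "_ = para _ _ ?A ?X ?D * w")
proof -
  have c: "?A \<in> carrier_mat (a' + b') (a' + b')" "?X \<in> carrier_mat (a' + b') (a + b)"
    "?D \<in> carrier_mat (a + b) (a + b)" by simp_all
  have z: "0\<^sub>m p q * blk s i j q t = 0\<^sub>m p t" for p q t i j by (rule left_mult_zero_mat) simp
  have z': "blk s i j q p * 0\<^sub>m p t = 0\<^sub>m q t" for p q t i j by (rule right_mult_zero_mat) simp
  have o: "blk s i j p t * 1\<^sub>m t = blk s i j p t" for p t i j by (rule right_mult_one_mat[of _ p t]) simp
  have al: "0\<^sub>m p t + blk s i j p t = blk s i j p t" for p t i j by (rule left_add_zero_mat) simp
  have ar: "blk s i j p t + 0\<^sub>m p t = blk s i j p t" for p t i j by (rule right_add_zero_mat) simp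
  have A1: "?A * w11 = w11"
    unfolding unip_def w11_def by (subst mult_four_block_mat[of _ a' a' _ b' _ b' _ _ a _ a']) (simp_all add: z z' o al ar)
  have A2: "?A * w12 = four_block_mat (0\<^sub>m a' b) (x22 s) (0\<^sub>m b' b) (1\<^sub>m b')"
    unfolding unip_def w12_def by (subst mult_four_block_mat[of _ a' a' _ b' _ b' _ _ b _ b']) (simp_all add: z z' o al ar)
  have X1: "?X * w21 = 0\<^sub>m (a' + b') n"
    unfolding w21_def na by (subst mult_four_block_mat[of _ a' a _ b _ b' _ _ a _ a']) (simp_all add: z z' o al ar)
  have X2: "?X * w22 = four_block_mat (x21 s) (0\<^sub>m a' b') (0\<^sub>m b' b) (0\<^sub>m b' b')"
    unfolding w22_def by (subst mult_four_block_mat[of _ a' a _ b _ b' _ _ b _ b']) (simp_all add: z z' o al ar)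
  have D1: "?D * w21 = w21"
    unfolding unip_def w21_def by (subst mult_four_block_mat[of _ a a _ b _ b _ _ a _ a']) (simp_all add: z z' o al ar)
  have D2: "?D * w22 = four_block_mat (x11 s) (0\<^sub>m a b') (1\<^sub>m b) (0\<^sub>m b b')"
    unfolding unip_def w22_def by (subst mult_four_block_mat[of _ a a _ b _ b _ _ b _ b']) (simp_all add: z z' o al ar)
  have X12: "?A * w12 + ?X * w22 = four_block_mat (x21 s) (x22 s) (0\<^sub>m b' b) (1\<^sub>m b')"
    unfolding A2 X2 by (subst add_four_block_mat[of _ a' b _ b' _ b']) (simp_all add: al ar)
  have "para (a' + b') (a + b) ?A ?X ?D * w = four_block_mat (?A * w11 + ?X * w21) (?A * w12 + ?X * w22)
      (0\<^sub>m (a + b) (a' + b') * w11 + ?D * w21) (0\<^sub>m (a + b) (a' + b') * w12 + ?D * w22)"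
    unfolding para_def w_def by (rule mult_four_block_mat) (use c w_carriers in auto)
  also have "\<dots> = four_block_mat w11 (four_block_mat (x21 s) (x22 s) (0\<^sub>m b' b) (1\<^sub>m b'))
     w21 (four_block_mat (x11 s) (0\<^sub>m a b') (1\<^sub>m b) (0\<^sub>m b b'))"
    unfolding X12 A1 X1 D1 D2 left_mult_zero_mat[OF w_carriers(1)] left_mult_zero_mat[OF w_carriers(2)]
    using w_carriers nb by (simp add: right_add_zero_mat[of _ "a' + b'" n] left_add_zero_mat[of _ "a + b" n])
  finally show ?thesis using w_unip[OF s(1)] s(2) by simp
qed

text \<open>The preimage of a stratum of the Grassmannian. It is a double coset of \<open>P\<close> and the normalizer of \<open>N\<close>, but
  only the compact part \<open>GL\<^sub>n(O) \<times> GL\<^sub>n(O)\<close> of the latter is needed to reach all of it.\<close>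

definition cell :: "'a mat set" where
  "cell = {para (a' + b') (a + b) A X D * (w * (unip n n x * levi n h1 h2)) | A X D x h1 h2.
     A \<in> carrier (GL (a' + b')) \<and> X \<in> carrier_mat (a' + b') (a + b) \<and> D \<in> carrier (GL (a + b)) \<and>
     x \<in> carrier_mat n n \<and> h1 \<in> GLO n \<and> h2 \<in> GLO n}"

lemma w_unip_levi_lower:
  assumes x: "x \<in> carrier_mat n n" and h: "h1 \<in> carrier_mat n n" "h2 \<in> carrier_mat n n"
  shows "blk (w * (unip n n x * levi n h1 h2)) (a' + b') 0 (a + b) n = w21 * h1"
    and "blk (w * (unip n n x * levi n h1 h2)) (a' + b') n (a + b) n = (w21 * x + w22) * h2"
proof -
  let ?Z = "w21 * x + w22" and ?Z' = "w11 * x + w12"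
  have c: "?Z \<in> carrier_mat (a + b) n" "?Z' \<in> carrier_mat (a' + b') n" using x w_carriers by auto
  have "w * (unip n n x * levi n h1 h2) = w * unip n n x * levi n h1 h2"
    using w_carrier h by (intro assoc_mult_mat[of _ "n + n" "n + n" _ "n + n" _ "n + n", symmetric]) (auto simp: levi_carrier)
  also have "w * unip n n x = four_block_mat w11 ?Z' w21 ?Z"
    using w_unip[OF x] w_mult_x[OF x] by simp
  also have "\<dots> * levi n h1 h2 = four_block_mat (w11 * h1 + ?Z' * 0\<^sub>m n n) (w11 * 0\<^sub>m n n + ?Z' * h2)
       (w21 * h1 + ?Z * 0\<^sub>m n n) (w21 * 0\<^sub>m n n + ?Z * h2)"
    unfolding levi_def by (rule mult_four_block_mat) (use w_carriers c h in auto)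
  finally have eq: "w * (unip n n x * levi n h1 h2) = four_block_mat (w11 * h1 + ?Z' * 0\<^sub>m n n) (w11 * 0\<^sub>m n n + ?Z' * h2)
       (w21 * h1 + ?Z * 0\<^sub>m n n) (w21 * 0\<^sub>m n n + ?Z * h2)" .
  have s: "w21 * h1 + ?Z * 0\<^sub>m n n = w21 * h1" "w21 * 0\<^sub>m n n + ?Z * h2 = ?Z * h2"
    using right_mult_zero_mat[OF c(1), of n] right_mult_zero_mat[OF w_carriers(3), of n] w_carriers c h
      right_add_zero_mat[of "w21 * h1" "a + b" n] left_add_zero_mat[of "?Z * h2" "a + b" n] by auto
  show "blk (w * (unip n n x * levi n h1 h2)) (a' + b') 0 (a + b) n = w21 * h1"
    "blk (w * (unip n n x * levi n h1 h2)) (a' + b') n (a + b) n = ?Z * h2"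
    unfolding eq s using w_carriers c h by (auto intro!: blk_four_block)
qed

text \<open>Multiply by \<open>w\<^sup>-\<^sup>1\<close> and compare the last rows. On the left they are \<open>(M, Z)\<close>, where \<open>Z\<close> is unipotent, fixes
  \<open>M\<close>, and the only non-zero block of \<open>M\<close> is \<open>x12\<close>; on the right they are \<open>D (k21, k22)\<close>. Hence
  \<open>M = Z\<^sup>-\<^sup>1 M = k22\<^sup>-\<^sup>1 k21\<close>, which is small.\<close>

lemma x12_small_if_near_base_point:
  assumes x: "x \<in> carrier_mat n n" and e: "0 < e" "e < 1"
    and A: "A \<in> carrier_mat (a' + b') (a' + b')" and X: "X \<in> carrier_mat (a' + b') (a + b)"
    and D: "D \<in> carrier_mat (a + b) (a + b)" and k: "k \<in> congruence_group (n + n) e"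
    and eq: "w * unip n n x = para (a' + b') (a + b) A X D * (k * w)"
  shows "x12 x \<in> matball a b' e"
proof -
  let ?r = "a' + b'" and ?m = "a + b"
  note kc = congruence_group_carrier[OF k]
  have kc': "k \<in> carrier_mat (?r + ?m) (?r + ?m)" using kc total by simp
  let ?k21 = "blk k ?r 0 ?m ?r" and ?k22 = "blk k ?r ?r ?m ?m"
  let ?Z = "unip a b (x11 x)" and ?N = "four_block_mat (0\<^sub>m a a') (x12 x) (0\<^sub>m b a') (0\<^sub>m b b')"
  have pc: "para ?r ?m A X D \<in> carrier_mat (n + n) (n + n)" using para_carrier[OF A D] total by simp
  have kb: "k - 1\<^sub>m (n + n) \<in> matball (?r + ?m) (?r + ?m) e" using k total by (simp add: congruence_group_def)
  have k21: "?k21 \<in> matball ?m ?r e"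
  proof -
    have "?k21 = blk (k - 1\<^sub>m (n + n)) ?r 0 ?m ?r" using kc total by (intro eq_matI) auto
    then show ?thesis using blk_matball[OF kb, of ?r ?m 0 ?r] by simp
  qed
  have k22: "?k22 \<in> congruence_group ?m e"
  proof -
    have "?k22 - 1\<^sub>m ?m = blk (k - 1\<^sub>m (n + n)) ?r ?r ?m ?m" using kc total by (intro eq_matI) auto
    then show ?thesis using blk_matball[OF kb, of ?r ?m ?r ?m] by (simp add: congruence_group_def)
  qed
  obtain k' where k': "k' \<in> congruence_group ?m e" "?k22 * k' = 1\<^sub>m ?m"
    using congruence_group_obtain_inverse[OF k22 e] by blast
  note k'c = congruence_group_carrier[OF k'(1)]
  have "w * unip n n x * v = para ?r ?m A X D * (k * w) * v" using eq by simp
  also have "\<dots> = para ?r ?m A X D * (k * (w * v))"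
    using pc kc w_carrier v_carrier
    by (simp add: assoc_mult_mat[of _ "n + n" "n + n" _ "n + n" _ "n + n"])
  also have "\<dots> = para ?r ?m A X D * k" using w_v kc by simp
  also have "\<dots> = four_block_mat (A * blk k 0 0 ?r ?r + X * ?k21) (A * blk k 0 ?r ?r ?m + X * ?k22)
       (0\<^sub>m ?m ?r * blk k 0 0 ?r ?r + D * ?k21) (0\<^sub>m ?m ?r * blk k 0 ?r ?r ?m + D * ?k22)"
    unfolding para_def by (subst (1) four_block_blk[OF kc'], rule mult_four_block_mat) (use A X D in auto)
  finally have L: "w * unip n n x * v = four_block_mat (A * blk k 0 0 ?r ?r + X * ?k21) (A * blk k 0 ?r ?r ?m + X * ?k22)
       (0\<^sub>m ?m ?r * blk k 0 0 ?r ?r + D * ?k21) (0\<^sub>m ?m ?r * blk k 0 ?r ?r ?m + D * ?k22)" .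
  let ?Y = "four_block_mat (x11 x) (x12 x) (1\<^sub>m b) (0\<^sub>m b b')"
  let ?Y' = "four_block_mat (x21 x) (x22 x) (0\<^sub>m b' b) (1\<^sub>m b')"
  have Yc: "?Y \<in> carrier_mat ?m n" "?Y' \<in> carrier_mat ?r n"
    using w_mult_x[OF x] w_carriers x by (metis add_carrier_mat)+
  have R: "w * unip n n x * v = four_block_mat (w11 * v11 + ?Y' * v21) (w11 * v12 + ?Y' * v22)
       (w21 * v11 + ?Y * v21) (w21 * v12 + ?Y * v22)"
    unfolding w_unip[OF x] v_def by (rule mult_four_block_mat) (use w_carriers v_carriers Yc in auto)
  have z: "0\<^sub>m p q * blk x i j q s = 0\<^sub>m p s" for p q s i j by (rule left_mult_zero_mat) simp
  have z': "blk x i j q p * 0\<^sub>m p t = 0\<^sub>m q t" for p q t i j by (rule right_mult_zero_mat) simp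
  have o: "blk x i j p t * 1\<^sub>m t = blk x i j p t" for p t i j by (rule right_mult_one_mat[of _ p t]) simp
  have al: "0\<^sub>m p t + blk x i j p t = blk x i j p t" for p t i j by (rule left_add_zero_mat) simp
  have ar: "blk x i j p t + 0\<^sub>m p t = blk x i j p t" for p t i j by (rule right_add_zero_mat) simp
  have 1: "w21 * v11 = 0\<^sub>m ?m ?r"
    unfolding w21_def v11_def by (subst mult_four_block_mat[of _ a a _ a' _ b _ _ a' _ b']) auto
  have 2: "?Y * v21 = ?N"
    unfolding v21_def by (subst mult_four_block_mat[of _ a b _ b' _ b _ _ a' _ b']) (simp_all add: z z' o al ar)
  have 3: "w21 * v12 = four_block_mat (1\<^sub>m a) (0\<^sub>m a b) (0\<^sub>m b a) (0\<^sub>m b b)"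
    unfolding w21_def v12_def by (subst mult_four_block_mat[of _ a a _ a' _ b _ _ a _ b]) auto
  have 4: "?Y * v22 = four_block_mat (0\<^sub>m a a) (x11 x) (0\<^sub>m b a) (1\<^sub>m b)"
    unfolding v22_def by (subst mult_four_block_mat[of _ a b _ b' _ b _ _ a _ b]) (simp_all add: z z' o al ar)
  have 5: "w21 * v12 + ?Y * v22 = ?Z"
    unfolding 3 4 unip_def by (subst add_four_block_mat[of _ a a _ b _ b]) (simp_all add: al ar)
  have Nc: "?N \<in> carrier_mat ?m ?r" by simp
  have 6: "w21 * v11 + ?Y * v21 = ?N" unfolding 1 2 by (rule left_add_zero_mat[OF Nc])
  have zz: "0\<^sub>m ?m ?r * blk k i j ?r s = 0\<^sub>m ?m s" for i j s by (rule left_mult_zero_mat) simp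
  have Dk: "D * ?k21 \<in> carrier_mat ?m ?r" "D * ?k22 \<in> carrier_mat ?m ?m" using D by auto
  have LL: "0\<^sub>m ?m ?r * blk k 0 0 ?r ?r + D * ?k21 = D * ?k21" "0\<^sub>m ?m ?r * blk k 0 ?r ?r ?m + D * ?k22 = D * ?k22"
    unfolding zz using Dk by (simp_all add: left_add_zero_mat[of _ ?m ?r] left_add_zero_mat[of _ ?m ?m])
  have "D * ?k21 = ?N \<and> D * ?k22 = ?Z"
  proof -
    have "four_block_mat (A * blk k 0 0 ?r ?r + X * ?k21) (A * blk k 0 ?r ?r ?m + X * ?k22) (D * ?k21) (D * ?k22)
       = four_block_mat (w11 * v11 + ?Y' * v21) (w11 * v12 + ?Y' * v22) ?N ?Z"
      using L R unfolding LL 5 6 by simp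
    then show ?thesis
      by (subst (asm) four_block_eq_iff[of _ ?r ?r _ ?m _ ?m]) (use A X D w_carriers v_carriers Yc in auto)
  qed
  then have DN: "D * ?k21 = ?N" and DZ: "D * ?k22 = ?Z" by auto
  have Zc: "?Z \<in> carrier_mat ?m ?m" by simp
  have "D = D * (?k22 * k')" using D k' by simp
  also have "\<dots> = ?Z * k'" unfolding DZ[symmetric] using D k'c by (intro assoc_mult_mat[symmetric]) auto
  finally have DZk: "D = ?Z * k'" .
  let ?Zi = "unip a b (- x11 x)"
  have ZiZ: "?Zi * ?Z = 1\<^sub>m ?m"
    by (rule mat_mult_left_right_inverse[OF _ _ unip_inverse]) simp_all
  have kk: "k' * ?k21 \<in> carrier_mat ?m ?r" using k'c by auto
  have "?Zi * ?N = ?Zi * (?Z * k' * ?k21)" using DN DZk by simp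
  also have "?Z * k' * ?k21 = ?Z * (k' * ?k21)" using k'c by (intro assoc_mult_mat[of _ ?m ?m _ ?m _ ?r]) auto
  also have "?Zi * (?Z * (k' * ?k21)) = ?Zi * ?Z * (k' * ?k21)"
    using kk by (intro assoc_mult_mat[of _ ?m ?m _ ?m _ ?r, symmetric]) auto
  also have "\<dots> = k' * ?k21" unfolding ZiZ by (rule left_mult_one_mat[OF kk])
  finally have "?Zi * ?N = k' * ?k21" .
  moreover have "?Zi * ?N = ?N"
  proof -
    have m: "- x11 x * 0\<^sub>m b a' = 0\<^sub>m a a'" "- x11 x * 0\<^sub>m b b' = 0\<^sub>m a b'" by (rule right_mult_zero_mat; simp)+
    have m1: "1\<^sub>m a * x12 x = x12 x" by (rule left_mult_one_mat[of _ a b']) simp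
    show ?thesis unfolding unip_def
      by (subst mult_four_block_mat[of _ a a _ b _ b _ _ a' _ b']) (simp_all add: z z' o al ar m m1)
  qed
  ultimately have N_eq: "?N = k' * ?k21" by simp
  have "k' * ?k21 \<in> matball ?m ?r (1 * e)"
    by (rule matball_mult[OF congruence_group_matball[OF k'(1) e] k21]) (use e in auto)
  then have "?N \<in> matball ?m ?r e" using N_eq by simp
  then have "blk ?N 0 a' a b' \<in> matball a b' e" by (rule blk_matball) auto
  moreover have "blk ?N 0 a' a b' = x12 x" by (rule blk_four_block(2)) auto
  ultimately show ?thesis by simp
qed

text \<open>If some entry of \<open>x12\<close> is large, then a small perturbation moves the subspace spanned by the
  last rows so that it meets the fixed space of \<open>N\<close> in a larger dimension: adding multiples of the last
  \<open>n\<close> columns to the first \<open>n\<close> replaces the identity block of \<open>w21\<close> by \<open>1 + x12 y\<close>, and a matrix \<open>y\<close> with the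
  single entry \<open>- 1 / x12\<^sub>i\<^sub>l\<close> makes row \<open>i\<close> of it vanish.\<close>

lemma large_x12_near_smaller_cell:
  assumes x: "x \<in> carrier_mat n n" and il: "i < a" "l < b'" and nz: "x12 x $$ (i, l) \<noteq> 0"
  shows "\<exists>k\<in>carrier_mat (n + n) (n + n). k - 1\<^sub>m (n + n) \<in> matball (n + n) (n + n) (1 / absv (x12 x $$ (i, l))) \<and>
    (\<exists>M\<in>carrier_mat a a. (\<forall>j<a. M $$ (i, j) = 0) \<and>
      blk (w * unip n n x * k) (a' + b') 0 (a + b) n = four_block_mat M (0\<^sub>m a a') (0\<^sub>m b a) (0\<^sub>m b a'))"
proof -
  define s where "s = x12 x $$ (i, l)"
  define y where "y = mat b' a (\<lambda>(l', i'). if l' = l \<and> i' = i then - (1 / s) else 0)"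
  define Y where "Y = four_block_mat (0\<^sub>m b a) (0\<^sub>m b a') y (0\<^sub>m b' a')"
  define k where "k = four_block_mat (1\<^sub>m n) (0\<^sub>m n n) Y (1\<^sub>m n)"
  define M where "M = 1\<^sub>m a + x12 x * y"
  have s0: "s \<noteq> 0" using nz by (simp add: s_def)
  have yc: "y \<in> carrier_mat b' a" by (simp add: y_def)
  have yb: "y \<in> matball b' a (1 / absv s)"
    by (rule matballI[OF yc]) (auto simp: y_def absv_divide absv_nonneg)
  have Yb: "Y \<in> matball n n (1 / absv s)"
  proof -
    have "Y \<in> matball (b + b') (a + a') (1 / absv s)"
      unfolding Y_def by (intro four_block_matball matball_zero yb) (auto simp: absv_nonneg)
    then show ?thesis by (simp flip: na nb)
  qed
  note Yc = matball_carrier[OF Yb]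
  have kc: "k \<in> carrier_mat (n + n) (n + n)" unfolding k_def by simp
  have "k - 1\<^sub>m (n + n) = four_block_mat (0\<^sub>m n n) (0\<^sub>m n n) Y (0\<^sub>m n n)"
    unfolding k_def using Yc by (intro eq_matI) auto
  then have kb: "k - 1\<^sub>m (n + n) \<in> matball (n + n) (n + n) (1 / absv s)"
    using Yb by (auto intro!: four_block_matball matball_zero simp: absv_nonneg)
  let ?Y = "four_block_mat (x11 x) (x12 x) (1\<^sub>m b) (0\<^sub>m b b')"
  let ?Y' = "four_block_mat (x21 x) (x22 x) (0\<^sub>m b' b) (1\<^sub>m b')"
  have YYc: "?Y \<in> carrier_mat (a + b) n" "?Y' \<in> carrier_mat (a' + b') n"
    using w_mult_x[OF x] w_carriers x by (metis add_carrier_mat)+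
  have R: "w * unip n n x * k = four_block_mat (w11 * 1\<^sub>m n + ?Y' * Y) (w11 * 0\<^sub>m n n + ?Y' * 1\<^sub>m n)
       (w21 * 1\<^sub>m n + ?Y * Y) (w21 * 0\<^sub>m n n + ?Y * 1\<^sub>m n)"
    unfolding w_unip[OF x] k_def by (rule mult_four_block_mat) (use w_carriers YYc Yc in auto)
  have xy: "x12 x * y \<in> carrier_mat a a" using yc by auto
  have "?Y * Y = four_block_mat (x12 x * y) (0\<^sub>m a a') (0\<^sub>m b a) (0\<^sub>m b a')"
  proof -
    have z': "blk x i j q p * 0\<^sub>m p t = 0\<^sub>m q t" for p q t i j by (rule right_mult_zero_mat) simp
    have z2: "0\<^sub>m b b' * y = 0\<^sub>m b a" by (rule left_mult_zero_mat[OF yc])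
    show ?thesis unfolding Y_def
      by (subst mult_four_block_mat[of _ a b _ b' _ b _ _ a _ a'])
        (use yc left_add_zero_mat[OF xy] in \<open>simp_all add: z' z2\<close>)
  qed
  then have "w21 * 1\<^sub>m n + ?Y * Y = w21 + four_block_mat (x12 x * y) (0\<^sub>m a a') (0\<^sub>m b a) (0\<^sub>m b a')"
    using right_mult_one_mat[OF w_carriers(3)] by simp
  also have "\<dots> = four_block_mat M (0\<^sub>m a a') (0\<^sub>m b a) (0\<^sub>m b a')"
    unfolding w21_def M_def by (subst add_four_block_mat[of _ a a _ a' _ b]) (use xy in auto)
  finally have e: "w21 * 1\<^sub>m n + ?Y * Y = four_block_mat M (0\<^sub>m a a') (0\<^sub>m b a) (0\<^sub>m b a')" .
  have "blk (w * unip n n x * k) (a' + b') 0 (a + b) n = w21 * 1\<^sub>m n + ?Y * Y"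
    unfolding R by (rule blk_four_block(3)) (use w_carriers YYc Yc in auto)
  moreover have "M $$ (i, j) = 0" if j: "j < a" for j
  proof -
    have "(x12 x * y) $$ (i, j) = (\<Sum>q = 0..<b'. x12 x $$ (i, q) * y $$ (q, j))"
      using il j yc by (auto simp: scalar_prod_def)
    also have "\<dots> = (\<Sum>q = 0..<b'. if q = l then (if j = i then - 1 else 0) else 0)"
      using il j s0 by (intro sum.cong) (auto simp: y_def s_def)
    also have "\<dots> = (if j = i then - 1 else 0)" using il by simp
    finally show ?thesis using xy il j by (auto simp: M_def)
  qed
  moreover have "M \<in> carrier_mat a a" using xy by (simp add: M_def)
  ultimately show ?thesis
    using kb e by (intro bexI[OF _ kc] conjI bexI[of _ M]) (simp_all add: s_def)
qed

end

context nonarchimedean_local_field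
begin

text \<open>The rank of the lower left block decides the cell. Let \<open>(C, E)\<close> be the last \<open>m\<close> rows of \<open>g\<close>. Once \<open>C\<close> is in
  normal form, its last \<open>b\<close> rows are zero, so the last \<open>b\<close> rows of \<open>E\<close> are linearly independent and can be
  brought to normal form by column operations on \<open>E\<close> alone. What is left, the first \<open>a\<close> rows of \<open>E\<close>, is the
  coordinate \<open>x\<close> on the orbit.\<close>

lemma bruhat_decomposition:
  assumes g: "g \<in> carrier (GL (r + m))" and rm: "r + m = n + n"
    and X: "X \<in> carrier (GL m)" and Y: "Y \<in> GLO n" and a: "a \<le> m" "a \<le> n"
    and eq: "X * blk g r 0 m n * Y = rank_form m n a"
  shows "m - a \<le> n" and "g \<in> bruhat_cell.cell absv n a (n - a) (m - a) (n - (m - a))"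
proof -
  define b where "b = m - a"
  define a' where "a' = n - a"
  have m_eq: "m = a + b" and n_eq: "n = a + a'" using a by (auto simp: b_def a'_def)
  define C where "C = blk g r 0 m n"
  define E where "E = blk g r n m n"
  obtain X' where X': "X' \<in> carrier (GL m)" "X * X' = 1\<^sub>m m" "X' * X = 1\<^sub>m m" using X by (rule GL_obtain_inverse)
  obtain Y' where Y': "Y' \<in> GLO n" "Y * Y' = 1\<^sub>m n" "Y' * Y = 1\<^sub>m n" using Y by (rule GLO_obtain_inverse)
  obtain gi where gi: "gi \<in> carrier (GL (r + m))" "g * gi = 1\<^sub>m (r + m)" using g by (rule GL_obtain_inverse)
  note c = X[THEN GL_carrier] X'(1)[THEN GL_carrier] Y[THEN GLO_carrier] Y'(1)[THEN GLO_carrier]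
  have CE: "C \<in> carrier_mat m n" "E \<in> carrier_mat m n" by (auto simp: C_def E_def)
  define U where "U = rank_form m n a"
  have U: "U = four_block_mat (1\<^sub>m a) (0\<^sub>m a a') (0\<^sub>m b a) (0\<^sub>m b a')"
    unfolding U_def m_eq n_eq by (rule rank_form_blocks)
  have Uc: "U \<in> carrier_mat m n" by (simp add: U_def)
  have Ubot: "blk U a 0 b n = 0\<^sub>m b n" unfolding U_def m_eq rank_form_def by (intro eq_matI) auto
  have XC: "X * C = U * Y'"
  proof -
    have "X * C = X * C * (Y * Y')" using Y' c CE by simp
    also have "\<dots> = X * C * Y * Y'" using c CE by (intro assoc_mult_mat[symmetric]) auto
    finally show ?thesis using eq by (simp add: C_def U_def)
  qed
  define E' where "E' = X * E"
  have E'c: "E' \<in> carrier_mat (a + b) n" unfolding E'_def using c CE m_eq by auto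
  define G12 where "G12 = blk gi 0 r n m"
  define G22 where "G22 = blk gi n r n m"
  have G: "G12 \<in> carrier_mat n m" "G22 \<in> carrier_mat n m" by (auto simp: G12_def G22_def)
  have gc: "g \<in> carrier_mat (r + m) (n + n)" "gi \<in> carrier_mat (n + n) (r + m)"
    using GL_carrier[OF g] GL_carrier[OF gi(1)] rm by auto
  have one: "C * G12 + E * G22 = 1\<^sub>m m"
  proof -
    have "g * gi = four_block_mat (blk g 0 0 r n * blk gi 0 0 n r + blk g 0 n r n * blk gi n 0 n r)
       (blk g 0 0 r n * G12 + blk g 0 n r n * G22) (C * blk gi 0 0 n r + E * blk gi n 0 n r) (C * G12 + E * G22)"
      unfolding C_def E_def G12_def G22_def
      by (subst (1) four_block_blk[OF gc(1)], subst (1) four_block_blk[OF gc(2)], rule mult_four_block_mat) auto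
    then have "blk (g * gi) r r m m = C * G12 + E * G22"
      using CE G by (simp only:) (intro blk_four_block(4), auto)
    moreover have "blk (g * gi) r r m m = 1\<^sub>m m" unfolding gi(2) by (intro eq_matI) auto
    ultimately show ?thesis by simp
  qed
  define P where "P = Y' * (G12 * X')"
  define Q where "Q = G22 * X'"
  have PQ: "P \<in> carrier_mat n m" "Q \<in> carrier_mat n m" unfolding P_def Q_def using c G by auto
  have UPEQ: "U * P + E' * Q = 1\<^sub>m m"
  proof -
    have "X * (C * G12) * X' = U * P"
    proof -
      have "X * (C * G12) * X' = X * C * G12 * X'" using c CE G by (simp add: assoc_mult_mat[of X m m C n G12 m])
      also have "\<dots> = U * Y' * G12 * X'" using XC by simp
      also have "\<dots> = U * Y' * (G12 * X')" using c Uc G by (intro assoc_mult_mat[of _ m n _ m _ m]) auto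
      also have "\<dots> = U * P" unfolding P_def using c Uc G by (intro assoc_mult_mat[of _ m n _ n _ m]) auto
      finally show ?thesis .
    qed
    moreover have "X * (E * G22) * X' = E' * Q"
    proof -
      have "X * (E * G22) * X' = X * E * G22 * X'" using c CE G by (simp add: assoc_mult_mat[of X m m E n G22 m])
      also have "\<dots> = X * E * (G22 * X')" using c CE G by (intro assoc_mult_mat[of _ m n _ m _ m]) auto
      finally show ?thesis by (simp add: E'_def Q_def)
    qed
    moreover have "X * (C * G12 + E * G22) * X' = X * (C * G12) * X' + X * (E * G22) * X'"
      using c CE G by (simp add: mult_add_distrib_mat[of X m m _ m] add_mult_distrib_mat[of _ m m _ _ m])
    ultimately have "U * P + E' * Q = X * (C * G12 + E * G22) * X'" by simp
    then show ?thesis unfolding one using c X' by simp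
  qed
  define E1 where "E1 = blk E' 0 0 a n"
  define E2 where "E2 = blk E' a 0 b n"
  have E12: "E1 \<in> carrier_mat a n" "E2 \<in> carrier_mat b n" by (auto simp: E1_def E2_def)
  have "E2 * blk Q 0 a n b = 1\<^sub>m b"
  proof -
    have "blk (U * P + E' * Q) a 0 b m = blk (U * P) a 0 b m + blk (E' * Q) a 0 b m"
      using Uc PQ E'c m_eq by (intro blk_add[of _ m m]) auto
    also have "blk (U * P) a 0 b m = 0\<^sub>m b n * P"
      using blk_mult_rows[of U m n P m a b] Uc PQ m_eq Ubot by simp
    also have "\<dots> = 0\<^sub>m b m" by (rule left_mult_zero_mat[OF PQ(1)])
    also have "blk (E' * Q) a 0 b m = E2 * Q"
      unfolding E2_def by (rule blk_mult_rows) (use E'c PQ in auto)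
    also have "0\<^sub>m b m + E2 * Q = E2 * Q" using E12 PQ by (intro left_add_zero_mat[of _ b m]) auto
    finally have 1: "blk (1\<^sub>m m) a 0 b m = E2 * Q" unfolding UPEQ .
    have "E2 * blk Q 0 a n b = blk (E2 * Q) 0 a b b"
      by (rule blk_mult_cols[symmetric]) (use E12 PQ m_eq in auto)
    also have "\<dots> = 1\<^sub>m b" unfolding 1[symmetric] using m_eq by (intro eq_matI) auto
    finally show ?thesis .
  qed
  from rank_of_right_invertible[OF E12(2) _ this] obtain X2 Y2 where
    bn: "b \<le> n" and X2: "X2 \<in> carrier (GL b)" and Y2: "Y2 \<in> GLO n" and XEY: "X2 * E2 * Y2 = rank_form b n b"
    by auto
  show "m - a \<le> n" using bn by (simp add: b_def)
  define b' where "b' = n - b"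
  interpret bruhat_cell absv n a a' b b'
    by unfold_locales (use n_eq bn in \<open>auto simp: b'_def\<close>)
  have U_w21: "U = w21" by (simp add: U w21_def)
  have r_eq: "r = a' + b'" using rm m_eq n_eq total by simp
  obtain X2' where X2': "X2' \<in> carrier (GL b)" "X2 * X2' = 1\<^sub>m b" "X2' * X2 = 1\<^sub>m b" using X2 by (rule GL_obtain_inverse)
  obtain Y2' where Y2': "Y2' \<in> GLO n" "Y2 * Y2' = 1\<^sub>m n" using Y2 by (rule GLO_obtain_inverse)
  note c2 = X2[THEN GL_carrier] X2'(1)[THEN GL_carrier] Y2[THEN GLO_carrier] Y2'(1)[THEN GLO_carrier]
  define dg where "dg = four_block_mat (1\<^sub>m a) (0\<^sub>m a b) (0\<^sub>m b a) X2'"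
  have dgc: "dg \<in> carrier_mat m m" unfolding dg_def m_eq using c2 by simp
  define x where "x = mat n n (\<lambda>(i, j). if i < a then (E1 * Y2) $$ (i, j) else 0)"
  have xc: "x \<in> carrier_mat n n" by (simp add: x_def)
  define Z where "Z = w21 * x + w22"
  have Zc: "Z \<in> carrier_mat m n" unfolding Z_def m_eq using w_carriers xc by auto
  have Z_eq: "Z = four_block_mat (x11 x) (x12 x) (1\<^sub>m b) (0\<^sub>m b b')" unfolding Z_def by (rule w_mult_x(2)[OF xc])
  have EYc: "E1 * Y2 \<in> carrier_mat a n" using E12 c2 by auto
  have Ztop: "blk Z 0 0 a n = E1 * Y2"
  proof (rule eq_matI)
    fix i j assume "i < dim_row (E1 * Y2)" "j < dim_col (E1 * Y2)"
    then have ij: "i < a" "j < n" using EYc by auto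
    then show "blk Z 0 0 a n $$ (i, j) = (E1 * Y2) $$ (i, j)"
      using nb n_eq by (auto simp: Z_eq x_def)
  qed (use EYc in auto)
  have Zbot: "blk Z a 0 b n = rank_form b n b"
    unfolding Z_eq rank_form_def using nb by (intro eq_matI) auto
  have ZYc: "Z * Y2' \<in> carrier_mat (a + b) n" using Zc c2 m_eq by auto
  have E'_eq: "E' = dg * (Z * Y2')"
  proof (rule eq_if_row_blocks_eq[OF E'c])
    show "dg * (Z * Y2') \<in> carrier_mat (a + b) n" using dgc ZYc m_eq by auto
    have t: "blk (Z * Y2') 0 0 a n = blk Z 0 0 a n * Y2'"
      by (rule blk_mult_rows[of _ m]) (use Zc c2 m_eq in auto)
    also have "\<dots> = E1 * (Y2 * Y2')" unfolding Ztop using E12 c2 by (intro assoc_mult_mat) auto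
    also have "\<dots> = E1" using Y2' E12 by simp
    finally show "blk E' 0 0 a n = blk (dg * (Z * Y2')) 0 0 a n"
      unfolding dg_def blk_diag_mult(1)[OF c2(2) ZYc] by (simp add: E1_def)
    have "blk (Z * Y2') a 0 b n = blk Z a 0 b n * Y2'"
      by (rule blk_mult_rows[of _ m]) (use Zc c2 m_eq in auto)
    also have "\<dots> = X2 * E2 * Y2 * Y2'" unfolding Zbot XEY ..
    also have "\<dots> = X2 * E2 * (Y2 * Y2')" using c2 E12 by (intro assoc_mult_mat[of _ b n _ n _ n]) auto
    also have "\<dots> = X2 * E2" using Y2' c2 E12 by simp
    finally have "X2' * blk (Z * Y2') a 0 b n = X2' * (X2 * E2)" by simp
    also have "\<dots> = X2' * X2 * E2" using c2 E12 by (intro assoc_mult_mat[symmetric]) auto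
    also have "\<dots> = E2" using X2' E12 by simp
    finally show "blk E' a 0 b n = blk (dg * (Z * Y2')) a 0 b n"
      unfolding dg_def blk_diag_mult(2)[OF c2(2) ZYc] by (simp add: E2_def)
  qed
  have UY: "U * Y' \<in> carrier_mat (a + b) n" using Uc c m_eq by auto
  have dgU: "U * Y' = dg * (U * Y')"
  proof (rule eq_if_row_blocks_eq[OF UY])
    show "dg * (U * Y') \<in> carrier_mat (a + b) n" using dgc UY m_eq by auto
    show "blk (U * Y') 0 0 a n = blk (dg * (U * Y')) 0 0 a n"
      unfolding dg_def blk_diag_mult(1)[OF c2(2) UY] ..
    have "blk (U * Y') a 0 b n = 0\<^sub>m b n * Y'"
      using blk_mult_rows[of U m n Y' n a b] Uc c m_eq Ubot by simp
    also have "\<dots> = 0\<^sub>m b n" using c by (intro left_mult_zero_mat) auto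
    finally have z: "blk (U * Y') a 0 b n = 0\<^sub>m b n" .
    show "blk (U * Y') a 0 b n = blk (dg * (U * Y')) a 0 b n"
      unfolding dg_def blk_diag_mult(2)[OF c2(2) UY] z using right_mult_zero_mat[OF c2(2), of n] by simp
  qed
  define D where "D = X' * dg"
  have Dc: "D \<in> carrier_mat m m" unfolding D_def using c dgc by auto
  define h where "h = w * (unip n n x * levi n Y' Y2')"
  have hG: "h \<in> carrier (GL (r + m))"
    unfolding h_def rm
    by (intro GL_mult GLO_subset_GL[OF w_GLO] GLO_subset_GL[OF levi_GLO] unip_GL xc Y' Y2')
  have low: "blk h r 0 m n = w21 * Y'" "blk h r n m n = Z * Y2'"
    unfolding h_def Z_def m_eq r_eq using w_unip_levi_lower[OF xc c(4) c2(4)] by auto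
  have X_cancel: "M = X' * (X * M)" if "M \<in> carrier_mat m n" for M
  proof -
    have "X' * (X * M) = X' * X * M" using that c by (intro assoc_mult_mat[symmetric]) auto
    then show ?thesis using X' that by simp
  qed
  have D1: "D * M = X' * (dg * M)" if "M \<in> carrier_mat m n" for M
    unfolding D_def using that c dgc by (intro assoc_mult_mat) auto
  have "blk g r 0 m n = D * blk h r 0 m n"
    unfolding low using X_cancel[OF CE(1)] XC dgU D1[of "U * Y'"] UY m_eq U_w21 by (simp add: C_def)
  moreover have "blk g r n m n = D * blk h r n m n"
    unfolding low using X_cancel[OF CE(2)] E'_eq D1[of "Z * Y2'"] ZYc m_eq by (simp add: E_def E'_def)
  ultimately obtain A XX where "A \<in> carrier (GL r)" "XX \<in> carrier_mat r m" "g = para r m A XX D * h" "D \<in> carrier (GL m)"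
    using same_lower_blocks_imp_same_coset[OF g hG Dc rm] by blast
  then have "g \<in> cell" unfolding cell_def h_def r_eq m_eq using xc Y' Y2' by blast
  then show "g \<in> bruhat_cell.cell absv n a (n - a) (m - a) (n - (m - a))"
    by (simp add: a'_def b_def b'_def)
qed

end

section \<open>Linear algebra of coinvariants and tensor products\<close>

lemma clinear_add: "clinear f \<Longrightarrow> f (x + y) = f x + f y"
  by (simp add: clinear_iff)

lemma clinear_scaleC: "clinear f \<Longrightarrow> f (c *\<^sub>C x) = c *\<^sub>C f x"
  by (simp add: clinear_iff)

lemma clinear_functional_scaleC: "clinear f \<Longrightarrow> f (c *\<^sub>C x) = c * (f x :: complex)"
  using clinear_scaleC[of f c x] by (simp add: scaleC_complex_def)

lemma clinear_zero: "clinear f \<Longrightarrow> f 0 = 0"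
  using clinear_add[of f 0 0] by simp

lemma clinear_diff: "clinear f \<Longrightarrow> f (x - y) = f x - f y"
  using clinear_add[of f "x - y" y] by simp

lemma clinear_sum: "clinear f \<Longrightarrow> f (\<Sum>i\<in>I. g i) = (\<Sum>i\<in>I. f (g i))"
  by (induction I rule: infinite_finite_induct) (auto simp: clinear_zero clinear_add)

lemma clinear_functionalI:
  "(\<And>x y. f (x + y) = f x + f y) \<Longrightarrow> (\<And>c x. f (c *\<^sub>C x) = c * f x) \<Longrightarrow> clinear (f :: _ \<Rightarrow> complex)"
  by (rule clinearI) (simp_all add: scaleC_complex_def)

lemma exists_separating_functional:
  fixes v :: "'v::complex_vector"
  assumes "v \<notin> complex_vector.span S"
  shows "\<exists>f. clinear f \<and> (\<forall>x\<in>S. f x = (0::complex)) \<and> f v = 1"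
proof -
  obtain B where B: "B \<subseteq> complex_vector.span S" "complex_vector.independent B"
    "complex_vector.span S \<subseteq> complex_vector.span B"
    by (rule complex_vector.maximal_independent_subset)
  have span_B: "complex_vector.span B = complex_vector.span S"
    using B complex_vector.span_mono[OF B(1)] by (simp add: complex_vector.span_span subset_antisym)
  interpret pair: vector_space_pair "scaleC :: complex \<Rightarrow> 'v \<Rightarrow> 'v" "scaleC :: complex \<Rightarrow> complex \<Rightarrow> complex"
    by unfold_locales
  have "complex_vector.independent (insert v B)"
    by (rule complex_vector.independent_insertI) (use assms span_B B in auto)
  from pair.linear_independent_extend[OF this, of "\<lambda>x. if x = v then 1 else 0"]
  obtain f :: "'v \<Rightarrow> complex" where f: "clinear f" "\<And>x. x \<in> insert v B \<Longrightarrow> f x = (if x = v then 1 else 0)"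
    by blast
  have vB: "v \<notin> B" using assms B(1) by blast
  have f0: "f x = 0" if "x \<in> complex_vector.span B" for x
    using that
  proof (induction rule: complex_vector.span_induct_alt)
    case base
    show ?case by (rule clinear_zero[OF f(1)])
  next
    case (step c x y)
    have "f x = 0" using f(2)[of x] step vB by auto
    then show ?case using step by (simp add: clinear_add[OF f(1)] clinear_functional_scaleC[OF f(1)])
  qed
  show ?thesis
    using f f0 span_B complex_vector.span_base[of _ S] by (intro exI[of _ f]) auto
qed

lemma tensor_ext:
  assumes L: "clinear L" and M: "clinear M" and eq: "\<And>v w. L (v \<otimes>\<^sub>t w) = M (v \<otimes>\<^sub>t w)"
  shows "L = M"
proof -
  have "\<exists>!K. clinear K \<and> (\<forall>v w. K (v \<otimes>\<^sub>t w) = M (v \<otimes>\<^sub>t w))"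
    by (rule ex1_tensor_lift) (use M in \<open>auto simp: clinear_iff tensor_bilinear\<close>)
  then show ?thesis using assms by blast
qed

lemma tensor_map_linear_pure:
  assumes "clinear f" "clinear g"
  shows "clinear (tensor_map f g) \<and> (\<forall>v w. tensor_map f g (v \<otimes>\<^sub>t w) = f v \<otimes>\<^sub>t g w)"
  unfolding tensor_map_def by (rule theI'[OF ex1_tensor_map[OF assms]])

lemma clinear_tensor_map: "clinear f \<Longrightarrow> clinear g \<Longrightarrow> clinear (tensor_map f g)"
  using tensor_map_linear_pure by blast

lemma tensor_map_pure: "clinear f \<Longrightarrow> clinear g \<Longrightarrow> tensor_map f g (v \<otimes>\<^sub>t w) = f v \<otimes>\<^sub>t g w"
  using tensor_map_linear_pure by blast

lemma clinear_comp: "clinear f \<Longrightarrow> clinear g \<Longrightarrow> clinear (\<lambda>x. f (g x))"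
  by (simp add: clinear_iff)

lemma clinear_id: "clinear (\<lambda>x. x)" by (simp add: clinear_iff)

lemma tensor_map_compose:
  assumes "clinear f" "clinear f'" "clinear g" "clinear g'"
  shows "tensor_map f g (tensor_map f' g' t) = tensor_map (\<lambda>x. f (f' x)) (\<lambda>x. g (g' x)) t"
proof -
  have "(\<lambda>t. tensor_map f g (tensor_map f' g' t)) = tensor_map (\<lambda>x. f (f' x)) (\<lambda>x. g (g' x))"
    by (rule tensor_ext) (use assms in \<open>auto intro: clinear_comp clinear_tensor_map simp: tensor_map_pure clinear_comp\<close>)
  then show ?thesis by metis
qed

lemma tensor_map_id: "tensor_map (\<lambda>x. x) (\<lambda>x. x) t = t"
proof -
  have "tensor_map (\<lambda>x. x) (\<lambda>x. x) = (\<lambda>t. t)"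
    by (rule tensor_ext) (auto intro: clinear_tensor_map clinear_id simp: tensor_map_pure clinear_id)
  then show ?thesis by metis
qed

text \<open>A functional that vanishes on all pure tensors is zero, as linear maps on the tensor product are
  determined by their values there.\<close>

lemma span_eq_UNIV_if_contains_pure_tensors:
  assumes "\<And>v w. v \<otimes>\<^sub>t w \<in> complex_vector.span S"
  shows "complex_vector.span S = UNIV"
proof (rule ccontr)
  assume "complex_vector.span S \<noteq> UNIV"
  then obtain t where "t \<notin> complex_vector.span S" by blast
  then obtain f where f: "clinear f" "\<forall>x\<in>S. f x = (0::complex)" "f t = 1"
    using exists_separating_functional by blast
  have "f x = 0" if "x \<in> complex_vector.span S" for x
    using that
  proof (induction rule: complex_vector.span_induct_alt)
    case base
    show ?case by (rule clinear_zero[OF f(1)])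
  next
    case (step c x y)
    then show ?case using f(2) by (simp add: clinear_add[OF f(1)] clinear_functional_scaleC[OF f(1)])
  qed
  then have "f = (\<lambda>_. 0)"
    using assms by (intro tensor_ext f clinear_functionalI) auto
  then show False using f(3) by simp
qed

lemma exists_tensor_functional:
  assumes "clinear f" "clinear (g :: _ \<Rightarrow> complex)"
  shows "\<exists>h. clinear h \<and> (\<forall>v w. h (v \<otimes>\<^sub>t w) = f v * g w)"
proof -
  have "\<exists>!h. clinear h \<and> (\<forall>v w. h (v \<otimes>\<^sub>t w) = f v * g w)"
    using assms by (intro ex1_tensor_lift clinear_functionalI)
      (simp_all add: clinear_add clinear_functional_scaleC algebra_simps)
  then show ?thesis by blast
qed

lemma twisted_jacquet_nonzero_iff:
  assumes V: "complex_vector.subspace V" and sub: "jacquet_kernel V \<pi> U \<theta> \<subseteq> V"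
  shows "twisted_jacquet_nonzero V \<pi> U \<theta> \<longleftrightarrow> \<not> V \<subseteq> jacquet_kernel V \<pi> U \<theta>"
proof -
  let ?W = "jacquet_kernel V \<pi> U \<theta>"
  have W: "complex_vector.subspace ?W" unfolding jacquet_kernel_def by (rule complex_vector.subspace_span)
  have coset: "{(x, y). x \<in> V \<and> y \<in> V \<and> x - y \<in> ?W} `` {x} = {y \<in> V. x - y \<in> ?W}" if "x \<in> V" for x
    using that by auto
  show ?thesis
  proof
    assume "twisted_jacquet_nonzero V \<pi> U \<theta>"
    then obtain x where x: "x \<in> V" "{y \<in> V. x - y \<in> ?W} \<noteq> ?W"
      unfolding twisted_jacquet_nonzero_def twisted_jacquet_module_def quotient_space_def quotient_def
      using coset by auto
    show "\<not> V \<subseteq> ?W"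
    proof
      assume "V \<subseteq> ?W"
      then have "{y \<in> V. x - y \<in> ?W} = ?W"
        using sub x(1) complex_vector.subspace_diff[OF W] by auto
      then show False using x(2) by simp
    qed
  next
    assume "\<not> V \<subseteq> ?W"
    then obtain x where x: "x \<in> V" "x \<notin> ?W" by blast
    have "x \<in> {y \<in> V. x - y \<in> ?W}" using x complex_vector.subspace_0[OF W] by simp
    then have "{y \<in> V. x - y \<in> ?W} \<noteq> ?W" using x by blast
    moreover have "{y \<in> V. x - y \<in> ?W} \<in> V // {(x, y). x \<in> V \<and> y \<in> V \<and> x - y \<in> ?W}"
      unfolding coset[OF x(1), symmetric] using x(1) by (rule quotientI)
    ultimately show "twisted_jacquet_nonzero V \<pi> U \<theta>"
      unfolding twisted_jacquet_nonzero_def twisted_jacquet_module_def quotient_space_def by (rule bexI)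
  qed
qed

lemma mat_trace_add:
  "A \<in> carrier_mat n n \<Longrightarrow> B \<in> carrier_mat n n \<Longrightarrow> mat_trace (A + B) = mat_trace A + (mat_trace B :: 'a::comm_ring_1)"
  by (simp add: mat_trace_def sum.distrib)

lemma mat_trace_commute:
  assumes "A \<in> carrier_mat p q" "B \<in> carrier_mat q p"
  shows "mat_trace (A * B) = mat_trace (B * A :: 'a::comm_ring_1 mat)"
proof -
  have "mat_trace (A * B) = (\<Sum>i<p. \<Sum>j<q. A $$ (i, j) * B $$ (j, i))"
    using assms by (auto simp: mat_trace_def scalar_prod_def atLeast0LessThan intro!: sum.cong)
  also have "\<dots> = (\<Sum>j<q. \<Sum>i<p. B $$ (j, i) * A $$ (i, j))"
    by (subst sum.swap) (simp add: mult.commute)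
  also have "\<dots> = mat_trace (B * A)"
    using assms by (auto simp: mat_trace_def scalar_prod_def atLeast0LessThan intro!: sum.cong)
  finally show ?thesis .
qed

lemma mat_trace_four_block:
  assumes "A \<in> carrier_mat p p" "D \<in> carrier_mat q q"
  shows "mat_trace (four_block_mat A B C D) = mat_trace A + (mat_trace D :: 'a::comm_ring_1)"
proof -
  have "mat_trace (four_block_mat A B C D) = (\<Sum>i<p + q. if i < p then A $$ (i, i) else D $$ (i - p, i - p))"
    using assms by (auto simp: mat_trace_def intro!: sum.cong)
  also have "\<dots> = (\<Sum>i<p. A $$ (i, i)) + (\<Sum>i<q. D $$ (i, i))"
    by (simp add: lessThan_atLeast0 sum.atLeast0_lessThan_Suc flip: sum.atLeastLessThan_concat[of 0 p "p + q"])
      (subst sum.atLeastLessThan_shift_0, simp)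
  finally show ?thesis using assms by (simp add: mat_trace_def)
qed

locale additive_character = nonarchimedean_local_field absv for absv :: "'a::field \<Rightarrow> real" +
  fixes \<psi> :: "'a \<Rightarrow> complex"
  assumes character: "nontrivial_additive_character absv \<psi>"
begin

lemma psi_add: "\<psi> (x + y) = \<psi> x * \<psi> y" using character by (simp add: nontrivial_additive_character_def)

lemma psi_norm: "cmod (\<psi> x) = 1" using character by (simp add: nontrivial_additive_character_def)

lemma psi_nonzero [simp]: "\<psi> x \<noteq> 0" using psi_norm[of x] by auto

lemma psi_0 [simp]: "\<psi> 0 = 1" using psi_add[of 0 0] by simp

lemma psi_nontrivial: "\<exists>x. \<psi> x \<noteq> 1" using character by (simp add: nontrivial_additive_character_def)

text \<open>The unit circle has no small subgroups: squaring moves a point near \<open>1\<close> away from \<open>1\<close> by a factor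
  of at least \<open>3/2\<close>.\<close>

lemma psi_locally_constant: "\<exists>e>0. \<forall>x. absv x \<le> e \<longrightarrow> \<psi> x = 1"
proof -
  have "continuous_map (field_topology absv) euclidean \<psi>"
    using character by (simp add: nontrivial_additive_character_def)
  then have "openin (field_topology absv) {x \<in> topspace (field_topology absv). \<psi> x \<in> ball 1 (1/2)}"
    by (rule openin_continuous_map_preimage) simp
  moreover have "topspace (field_topology absv) = UNIV"
    using Metric_space.topspace_mtopology[OF metric] by (simp add: field_topology_def)
  ultimately have o: "openin (field_topology absv) {x. \<psi> x \<in> ball 1 (1/2)}" by simp
  have z: "0 \<in> {x. \<psi> x \<in> ball 1 (1/2)}" by simp
  from openin_field_topology_obtain[OF o z] obtain d where d: "0 < d" "\<And>x. absv (x - 0) < d \<Longrightarrow> x \<in> {x. \<psi> x \<in> ball 1 (1/2)}"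
    by metis
  have near: "cmod (\<psi> x - 1) < 1/2" if "absv x < d" for x
    using d(2)[of x] that by (simp add: dist_norm norm_minus_commute)
  have grow: "(3/2) ^ k * cmod (\<psi> x - 1) < 1/2" if "absv x < d" for x k
    using that
  proof (induction k arbitrary: x)
    case 0
    then show ?case using near by simp
  next
    case (Suc k)
    have "absv (x + x) < d" using Suc.prems absv_ultrametric[of x x] by simp
    then have IH: "(3/2) ^ k * cmod (\<psi> (x + x) - 1) < 1/2" by (rule Suc.IH)
    have "\<psi> (x + x) - 1 = (\<psi> x - 1) * (\<psi> x + 1)" unfolding psi_add by (simp add: algebra_simps)
    moreover have "3/2 \<le> cmod (\<psi> x + 1)"
      using norm_triangle_ineq4[of "\<psi> x + 1" "\<psi> x - 1"] near[OF Suc.prems] by simp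
    ultimately have "cmod (\<psi> x - 1) * (3/2) \<le> cmod (\<psi> (x + x) - 1)"
      by (simp only: norm_mult) (rule mult_left_mono, auto)
    then have "(3/2) ^ k * (cmod (\<psi> x - 1) * (3/2)) \<le> (3/2) ^ k * cmod (\<psi> (x + x) - 1)"
      by (intro mult_left_mono) auto
    moreover have "(3/2) ^ Suc k * cmod (\<psi> x - 1) = (3/2) ^ k * (cmod (\<psi> x - 1) * (3/2))" by simp
    ultimately show ?case using IH by linarith
  qed
  have "\<psi> x = 1" if "absv x \<le> d / 2" for x
  proof (rule ccontr)
    assume "\<psi> x \<noteq> 1"
    then have pos: "0 < cmod (\<psi> x - 1)" by simp
    obtain k where "1 / cmod (\<psi> x - 1) < (3/2) ^ k" using real_arch_pow[of "3/2"] by auto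
    then have "1 < (3/2) ^ k * cmod (\<psi> x - 1)" using pos by (simp add: field_simps)
    then show False using grow[of x k] that d(1) by simp
  qed
  then show ?thesis using d(1) by (intro exI[of _ "d / 2"]) simp
qed

lemma mat_trace_matball: "A \<in> matball n n c \<Longrightarrow> 0 \<le> c \<Longrightarrow> absv (mat_trace A) \<le> c"
  unfolding mat_trace_def using matball_carrier[of A n n c]
  by (intro absv_sum_le) (auto intro: matball_entry)

text \<open>The characters of the additive group of \<open>p \<times> q\<close> matrices, indexed by \<open>q \<times> p\<close> matrices through the trace
  pairing.\<close>

definition chi :: "'a mat \<Rightarrow> 'a mat \<Rightarrow> complex" where "chi H y = \<psi> (mat_trace (y * H))"

lemma chi_nonzero [simp]: "chi H y \<noteq> 0" by (simp add: chi_def)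

lemma chi_add: "H \<in> carrier_mat q p \<Longrightarrow> x \<in> carrier_mat p q \<Longrightarrow> y \<in> carrier_mat p q \<Longrightarrow> chi H (x + y) = chi H x * chi H y"
  unfolding chi_def by (simp add: add_mult_distrib_mat[of x p q y H p] mat_trace_add[of _ p] psi_add)

lemma chi_locally_constant:
  assumes H: "H \<in> carrier_mat q p"
  shows "\<exists>e>0. \<forall>y\<in>matball p q e. chi H y = 1"
proof -
  obtain e where e: "0 < e" "\<And>x. absv x \<le> e \<Longrightarrow> \<psi> x = 1" using psi_locally_constant by blast
  obtain c where c: "H \<in> matball q p c" using matball_exhaust[OF H] by blast
  let ?c = "\<bar>c\<bar> + 1"
  have Hc: "H \<in> matball q p ?c" using c by (rule matball_mono) simp
  have "chi H y = 1" if y: "y \<in> matball p q (e / ?c)" for y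
  proof -
    have "y * H \<in> matball p p (e / ?c * ?c)" by (rule matball_mult[OF y Hc]) (use e in auto)
    then have "absv (mat_trace (y * H)) \<le> e" using e(1) by (intro mat_trace_matball[of _ p]) auto
    then show ?thesis using e(2) by (simp add: chi_def)
  qed
  then show ?thesis using e(1) by (intro exI[of _ "e / ?c"]) (auto simp: add_nonneg_pos)
qed

text \<open>The kernel of the projection from \<open>\<rho>\<close> to its twisted Jacquet module, for the unipotent radical with
  blocks \<open>p\<close> and \<open>q\<close> and the character \<open>chi H\<close>.\<close>

definition unip_kernel :: "('a mat \<Rightarrow> 'v::complex_vector \<Rightarrow> 'v) \<Rightarrow> nat \<Rightarrow> nat \<Rightarrow> 'a mat \<Rightarrow> 'v set" where
  "unip_kernel \<rho> p q H =
    complex_vector.span {\<rho> (unip p q y) v - chi H y *\<^sub>C v | y v. y \<in> carrier_mat p q}"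

lemma smooth_rep_linear: "smooth_rep absv n \<rho> \<Longrightarrow> g \<in> carrier (GL n) \<Longrightarrow> clinear (\<rho> g)"
  by (simp add: smooth_rep_def)

lemma smooth_rep_one: "smooth_rep absv n \<rho> \<Longrightarrow> \<rho> (1\<^sub>m n) v = v"
  by (simp add: smooth_rep_def)

lemma smooth_rep_mult: "smooth_rep absv n \<rho> \<Longrightarrow> g \<in> carrier (GL n) \<Longrightarrow> h \<in> carrier (GL n) \<Longrightarrow> \<rho> (g * h) v = \<rho> g (\<rho> h v)"
  by (simp add: smooth_rep_def)

lemma smooth_rep_stabilizer:
  assumes "smooth_rep absv n \<rho>"
  shows "\<exists>e>0. e < 1 \<and> (\<forall>g\<in>congruence_group n e. \<rho> g v = v)"
proof -
  have o: "openin (GL_topology absv n) {g \<in> carrier (GL n). \<rho> g v = v}"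
    using assms by (simp add: smooth_rep_def)
  have "1\<^sub>m n \<in> {g \<in> carrier (GL n). \<rho> g v = v}" using GL_one smooth_rep_one[OF assms] by simp
  from open_contains_congruence_group[OF o this] obtain e where
    "0 < e" "e < 1" "congruence_group n e \<subseteq> {g \<in> carrier (GL n). \<rho> g v = v}" .
  then show ?thesis by (intro exI[of _ e]) blast
qed

text \<open>The operator of \<open>diag(A, B\<^sup>-\<^sup>1)\<close> maps one kernel into the other: conjugation by this matrix takes \<open>y\<close> to
  \<open>A y B\<close>, and \<open>tr(A y B H) = tr(y B H A)\<close>.\<close>

lemma unip_kernel_conjugate:
  assumes \<rho>: "smooth_rep absv (p + q) \<rho>" and H: "H \<in> carrier_mat q p"
    and A: "A \<in> carrier (GL p)" and B: "B \<in> carrier (GL q)"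
    and full: "unip_kernel \<rho> p q (B * H * A) = UNIV"
  shows "unip_kernel \<rho> p q H = UNIV"
proof -
  obtain B' where B': "B' \<in> carrier (GL q)" "B * B' = 1\<^sub>m q" "B' * B = 1\<^sub>m q" using B by (rule GL_obtain_inverse)
  obtain A' where A': "A' \<in> carrier (GL p)" "A * A' = 1\<^sub>m p" "A' * A = 1\<^sub>m p" using A by (rule GL_obtain_inverse)
  note c = A[THEN GL_carrier] B[THEN GL_carrier] B'(1)[THEN GL_carrier] A'(1)[THEN GL_carrier] H
  define d where "d = four_block_mat A (0\<^sub>m p q) (0\<^sub>m q p) B'"
  define d' where "d' = four_block_mat A' (0\<^sub>m p q) (0\<^sub>m q p) B"
  have d: "d \<in> carrier (GL (p + q))" unfolding d_def by (rule diag_GL[OF A B'(1)])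
  have d': "d' \<in> carrier (GL (p + q))" unfolding d'_def by (rule diag_GL[OF A'(1) B])
  have dd': "d * d' = 1\<^sub>m (p + q)" unfolding d_def d'_def by (rule diag_inverse) (use c A' B' in auto)
  have lin: "clinear (\<rho> d)" using \<rho> d by (rule smooth_rep_linear)
  have conj: "d * unip p q y = unip p q (A * y * B) * d" if y: "y \<in> carrier_mat p q" for y
  proof -
    have "A * y * B * B' = A * y * (B * B')"
      by (rule assoc_mult_mat[of _ p q _ q _ q]) (use c y in auto)
    then have e: "A * y * B * B' = A * y" using B' c y by simp
    have yc: "A * y * B \<in> carrier_mat p q" using c y by auto
    show ?thesis unfolding d_def unip_def using c y yc e
      by (simp add: mult_four_block_mat[of _ p p _ q _ q _ _ p _ q] left_add_zero_mat right_add_zero_mat)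
  qed
  have chi_conj: "chi (B * H * A) y = chi H (A * y * B)" if y: "y \<in> carrier_mat p q" for y
  proof -
    have "mat_trace (y * (B * H * A)) = mat_trace (y * (B * H) * A)"
      using c y by (subst assoc_mult_mat[of y p q "B * H" p A p]) auto
    also have "\<dots> = mat_trace (A * (y * (B * H)))"
      by (rule mat_trace_commute[of _ p p]) (use c y in auto)
    also have "A * (y * (B * H)) = A * y * B * H"
    proof -
      have "A * y * B * H = A * y * (B * H)" using c y by (intro assoc_mult_mat[of _ p q _ q _ p]) auto
      also have "\<dots> = A * (y * (B * H))" using c y by (intro assoc_mult_mat[of _ p p _ q _ p]) auto
      finally show ?thesis by simp
    qed
    finally show ?thesis by (simp add: chi_def)
  qed
  have img: "\<rho> d x \<in> unip_kernel \<rho> p q H" if "x \<in> unip_kernel \<rho> p q (B * H * A)" for x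
    using that unfolding unip_kernel_def[of \<rho> p q "B * H * A"]
  proof (induction rule: complex_vector.span_induct_alt)
    case base
    have "\<rho> d 0 = 0" by (rule clinear_zero[OF lin])
    then show ?case by (simp add: unip_kernel_def complex_vector.span_zero)
  next
    case (step c0 x z)
    then obtain y v where y: "y \<in> carrier_mat p q" and x: "x = \<rho> (unip p q y) v - chi (B * H * A) y *\<^sub>C v" by blast
    have yc: "A * y * B \<in> carrier_mat p q" using c y by auto
    have "\<rho> d (\<rho> (unip p q y) v) = \<rho> (d * unip p q y) v"
      using smooth_rep_mult[OF \<rho> d unip_GL[OF y]] by simp
    also have "\<dots> = \<rho> (unip p q (A * y * B)) (\<rho> d v)"
      unfolding conj[OF y] by (rule smooth_rep_mult[OF \<rho> unip_GL[OF yc] d])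
    finally have e: "\<rho> d (\<rho> (unip p q y) v) = \<rho> (unip p q (A * y * B)) (\<rho> d v)" .
    have "\<rho> d x = \<rho> (unip p q (A * y * B)) (\<rho> d v) - chi H (A * y * B) *\<^sub>C \<rho> d v"
      unfolding x clinear_diff[OF lin] e clinear_scaleC[OF lin] chi_conj[OF y] ..
    then have "\<rho> d x \<in> unip_kernel \<rho> p q H"
      unfolding unip_kernel_def using yc by (intro complex_vector.span_base) blast
    then show ?case using step.IH lin unfolding unip_kernel_def
      by (simp add: clinear_iff complex_vector.span_add complex_vector.span_scale)
  qed
  have "x \<in> unip_kernel \<rho> p q H" for x
  proof -
    have "\<rho> d (\<rho> d' x) = x" using smooth_rep_mult[OF \<rho> d d'] dd' smooth_rep_one[OF \<rho>] by metis
    then show ?thesis using img[of "\<rho> d' x"] full by simp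
  qed
  then show ?thesis by blast
qed

lemma unip_kernel_equivalent:
  assumes \<rho>: "smooth_rep absv (p + q) \<rho>" and H: "H \<in> carrier_mat q p"
    and A: "A \<in> carrier (GL p)" and B: "B \<in> carrier (GL q)"
  shows "unip_kernel \<rho> p q (B * H * A) = UNIV \<longleftrightarrow> unip_kernel \<rho> p q H = UNIV"
proof
  assume "unip_kernel \<rho> p q (B * H * A) = UNIV"
  then show "unip_kernel \<rho> p q H = UNIV" by (rule unip_kernel_conjugate[OF \<rho> H A B])
next
  assume full: "unip_kernel \<rho> p q H = UNIV"
  obtain B' where B': "B' \<in> carrier (GL q)" "B' * B = 1\<^sub>m q" using B by (rule GL_obtain_inverse)
  obtain A' where A': "A' \<in> carrier (GL p)" "A * A' = 1\<^sub>m p" using A by (rule GL_obtain_inverse)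
  note c = A[THEN GL_carrier] B[THEN GL_carrier] B'(1)[THEN GL_carrier] A'(1)[THEN GL_carrier] H
  have BHA: "B * H * A \<in> carrier_mat q p" using c by auto
  have "B' * (B * H * A) * A' = B' * (B * H * (A * A'))"
  proof -
    have "B' * (B * H * A) * A' = B' * (B * H * A * A')" using c BHA by (intro assoc_mult_mat[of _ q q _ p _ p]) auto
    also have "B * H * A * A' = B * H * (A * A')" using c by (intro assoc_mult_mat[of _ q p _ p _ p]) auto
    finally show ?thesis .
  qed
  also have "B * H * (A * A') = B * H" using A' c by simp
  also have "B' * (B * H) = B' * B * H" using c by (intro assoc_mult_mat[of _ q q _ q _ p, symmetric]) auto
  also have "\<dots> = H" using B' c by simp
  finally have "unip_kernel \<rho> p q (B' * (B * H * A) * A') = UNIV" using full by simp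
  then show "unip_kernel \<rho> p q (B * H * A) = UNIV" by (rule unip_kernel_conjugate[OF \<rho> BHA A'(1) B'(1)])
qed

text \<open>Up to equivalence \<open>H\<close> is determined by its rank, which is maximal if \<open>H\<close> has a one-sided inverse.\<close>

lemma unip_kernel_right_invertible:
  assumes \<rho>: "smooth_rep absv (p + q) \<rho>" and H: "H \<in> carrier_mat q p" "Q \<in> carrier_mat p q" "H * Q = 1\<^sub>m q"
  shows "unip_kernel \<rho> p q H = UNIV \<longleftrightarrow> unip_kernel \<rho> p q (rank_form q p q) = UNIV"
proof -
  obtain X Y where "X \<in> carrier (GL q)" "Y \<in> GLO p" "X * H * Y = rank_form q p q"
    using rank_of_right_invertible[OF H] by blast
  then show ?thesis using unip_kernel_equivalent[OF \<rho> H(1) GLO_subset_GL[of Y p], of X] by simp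
qed

lemma unip_kernel_left_invertible:
  assumes \<rho>: "smooth_rep absv (p + q) \<rho>" and H: "H \<in> carrier_mat q p" "Q \<in> carrier_mat p q" "Q * H = 1\<^sub>m p"
  shows "unip_kernel \<rho> p q H = UNIV \<longleftrightarrow> unip_kernel \<rho> p q (rank_form q p p) = UNIV"
proof -
  obtain X Y where "X \<in> carrier (GL q)" "Y \<in> GLO p" "X * H * Y = rank_form q p p"
    using rank_of_left_invertible[OF H] by blast
  then show ?thesis using unip_kernel_equivalent[OF \<rho> H(1) GLO_subset_GL[of Y p], of X] by simp
qed

lemma unipotent_block3_upper:
  assumes z: "z \<in> carrier_mat k (k + s)"
  shows "unipotent_block3 k k s (blk z 0 0 k k) (blk z 0 k k s) (0\<^sub>m k s) = unip k (k + s) z"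
  unfolding unipotent_block3_def unip_def append_rows_def
  using z by (intro eq_matI) auto

lemma unipotent_block3_right:
  assumes y: "y \<in> carrier_mat (p + m) m"
  shows "unipotent_block3 p m m (0\<^sub>m p m) (blk y 0 0 p m) (blk y p 0 m m) = unip (p + m) m y"
  unfolding unipotent_block3_def unip_def append_rows_def
  using y by (intro eq_matI) auto

text \<open>The blocks \<open>x\<close> and \<open>y\<close> of an element of \<open>N(k,1)\<close> form one \<open>k \<times> (r - k)\<close> matrix, so this group is the full
  unipotent radical with blocks \<open>k\<close> and \<open>r - k\<close>. The same holds for \<open>N(k,2)\<close> with blocks \<open>n - k\<close> and \<open>n + k - r\<close>.\<close>

lemma N1_group_eq:
  assumes k: "2 * k \<le> r"
  shows "N1_group r k = {unip k (r - k) z | z. z \<in> carrier_mat k (r - k)}"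
proof -
  define s where "s = r - 2 * k"
  have dims: "r - k = k + s" using k by (simp add: s_def)
  show ?thesis unfolding N1_group_def s_def[symmetric] dims
  proof (intro equalityI subsetI)
    fix u :: "'a mat" assume "u \<in> {unipotent_block3 k k s x y (0\<^sub>m k s) | x y. x \<in> carrier_mat k k \<and> y \<in> carrier_mat k s}"
    then obtain x y where xy: "x \<in> carrier_mat k k" "y \<in> carrier_mat k s"
      "u = unipotent_block3 k k s x y (0\<^sub>m k s)" by blast
    define z where "z = mat k (k + s) (\<lambda>(i, j). if j < k then x $$ (i, j) else y $$ (i, j - k))"
    have zc: "z \<in> carrier_mat k (k + s)" by (simp add: z_def)
    have "blk z 0 0 k k = x" "blk z 0 k k s = y" using xy by (auto intro!: eq_matI simp: z_def)
    then have "u = unip k (k + s) z" using unipotent_block3_upper[OF zc] xy(3) by simp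
    then show "u \<in> {unip k (k + s) z | z. z \<in> carrier_mat k (k + s)}" using zc by blast
  next
    fix u :: "'a mat" assume "u \<in> {unip k (k + s) z | z. z \<in> carrier_mat k (k + s)}"
    then obtain z where z: "z \<in> carrier_mat k (k + s)" "u = unip k (k + s) z" by blast
    then have "u = unipotent_block3 k k s (blk z 0 0 k k) (blk z 0 k k s) (0\<^sub>m k s)"
      using unipotent_block3_upper by simp
    then show "u \<in> {unipotent_block3 k k s x y (0\<^sub>m k s) | x y. x \<in> carrier_mat k k \<and> y \<in> carrier_mat k s}"
      using blk_carrier by blast
  qed
qed

lemma N2_group_eq:
  assumes k: "2 * k \<le> r" "r \<le> n + k"
  shows "N2_group n r k = {unip (n - k) (n + k - r) z | z. z \<in> carrier_mat (n - k) (n + k - r)}"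
proof -
  define p where "p = r - 2 * k"
  define m where "m = n + k - r"
  have dims: "n - k = p + m" using k by (simp add: p_def m_def)
  show ?thesis unfolding N2_group_def Let_def p_def[symmetric] m_def[symmetric] dims
  proof (intro equalityI subsetI)
    fix u :: "'a mat" assume "u \<in> {unipotent_block3 p m m (0\<^sub>m p m) x y | x y. x \<in> carrier_mat p m \<and> y \<in> carrier_mat m m}"
    then obtain x y where xy: "x \<in> carrier_mat p m" "y \<in> carrier_mat m m"
      "u = unipotent_block3 p m m (0\<^sub>m p m) x y" by blast
    define z where "z = mat (p + m) m (\<lambda>(i, j). if i < p then x $$ (i, j) else y $$ (i - p, j))"
    have zc: "z \<in> carrier_mat (p + m) m" by (simp add: z_def)
    have "blk z 0 0 p m = x" "blk z p 0 m m = y" using xy by (auto intro!: eq_matI simp: z_def)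
    then have "u = unip (p + m) m z" using unipotent_block3_right[OF zc] xy(3) by simp
    then show "u \<in> {unip (p + m) m z | z. z \<in> carrier_mat (p + m) m}" using zc by blast
  next
    fix u :: "'a mat" assume "u \<in> {unip (p + m) m z | z. z \<in> carrier_mat (p + m) m}"
    then obtain z where z: "z \<in> carrier_mat (p + m) m" "u = unip (p + m) m z" by blast
    then have "u = unipotent_block3 p m m (0\<^sub>m p m) (blk z 0 0 p m) (blk z p 0 m m)"
      using unipotent_block3_right by simp
    then show "u \<in> {unipotent_block3 p m m (0\<^sub>m p m) x y | x y. x \<in> carrier_mat p m \<and> y \<in> carrier_mat m m}"
      using blk_carrier by blast
  qed
qed

lemma jacquet_kernel_eq_unip_kernel:
  assumes grp: "U = {unip p q z | z. z \<in> carrier_mat p q}"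
    and th: "\<And>z. z \<in> carrier_mat p q \<Longrightarrow> \<theta> (unip p q z) = chi H z"
  shows "jacquet_kernel UNIV \<rho> U \<theta> = unip_kernel \<rho> p q H"
proof -
  have "{\<rho> u v - \<theta> u *\<^sub>C v | u v. u \<in> U \<and> v \<in> UNIV} =
      {\<rho> (unip p q y) v - chi H y *\<^sub>C v | y v. y \<in> carrier_mat p q}"
  proof (intro equalityI subsetI)
    fix x assume "x \<in> {\<rho> u v - \<theta> u *\<^sub>C v | u v. u \<in> U \<and> v \<in> UNIV}"
    then obtain z v where "z \<in> carrier_mat p q" "x = \<rho> (unip p q z) v - \<theta> (unip p q z) *\<^sub>C v"
      using grp by blast
    then show "x \<in> {\<rho> (unip p q y) v - chi H y *\<^sub>C v | y v. y \<in> carrier_mat p q}" using th by auto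
  next
    fix x assume "x \<in> {\<rho> (unip p q y) v - chi H y *\<^sub>C v | y v. y \<in> carrier_mat p q}"
    then obtain z v where z: "z \<in> carrier_mat p q" and x: "x = \<rho> (unip p q z) v - chi H z *\<^sub>C v" by blast
    have "unip p q z \<in> U" using grp z by blast
    moreover have "x = \<rho> (unip p q z) v - \<theta> (unip p q z) *\<^sub>C v" using x th[OF z] by simp
    ultimately show "x \<in> {\<rho> u v - \<theta> u *\<^sub>C v | u v. u \<in> U \<and> v \<in> UNIV}" by blast
  qed
  then show ?thesis by (simp add: jacquet_kernel_def unip_kernel_def)
qed

lemma rank_form_dim [simp]: "dim_row (rank_form p q c) = p" "dim_col (rank_form p q c) = q"
  by (simp_all add: rank_form_def)

lemma jacquet_kernel_N1:
  assumes k: "2 * k \<le> r"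
  shows "jacquet_kernel UNIV \<rho> (N1_group r k) (N1_char \<psi> k) = unip_kernel \<rho> k (r - k) (rank_form (r - k) k k)"
proof (rule jacquet_kernel_eq_unip_kernel[OF N1_group_eq[OF k]])
  fix z :: "'a mat" assume z: "z \<in> carrier_mat k (r - k)"
  have "(z * rank_form (r - k) k k) $$ (i, i) = z $$ (i, i)" if i: "i < k" for i
  proof -
    have "(z * rank_form (r - k) k k) $$ (i, i) = (\<Sum>l = 0..<r - k. z $$ (i, l) * rank_form (r - k) k k $$ (l, i))"
      using z i by (simp add: scalar_prod_def)
    also have "\<dots> = (\<Sum>l = 0..<r - k. if l = i then z $$ (i, l) else 0)"
      using i by (intro sum.cong[OF refl]) (auto simp: rank_form_def)
    finally show ?thesis using i k by simp
  qed
  then have "mat_trace (z * rank_form (r - k) k k) = (\<Sum>i<k. z $$ (i, i))"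
    using z by (simp add: mat_trace_def)
  moreover have "mat_trace (mat k k (\<lambda>(i, j). unip k (r - k) z $$ (i, k + j))) = (\<Sum>i<k. z $$ (i, i))"
    using z k by (auto simp: mat_trace_def unip_def intro!: sum.cong)
  ultimately show "N1_char \<psi> k (unip k (r - k) z) = chi (rank_form (r - k) k k) z"
    by (simp add: N1_char_def chi_def)
qed

text \<open>Pairing a matrix with this one gives the trace of its lowest \<open>m \<times> m\<close> block.\<close>

definition bottom_form :: "nat \<Rightarrow> nat \<Rightarrow> 'a mat" where
  "bottom_form p m = mat m (p + m) (\<lambda>(i, j). if j = p + i then 1 else 0)"

lemma jacquet_kernel_N2:
  assumes k: "2 * k \<le> r" "r \<le> n + k"
  shows "jacquet_kernel UNIV \<rho> (N2_group n r k) (N2_char \<psi> n r k) =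
    unip_kernel \<rho> (n - k) (n + k - r) (bottom_form (r - 2 * k) (n + k - r))"
proof (rule jacquet_kernel_eq_unip_kernel[OF N2_group_eq[OF k]])
  define p where "p = r - 2 * k"
  define m where "m = n + k - r"
  have dims: "n - k = p + m" using k by (simp add: p_def m_def)
  fix z :: "'a mat" assume "z \<in> carrier_mat (n - k) (n + k - r)"
  then have z: "z \<in> carrier_mat (p + m) m" unfolding dims m_def by simp
  have "(z * bottom_form p m) $$ (i, i) = (if i < p then 0 else z $$ (i, i - p))" if i: "i < p + m" for i
  proof -
    have "(z * bottom_form p m) $$ (i, i) = (\<Sum>l = 0..<m. z $$ (i, l) * bottom_form p m $$ (l, i))"
      using z i by (simp add: scalar_prod_def bottom_form_def)
    also have "\<dots> = (\<Sum>l = 0..<m. if l = i - p \<and> p \<le> i then z $$ (i, l) else 0)"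
      using i by (intro sum.cong[OF refl]) (auto simp: bottom_form_def)
    also have "\<dots> = (if i < p then 0 else z $$ (i, i - p))" using i by auto
    finally show ?thesis .
  qed
  then have "mat_trace (z * bottom_form p m) = (\<Sum>i<p + m. if i < p then 0 else z $$ (i, i - p))"
    using z by (simp add: mat_trace_def)
  also have "\<dots> = (\<Sum>i<m. z $$ (p + i, i))"
  proof -
    have "(\<Sum>i<p + m. if i < p then 0 else z $$ (i, i - p)) = (\<Sum>i\<in>{p..<p + m}. z $$ (i, i - p))"
      by (rule sum.mono_neutral_cong_right) auto
    also have "\<dots> = (\<Sum>i\<in>{0..<m}. z $$ (i + p, i + p - p))"
      using sum.shift_bounds_nat_ivl[of "\<lambda>i. z $$ (i, i - p)" 0 p m] by (simp add: add.commute)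
    finally show ?thesis by (simp add: lessThan_atLeast0 add.commute)
  qed
  finally have "mat_trace (z * bottom_form p m) = (\<Sum>i<m. z $$ (p + i, i))" .
  moreover have "mat_trace (mat m m (\<lambda>(i, j). unip (p + m) m z $$ (p + i, p + m + j))) = (\<Sum>i<m. z $$ (p + i, i))"
    using z by (auto simp: mat_trace_def unip_def intro!: sum.cong)
  ultimately show "N2_char \<psi> n r k (unip (n - k) (n + k - r) z) = chi (bottom_form (r - 2 * k) (n + k - r)) z"
    unfolding N2_char_def Let_def chi_def p_def[symmetric] m_def[symmetric] dims by simp
qed

lemma bottom_form_right_invertible:
  "bottom_form p m * mat (p + m) m (\<lambda>(i, j). if i = p + j then 1 else 0) = 1\<^sub>m m"
proof (rule eq_matI)
  fix i j assume "i < dim_row (1\<^sub>m m)" "j < dim_col (1\<^sub>m m)"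
  then have ij: "i < m" "j < m" by auto
  have "(bottom_form p m * mat (p + m) m (\<lambda>(i, j). if i = p + j then 1 else 0)) $$ (i, j) =
      (\<Sum>l = 0..<p + m. bottom_form p m $$ (i, l) * (if l = p + j then 1 else 0))"
    using ij by (simp add: scalar_prod_def bottom_form_def)
  also have "\<dots> = (\<Sum>l = 0..<p + m. if l = p + i then (if i = j then 1 else 0) else 0)"
    using ij by (intro sum.cong[OF refl]) (auto simp: bottom_form_def)
  finally show "(bottom_form p m * mat (p + m) m (\<lambda>(i, j). if i = p + j then 1 else 0)) $$ (i, j) = 1\<^sub>m m $$ (i, j)"
    using ij by simp
qed (auto simp: bottom_form_def)

text \<open>The vectors killed by the averages over all large balls form a subspace, and by translation invariance it
  contains the generators: the average of \<open>\<sigma> y0 v\<close> over a ball that contains \<open>y0\<close> is \<open>chi H y0\<close> times that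
  of \<open>v\<close>. The inner radius \<open>e'\<close> has to be so small that the summands depend only on the class modulo the
  smaller ball.\<close>

lemma average_eq_0_if_in_span:
  fixes \<sigma> :: "'a mat \<Rightarrow> 'v::complex_vector \<Rightarrow> 'v"
  assumes lin: "\<And>y. y \<in> carrier_mat p q \<Longrightarrow> clinear (\<sigma> y)"
    and hom: "\<And>x y t. x \<in> carrier_mat p q \<Longrightarrow> y \<in> carrier_mat p q \<Longrightarrow> \<sigma> (x + y) t = \<sigma> x (\<sigma> y t)"
    and smooth: "\<And>t. t \<in> V \<Longrightarrow> \<exists>e>0. \<forall>y\<in>matball p q e. \<sigma> y t = t"
    and H: "H \<in> carrier_mat q p"
    and t: "t \<in> complex_vector.span {\<sigma> y v - chi H y *\<^sub>C v | y v. y \<in> carrier_mat p q \<and> v \<in> V}"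
  shows "\<exists>c e. 0 < e \<and> (\<forall>c'\<ge>c. \<forall>e'. 0 < e' \<and> e' \<le> e \<longrightarrow>
    (\<Sum>y\<in>reps p q c' e'. inverse (chi H y) *\<^sub>C \<sigma> y t) = 0)"
  using t
proof (induction rule: complex_vector.span_induct_alt)
  case base
  have "\<sigma> y 0 = 0" if "y \<in> carrier_mat p q" for y
    by (rule clinear_zero[OF lin[OF that]])
  then have "(\<Sum>y\<in>reps p q c' e'. inverse (chi H y) *\<^sub>C \<sigma> y 0) = 0" if "0 < e'" for c' e'
    using reps_subset[OF that] matball_carrier by (intro sum.neutral) (metis complex_vector.scale_zero_right)
  then show ?case by (intro exI[of _ 0] exI[of _ 1]) simp
next
  case (step d x z)
  then obtain y0 v where y0: "y0 \<in> carrier_mat p q" and v: "v \<in> V" and x: "x = \<sigma> y0 v - chi H y0 *\<^sub>C v" by blast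
  from step.IH obtain c1 e1 where IH: "0 < e1" "\<And>c' e'. c1 \<le> c' \<Longrightarrow> 0 < e' \<Longrightarrow> e' \<le> e1 \<Longrightarrow>
      (\<Sum>y\<in>reps p q c' e'. inverse (chi H y) *\<^sub>C \<sigma> y z) = 0" by blast
  obtain e2 where e2: "0 < e2" "\<And>y. y \<in> matball p q e2 \<Longrightarrow> \<sigma> y v = v" using smooth[OF v] by blast
  obtain e3 where e3: "0 < e3" "\<And>y. y \<in> matball p q e3 \<Longrightarrow> chi H y = 1" using chi_locally_constant[OF H] by blast
  obtain c2 where c2: "y0 \<in> matball p q c2" using matball_exhaust[OF y0] by blast
  define F where "F y = inverse (chi H y) *\<^sub>C \<sigma> y v" for y
  have "(\<Sum>y\<in>reps p q c' e'. inverse (chi H y) *\<^sub>C \<sigma> y (d *\<^sub>C x + z)) = 0"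
    if c': "max c1 c2 \<le> c'" and e': "0 < e'" "e' \<le> min e1 (min e2 e3)" for c' e'
  proof -
    have F_const: "F y = F y'" if y: "y \<in> matball p q c'" "y' \<in> matball p q c'" "y - y' \<in> matball p q e'" for y y'
    proof -
      note yc = matball_carrier[OF y(1)] matball_carrier[OF y(2)] matball_carrier[OF y(3)]
      have dec: "y = y' + (y - y')" using yc by (intro eq_matI) auto
      have "\<sigma> y v = \<sigma> y' (\<sigma> (y - y') v)" using hom[OF yc(2,3)] dec by metis
      also have "\<sigma> (y - y') v = v" by (rule e2(2)) (use y(3) e' in \<open>auto intro: matball_mono\<close>)
      finally have 1: "\<sigma> y v = \<sigma> y' v" .
      have "chi H y = chi H y' * chi H (y - y')" using chi_add[OF H yc(2,3)] dec by metis
      also have "chi H (y - y') = 1" by (rule e3(2)) (use y(3) e' in \<open>auto intro: matball_mono\<close>)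
      finally show ?thesis using 1 by (simp add: F_def)
    qed
    have y0c': "y0 \<in> matball p q c'" using c2 c' by (auto intro: matball_mono)
    have tr: "(\<Sum>y\<in>reps p q c' e'. F (y + y0)) = (\<Sum>y\<in>reps p q c' e'. F y)"
      using reps_sum_translate[of e' y0 p q c' F, OF e'(1) y0c' F_const] by blast
    have term_eq: "inverse (chi H y) *\<^sub>C \<sigma> y x = chi H y0 *\<^sub>C F (y + y0) - chi H y0 *\<^sub>C F y"
      if y: "y \<in> carrier_mat p q" for y
    proof -
      have "\<sigma> y x = \<sigma> y (\<sigma> y0 v) - chi H y0 *\<^sub>C \<sigma> y v"
        unfolding x clinear_diff[OF lin[OF y]] clinear_scaleC[OF lin[OF y]] ..
      also have "\<sigma> y (\<sigma> y0 v) = \<sigma> (y + y0) v" using hom[OF y y0] by simp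
      finally have 1: "\<sigma> y x = \<sigma> (y + y0) v - chi H y0 *\<^sub>C \<sigma> y v" .
      have 2: "chi H y0 *\<^sub>C F (y + y0) = inverse (chi H y) *\<^sub>C \<sigma> (y + y0) v"
        by (simp add: F_def chi_add[OF H y y0] scaleC_scaleC field_simps)
      have 3: "chi H y0 *\<^sub>C F y = inverse (chi H y) *\<^sub>C chi H y0 *\<^sub>C \<sigma> y v"
        by (simp add: F_def scaleC_scaleC mult.commute)
      show ?thesis unfolding 1 2 3 by (rule complex_vector.scale_right_diff_distrib)
    qed
    have "(\<Sum>y\<in>reps p q c' e'. inverse (chi H y) *\<^sub>C \<sigma> y (d *\<^sub>C x + z)) =
        (\<Sum>y\<in>reps p q c' e'. d *\<^sub>C (chi H y0 *\<^sub>C F (y + y0) - chi H y0 *\<^sub>C F y) + inverse (chi H y) *\<^sub>C \<sigma> y z)"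
    proof (rule sum.cong[OF refl])
      fix y assume "y \<in> reps p q c' e'"
      then have y: "y \<in> carrier_mat p q" using reps_subset[OF e'(1)] matball_carrier by blast
      have "\<sigma> y (d *\<^sub>C x + z) = d *\<^sub>C \<sigma> y x + \<sigma> y z" 
        by (simp add: clinear_add[OF lin[OF y]] clinear_scaleC[OF lin[OF y]])
      then show "inverse (chi H y) *\<^sub>C \<sigma> y (d *\<^sub>C x + z) =
          d *\<^sub>C (chi H y0 *\<^sub>C F (y + y0) - chi H y0 *\<^sub>C F y) + inverse (chi H y) *\<^sub>C \<sigma> y z"
        unfolding term_eq[OF y, symmetric] by (simp add: scaleC_add_right scaleC_scaleC mult.commute)
    qed
    also have "\<dots> = d *\<^sub>C (chi H y0 *\<^sub>C (\<Sum>y\<in>reps p q c' e'. F (y + y0)) - chi H y0 *\<^sub>C (\<Sum>y\<in>reps p q c' e'. F y))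
        + (\<Sum>y\<in>reps p q c' e'. inverse (chi H y) *\<^sub>C \<sigma> y z)"
      by (simp only: sum.distrib sum_subtractf complex_vector.scale_sum_right complex_vector.scale_right_diff_distrib)
    also have "\<dots> = 0" unfolding tr using IH(2)[of c' e'] c' e' by simp
    finally show ?thesis .
  qed
  then show ?case using IH(1) e2(1) e3(1)
    by (intro exI[of _ "max c1 c2"] exI[of _ "min e1 (min e2 e3)"]) auto
qed

end

section \<open>Parabolic induction\<close>

locale induced_rep = additive_character absv \<psi> for absv :: "'a::field \<Rightarrow> real" and \<psi> +
  fixes n r m :: nat
    and \<rho>1 :: "'a mat \<Rightarrow> 'v::complex_vector \<Rightarrow> 'v" and \<rho>2 :: "'a mat \<Rightarrow> 'w::complex_vector \<Rightarrow> 'w"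
  assumes rm: "r + m = n + n"
    and \<rho>1: "smooth_rep absv r \<rho>1" and \<rho>2: "smooth_rep absv m \<rho>2"
begin

definition Ind :: "('a mat \<Rightarrow> ('v, 'w) tensor) set" where
  "Ind = parabolic_induction_space absv r m \<rho>1 \<rho>2"

definition \<sigma> :: "'a mat \<Rightarrow> 'a mat \<Rightarrow> ('v, 'w) tensor \<Rightarrow> ('v, 'w) tensor" where
  "\<sigma> A D = tensor_map (\<rho>1 A) (\<rho>2 D)"

definition coef :: "'a mat \<Rightarrow> 'a mat \<Rightarrow> complex" where
  "coef A D = complex_of_real (sqrt (parabolic_modulus absv r m A D))"

lemma \<rho>_linear: "A \<in> carrier (GL r) \<Longrightarrow> clinear (\<rho>1 A)" "D \<in> carrier (GL m) \<Longrightarrow> clinear (\<rho>2 D)"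
  using smooth_rep_linear \<rho>1 \<rho>2 by blast+

lemma \<sigma>_linear: "A \<in> carrier (GL r) \<Longrightarrow> D \<in> carrier (GL m) \<Longrightarrow> clinear (\<sigma> A D)"
  unfolding \<sigma>_def by (intro clinear_tensor_map \<rho>_linear)

lemma \<sigma>_pure: "A \<in> carrier (GL r) \<Longrightarrow> D \<in> carrier (GL m) \<Longrightarrow> \<sigma> A D (v \<otimes>\<^sub>t w) = \<rho>1 A v \<otimes>\<^sub>t \<rho>2 D w"
  unfolding \<sigma>_def by (intro tensor_map_pure \<rho>_linear)

lemma \<sigma>_mult:
  assumes "A \<in> carrier (GL r)" "A' \<in> carrier (GL r)" "D \<in> carrier (GL m)" "D' \<in> carrier (GL m)"
  shows "\<sigma> (A * A') (D * D') t = \<sigma> A D (\<sigma> A' D' t)"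
proof -
  have "\<rho>1 (A * A') = (\<lambda>v. \<rho>1 A (\<rho>1 A' v))" using smooth_rep_mult[OF \<rho>1 assms(1,2)] by blast
  moreover have "\<rho>2 (D * D') = (\<lambda>v. \<rho>2 D (\<rho>2 D' v))" using smooth_rep_mult[OF \<rho>2 assms(3,4)] by blast
  ultimately show ?thesis unfolding \<sigma>_def using assms by (simp add: tensor_map_compose \<rho>_linear)
qed

lemma \<sigma>_one: "\<sigma> (1\<^sub>m r) (1\<^sub>m m) t = t"
proof -
  have "\<rho>1 (1\<^sub>m r) = (\<lambda>v. v)" "\<rho>2 (1\<^sub>m m) = (\<lambda>v. v)"
    using smooth_rep_one[OF \<rho>1] smooth_rep_one[OF \<rho>2] by blast+
  then show ?thesis unfolding \<sigma>_def by (simp add: tensor_map_id)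
qed

lemma coef_mult:
  assumes "A \<in> carrier_mat r r" "A' \<in> carrier_mat r r" "D \<in> carrier_mat m m" "D' \<in> carrier_mat m m"
  shows "coef (A * A') (D * D') = coef A D * coef A' D'"
  using assms unfolding coef_def parabolic_modulus_def
  by (simp add: det_mult absv_mult power_mult_distrib real_sqrt_mult real_sqrt_divide)

lemma coef_eq_1: "absv (det A) = 1 \<Longrightarrow> absv (det D) = 1 \<Longrightarrow> coef A D = 1"
  by (simp add: coef_def parabolic_modulus_def)

lemma Ind_zero_outside: "f \<in> Ind \<Longrightarrow> g \<notin> carrier (GL (n + n)) \<Longrightarrow> f g = 0"
  by (simp add: Ind_def parabolic_induction_space_def flip: rm)

lemma Ind_equivariant:
  "f \<in> Ind \<Longrightarrow> A \<in> carrier (GL r) \<Longrightarrow> X \<in> carrier_mat r m \<Longrightarrow> D \<in> carrier (GL m) \<Longrightarrow> g \<in> carrier (GL (n + n)) \<Longrightarrow>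
    f (para r m A X D * g) = coef A D *\<^sub>C \<sigma> A D (f g)"
  by (simp add: Ind_def parabolic_induction_space_def para_def coef_def \<sigma>_def flip: rm)

lemma Ind_smooth:
  assumes "f \<in> Ind"
  shows "\<exists>e>0. e < 1 \<and> (\<forall>g\<in>carrier (GL (n + n)). \<forall>k\<in>congruence_group (n + n) e. f (g * k) = f g)"
proof -
  obtain K where K: "subgroup K (GL (n + n))" "openin (GL_topology absv (n + n)) K"
    "\<And>g k. g \<in> carrier (GL (n + n)) \<Longrightarrow> k \<in> K \<Longrightarrow> f (g * k) = f g"
    using assms unfolding Ind_def parabolic_induction_space_def rm by blast
  have "1\<^sub>m (n + n) \<in> K" using subgroup.one_closed[OF K(1)] by simp
  from open_contains_congruence_group[OF K(2) this] obtain e where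
    "0 < e" "e < 1" "congruence_group (n + n) e \<subseteq> K" .
  then show ?thesis using K(3) by (intro exI[of _ e]) blast
qed

lemma Ind_I:
  assumes "\<And>g. g \<notin> carrier (GL (n + n)) \<Longrightarrow> f g = 0"
    and "\<And>A X D g. A \<in> carrier (GL r) \<Longrightarrow> X \<in> carrier_mat r m \<Longrightarrow> D \<in> carrier (GL m) \<Longrightarrow> g \<in> carrier (GL (n + n)) \<Longrightarrow>
      f (para r m A X D * g) = coef A D *\<^sub>C \<sigma> A D (f g)"
    and e: "0 < e" "e < 1"
    and "\<And>g k. g \<in> carrier (GL (n + n)) \<Longrightarrow> k \<in> congruence_group (n + n) e \<Longrightarrow> f (g * k) = f g"
  shows "f \<in> Ind"
  using assms congruence_group_subgroup[OF e, of "n + n"] congruence_group_open[OF e, of "n + n"]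
  unfolding Ind_def parabolic_induction_space_def rm
  by (auto simp: para_def coef_def \<sigma>_def intro!: exI[of _ "congruence_group (n + n) e"])

lemma para_mult_GL:
  "A \<in> carrier (GL r) \<Longrightarrow> X \<in> carrier_mat r m \<Longrightarrow> D \<in> carrier (GL m) \<Longrightarrow> g \<in> carrier (GL (n + n)) \<Longrightarrow>
    para r m A X D * g \<in> carrier (GL (n + n))"
  using GL_mult[OF para_GL[of A r X m D, unfolded rm], of g] by simp

lemma Ind_subspace: "complex_vector.subspace Ind"
proof (rule complex_vector.subspaceI)
  show "0 \<in> Ind"
    by (rule Ind_I[of _ "1/2"]) (auto simp: clinear_zero \<sigma>_linear)
  fix f f' assume f: "f \<in> Ind" "f' \<in> Ind"
  obtain e where e: "0 < e" "e < 1" "\<And>g k. g \<in> carrier (GL (n + n)) \<Longrightarrow> k \<in> congruence_group (n + n) e \<Longrightarrow> f (g * k) = f g"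
    using Ind_smooth[OF f(1)] by blast
  obtain e' where e': "0 < e'" "e' < 1" "\<And>g k. g \<in> carrier (GL (n + n)) \<Longrightarrow> k \<in> congruence_group (n + n) e' \<Longrightarrow> f' (g * k) = f' g"
    using Ind_smooth[OF f(2)] by blast
  show "f + f' \<in> Ind"
  proof (rule Ind_I[of _ "min e e'"])
    fix g k :: "'a mat" assume g: "g \<in> carrier (GL (n + n))" and k: "k \<in> congruence_group (n + n) (min e e')"
    have "f (g * k) = f g" using e(3)[OF g congruence_group_mono[OF k]] by simp
    moreover have "f' (g * k) = f' g" using e'(3)[OF g congruence_group_mono[OF k]] by simp
    ultimately show "(f + f') (g * k) = (f + f') g" by simp
  qed (use f e e' in \<open>simp_all add: Ind_zero_outside Ind_equivariant clinear_add \<sigma>_linear scaleC_add_right\<close>)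
next
  fix c f assume f: "f \<in> Ind"
  obtain e where e: "0 < e" "e < 1" "\<And>g k. g \<in> carrier (GL (n + n)) \<Longrightarrow> k \<in> congruence_group (n + n) e \<Longrightarrow> f (g * k) = f g"
    using Ind_smooth[OF f] by blast
  show "c *\<^sub>C f \<in> Ind"
    by (rule Ind_I[OF _ _ e(1,2)])
      (use f e(3) in \<open>simp_all add: scaleC_fun_def Ind_zero_outside Ind_equivariant clinear_scaleC \<sigma>_linear scaleC_scaleC mult.commute\<close>)
qed

abbreviation \<pi> :: "'a mat \<Rightarrow> ('a mat \<Rightarrow> ('v, 'w) tensor) \<Rightarrow> 'a mat \<Rightarrow> ('v, 'w) tensor" where
  "\<pi> \<equiv> right_translation (n + n)"

lemma \<pi>_apply: "g \<in> carrier (GL (n + n)) \<Longrightarrow> \<pi> u f g = f (g * u)" by (simp add: right_translation_def)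

lemma \<pi>_linear: "clinear (\<pi> u)"
  by (rule clinearI) (auto simp: right_translation_def scaleC_fun_def fun_eq_iff)

lemma \<pi>_mult:
  assumes "u \<in> carrier (GL (n + n))" "u' \<in> carrier (GL (n + n))"
  shows "\<pi> (u * u') f = \<pi> u (\<pi> u' f)"
proof
  fix g
  show "\<pi> (u * u') f g = \<pi> u (\<pi> u' f) g"
  proof (cases "g \<in> carrier (GL (n + n))")
    case True
    have "g * u * u' = g * (u * u')"
      using True[THEN GL_carrier] assms[THEN GL_carrier] by (intro assoc_mult_mat) auto
    then show ?thesis using True GL_mult[OF True assms(1)] by (simp add: \<pi>_apply)
  qed (simp add: right_translation_def)
qed

lemma Ind_translate:
  assumes f: "f \<in> Ind" and u: "u \<in> carrier (GL (n + n))"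
  shows "\<pi> u f \<in> Ind"
proof -
  obtain u' where u': "u' \<in> carrier (GL (n + n))" "u * u' = 1\<^sub>m (n + n)" "u' * u = 1\<^sub>m (n + n)"
    using u by (rule GL_obtain_inverse)
  note uc = u[THEN GL_carrier] u'(1)[THEN GL_carrier]
  obtain e where e: "0 < e" "e < 1" "\<And>g k. g \<in> carrier (GL (n + n)) \<Longrightarrow> k \<in> congruence_group (n + n) e \<Longrightarrow> f (g * k) = f g"
    using Ind_smooth[OF f] by blast
  obtain c0 where c0: "u \<in> matball (n + n) (n + n) c0" using matball_exhaust[OF uc(1)] by blast
  obtain c1 where c1: "u' \<in> matball (n + n) (n + n) c1" using matball_exhaust[OF uc(2)] by blast
  \<comment> \<open>A common bound for \<open>u\<close> and its inverse: conjugation by \<open>u\<close> enlarges a ball around \<open>1\<close> by at most \<open>c\<^sup>2\<close>.\<close>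
  define c where "c = max 1 (max c0 c1)"
  have c: "1 \<le> c" "u \<in> matball (n + n) (n + n) c" "u' \<in> matball (n + n) (n + n) c"
    using c0 c1 by (auto simp: c_def intro: matball_mono)
  define d where "d = e / (c * c)"
  have cc: "1 \<le> c * c" using c(1) mult_mono[of 1 c 1 c] by simp
  have d: "0 < d" "d < 1" using e cc by (auto simp: d_def divide_less_eq)
  show ?thesis
  proof (rule Ind_I[OF _ _ d])
    fix g k :: "'a mat" assume g: "g \<in> carrier (GL (n + n))" and k: "k \<in> congruence_group (n + n) d"
    have kG: "k \<in> carrier (GL (n + n))" using congruence_group_GLO[OF k d] by (rule GLO_subset_GL)
    note gc = g[THEN GL_carrier] kG[THEN GL_carrier]
    have "u' * k * u \<in> congruence_group (n + n) e"
    proof -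
      have "u' * (k - 1\<^sub>m (n + n)) * u = u' * k * u - 1\<^sub>m (n + n)"
        using uc gc u'(3) mult_minus_distrib_mat[of u' "n + n" "n + n" k "n + n" "1\<^sub>m (n + n)"]
          minus_mult_distrib_mat[of "u' * k" "n + n" "n + n" u' u "n + n"] by simp
      moreover have "u' * (k - 1\<^sub>m (n + n)) * u \<in> matball (n + n) (n + n) (c * d * c)"
        by (intro matball_mult) (use c k d in \<open>auto simp: congruence_group_def\<close>)
      moreover have "c * d * c = e" using c(1) by (simp add: d_def)
      ultimately show ?thesis using uc gc by (simp add: congruence_group_def)
    qed
    then have "f (g * u * (u' * k * u)) = f (g * u)" by (rule e(3)[OF GL_mult[OF g u]])
    moreover have "g * u * (u' * k * u) = g * k * u"
    proof -
      have "g * u * (u' * k * u) = g * (u * (u' * (k * u)))"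
        using uc gc by (simp add: assoc_mult_mat[of _ "n + n" "n + n" _ "n + n" _ "n + n"])
      also have "u * (u' * (k * u)) = u * u' * (k * u)"
        using uc gc by (intro assoc_mult_mat[symmetric]) auto
      also have "\<dots> = k * u" using u' uc gc by simp
      also have "g * (k * u) = g * k * u" using uc gc by (intro assoc_mult_mat[symmetric]) auto
      finally show ?thesis .
    qed
    ultimately show "\<pi> u f (g * k) = \<pi> u f g" using g GL_mult[OF g kG] by (simp add: \<pi>_apply)
  next
    fix A X D g :: "'a mat" assume AXD: "A \<in> carrier (GL r)" "X \<in> carrier_mat r m" "D \<in> carrier (GL m)"
      and g: "g \<in> carrier (GL (n + n))"
    have "para r m A X D * g * u = para r m A X D * (g * u)"
      using para_GL[OF AXD, THEN GL_carrier] g[THEN GL_carrier] uc unfolding rm by (intro assoc_mult_mat) auto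
    then show "\<pi> u f (para r m A X D * g) = coef A D *\<^sub>C \<sigma> A D (\<pi> u f g)"
      using para_mult_GL[OF AXD g] g Ind_equivariant[OF f AXD GL_mult[OF g u]] by (simp add: \<pi>_apply)
  qed (simp add: right_translation_def)
qed

lemma N_group_eq: "N_group n = {unip n n x | x. x \<in> carrier_mat n n}"
  by (simp add: N_group_def unip_def)

lemma N_char_unip:
  assumes x: "x \<in> carrier_mat n n" shows "N_char \<psi> n (unip n n x) = chi (1\<^sub>m n) x"
proof -
  have "mat n n (\<lambda>(i, j). unip n n x $$ (i, n + j)) = x"
    using x by (intro eq_matI) (auto simp: unip_def)
  then show ?thesis using x by (simp add: N_char_def chi_def)
qed

definition Ker :: "('a mat \<Rightarrow> ('v, 'w) tensor) set" where
  "Ker = complex_vector.span {\<pi> (unip n n x) f - chi (1\<^sub>m n) x *\<^sub>C f | x f. x \<in> carrier_mat n n \<and> f \<in> Ind}"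

lemma jacquet_kernel_N: "jacquet_kernel Ind \<pi> (N_group n) (N_char \<psi> n) = Ker"
proof -
  have "{\<pi> u f - N_char \<psi> n u *\<^sub>C f | u f. u \<in> N_group n \<and> f \<in> Ind} =
      {\<pi> (unip n n x) f - chi (1\<^sub>m n) x *\<^sub>C f | x f. x \<in> carrier_mat n n \<and> f \<in> Ind}"
  proof (intro equalityI subsetI)
    fix h assume "h \<in> {\<pi> u f - N_char \<psi> n u *\<^sub>C f | u f. u \<in> N_group n \<and> f \<in> Ind}"
    then obtain x f where x: "x \<in> carrier_mat n n" and "f \<in> Ind"
      "h = \<pi> (unip n n x) f - N_char \<psi> n (unip n n x) *\<^sub>C f" unfolding N_group_eq by blast
    then show "h \<in> {\<pi> (unip n n x) f - chi (1\<^sub>m n) x *\<^sub>C f | x f. x \<in> carrier_mat n n \<and> f \<in> Ind}"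
      unfolding N_char_unip[OF x] by blast
  next
    fix h assume "h \<in> {\<pi> (unip n n x) f - chi (1\<^sub>m n) x *\<^sub>C f | x f. x \<in> carrier_mat n n \<and> f \<in> Ind}"
    then obtain x f where x: "x \<in> carrier_mat n n" and f: "f \<in> Ind"
      and "h = \<pi> (unip n n x) f - chi (1\<^sub>m n) x *\<^sub>C f" by blast
    then have "h = \<pi> (unip n n x) f - N_char \<psi> n (unip n n x) *\<^sub>C f" unfolding N_char_unip[OF x] by simp
    moreover have "unip n n x \<in> N_group n" unfolding N_group_eq using x by blast
    ultimately show "h \<in> {\<pi> u f - N_char \<psi> n u *\<^sub>C f | u f. u \<in> N_group n \<and> f \<in> Ind}" using f by blast
  qed
  then show ?thesis by (simp add: jacquet_kernel_def Ker_def)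
qed

lemma Ker_subset_Ind: "Ker \<subseteq> Ind"
  unfolding Ker_def
proof (rule complex_vector.span_minimal[OF _ Ind_subspace])
  show "{\<pi> (unip n n x) f - chi (1\<^sub>m n) x *\<^sub>C f | x f. x \<in> carrier_mat n n \<and> f \<in> Ind} \<subseteq> Ind"
    using Ind_translate unip_GL Ind_subspace
    by (auto intro!: complex_vector.subspace_diff complex_vector.subspace_scale)
qed

lemma average_eq_0_if_in_Ker:
  assumes "f \<in> Ker"
  shows "\<exists>c e. 0 < e \<and> (\<forall>c'\<ge>c. \<forall>e'. 0 < e' \<and> e' \<le> e \<longrightarrow>
    (\<Sum>y\<in>reps n n c' e'. inverse (chi (1\<^sub>m n) y) *\<^sub>C \<pi> (unip n n y) f) = 0)"
proof (rule average_eq_0_if_in_span[where V = Ind])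
  show "clinear (\<pi> (unip n n y))" for y by (rule \<pi>_linear)
  show "\<pi> (unip n n (x + y)) f = \<pi> (unip n n x) (\<pi> (unip n n y) f)"
    if "x \<in> carrier_mat n n" "y \<in> carrier_mat n n" for x y f
    using \<pi>_mult[OF unip_GL[OF that(1)] unip_GL[OF that(2)]] by (simp add: unip_mult[OF that])
  show "\<exists>e>0. \<forall>y\<in>matball n n e. \<pi> (unip n n y) f = f" if f: "f \<in> Ind" for f
  proof -
    obtain e where e: "0 < e" "\<And>g k. g \<in> carrier (GL (n + n)) \<Longrightarrow> k \<in> congruence_group (n + n) e \<Longrightarrow> f (g * k) = f g"
      using Ind_smooth[OF f] by blast
    have "\<pi> (unip n n y) f = f" if y: "y \<in> matball n n e" for y
    proof
      fix g show "\<pi> (unip n n y) f g = f g"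
        using e(2)[of g "unip n n y"] unip_congruence_group[OF y e(1)] Ind_zero_outside[OF f, of g]
        by (simp add: right_translation_def)
    qed
    then show ?thesis using e(1) by blast
  qed
qed (use assms in \<open>auto simp: Ker_def\<close>)

end

lemma sum_fun_apply: "(\<Sum>i\<in>I. f i) x = (\<Sum>i\<in>I. f i x :: 'v::comm_monoid_add)"
  by (induction I rule: infinite_finite_induct) auto

context bruhat_cell
begin

text \<open>The components of \<open>x\<close> in the stabilizer of \<open>P w\<close> and along the orbit.\<close>

definition stab_part :: "'a mat \<Rightarrow> 'a mat" where "stab_part x = four_block_mat (x11 x) (0\<^sub>m a b') (x21 x) (x22 x)"
definition top_part :: "'a mat \<Rightarrow> 'a mat" where "top_part x = four_block_mat (0\<^sub>m a b) (x12 x) (0\<^sub>m a' b) (0\<^sub>m a' b')"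

lemma four_block_carrier_n:
  "A \<in> carrier_mat a b \<Longrightarrow> D \<in> carrier_mat a' b' \<Longrightarrow> four_block_mat A B C D \<in> carrier_mat n n"
  using four_block_carrier_mat[of A a b D a' b' B C] by (simp flip: na nb)

lemma stab_part_carrier [simp]: "stab_part x \<in> carrier_mat n n" and top_part_carrier [simp]: "top_part x \<in> carrier_mat n n"
  unfolding stab_part_def top_part_def by (auto intro: four_block_carrier_n)

lemma stab_part_blocks: "x11 (stab_part x) = x11 x" "x12 (stab_part x) = 0\<^sub>m a b'" "x21 (stab_part x) = x21 x" "x22 (stab_part x) = x22 x"
  unfolding stab_part_def by (auto intro!: blk_four_block)

lemma top_part_blocks: "x11 (top_part x) = 0\<^sub>m a b" "x12 (top_part x) = x12 x" "x21 (top_part x) = 0\<^sub>m a' b" "x22 (top_part x) = 0\<^sub>m a' b'"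
  unfolding top_part_def by (auto intro!: blk_four_block)

lemma stab_plus_top:
  assumes x: "x \<in> carrier_mat n n" shows "stab_part x + top_part x = x"
proof -
  have z: "0\<^sub>m p q + blk x i j p q = blk x i j p q" "blk x i j p q + 0\<^sub>m p q = blk x i j p q" for p q i j
    by (auto intro: left_add_zero_mat right_add_zero_mat)
  show ?thesis unfolding stab_part_def top_part_def
    by (subst (5) x_blocks[OF x], subst add_four_block_mat[of _ a b _ b' _ a']) (simp_all add: z)
qed

lemma four_block_matball_n:
  assumes "A \<in> matball a b c" "B \<in> matball a b' c" "C \<in> matball a' b c" "D \<in> matball a' b' c"
  shows "four_block_mat A B C D \<in> matball n n c"
  using four_block_matball[OF assms] by (simp flip: na nb)

lemma top_part_matball: "x12 x \<in> matball a b' c \<Longrightarrow> 0 \<le> c \<Longrightarrow> top_part x \<in> matball n n c"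
  unfolding top_part_def by (intro four_block_matball_n matball_zero) auto

lemma x12_matball: "x \<in> matball n n c \<Longrightarrow> x12 x \<in> matball a b' c"
  by (rule blk_matball) (use na nb in auto)

lemma x12_add: "x \<in> carrier_mat n n \<Longrightarrow> y \<in> carrier_mat n n \<Longrightarrow> x12 (x + y) = x12 x + x12 y"
  by (rule blk_add) (use na nb in auto)

end

locale induced_cell = induced_rep absv \<psi> n r m \<rho>1 \<rho>2 + bruhat_cell absv n a a' b b'
  for absv :: "'a::field \<Rightarrow> real" and \<psi> and n r m :: nat
    and \<rho>1 :: "'a mat \<Rightarrow> 'v::complex_vector \<Rightarrow> 'v" and \<rho>2 :: "'a mat \<Rightarrow> 'w::complex_vector \<Rightarrow> 'w"
    and a a' b b' :: nat +
  assumes r_eq: "r = a' + b'" and m_eq: "m = a + b"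
begin

lemma chi_blocks:
  assumes x: "x \<in> carrier_mat n n" and h: "h \<in> carrier_mat n n"
  shows "chi h x = chi (blk h 0 0 b a) (x11 x) * chi (blk h b 0 b' a) (x12 x)
     * chi (blk h 0 a b a') (x21 x) * chi (blk h b a b' a') (x22 x)"
proof -
  let ?h11 = "blk h 0 0 b a" and ?h12 = "blk h 0 a b a'" and ?h21 = "blk h b 0 b' a" and ?h22 = "blk h b a b' a'"
  have h': "h = four_block_mat ?h11 ?h12 ?h21 ?h22" by (rule four_block_blk) (use h na nb in auto)
  have "x * h = four_block_mat (x11 x * ?h11 + x12 x * ?h21) (x11 x * ?h12 + x12 x * ?h22)
     (x21 x * ?h11 + x22 x * ?h21) (x21 x * ?h12 + x22 x * ?h22)"
    by (subst (1) x_blocks[OF x], subst (1) h', rule mult_four_block_mat) auto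
  then have "mat_trace (x * h) = mat_trace (x11 x * ?h11 + x12 x * ?h21) + mat_trace (x21 x * ?h12 + x22 x * ?h22)"
    by (simp only:) (rule mat_trace_four_block[of _ a _ a'], auto)
  also have "mat_trace (x11 x * ?h11 + x12 x * ?h21) = mat_trace (x11 x * ?h11) + mat_trace (x12 x * ?h21)"
    by (rule mat_trace_add[of _ a]) auto
  also have "mat_trace (x21 x * ?h12 + x22 x * ?h22) = mat_trace (x21 x * ?h12) + mat_trace (x22 x * ?h22)"
    by (rule mat_trace_add[of _ a']) auto
  finally show ?thesis by (simp add: chi_def psi_add)
qed

lemma chi_zero_form: "chi (0\<^sub>m q p) y = 1" if "y \<in> carrier_mat p q" for p q y
proof -
  have "y * 0\<^sub>m q p = 0\<^sub>m p p" by (rule right_mult_zero_mat[OF that])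
  then show ?thesis by (simp add: chi_def mat_trace_def)
qed

lemma chi_zero: "H \<in> carrier_mat q p \<Longrightarrow> chi H (0\<^sub>m p q) = 1"
  by (simp add: chi_def mat_trace_def left_mult_zero_mat)

lemma coef_unip: "y \<in> carrier_mat a' b' \<Longrightarrow> z \<in> carrier_mat a b \<Longrightarrow> coef (unip a' b' y) (unip a b z) = 1"
proof -
  have "det (unip p q y) = (1::'a)" if "y \<in> carrier_mat p q" for p q y
    unfolding unip_def using that by (subst det_four_block_mat_lower_left_zero[of _ p _ q]) auto
  then show "y \<in> carrier_mat a' b' \<Longrightarrow> z \<in> carrier_mat a b \<Longrightarrow> ?thesis" by (intro coef_eq_1) auto
qed

lemma w_GL: "w \<in> carrier (GL (n + n))" by (rule GLO_subset_GL[OF w_GLO])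

lemma w_unip_GL: "x \<in> carrier_mat n n \<Longrightarrow> l \<in> carrier (GL (n + n)) \<Longrightarrow> w * (unip n n x * l) \<in> carrier (GL (n + n))"
  by (intro GL_mult w_GL unip_GL)

text \<open>The diagonal blocks of the element of \<open>P\<close> in question are unipotent, so the modulus character does not
  appear.\<close>

lemma value_at_stabilizer_translate:
  assumes f: "f \<in> Ind" and s: "s \<in> carrier_mat n n" "x12 s = 0\<^sub>m a b'" and x: "x \<in> carrier_mat n n"
    and l: "l \<in> carrier (GL (n + n))"
  shows "f (w * (unip n n (s + x) * l)) = \<sigma> (unip a' b' (x22 s)) (unip a b (x11 s)) (f (w * (unip n n x * l)))"
proof -
  let ?A = "unip a' b' (x22 s)" and ?D = "unip a b (x11 s)"
  let ?X = "four_block_mat (0\<^sub>m a' a) (x21 s) (0\<^sub>m b' a) (0\<^sub>m b' b)"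
  have A: "?A \<in> carrier (GL r)" unfolding r_eq by (rule unip_GL) simp
  have D: "?D \<in> carrier (GL m)" unfolding m_eq by (rule unip_GL) simp
  have X: "?X \<in> carrier_mat r m" unfolding r_eq m_eq by (intro four_block_carrier_mat) auto
  note lc = GL_carrier[OF l]
  have P: "para r m ?A ?X ?D \<in> carrier_mat (n + n) (n + n)"
    using para_GL[OF A X D, THEN GL_carrier] by (simp add: rm)
  have xl: "unip n n x * l \<in> carrier_mat (n + n) (n + n)"
    using lc by (intro mult_carrier_mat[of _ "n + n" "n + n"]) auto
  have "w * (unip n n (s + x) * l) = w * (unip n n s * (unip n n x * l))"
    using s x lc by (simp add: unip_mult[symmetric] assoc_mult_mat[of _ "n + n" "n + n" _ "n + n" _ "n + n"])
  also have "\<dots> = w * unip n n s * (unip n n x * l)"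
    using w_carrier xl by (intro assoc_mult_mat[of _ "n + n" "n + n" _ "n + n" _ "n + n", symmetric]) auto
  also have "w * unip n n s = para r m ?A ?X ?D * w"
    unfolding r_eq m_eq by (rule w_unip_stabilizer[OF s])
  also have "para r m ?A ?X ?D * w * (unip n n x * l) = para r m ?A ?X ?D * (w * (unip n n x * l))"
    using P w_carrier xl by (intro assoc_mult_mat[of _ "n + n" "n + n" _ "n + n" _ "n + n"]) auto
  finally show ?thesis
    using Ind_equivariant[OF f A X D w_unip_GL[OF x l]] coef_unip by (simp add: scaleC_one)
qed

section \<open>A function supported near one point\<close>

definition near_base_point ::
    "real \<Rightarrow> 'a mat \<Rightarrow> 'a mat \<Rightarrow> 'a mat \<Rightarrow> 'a mat \<Rightarrow> 'a mat \<Rightarrow> bool" where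
  "near_base_point e g A X D k \<longleftrightarrow> A \<in> carrier (GL r) \<and> X \<in> carrier_mat r m \<and> D \<in> carrier (GL m) \<and>
    k \<in> congruence_group (n + n) e \<and> g = para r m A X D * (k * w)"

text \<open>The function supported on \<open>P K w\<close>, for the congruence subgroup \<open>K\<close> of radius \<open>e\<close>, with value \<open>t\<close> at \<open>w\<close>. The
  choice in the definition does not matter if \<open>t\<close> is fixed by the congruence subgroups of the Levi factor.\<close>

definition bump :: "real \<Rightarrow> ('v, 'w) tensor \<Rightarrow> 'a mat \<Rightarrow> ('v, 'w) tensor" where
  "bump e t g = (if \<exists>A X D k. near_base_point e g A X D k
     then SOME z. \<exists>A X D k. near_base_point e g A X D k \<and> z = coef A D *\<^sub>C \<sigma> A D t else 0)"

text \<open>Two representations of the same point differ by an element of \<open>P \<inter> K\<close>. Its diagonal blocks lie in the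
  congruence subgroups; they fix \<open>t\<close> and have determinants of absolute value \<open>1\<close>.\<close>

lemma near_base_point_unique:
  assumes e: "0 < e" "e < 1"
    and t: "\<And>k1 k2. k1 \<in> congruence_group r e \<Longrightarrow> k2 \<in> congruence_group m e \<Longrightarrow> \<sigma> k1 k2 t = t"
    and 1: "near_base_point e g A X D k" and 2: "near_base_point e g A' X' D' k'"
  shows "coef A D *\<^sub>C \<sigma> A D t = coef A' D' *\<^sub>C \<sigma> A' D' t"
proof -
  note h = 1[unfolded near_base_point_def] and h' = 2[unfolded near_base_point_def]
  have k: "k \<in> congruence_group (n + n) e" and k': "k' \<in> congruence_group (n + n) e" using h h' by auto
  note kc = congruence_group_carrier[OF k] congruence_group_carrier[OF k']
  obtain ki where ki: "ki \<in> congruence_group (n + n) e" "k * ki = 1\<^sub>m (n + n)"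
    using congruence_group_obtain_inverse[OF k e] by blast
  note kic = congruence_group_carrier[OF ki(1)]
  let ?P = "para r m A X D" and ?P' = "para r m A' X' D'"
  have Pc: "?P \<in> carrier_mat (n + n) (n + n)" "?P' \<in> carrier_mat (n + n) (n + n)"
    using h h' para_carrier[of A r D m X] para_carrier[of A' r D' m X'] GL_carrier rm by auto
  define q where "q = k' * ki"
  have q: "q \<in> congruence_group (n + n) e" unfolding q_def by (rule congruence_group_mult[OF k' ki(1) e])
  note qc = congruence_group_carrier[OF q]
  have cancel: "(P * (K * w)) * (v * ki) = P * (K * ki)"
    if "P \<in> carrier_mat (n + n) (n + n)" "K \<in> carrier_mat (n + n) (n + n)" for P K
  proof -
    have "(P * (K * w)) * (v * ki) = P * (K * (w * (v * ki)))"
      using that w_carrier v_carrier kic by (simp add: assoc_mult_mat[of _ "n + n" "n + n" _ "n + n" _ "n + n"])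
    also have "w * (v * ki) = w * v * ki"
      using w_carrier v_carrier kic by (intro assoc_mult_mat[symmetric]) auto
    also have "\<dots> = ki" unfolding w_v using kic by simp
    finally show ?thesis .
  qed
  have "?P * (k * ki) = ?P' * (k' * ki)"
    using cancel[OF Pc(1) kc(1)] cancel[OF Pc(2) kc(2)] h h' by simp
  then have PP: "?P = ?P' * q" using ki Pc by (simp add: q_def)
  let ?q = "\<lambda>i j p s. blk q i j p s"
  have qc': "q \<in> carrier_mat (r + m) (r + m)" using qc rm by simp
  have c: "A \<in> carrier_mat r r" "D \<in> carrier_mat m m" "A' \<in> carrier_mat r r" "D' \<in> carrier_mat m m"
    "X \<in> carrier_mat r m" "X' \<in> carrier_mat r m" using h h' GL_carrier by auto
  have "?P' * q = four_block_mat (A' * ?q 0 0 r r + X' * ?q r 0 m r) (A' * ?q 0 r r m + X' * ?q r r m m)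
     (0\<^sub>m m r * ?q 0 0 r r + D' * ?q r 0 m r) (0\<^sub>m m r * ?q 0 r r m + D' * ?q r r m m)"
    unfolding para_def by (subst (1) four_block_blk[OF qc'], rule mult_four_block_mat) (use c in auto)
  also have "0\<^sub>m m r * ?q 0 0 r r = 0\<^sub>m m r" by (rule left_mult_zero_mat) simp
  also have "0\<^sub>m m r + D' * ?q r 0 m r = D' * ?q r 0 m r" by (rule left_add_zero_mat) (use c in auto)
  also have "0\<^sub>m m r * ?q 0 r r m = 0\<^sub>m m m" by (rule left_mult_zero_mat) simp
  also have "0\<^sub>m m m + D' * ?q r r m m = D' * ?q r r m m" by (rule left_add_zero_mat) (use c in auto)
  finally have "four_block_mat A X (0\<^sub>m m r) D = four_block_mat (A' * ?q 0 0 r r + X' * ?q r 0 m r)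
      (A' * ?q 0 r r m + X' * ?q r r m m) (D' * ?q r 0 m r) (D' * ?q r r m m)"
    using PP by (simp add: para_def)
  then have eqs: "A = A' * ?q 0 0 r r + X' * ?q r 0 m r" "0\<^sub>m m r = D' * ?q r 0 m r" "D = D' * ?q r r m m"
    by (subst (asm) four_block_eq_iff[of _ r r _ m _ m]; use c in auto)+
  obtain Di where Di: "Di \<in> carrier (GL m)" "Di * D' = 1\<^sub>m m" using h' GL_obtain_inverse by metis
  note Dic = GL_carrier[OF Di(1)]
  have "?q r 0 m r = Di * D' * ?q r 0 m r" using Di by simp
  also have "\<dots> = Di * (D' * ?q r 0 m r)" using Dic c by (intro assoc_mult_mat) auto
  also have "\<dots> = 0\<^sub>m m r" unfolding eqs(2)[symmetric] by (rule right_mult_zero_mat[OF Dic])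
  finally have q21: "?q r 0 m r = 0\<^sub>m m r" .
  have A_eq: "A = A' * ?q 0 0 r r"
  proof -
    have "X' * 0\<^sub>m m r = 0\<^sub>m r r" by (rule right_mult_zero_mat[OF c(6)])
    then show ?thesis using eqs(1) unfolding q21 using right_add_zero_mat[of "A' * ?q 0 0 r r" r r] c by simp
  qed
  have qb: "q - 1\<^sub>m (n + n) \<in> matball (r + m) (r + m) e" using q rm by (simp add: congruence_group_def)
  have k1: "?q 0 0 r r \<in> congruence_group r e"
  proof -
    have "?q 0 0 r r - 1\<^sub>m r = blk (q - 1\<^sub>m (n + n)) 0 0 r r" using qc rm by (intro eq_matI) auto
    then show ?thesis using blk_matball[OF qb, of 0 r 0 r] by (simp add: congruence_group_def)
  qed
  have k2: "?q r r m m \<in> congruence_group m e"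
  proof -
    have "?q r r m m - 1\<^sub>m m = blk (q - 1\<^sub>m (n + n)) r r m m" using qc rm by (intro eq_matI) auto
    then show ?thesis using blk_matball[OF qb, of r m r m] by (simp add: congruence_group_def)
  qed
  have O: "?q 0 0 r r \<in> GLO r" "?q r r m m \<in> GLO m" using congruence_group_GLO k1 k2 e by auto
  have "\<sigma> A D t = \<sigma> A' D' (\<sigma> (?q 0 0 r r) (?q r r m m) t)"
    unfolding A_eq eqs(3) by (rule \<sigma>_mult) (use h' O GLO_subset_GL in auto)
  then have "\<sigma> A D t = \<sigma> A' D' t" using t[OF k1 k2] by simp
  moreover have "coef A D = coef A' D'"
    unfolding A_eq eqs(3) using coef_mult[of A' "?q 0 0 r r" D' "?q r r m m"] c coef_eq_1[OF det_GLO[OF O(1)] det_GLO[OF O(2)]]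
    by simp
  ultimately show ?thesis by simp
qed

lemma bump_eq:
  assumes e: "0 < e" "e < 1"
    and t: "\<And>k1 k2. k1 \<in> congruence_group r e \<Longrightarrow> k2 \<in> congruence_group m e \<Longrightarrow> \<sigma> k1 k2 t = t"
    and near: "near_base_point e g A X D k"
  shows "bump e t g = coef A D *\<^sub>C \<sigma> A D t"
proof -
  have ex: "\<exists>z A X D k. near_base_point e g A X D k \<and> z = coef A D *\<^sub>C \<sigma> A D t" using near by blast
  from someI_ex[OF ex] obtain A' X' D' k' where "near_base_point e g A' X' D' k'"
    "(SOME z. \<exists>A X D k. near_base_point e g A X D k \<and> z = coef A D *\<^sub>C \<sigma> A D t) = coef A' D' *\<^sub>C \<sigma> A' D' t"
    by blast
  moreover have "bump e t g = (SOME z. \<exists>A X D k. near_base_point e g A X D k \<and> z = coef A D *\<^sub>C \<sigma> A D t)"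
    unfolding bump_def using near by (auto simp del: split_paired_Ex)
  ultimately show ?thesis using near_base_point_unique[OF e t near] by simp
qed

lemma near_base_point_mult_para:
  assumes A: "A' \<in> carrier (GL r)" and X: "X' \<in> carrier_mat r m" and D: "D' \<in> carrier (GL m)"
    and near: "near_base_point e g A X D k"
  shows "near_base_point e (para r m A' X' D' * g) (A' * A) (A' * X + X' * D) (D' * D) k"
proof -
  note h = near[unfolded near_base_point_def]
  have c: "A \<in> carrier_mat r r" "D \<in> carrier_mat m m" "A' \<in> carrier_mat r r" "D' \<in> carrier_mat m m"
    using h A D GL_carrier by auto
  have kc: "k \<in> carrier_mat (n + n) (n + n)" using h congruence_group_carrier by blast
  have "para r m A' X' D' * (para r m A X D * (k * w)) = para r m A' X' D' * para r m A X D * (k * w)"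
    by (rule assoc_mult_mat[of _ "n + n" "n + n" _ "n + n" _ "n + n", symmetric])
      (use para_carrier[OF c(3,4)] para_carrier[OF c(1,2)] kc w_carrier rm in auto)
  also have "para r m A' X' D' * para r m A X D = para r m (A' * A) (A' * X + X' * D) (D' * D)"
    by (rule para_mult) (use c h X in auto)
  finally show ?thesis unfolding near_base_point_def using h A D X c by (auto intro: GL_mult)
qed

lemma bump_in_Ind:
  assumes e: "0 < e" "e < 1"
    and t: "\<And>k1 k2. k1 \<in> congruence_group r e \<Longrightarrow> k2 \<in> congruence_group m e \<Longrightarrow> \<sigma> k1 k2 t = t"
  shows "bump e t \<in> Ind"
proof (rule Ind_I[OF _ _ e])
  fix g :: "'a mat" assume g: "g \<notin> carrier (GL (n + n))"
  have "\<not> near_base_point e g A X D k" for A X D k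
  proof
    assume "near_base_point e g A X D k"
    note h = this[unfolded near_base_point_def]
    have "k \<in> carrier (GL (n + n))" using h congruence_group_GLO[OF _ e] GLO_subset_GL by blast
    then have "k * w \<in> carrier (GL (n + n))" using w_GL by (rule GL_mult)
    then have "g \<in> carrier (GL (n + n))" using h para_mult_GL by blast
    then show False using g by simp
  qed
  then show "bump e t g = 0" by (simp add: bump_def)
next
  fix A X D g :: "'a mat"
  assume AXD: "A \<in> carrier (GL r)" "X \<in> carrier_mat r m" "D \<in> carrier (GL m)" and g: "g \<in> carrier (GL (n + n))"
  show "bump e t (para r m A X D * g) = coef A D *\<^sub>C \<sigma> A D (bump e t g)"
  proof (cases "\<exists>A X D k. near_base_point e g A X D k")
    case True
    then obtain A1 X1 D1 k where near: "near_base_point e g A1 X1 D1 k" by blast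
    note h = near[unfolded near_base_point_def]
    have "bump e t (para r m A X D * g) = coef (A * A1) (D * D1) *\<^sub>C \<sigma> (A * A1) (D * D1) t"
      by (rule bump_eq[OF e t near_base_point_mult_para[OF AXD near]])
    also have "\<dots> = coef A D *\<^sub>C \<sigma> A D (coef A1 D1 *\<^sub>C \<sigma> A1 D1 t)"
      using h AXD \<sigma>_mult[of A A1 D D1 t]
        coef_mult[OF GL_carrier GL_carrier GL_carrier GL_carrier, of A A1 D D1]
      by (simp add: clinear_scaleC[OF \<sigma>_linear] scaleC_scaleC)
    also have "coef A1 D1 *\<^sub>C \<sigma> A1 D1 t = bump e t g" by (rule bump_eq[OF e t near, symmetric])
    finally show ?thesis .
  next
    case False
    have "\<not> near_base_point e (para r m A X D * g) A1 X1 D1 k" for A1 X1 D1 k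
    proof
      assume near: "near_base_point e (para r m A X D * g) A1 X1 D1 k"
      obtain A' X' D' where inv: "A' \<in> carrier (GL r)" "X' \<in> carrier_mat r m" "D' \<in> carrier (GL m)"
        "para r m A' X' D' * para r m A X D = 1\<^sub>m (r + m)" using AXD by (rule para_obtain_inverse)
      have "para r m A' X' D' * (para r m A X D * g) = para r m A' X' D' * para r m A X D * g"
        by (rule assoc_mult_mat[of _ "n + n" "n + n" _ "n + n" _ "n + n", symmetric])
          (use para_GL[OF inv(1-3), THEN GL_carrier] para_GL[OF AXD, THEN GL_carrier] g[THEN GL_carrier] rm in auto)
      then have "para r m A' X' D' * (para r m A X D * g) = g" using inv(4) g[THEN GL_carrier] rm by simp
      then show False using near_base_point_mult_para[OF inv(1-3) near] False by auto
    qed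
    then have "bump e t (para r m A X D * g) = 0" by (simp add: bump_def)
    moreover have "bump e t g = 0" using False by (simp add: bump_def)
    ultimately show ?thesis using clinear_zero[OF \<sigma>_linear[OF AXD(1,3)]] by simp
  qed
next
  have right: "\<exists>k. near_base_point e (g * k0) A X D k"
    if k0: "k0 \<in> congruence_group (n + n) e" and near: "near_base_point e g A X D k1" for g k0 A X D k1
  proof -
    note h = near[unfolded near_base_point_def]
    have k1: "k1 \<in> congruence_group (n + n) e" using h by blast
    note kc = congruence_group_carrier[OF k0] congruence_group_carrier[OF k1]
    have k2: "w * k0 * v \<in> congruence_group (n + n) e"
      by (rule congruence_group_conj[OF v_matball GLO_matball[OF w_GLO] w_v k0 e(1)])
    have wv: "k1 * (w * k0 * v) * w = k1 * w * k0"
    proof -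
      have "k1 * (w * k0 * v) * w = k1 * (w * (k0 * (v * w)))"
        using kc w_carrier v_carrier by (simp add: assoc_mult_mat[of _ "n + n" "n + n" _ "n + n" _ "n + n"])
      also have "\<dots> = k1 * (w * k0)" unfolding v_w using kc by simp
      also have "\<dots> = k1 * w * k0" using kc w_carrier by (intro assoc_mult_mat[symmetric]) auto
      finally show ?thesis .
    qed
    have P: "para r m A X D \<in> carrier_mat (n + n) (n + n)"
      using h para_carrier[of A r D m X] GL_carrier rm by auto
    have "g * k0 = para r m A X D * (k1 * w * k0)"
      using h P kc w_carrier assoc_mult_mat[of "para r m A X D" "n + n" "n + n" "k1 * w" "n + n" k0 "n + n"] by simp
    then have "g * k0 = para r m A X D * (k1 * (w * k0 * v) * w)" unfolding wv .
    then show ?thesis using h congruence_group_mult[OF k1 k2 e] unfolding near_base_point_def by blast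
  qed
  fix g k0 :: "'a mat" assume g: "g \<in> carrier (GL (n + n))" and k0: "k0 \<in> congruence_group (n + n) e"
  show "bump e t (g * k0) = bump e t g"
  proof (cases "\<exists>A X D k. near_base_point e g A X D k")
    case True
    then obtain A X D k where near: "near_base_point e g A X D k" by blast
    then obtain k' where near': "near_base_point e (g * k0) A X D k'" using right[OF k0] by blast
    show ?thesis using bump_eq[OF e t near] bump_eq[OF e t near'] by simp
  next
    case False
    obtain ki where ki: "ki \<in> congruence_group (n + n) e" "k0 * ki = 1\<^sub>m (n + n)"
      using congruence_group_obtain_inverse[OF k0 e] by blast
    have gk: "g * k0 * ki = g"
      using GL_carrier[OF g] congruence_group_carrier[OF k0] congruence_group_carrier[OF ki(1)] ki(2)
        assoc_mult_mat[of g "n + n" "n + n" k0 "n + n" ki "n + n"] by simp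
    have "\<not> near_base_point e (g * k0) A X D k" for A X D k
      using right[OF ki(1), of "g * k0" A X D k] gk False by auto
    then show ?thesis using False by (simp add: bump_def)
  qed
qed

text \<open>Let \<open>L\<close> be the functional on the tensor product given by \<open>L1\<close> and \<open>L2\<close>. On the orbit \<open>P w N\<close> the function
  \<open>L \<circ> bump\<close>, divided by the character, is the indicator function of a ball in the coordinate \<open>x12\<close>. So its
  averages count representatives in that ball and are non-zero, while those of a function in the kernel vanish.\<close>

lemma not_Ind_subset_Ker:
  assumes ba: "b \<le> a"
    and L1: "clinear L1" "L1 v0 = (1::complex)"
      "\<And>y u. y \<in> carrier_mat a' b' \<Longrightarrow> L1 (\<rho>1 (unip a' b' y) u) = chi (blk (1\<^sub>m n) b a b' a') y * L1 u"
    and L2: "clinear L2" "L2 w0 = (1::complex)"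
      "\<And>y u. y \<in> carrier_mat a b \<Longrightarrow> L2 (\<rho>2 (unip a b y) u) = chi (blk (1\<^sub>m n) 0 0 b a) y * L2 u"
  shows "\<not> Ind \<subseteq> Ker"
proof
  assume sub: "Ind \<subseteq> Ker"
  obtain L where L: "clinear L" "\<And>v w. L (v \<otimes>\<^sub>t w) = L1 v * L2 w"
    using exists_tensor_functional[OF L1(1) L2(1)] by blast
  have L_eq: "L (\<sigma> (unip a' b' y) (unip a b z) t) = chi (blk (1\<^sub>m n) b a b' a') y * chi (blk (1\<^sub>m n) 0 0 b a) z * L t"
    if y: "y \<in> carrier_mat a' b'" and z: "z \<in> carrier_mat a b" for y z t
  proof -
    have G: "unip a' b' y \<in> carrier (GL r)" "unip a b z \<in> carrier (GL m)"
      unfolding r_eq m_eq using y z by (auto intro: unip_GL)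
    have "(\<lambda>t. L (\<sigma> (unip a' b' y) (unip a b z) t)) =
        (\<lambda>t. (chi (blk (1\<^sub>m n) b a b' a') y * chi (blk (1\<^sub>m n) 0 0 b a) z) * L t)"
    proof (rule tensor_ext)
      show "clinear (\<lambda>t. L (\<sigma> (unip a' b' y) (unip a b z) t))"
        by (rule clinear_comp[OF L(1) \<sigma>_linear[OF G]])
      show "clinear (\<lambda>t. (chi (blk (1\<^sub>m n) b a b' a') y * chi (blk (1\<^sub>m n) 0 0 b a) z) * L t)"
        by (rule clinear_functionalI) (simp_all add: clinear_add[OF L(1)] clinear_functional_scaleC[OF L(1)] algebra_simps)
      show "L (\<sigma> (unip a' b' y) (unip a b z) (v' \<otimes>\<^sub>t w')) =
          (chi (blk (1\<^sub>m n) b a b' a') y * chi (blk (1\<^sub>m n) 0 0 b a) z) * L (v' \<otimes>\<^sub>t w')" for v' w'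
        by (simp add: \<sigma>_pure[OF G] L(2) L1(3)[OF y] L2(3)[OF z])
    qed
    then show ?thesis by metis
  qed
  obtain e1 where e1: "0 < e1" "e1 < 1" "\<And>g. g \<in> congruence_group r e1 \<Longrightarrow> \<rho>1 g v0 = v0"
    using smooth_rep_stabilizer[OF \<rho>1] by blast
  obtain e2 where e2: "0 < e2" "\<And>g. g \<in> congruence_group m e2 \<Longrightarrow> \<rho>2 g w0 = w0"
    using smooth_rep_stabilizer[OF \<rho>2] by blast
  obtain e3 where e3: "0 < e3" "\<And>y. y \<in> matball n n e3 \<Longrightarrow> chi (1\<^sub>m n) y = 1"
    using chi_locally_constant[of "1\<^sub>m n" n n] by auto
  define e where "e = min e1 (min e2 e3)"
  have e: "0 < e" "e < 1" using e1 e2 e3 by (auto simp: e_def)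
  define t where "t = v0 \<otimes>\<^sub>t w0"
  have t: "\<sigma> k1 k2 t = t" if k: "k1 \<in> congruence_group r e" "k2 \<in> congruence_group m e" for k1 k2
  proof -
    have "\<rho>1 k1 v0 = v0" by (rule e1(3)) (use k(1) in \<open>auto intro: congruence_group_mono simp: e_def\<close>)
    moreover have "\<rho>2 k2 w0 = w0" by (rule e2(2)) (use k(2) in \<open>auto intro: congruence_group_mono simp: e_def\<close>)
    moreover have "k1 \<in> carrier (GL r)" "k2 \<in> carrier (GL m)"
      using k congruence_group_GLO e GLO_subset_GL by blast+
    ultimately show ?thesis by (simp add: t_def \<sigma>_pure)
  qed
  define f where "f = bump e t"
  have f: "f \<in> Ind" unfolding f_def by (rule bump_in_Ind[OF e t])
  have "near_base_point e w (1\<^sub>m r) (0\<^sub>m r m) (1\<^sub>m m) (1\<^sub>m (n + n))"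
    unfolding near_base_point_def using w_carrier one_in_congruence_group[OF e(1)] rm by (simp add: para_def GL_one)
  then have fw: "f w = t"
    unfolding f_def using bump_eq[OF e t, of w "1\<^sub>m r" "0\<^sub>m r m" "1\<^sub>m m" "1\<^sub>m (n + n)"]
    by (simp add: coef_eq_1 scaleC_one \<sigma>_one)
  have Lt: "L t = 1" by (simp add: t_def L(2) L1(2) L2(2))
  define F where "F x = inverse (chi (1\<^sub>m n) x) * L (f (w * unip n n x))" for x
  have F0: "F x = 0" if x: "x \<in> carrier_mat n n" and far: "x12 x \<notin> matball a b' e" for x
  proof -
    have "\<not> near_base_point e (w * unip n n x) A X D k" for A X D k
    proof
      assume "near_base_point e (w * unip n n x) A X D k"
      note h = this[unfolded near_base_point_def, unfolded r_eq m_eq]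
      have "x12 x \<in> matball a b' e"
        by (rule x12_small_if_near_base_point[OF x e, of A X D k]) (use h GL_carrier in blast)+
      then show False using far by simp
    qed
    then have "f (w * unip n n x) = 0" by (simp add: f_def bump_def)
    then show ?thesis by (simp add: F_def clinear_zero[OF L(1)])
  qed
  have F1: "F x = 1" if x: "x \<in> carrier_mat n n" and near: "x12 x \<in> matball a b' e" for x
  proof -
    have T: "top_part x \<in> matball n n e" using near e by (intro top_part_matball) auto
    have TG: "unip n n (top_part x) \<in> congruence_group (n + n) e" by (rule unip_congruence_group[OF T e(1)])
    have TG': "unip n n (top_part x) \<in> carrier (GL (n + n))" by (rule unip_GL) simp
    have wx: "w * unip n n x = w * (unip n n (stab_part x + 0\<^sub>m n n) * unip n n (top_part x))"
      using stab_plus_top[OF x] unip_mult[of "stab_part x" n n "top_part x"] by simp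
    have "f (w * (unip n n (stab_part x + 0\<^sub>m n n) * unip n n (top_part x))) =
        \<sigma> (unip a' b' (x22 x)) (unip a b (x11 x)) (f (w * (unip n n (0\<^sub>m n n) * unip n n (top_part x))))"
      using value_at_stabilizer_translate[OF f stab_part_carrier stab_part_blocks(2) zero_carrier_mat TG', of x] by (simp add: stab_part_blocks)
    moreover have "f (w * (unip n n (0\<^sub>m n n) * unip n n (top_part x))) = f w"
    proof -
      have "f (w * unip n n (top_part x)) = f w"
      proof -
        have near: "near_base_point e w (1\<^sub>m r) (0\<^sub>m r m) (1\<^sub>m m) (1\<^sub>m (n + n))" by fact
        have k2: "w * unip n n (top_part x) * v \<in> congruence_group (n + n) e"
          by (rule congruence_group_conj[OF v_matball GLO_matball[OF w_GLO] w_v TG e(1)])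
        have "w * unip n n (top_part x) * v * w = w * unip n n (top_part x)"
        proof -
          have "w * unip n n (top_part x) * v * w = w * unip n n (top_part x) * (v * w)"
            using w_carrier v_carrier mult_carrier_mat[OF w_carrier unip_carrier[of n n]]
            by (intro assoc_mult_mat[of _ "n + n" "n + n" _ "n + n" _ "n + n"]) auto
          then show ?thesis unfolding v_w
            using right_mult_one_mat[OF mult_carrier_mat[OF w_carrier unip_carrier[of n n]]] by metis
        qed
        then have "near_base_point e (w * unip n n (top_part x)) (1\<^sub>m r) (0\<^sub>m r m) (1\<^sub>m m) (w * unip n n (top_part x) * v)"
          unfolding near_base_point_def using k2 w_carrier rm by (simp add: para_def GL_one)
        from bump_eq[OF e t this] show ?thesis using fw by (simp add: f_def coef_eq_1 scaleC_one \<sigma>_one)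
      qed
      then show ?thesis by (simp add: unip_zero left_mult_one_mat[OF unip_carrier])
    qed
    ultimately have fx: "f (w * unip n n x) = \<sigma> (unip a' b' (x22 x)) (unip a b (x11 x)) t"
      using wx fw by simp
    let ?h = "1\<^sub>m n :: 'a mat"
    \<comment> \<open>This is \<open>B \<subseteq> A\<close>: the character is trivial on the component \<open>x21\<close>, which acts trivially.\<close>
    have z12: "blk ?h 0 a b a' = 0\<^sub>m b a'" using ba na nb by (intro eq_matI) auto
    \<comment> \<open>The character need not be trivial on the component \<open>x12\<close>, but it is on the small ball in question.\<close>
    have c21: "chi (blk ?h b 0 b' a) (x12 x) = 1"
    proof -
      have "chi ?h (top_part x) = 1" by (rule e3(2)) (use T in \<open>auto intro: matball_mono simp: e_def\<close>)
      then show ?thesis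
        using chi_blocks[of "top_part x" ?h] by (simp add: top_part_blocks chi_zero)
    qed
    have "chi ?h x = chi (blk ?h 0 0 b a) (x11 x) * chi (blk ?h b a b' a') (x22 x)"
      using chi_blocks[OF x, of ?h] c21 z12 chi_zero_form[of "x21 x" a' b] by simp
    then show ?thesis unfolding F_def fx L_eq[OF blk_carrier blk_carrier] Lt by (simp add: field_simps)
  qed
  have "f \<in> Ker" using sub f by blast
  from average_eq_0_if_in_Ker[OF this] obtain c0 e0 where avg: "0 < e0" "\<And>c' e'. c0 \<le> c' \<Longrightarrow> 0 < e' \<Longrightarrow> e' \<le> e0 \<Longrightarrow>
    (\<Sum>y\<in>reps n n c' e'. inverse (chi (1\<^sub>m n) y) *\<^sub>C \<pi> (unip n n y) f) = 0" by blast
  define c' where "c' = max 0 c0"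
  define e' where "e' = min e e0"
  have e': "0 < e'" "e' \<le> e" "e' \<le> e0" and c': "0 \<le> c'" "c0 \<le> c'" using e avg(1) by (auto simp: e'_def c'_def)
  let ?T = "reps n n c' e'"
  have Tc: "y \<in> carrier_mat n n" if "y \<in> ?T" for y using reps_subset[OF e'(1) that] matball_carrier by blast
  have "(\<Sum>y\<in>?T. F y) = L ((\<Sum>y\<in>?T. inverse (chi (1\<^sub>m n) y) *\<^sub>C \<pi> (unip n n y) f) w)"
  proof -
    have "(\<Sum>y\<in>?T. inverse (chi (1\<^sub>m n) y) *\<^sub>C \<pi> (unip n n y) f) w =
        (\<Sum>y\<in>?T. inverse (chi (1\<^sub>m n) y) *\<^sub>C f (w * unip n n y))"
      using w_GL by (simp add: sum_fun_apply scaleC_fun_def \<pi>_apply)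
    then show ?thesis
      by (simp add: clinear_sum[OF L(1)] clinear_functional_scaleC[OF L(1)] F_def)
  qed
  also have "\<dots> = 0" using avg(2)[OF c'(2) e'(1) e'(3)] by (simp add: clinear_zero[OF L(1)])
  finally have sum0: "(\<Sum>y\<in>?T. F y) = 0" .
  have "(\<Sum>y\<in>?T. F y) = (\<Sum>y\<in>?T. if x12 y \<in> matball a b' e then 1 else 0)"
    by (rule sum.cong[OF refl]) (use F0 F1 Tc in auto)
  also have "\<dots> = of_nat (card {y\<in>?T. x12 y \<in> matball a b' e})"
    using reps_finite[OF e'(1)] by (simp add: sum.If_cases Int_def)
  finally have "card {y\<in>?T. x12 y \<in> matball a b' e} = 0" using sum0 by simp
  then have none: "{y\<in>?T. x12 y \<in> matball a b' e} = {}" using reps_finite[OF e'(1), of n n c'] by simp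
  obtain y where y: "y \<in> ?T" "0\<^sub>m n n - y \<in> matball n n e'"
    using reps_cover[OF e'(1) matball_zero[OF c'(1)], of n n] by blast
  have "y - 0\<^sub>m n n \<in> matball n n e'" by (rule matball_diff_commute[OF _ Tc[OF y(1)] y(2)]) simp
  moreover have "y - 0\<^sub>m n n = y" using Tc[OF y(1)] by (intro eq_matI) auto
  ultimately have "y \<in> matball n n e" using e'(2) by (auto intro: matball_mono)
  then have "x12 y \<in> matball a b' e" by (rule x12_matball)
  then show False using none y(1) by blast
qed

end

section \<open>Averaging out the strata\<close>

context bruhat_cell
begin

lemma cell_mult_levi:
  assumes g: "g \<in> cell" and k: "k1 \<in> GLO n" "k2 \<in> GLO n"
  shows "g * levi n k1 k2 \<in> cell"
proof -
  obtain A X D x h1 h2 where h: "A \<in> carrier (GL (a' + b'))" "X \<in> carrier_mat (a' + b') (a + b)"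
    "D \<in> carrier (GL (a + b))" "x \<in> carrier_mat n n" "h1 \<in> GLO n" "h2 \<in> GLO n"
    and g_eq: "g = para (a' + b') (a + b) A X D * (w * (unip n n x * levi n h1 h2))"
    using g unfolding cell_def by blast
  let ?P = "para (a' + b') (a + b) A X D"
  have P: "?P \<in> carrier_mat (n + n) (n + n)"
    using para_carrier[OF h(1)[THEN GL_carrier] h(3)[THEN GL_carrier], of X] total by simp
  have l: "levi n h1 h2 \<in> carrier_mat (n + n) (n + n)" "levi n k1 k2 \<in> carrier_mat (n + n) (n + n)"
    using h k by (auto intro: levi_carrier GLO_carrier)
  have "g * levi n k1 k2 = ?P * (w * (unip n n x * (levi n h1 h2 * levi n k1 k2)))"
  proof -
    have ul: "unip n n x * levi n h1 h2 \<in> carrier_mat (n + n) (n + n)"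
      by (rule mult_carrier_mat[OF unip_carrier l(1)])
    have wul: "w * (unip n n x * levi n h1 h2) \<in> carrier_mat (n + n) (n + n)"
      by (rule mult_carrier_mat[OF w_carrier ul])
    show ?thesis unfolding g_eq
      by (simp only: assoc_mult_mat[OF P wul l(2)] assoc_mult_mat[OF w_carrier ul l(2)] assoc_mult_mat[OF unip_carrier l])
  qed
  also have "levi n h1 h2 * levi n k1 k2 = levi n (h1 * k1) (h2 * k2)"
    by (rule levi_mult) (use h k GLO_carrier in auto)
  finally show ?thesis unfolding cell_def using h k GLO_mult by blast
qed

lemma cell_element_mult_unip:
  assumes A: "A \<in> carrier (GL (a' + b'))" and D: "D \<in> carrier (GL (a + b))"
    and x: "x \<in> carrier_mat n n" and h: "h1 \<in> GLO n" "h2 \<in> GLO n"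
    and h2': "h2' \<in> carrier_mat n n" "h2' * h2 = 1\<^sub>m n" and t: "t \<in> carrier_mat n n"
  shows "para (a' + b') (a + b) A X D * (w * (unip n n x * levi n h1 h2)) * unip n n t =
    para (a' + b') (a + b) A X D * (w * (unip n n (x + h1 * t * h2') * levi n h1 h2))"
proof -
  note hc = h[THEN GLO_carrier] h2'(1)
  let ?P = "para (a' + b') (a + b) A X D"
  let ?t = "h1 * t * h2'"
  have tc: "?t \<in> carrier_mat n n" using hc t by auto
  have P: "?P \<in> carrier_mat (n + n) (n + n)"
    using para_carrier[OF A[THEN GL_carrier] D[THEN GL_carrier], of X] total by simp
  have l: "levi n h1 h2 \<in> carrier_mat (n + n) (n + n)" using hc by (auto intro: levi_carrier)
  have ul: "unip n n x * levi n h1 h2 \<in> carrier_mat (n + n) (n + n)"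
    by (rule mult_carrier_mat[OF unip_carrier l])
  have wul: "w * (unip n n x * levi n h1 h2) \<in> carrier_mat (n + n) (n + n)"
    by (rule mult_carrier_mat[OF w_carrier ul])
  have "?P * (w * (unip n n x * levi n h1 h2)) * unip n n t = ?P * (w * (unip n n x * (levi n h1 h2 * unip n n t)))"
    by (simp only: assoc_mult_mat[OF P wul unip_carrier] assoc_mult_mat[OF w_carrier ul unip_carrier]
        assoc_mult_mat[OF unip_carrier l unip_carrier])
  also have "levi n h1 h2 * unip n n t = unip n n ?t * levi n h1 h2"
    by (rule levi_unip) (use hc h2' t in auto)
  also have "unip n n x * (unip n n ?t * levi n h1 h2) = unip n n (x + ?t) * levi n h1 h2"
    unfolding unip_mult[OF x tc, symmetric] by (rule assoc_mult_mat[OF unip_carrier unip_carrier l, symmetric])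
  finally show ?thesis .
qed

lemma cell_mult_unip:
  assumes g: "g \<in> cell" and t: "t \<in> carrier_mat n n"
  shows "g * unip n n t \<in> cell"
proof -
  obtain A X D x h1 h2 where h: "A \<in> carrier (GL (a' + b'))" "X \<in> carrier_mat (a' + b') (a + b)"
    "D \<in> carrier (GL (a + b))" "x \<in> carrier_mat n n" "h1 \<in> GLO n" "h2 \<in> GLO n"
    and g_eq: "g = para (a' + b') (a + b) A X D * (w * (unip n n x * levi n h1 h2))"
    using g unfolding cell_def by blast
  obtain h2' where h2': "h2' \<in> GLO n" "h2' * h2 = 1\<^sub>m n" using h(6) GLO_obtain_inverse by blast
  have "x + h1 * t * h2' \<in> carrier_mat n n"
    using h(4) t GLO_carrier[OF h(5)] GLO_carrier[OF h2'(1)] by auto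
  then show ?thesis
    unfolding g_eq cell_element_mult_unip[OF h(1,3,4,5,6) GLO_carrier[OF h2'(1)] h2'(2) t] cell_def
    using h by blast
qed

text \<open>If \<open>h\<close> maps \<open>B\<close> into \<open>A\<close>, it is injective on \<open>B\<close> and induces a surjection \<open>F\<^sup>n/B \<rightarrow> F\<^sup>n/A\<close>; the blocks
  of the inverse matrix provide the one-sided inverses.\<close>

lemma inverse_blocks:
  assumes hc: "h \<in> carrier_mat n n" and gc: "g \<in> carrier_mat n n" and inv: "h * g = 1\<^sub>m n" "g * h = 1\<^sub>m n"
    and zero: "blk h 0 a b a' = 0\<^sub>m b a'"
  shows "blk h 0 0 b a * blk g 0 0 a b = 1\<^sub>m b" "blk g a b a' b' * blk h b a b' a' = 1\<^sub>m a'"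
proof -
  let ?h11 = "blk h 0 0 b a" and ?h12 = "blk h 0 a b a'" and ?h21 = "blk h b 0 b' a" and ?h22 = "blk h b a b' a'"
  let ?g11 = "blk g 0 0 a b" and ?g12 = "blk g 0 b a b'" and ?g21 = "blk g a 0 a' b" and ?g22 = "blk g a b a' b'"
  have h': "h = four_block_mat ?h11 ?h12 ?h21 ?h22" by (rule four_block_blk) (use hc na nb in auto)
  have g': "g = four_block_mat ?g11 ?g12 ?g21 ?g22" by (rule four_block_blk) (use gc na nb in auto)
  show "?h11 * ?g11 = 1\<^sub>m b"
  proof -
    have "h * g = four_block_mat (?h11 * ?g11 + ?h12 * ?g21) (?h11 * ?g12 + ?h12 * ?g22)
       (?h21 * ?g11 + ?h22 * ?g21) (?h21 * ?g12 + ?h22 * ?g22)"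
      by (subst (1) h', subst (1) g', rule mult_four_block_mat) auto
    then have "blk (h * g) 0 0 b b = ?h11 * ?g11 + ?h12 * ?g21"
      by (simp only:) (rule blk_four_block(1)[of _ b b _ b' _ b'], auto)
    also have "?h12 * ?g21 = 0\<^sub>m b b" unfolding zero by (rule left_mult_zero_mat) simp
    also have "?h11 * ?g11 + 0\<^sub>m b b = ?h11 * ?g11" by (rule right_add_zero_mat) auto
    finally have "blk (1\<^sub>m n) 0 0 b b = ?h11 * ?g11" unfolding inv(1) .
    moreover have "blk (1\<^sub>m n) 0 0 b b = (1\<^sub>m b :: 'a mat)" using nb by (intro eq_matI) auto
    ultimately show ?thesis by simp
  qed
  show "?g22 * ?h22 = 1\<^sub>m a'"
  proof -
    have "g * h = four_block_mat (?g11 * ?h11 + ?g12 * ?h21) (?g11 * ?h12 + ?g12 * ?h22)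
       (?g21 * ?h11 + ?g22 * ?h21) (?g21 * ?h12 + ?g22 * ?h22)"
      by (subst (1) g', subst (1) h', rule mult_four_block_mat) auto
    then have "blk (g * h) a a a' a' = ?g21 * ?h12 + ?g22 * ?h22"
      by (simp only:) (rule blk_four_block(4)[of _ a a _ a' _ a'], auto)
    also have "?g21 * ?h12 = 0\<^sub>m a' a'" unfolding zero by (rule right_mult_zero_mat) simp
    also have "0\<^sub>m a' a' + ?g22 * ?h22 = ?g22 * ?h22" by (rule left_add_zero_mat) auto
    finally have "blk (1\<^sub>m n) a a a' a' = ?g22 * ?h22" unfolding inv(2) .
    moreover have "blk (1\<^sub>m n) a a a' a' = (1\<^sub>m a' :: 'a mat)" using na by (intro eq_matI) auto
    ultimately show ?thesis by simp
  qed
qed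

end

context induced_rep
begin

text \<open>Every tensor is a finite sum of pure tensors.\<close>

lemma tensor_smooth: "\<exists>e>0. e < 1 \<and> (\<forall>k1\<in>congruence_group r e. \<forall>k2\<in>congruence_group m e. \<sigma> k1 k2 t = t)"
proof -
  let ?S = "{v \<otimes>\<^sub>t w | v w. True} :: ('v, 'w) tensor set"
  have "complex_vector.span ?S = UNIV"
    by (rule span_eq_UNIV_if_contains_pure_tensors) (auto intro: complex_vector.span_base)
  then have "t \<in> complex_vector.span ?S" by simp
  then show ?thesis
  proof (induction rule: complex_vector.span_induct_alt)
    case base
    have "\<sigma> k1 k2 0 = 0" if k: "k1 \<in> congruence_group r (1/2)" "k2 \<in> congruence_group m (1/2)" for k1 k2
    proof -
      have "k1 \<in> carrier (GL r)" "k2 \<in> carrier (GL m)"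
        using congruence_group_GLO[OF k(1)] congruence_group_GLO[OF k(2)] GLO_subset_GL by auto
      then show ?thesis by (intro clinear_zero \<sigma>_linear)
    qed
    then show ?case by (intro exI[of _ "1/2"]) auto
  next
    case (step c x y)
    then obtain v w where x: "x = v \<otimes>\<^sub>t w" by blast
    obtain e0 where e0: "0 < e0" "e0 < 1" "\<forall>k1\<in>congruence_group r e0. \<forall>k2\<in>congruence_group m e0. \<sigma> k1 k2 y = y"
      using step.IH by blast
    obtain e1 where e1: "0 < e1" "\<forall>g\<in>congruence_group r e1. \<rho>1 g v = v" using smooth_rep_stabilizer[OF \<rho>1] by blast
    obtain e2 where e2: "0 < e2" "\<forall>g\<in>congruence_group m e2. \<rho>2 g w = w" using smooth_rep_stabilizer[OF \<rho>2] by blast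
    define e where "e = min e0 (min e1 e2)"
    have e: "0 < e" "e < 1" "e \<le> e0" "e \<le> e1" "e \<le> e2" using e0 e1 e2 by (auto simp: e_def)
    have "\<sigma> k1 k2 (c *\<^sub>C x + y) = c *\<^sub>C x + y"
      if k: "k1 \<in> congruence_group r e" "k2 \<in> congruence_group m e" for k1 k2
    proof -
      have G: "k1 \<in> carrier (GL r)" "k2 \<in> carrier (GL m)"
        using congruence_group_GLO[OF k(1) e(1,2)] congruence_group_GLO[OF k(2) e(1,2)] GLO_subset_GL by auto
      have "\<sigma> k1 k2 y = y"
        using e0(3) congruence_group_mono[OF k(1) e(3)] congruence_group_mono[OF k(2) e(3)] by blast
      moreover have "\<sigma> k1 k2 x = x"
        unfolding x \<sigma>_pure[OF G]
        using e1(2) e2(2) congruence_group_mono[OF k(1) e(4)] congruence_group_mono[OF k(2) e(5)] by simp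
      ultimately show ?thesis by (simp add: clinear_add[OF \<sigma>_linear[OF G]] clinear_scaleC[OF \<sigma>_linear[OF G]])
    qed
    then show ?case using e by blast
  qed
qed

abbreviation cell_of :: "nat \<Rightarrow> 'a mat set" where
  "cell_of c \<equiv> bruhat_cell.cell absv n c (n - c) (m - c) (n - (m - c))"

text \<open>The cells of rank below \<open>a\<close> form a closed set. The bounds on \<open>c\<close> make the four dimensions of a cell
  genuine, as subtraction truncates.\<close>

definition vanishes_below :: "nat \<Rightarrow> ('a mat \<Rightarrow> ('v, 'w) tensor) \<Rightarrow> bool" where
  "vanishes_below a f \<longleftrightarrow> (\<forall>c<a. c \<le> m \<longrightarrow> c \<le> n \<longrightarrow> m - c \<le> n \<longrightarrow> (\<forall>g\<in>cell_of c. f g = 0))"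

end

lemma uniform_bounds:
  fixes P :: "'t \<Rightarrow> real \<Rightarrow> real \<Rightarrow> bool"
  assumes "finite S" and "\<And>t. t \<in> S \<Longrightarrow> \<exists>c e. 0 < e \<and> (\<forall>c'\<ge>c. \<forall>e'. 0 < e' \<and> e' \<le> e \<longrightarrow> P t c' e')"
  shows "\<exists>c e. 0 < e \<and> (\<forall>t\<in>S. \<forall>c'\<ge>c. \<forall>e'. 0 < e' \<and> e' \<le> e \<longrightarrow> P t c' e')"
  using assms
proof (induction S rule: finite_induct)
  case empty
  show ?case by (intro exI[of _ 0] exI[of _ 1]) simp
next
  case (insert s S)
  obtain c1 e1 where 1: "0 < e1" "\<forall>c'\<ge>c1. \<forall>e'. 0 < e' \<and> e' \<le> e1 \<longrightarrow> P s c' e'" using insert.prems by blast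
  obtain c2 e2 where 2: "0 < e2" "\<forall>t\<in>S. \<forall>c'\<ge>c2. \<forall>e'. 0 < e' \<and> e' \<le> e2 \<longrightarrow> P t c' e'"
    using insert.IH insert.prems by blast
  show ?case by (rule exI[of _ "max c1 c2"], rule exI[of _ "min e1 e2"]) (use 1 2 in auto)
qed

context induced_cell
begin

lemma value_translate_small:
  assumes f: "\<And>g k. g \<in> carrier (GL (n + n)) \<Longrightarrow> k \<in> congruence_group (n + n) e \<Longrightarrow> f (g * k) = f g"
    and e: "0 < e" and h: "h1 \<in> GLO n" "h2 \<in> GLO n" and x: "x \<in> carrier_mat n n" and y: "y \<in> matball n n e"
  shows "f (w * (unip n n (x + y) * levi n h1 h2)) = f (w * (unip n n x * levi n h1 h2))"
proof -
  let ?l = "levi n h1 h2"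
  have l: "?l \<in> GLO (n + n)" by (rule levi_GLO[OF h])
  obtain l' where l': "l' \<in> GLO (n + n)" "?l * l' = 1\<^sub>m (n + n)" "l' * ?l = 1\<^sub>m (n + n)" using l by (rule GLO_obtain_inverse)
  note lc = GLO_carrier[OF l] GLO_carrier[OF l'(1)]
  note yc = matball_carrier[OF y]
  have k: "l' * unip n n y * ?l \<in> congruence_group (n + n) e"
    by (rule congruence_group_conj[OF GLO_matball[OF l] GLO_matball[OF l'(1)] l'(3) unip_congruence_group[OF y e] e])
  have yl: "unip n n y * ?l \<in> carrier_mat (n + n) (n + n)" by (rule mult_carrier_mat[OF unip_carrier lc(1)])
  have "unip n n (x + y) * ?l = unip n n x * (?l * (l' * unip n n y * ?l))"
  proof -
    have "?l * (l' * unip n n y * ?l) = ?l * (l' * (unip n n y * ?l))"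
      by (simp only: assoc_mult_mat[OF lc(2) unip_carrier lc(1)])
    also have "\<dots> = ?l * l' * (unip n n y * ?l)" by (simp only: assoc_mult_mat[OF lc yl])
    also have "\<dots> = unip n n y * ?l" unfolding l'(2) by (rule left_mult_one_mat[OF yl])
    finally show ?thesis
      by (simp only: unip_mult[OF x yc, symmetric] assoc_mult_mat[OF unip_carrier unip_carrier lc(1)])
  qed
  moreover have "w * (unip n n x * (?l * (l' * unip n n y * ?l))) = w * (unip n n x * ?l) * (l' * unip n n y * ?l)"
  proof -
    note kc = congruence_group_carrier[OF k]
    have xl: "unip n n x * ?l \<in> carrier_mat (n + n) (n + n)" by (rule mult_carrier_mat[OF unip_carrier lc(1)])
    show ?thesis
      by (simp only: assoc_mult_mat[OF w_carrier xl kc] assoc_mult_mat[OF unip_carrier lc(1) kc])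
  qed
  ultimately show ?thesis using f[OF w_unip_GL[OF x GLO_subset_GL[OF l]] k] by simp
qed

text \<open>By \<open>large_x12_near_smaller_cell\<close> a perturbation of size at most \<open>e\<close>, under which \<open>f\<close> is invariant, moves the
  point into a smaller cell, where \<open>f\<close> vanishes.\<close>

lemma value_eq_0_if_x12_large:
  assumes van: "vanishes_below a f"
    and f: "\<And>g k. g \<in> carrier (GL (n + n)) \<Longrightarrow> k \<in> congruence_group (n + n) e \<Longrightarrow> f (g * k) = f g"
    and e: "0 < e" "e < 1" and h: "h1 \<in> GLO n" "h2 \<in> GLO n" and x: "x \<in> carrier_mat n n"
    and large: "x12 x \<notin> matball a b' (1 / e)"
  shows "f (w * (unip n n x * levi n h1 h2)) = 0"
proof -
  let ?l = "levi n h1 h2"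
  have l: "?l \<in> GLO (n + n)" by (rule levi_GLO[OF h])
  obtain l' where l': "l' \<in> GLO (n + n)" "?l * l' = 1\<^sub>m (n + n)" "l' * ?l = 1\<^sub>m (n + n)" using l by (rule GLO_obtain_inverse)
  note lc = GLO_carrier[OF l] GLO_carrier[OF l'(1)]
  obtain i j where ij: "i < a" "j < b'" "1 / e < absv (x12 x $$ (i, j))"
    using large unfolding matball_def by force
  have nz: "x12 x $$ (i, j) \<noteq> 0"
  proof
    assume "x12 x $$ (i, j) = 0"
    then show False using ij(3) e(1) by (simp add: divide_less_0_iff)
  qed
  obtain k M where kc: "k \<in> carrier_mat (n + n) (n + n)"
    and kb: "k - 1\<^sub>m (n + n) \<in> matball (n + n) (n + n) (1 / absv (x12 x $$ (i, j)))"
    and M: "M \<in> carrier_mat a a" "\<And>j. j < a \<Longrightarrow> M $$ (i, j) = 0"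
    and blk: "blk (w * unip n n x * k) (a' + b') 0 (a + b) n = four_block_mat M (0\<^sub>m a a') (0\<^sub>m b a) (0\<^sub>m b a')"
    using large_x12_near_smaller_cell[OF x ij(1,2) nz] by blast
  have small: "1 / absv (x12 x $$ (i, j)) \<le> e"
  proof -
    have "0 < absv (x12 x $$ (i, j))" using ij(3) e(1) by (smt (verit) divide_pos_pos)
    then show ?thesis using ij(3) e(1) by (simp add: field_simps)
  qed
  have k: "k \<in> congruence_group (n + n) e"
    unfolding congruence_group_def using kc matball_mono[OF kb small] by simp
  have kG: "k \<in> carrier (GL (n + n))" by (rule GLO_subset_GL[OF congruence_group_GLO[OF k e]])
  define g where "g = w * unip n n x * k"
  have wx: "w * unip n n x \<in> carrier (GL (n + n))" by (intro GL_mult w_GL unip_GL x)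
  note wxc = GL_carrier[OF wx]
  have gG: "g \<in> carrier (GL (n + n))" unfolding g_def by (rule GL_mult[OF wx kG])
  have gG': "g \<in> carrier (GL (r + m))" using gG rm by simp
  obtain X Y c where XY: "X \<in> carrier (GL m)" "Y \<in> GLO n" "c \<le> m" "c \<le> n"
    and eq: "X * blk g r 0 m n * Y = rank_form m n c"
    using rank_normal_form[OF blk_carrier] by blast
  have "c < a"
    by (rule rank_lt_if_zero_row[OF M(1) ij(1) M(2), of X b Y a'])
      (use XY eq blk GL_carrier GLO_carrier m_eq na r_eq in \<open>auto simp: g_def\<close>)
  have cell: "m - c \<le> n" "g \<in> cell_of c"
    using bruhat_decomposition[OF gG' rm XY(1,2,3,4) eq] by auto
  interpret C: bruhat_cell absv n c "n - c" "m - c" "n - (m - c)"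
    by unfold_locales (use XY cell in auto)
  have "g * ?l \<in> cell_of c" by (rule C.cell_mult_levi[OF cell(2) h])
  then have g0: "f (g * ?l) = 0" using van \<open>c < a\<close> XY(3,4) cell(1) unfolding vanishes_below_def by blast
  have kl: "l' * k * ?l \<in> congruence_group (n + n) e"
    by (rule congruence_group_conj[OF GLO_matball[OF l] GLO_matball[OF l'(1)] l'(3) k e(1)])
  have "w * (unip n n x * ?l) * (l' * k * ?l) = g * ?l"
  proof -
    have kl': "k * ?l \<in> carrier_mat (n + n) (n + n)" by (rule mult_carrier_mat[OF kc lc(1)])
    have "?l * (l' * k * ?l) = ?l * (l' * (k * ?l))" by (simp only: assoc_mult_mat[OF lc(2) kc lc(1)])
    also have "\<dots> = ?l * l' * (k * ?l)" by (simp only: assoc_mult_mat[OF lc kl'])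
    also have "\<dots> = k * ?l" unfolding l'(2) by (rule left_mult_one_mat[OF kl'])
    finally have 1: "?l * (l' * k * ?l) = k * ?l" .
    have "w * (unip n n x * ?l) = w * unip n n x * ?l"
      by (rule assoc_mult_mat[OF w_carrier unip_carrier lc(1), symmetric])
    then show ?thesis
      by (simp only: assoc_mult_mat[OF wxc lc(1) congruence_group_carrier[OF kl]] 1 g_def assoc_mult_mat[OF wxc kc lc(1)])
  qed
  then show ?thesis using f[OF w_unip_GL[OF x GLO_subset_GL[OF l]] kl] g0 by simp
qed

text \<open>The values of \<open>f\<close> on the orbit are moved around by the stabilizer from finitely many vectors, and
  each of these is killed by large averages over the subgroup \<open>\<iota>\<close> of the stabilizer if it lies in the
  kernel for that subgroup. The stabilizer is abelian, so the averages may be taken before moving.\<close>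

lemma averages_vanish_on_orbit:
  assumes fI: "f \<in> Ind" and van: "vanishes_below a f"
    and f: "\<And>g k. g \<in> carrier (GL (n + n)) \<Longrightarrow> k \<in> congruence_group (n + n) e \<Longrightarrow> f (g * k) = f g"
    and e: "0 < e" "e < 1" and hh: "h1 \<in> GLO n" "h2 \<in> GLO n"
    and H: "H \<in> carrier_mat q p"
    and \<iota>: "\<And>y. y \<in> carrier_mat p q \<Longrightarrow> \<iota> y \<in> carrier_mat n n"
      "\<And>y. y \<in> carrier_mat p q \<Longrightarrow> x12 (\<iota> y) = 0\<^sub>m a b'"
      "\<And>y c. y \<in> matball p q c \<Longrightarrow> 0 \<le> c \<Longrightarrow> \<iota> y \<in> matball n n c"
      "\<And>x y. x \<in> carrier_mat p q \<Longrightarrow> y \<in> carrier_mat p q \<Longrightarrow> \<iota> (x + y) = \<iota> x + \<iota> y"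
      "inj_on \<iota> (carrier_mat p q)"
    and chi: "\<And>y. y \<in> carrier_mat p q \<Longrightarrow> chi h (\<iota> y) = chi H y"
    and full: "\<And>t. t \<in> complex_vector.span
      {\<sigma> (unip a' b' (x22 (\<iota> y))) (unip a b (x11 (\<iota> y))) s - chi H y *\<^sub>C s | y s. y \<in> carrier_mat p q}"
  shows "\<exists>c D. finite D \<and> D \<noteq> {} \<and> D \<subseteq> matball n n c \<and> (\<forall>z\<in>carrier_mat n n.
    (\<Sum>y\<in>D. inverse (chi h y) *\<^sub>C f (w * (unip n n (z + y) * levi n h1 h2))) = 0)"
proof -
  let ?l = "levi n h1 h2"
  define \<phi> where "\<phi> x = f (w * (unip n n x * ?l))" for x
  define S where "S s = \<sigma> (unip a' b' (x22 s)) (unip a b (x11 s))" for s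
  have G: "unip a' b' (x22 s) \<in> carrier (GL r)" "unip a b (x11 s) \<in> carrier (GL m)" for s
    unfolding r_eq m_eq by (auto intro: unip_GL)
  have lG: "?l \<in> carrier (GL (n + n))" by (rule GLO_subset_GL[OF levi_GLO[OF hh]])
  have S_lin: "clinear (S s)" for s unfolding S_def by (rule \<sigma>_linear[OF G])
  have \<phi>S: "\<phi> (s + x) = S s (\<phi> x)" if "s \<in> carrier_mat n n" "x12 s = 0\<^sub>m a b'" "x \<in> carrier_mat n n" for s x
    unfolding \<phi>_def S_def by (rule value_at_stabilizer_translate[OF fI that lG])
  have \<phi>_small: "\<phi> (x + y) = \<phi> x" if "x \<in> carrier_mat n n" "y \<in> matball n n e" for x y
    unfolding \<phi>_def by (rule value_translate_small[where e = e, OF f e(1) hh that])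
  have \<phi>0: "\<phi> x = 0" if "x \<in> carrier_mat n n" "x12 x \<notin> matball a b' (1 / e)" for x
    unfolding \<phi>_def by (rule value_eq_0_if_x12_large[where e = e, OF van f e hh that])
  have avg: "\<exists>c e. 0 < e \<and> (\<forall>c'\<ge>c. \<forall>e'. 0 < e' \<and> e' \<le> e \<longrightarrow>
     (\<Sum>y\<in>reps p q c' e'. inverse (chi H y) *\<^sub>C S (\<iota> y) t) = 0)" for t
  proof (rule average_eq_0_if_in_span[where V = UNIV and \<sigma> = "\<lambda>y. S (\<iota> y)", OF _ _ _ H])
    show "clinear (S (\<iota> y))" for y by (rule S_lin)
    show "S (\<iota> (x + y)) t = S (\<iota> x) (S (\<iota> y) t)" if xy: "x \<in> carrier_mat p q" "y \<in> carrier_mat p q" for x y t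
    proof -
      have 1: "x22 (\<iota> x + \<iota> y) = x22 (\<iota> x) + x22 (\<iota> y)" by (rule blk_add[OF \<iota>(1)[OF xy(1)] \<iota>(1)[OF xy(2)]]) (use na nb in auto)
      have 2: "x11 (\<iota> x + \<iota> y) = x11 (\<iota> x) + x11 (\<iota> y)" by (rule blk_add[OF \<iota>(1)[OF xy(1)] \<iota>(1)[OF xy(2)]]) (use na nb in auto)
      show ?thesis unfolding S_def \<iota>(4)[OF xy] 1 2 unip_mult[OF blk_carrier blk_carrier, symmetric]
        by (rule \<sigma>_mult[OF G(1) G(1) G(2) G(2)])
    qed
    show "\<exists>e>0. \<forall>y\<in>matball p q e. S (\<iota> y) t = t" for t
    proof -
      obtain d where d: "0 < d" "\<forall>k1\<in>congruence_group r d. \<forall>k2\<in>congruence_group m d. \<sigma> k1 k2 t = t"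
        using tensor_smooth[of t] by blast
      have "S (\<iota> y) t = t" if y: "y \<in> matball p q d" for y
      proof -
        have "\<iota> y \<in> matball n n d" by (rule \<iota>(3)[OF y]) (use d in simp)
        then have "x22 (\<iota> y) \<in> matball a' b' d" "x11 (\<iota> y) \<in> matball a b d"
          using na nb by (auto intro!: blk_matball[of _ n n])
        then show ?thesis using d unip_congruence_group unfolding S_def r_eq m_eq by blast
      qed
      then show ?thesis using d(1) by blast
    qed
    show "t \<in> complex_vector.span {S (\<iota> y) v - chi H y *\<^sub>C v | y v. y \<in> carrier_mat p q \<and> v \<in> UNIV}"
      using full[of t] by (simp add: S_def)
  qed
  \<comment> \<open>Modulo the stabilizer a point is given by \<open>x12\<close>. As \<open>f\<close> vanishes where \<open>x12\<close> exceeds \<open>1 / e\<close> and does not change under shifts by at most \<open>e\<close>, the values at these representatives suffice.\<close>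
  let ?R = "reps n n (1 / e) e"
  obtain c0 e0 where e0: "0 < e0" and zero: "\<And>t c' e'. t \<in> \<phi> ` ?R \<Longrightarrow> c0 \<le> c' \<Longrightarrow> 0 < e' \<Longrightarrow> e' \<le> e0 \<Longrightarrow>
      (\<Sum>y\<in>reps p q c' e'. inverse (chi H y) *\<^sub>C S (\<iota> y) t) = 0"
    using uniform_bounds[of "\<phi> ` ?R" "\<lambda>t c' e'. (\<Sum>y\<in>reps p q c' e'. inverse (chi H y) *\<^sub>C S (\<iota> y) t) = 0",
        OF finite_imageI[OF reps_finite[OF e(1)]] avg] by blast
  define c where "c = max 0 c0"
  let ?D0 = "reps p q c e0"
  have c: "0 \<le> c" "c0 \<le> c" by (auto simp: c_def)
  have D0c: "y \<in> carrier_mat p q" if "y \<in> ?D0" for y using reps_subset[OF e0 that] matball_carrier by blast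
  have inj: "inj_on \<iota> ?D0" using \<iota>(5) by (rule inj_on_subset) (use D0c in blast)
  have "(\<Sum>y\<in>\<iota> ` ?D0. inverse (chi h y) *\<^sub>C \<phi> (z + y)) = 0" if z: "z \<in> carrier_mat n n" for z
  proof -
    have 1: "(\<Sum>y\<in>\<iota> ` ?D0. inverse (chi h y) *\<^sub>C \<phi> (z + y)) = (\<Sum>y\<in>?D0. inverse (chi H y) *\<^sub>C \<phi> (z + \<iota> y))"
      using inj by (simp add: sum.reindex chi D0c)
    show ?thesis
    proof (cases "x12 z \<in> matball a b' (1 / e)")
      case False
      have "\<phi> (z + \<iota> y) = 0" if y: "y \<in> ?D0" for y
      proof (rule \<phi>0)
        note yc = \<iota>(1)[OF D0c[OF y]]
        show "z + \<iota> y \<in> carrier_mat n n" using z yc by simp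
        have "x12 (z + \<iota> y) = x12 z"
          unfolding x12_add[OF z yc] \<iota>(2)[OF D0c[OF y]] by (rule right_add_zero_mat) simp
        then show "x12 (z + \<iota> y) \<notin> matball a b' (1 / e)" using False by simp
      qed
      then show ?thesis unfolding 1 by simp
    next
      case True
      have tz: "top_part z \<in> matball n n (1 / e)" using True e by (intro top_part_matball) auto
      obtain \<tau> where \<tau>: "\<tau> \<in> ?R" "top_part z - \<tau> \<in> matball n n e" using reps_cover[OF e(1) tz] by blast
      have \<tau>c: "\<tau> \<in> carrier_mat n n" using reps_subset[OF e(1) \<tau>(1)] matball_carrier by blast
      have "\<tau> + (top_part z - \<tau>) = top_part z" using \<tau>c carrier_matD[OF top_part_carrier[of z]] by (intro eq_matI) auto
      then have \<phi>\<tau>: "\<phi> (top_part z) = \<phi> \<tau>" using \<phi>_small[OF \<tau>c \<tau>(2)] by simp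
      have "\<phi> (z + \<iota> y) = S (stab_part z) (S (\<iota> y) (\<phi> \<tau>))" if y: "y \<in> ?D0" for y
      proof -
        note yc = \<iota>(1)[OF D0c[OF y]]
        have iy: "\<iota> y + top_part z \<in> carrier_mat n n" using yc by simp
        have "z + \<iota> y = stab_part z + top_part z + \<iota> y" using stab_plus_top[OF z] by simp
        also have "\<dots> = stab_part z + (\<iota> y + top_part z)"
          using yc carrier_matD[OF stab_part_carrier[of z]] carrier_matD[OF top_part_carrier[of z]]
          by (intro eq_matI) auto
        finally have "\<phi> (z + \<iota> y) = S (stab_part z) (\<phi> (\<iota> y + top_part z))"
          using \<phi>S[OF stab_part_carrier stab_part_blocks(2) iy] by simp
        also have "\<phi> (\<iota> y + top_part z) = S (\<iota> y) (\<phi> \<tau>)"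
          using \<phi>S[OF yc \<iota>(2)[OF D0c[OF y]] top_part_carrier] \<phi>\<tau> by simp
        finally show ?thesis .
      qed
      then have "(\<Sum>y\<in>?D0. inverse (chi H y) *\<^sub>C \<phi> (z + \<iota> y)) =
          S (stab_part z) (\<Sum>y\<in>?D0. inverse (chi H y) *\<^sub>C S (\<iota> y) (\<phi> \<tau>))"
        by (simp add: clinear_sum[OF S_lin] clinear_scaleC[OF S_lin])
      also have "\<dots> = 0" using zero[of "\<phi> \<tau>" c e0] \<tau>(1) c e0 by (simp add: clinear_zero[OF S_lin])
      finally show ?thesis unfolding 1 .
    qed
  qed
  moreover have "finite (\<iota> ` ?D0)" using reps_finite[OF e0] by simp
  moreover have "\<iota> ` ?D0 \<noteq> {}" using reps_nonempty[OF e0 c(1)] by simp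
  moreover have "\<iota> ` ?D0 \<subseteq> matball n n c" using \<iota>(3)[OF reps_subset[OF e0] c(1)] by blast
  ultimately show ?thesis unfolding \<phi>_def by blast
qed

text \<open>The inclusions of the three components of the stabilizer.\<close>

definition emb11 :: "'a mat \<Rightarrow> 'a mat" where "emb11 y = four_block_mat y (0\<^sub>m a b') (0\<^sub>m a' b) (0\<^sub>m a' b')"
definition emb21 :: "'a mat \<Rightarrow> 'a mat" where "emb21 y = four_block_mat (0\<^sub>m a b) (0\<^sub>m a b') y (0\<^sub>m a' b')"
definition emb22 :: "'a mat \<Rightarrow> 'a mat" where "emb22 y = four_block_mat (0\<^sub>m a b) (0\<^sub>m a b') (0\<^sub>m a' b) y"

lemma emb11:
  assumes y: "y \<in> carrier_mat a b"
  shows "emb11 y \<in> carrier_mat n n" "x11 (emb11 y) = y" "x12 (emb11 y) = 0\<^sub>m a b'" "x21 (emb11 y) = 0\<^sub>m a' b"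
    "x22 (emb11 y) = 0\<^sub>m a' b'"
  unfolding emb11_def using y by (auto intro!: blk_four_block four_block_carrier_n)

lemma emb21:
  assumes y: "y \<in> carrier_mat a' b"
  shows "emb21 y \<in> carrier_mat n n" "x11 (emb21 y) = 0\<^sub>m a b" "x12 (emb21 y) = 0\<^sub>m a b'" "x21 (emb21 y) = y"
    "x22 (emb21 y) = 0\<^sub>m a' b'"
  unfolding emb21_def using y by (auto intro!: blk_four_block four_block_carrier_n)

lemma emb22:
  assumes y: "y \<in> carrier_mat a' b'"
  shows "emb22 y \<in> carrier_mat n n" "x11 (emb22 y) = 0\<^sub>m a b" "x12 (emb22 y) = 0\<^sub>m a b'" "x21 (emb22 y) = 0\<^sub>m a' b"
    "x22 (emb22 y) = y"
  unfolding emb22_def using y by (auto intro!: blk_four_block four_block_carrier_n)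

lemma emb_matball:
  "0 \<le> c \<Longrightarrow> y \<in> matball a b c \<Longrightarrow> emb11 y \<in> matball n n c"
  "0 \<le> c \<Longrightarrow> y \<in> matball a' b c \<Longrightarrow> emb21 y \<in> matball n n c"
  "0 \<le> c \<Longrightarrow> y \<in> matball a' b' c \<Longrightarrow> emb22 y \<in> matball n n c"
  unfolding emb11_def emb21_def emb22_def by (intro four_block_matball_n matball_zero; simp)+

lemma emb_add:
  "x \<in> carrier_mat a b \<Longrightarrow> y \<in> carrier_mat a b \<Longrightarrow> emb11 (x + y) = emb11 x + emb11 y"
  "x \<in> carrier_mat a' b \<Longrightarrow> y \<in> carrier_mat a' b \<Longrightarrow> emb21 (x + y) = emb21 x + emb21 y"
  "x \<in> carrier_mat a' b' \<Longrightarrow> y \<in> carrier_mat a' b' \<Longrightarrow> emb22 (x + y) = emb22 x + emb22 y"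
  unfolding emb11_def emb21_def emb22_def
  by (subst add_four_block_mat[of _ a b _ b' _ a']; simp)+

lemma chi_emb:
  assumes h: "h \<in> carrier_mat n n"
  shows "y \<in> carrier_mat a b \<Longrightarrow> chi h (emb11 y) = chi (blk h 0 0 b a) y"
    "y \<in> carrier_mat a' b \<Longrightarrow> chi h (emb21 y) = chi (blk h 0 a b a') y"
    "y \<in> carrier_mat a' b' \<Longrightarrow> chi h (emb22 y) = chi (blk h b a b' a') y"
  using chi_blocks[OF emb11(1) h] chi_blocks[OF emb21(1) h] chi_blocks[OF emb22(1) h]
  by (simp_all add: emb11 emb21 emb22 chi_zero)

lemma exists_nontrivial_value:
  assumes H: "H \<in> carrier_mat q p" "H \<noteq> 0\<^sub>m q p"
  shows "\<exists>y\<in>carrier_mat p q. chi H y \<noteq> 1"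
proof -
  have "\<exists>j<q. \<exists>i<p. H $$ (j, i) \<noteq> 0"
  proof (rule ccontr)
    assume "\<not> (\<exists>j<q. \<exists>i<p. H $$ (j, i) \<noteq> 0)"
    then have "H = 0\<^sub>m q p" using H(1) by (intro eq_matI) auto
    then show False using H(2) by simp
  qed
  then obtain i j where ij: "j < q" "i < p" "H $$ (j, i) \<noteq> 0" by blast
  obtain z where z: "\<psi> z \<noteq> 1" using psi_nontrivial by blast
  define y where "y = mat p q (\<lambda>(i', j'). if i' = i \<and> j' = j then z / H $$ (j, i) else 0)"
  have yc: "y \<in> carrier_mat p q" by (simp add: y_def)
  have "(y * H) $$ (i', i') = (if i' = i then z else 0)" if i': "i' < p" for i'
  proof -
    have "(y * H) $$ (i', i') = (\<Sum>l = 0..<q. y $$ (i', l) * H $$ (l, i'))"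
      using yc H i' by (simp add: scalar_prod_def)
    also have "\<dots> = (\<Sum>l = 0..<q. if l = j then (if i' = i then z else 0) else 0)"
      using i' ij by (intro sum.cong[OF refl]) (auto simp: y_def)
    finally show ?thesis using ij by simp
  qed
  then have "mat_trace (y * H) = (\<Sum>i'<p. if i' = i then z else 0)" using yc by (simp add: mat_trace_def)
  also have "\<dots> = z" using ij by simp
  finally show ?thesis using z yc by (intro bexI[of _ y]) (simp_all add: chi_def)
qed

lemma \<sigma>_one': "\<sigma> (1\<^sub>m (a' + b')) (1\<^sub>m (a + b)) t = t"
  using \<sigma>_one[of t] by (simp only: r_eq m_eq)

text \<open>The matrix \<open>h\<close> carries \<open>\<psi>\<close> to the orbit under consideration, and its block \<open>B \<rightarrow> F\<^sup>n/A\<close> decides the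
  case. If that block is non-zero, the component \<open>x21\<close> of the stabilizer acts trivially but has a
  non-trivial character, so its coinvariants are zero. Otherwise \<open>dim B \<le> dim A\<close>, the blocks \<open>F\<^sup>n/B \<rightarrow> F\<^sup>n/A\<close>
  and \<open>B \<rightarrow> A\<close> have full rank, and the twisted Jacquet module of \<open>\<rho>1\<close> or of \<open>\<rho>2\<close> for the corresponding
  characters is zero; then the component \<open>x22\<close> or \<open>x11\<close> does it.\<close>

lemma averages_vanish_pointwise:
  assumes fI: "f \<in> Ind" and van: "vanishes_below a f"
    and f: "\<And>g k. g \<in> carrier (GL (n + n)) \<Longrightarrow> k \<in> congruence_group (n + n) e \<Longrightarrow> f (g * k) = f g"
    and e: "0 < e" "e < 1" and hh: "h1 \<in> GLO n" "h2 \<in> GLO n" and h: "h \<in> GLO n"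
    and no_jacquet: "b \<le> a \<Longrightarrow> unip_kernel \<rho>1 a' b' (rank_form b' a' a') = UNIV \<or> unip_kernel \<rho>2 a b (rank_form b a b) = UNIV"
  shows "\<exists>c D. finite D \<and> D \<noteq> {} \<and> D \<subseteq> matball n n c \<and> (\<forall>z\<in>carrier_mat n n.
    (\<Sum>y\<in>D. inverse (chi h y) *\<^sub>C f (w * (unip n n (z + y) * levi n h1 h2))) = 0)"
proof (cases "blk h 0 a b a' = 0\<^sub>m b a'")
  case False
  note hc = GLO_carrier[OF h]
  let ?H = "blk h 0 a b a'"
  obtain y0 where y0: "y0 \<in> carrier_mat a' b" "chi ?H y0 \<noteq> 1"
    using exists_nontrivial_value[OF blk_carrier False] by blast
  show ?thesis
  proof (rule averages_vanish_on_orbit[where e = e and \<iota> = emb21 and H = ?H and p = a' and q = b, OF fI van f e hh])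
    fix t :: "('v, 'w) tensor"
    let ?B = "{\<sigma> (unip a' b' (x22 (emb21 y))) (unip a b (x11 (emb21 y))) s - chi ?H y *\<^sub>C s | y s. y \<in> carrier_mat a' b}"
    have "\<sigma> (unip a' b' (x22 (emb21 y0))) (unip a b (x11 (emb21 y0))) t = t"
      by (simp add: emb21[OF y0(1)] unip_zero \<sigma>_one')
    then have "t - chi ?H y0 *\<^sub>C t \<in> ?B" using y0(1) by (metis (mono_tags, lifting) mem_Collect_eq)
    then have "inverse (1 - chi ?H y0) *\<^sub>C (t - chi ?H y0 *\<^sub>C t) \<in> complex_vector.span ?B"
      by (intro complex_vector.span_scale complex_vector.span_base)
    moreover have "inverse (1 - chi ?H y0) *\<^sub>C (t - chi ?H y0 *\<^sub>C t) = t"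
    proof -
      have "t - chi ?H y0 *\<^sub>C t = (1 - chi ?H y0) *\<^sub>C t"
        by (simp add: complex_vector.scale_left_diff_distrib scaleC_one)
      then show ?thesis using y0(2) by (simp add: scaleC_scaleC scaleC_one)
    qed
    ultimately show "t \<in> complex_vector.span ?B" by simp
  next
    show "inj_on emb21 (carrier_mat a' b)" by (rule inj_onI) (metis emb21(4))
  qed (use emb21 emb_matball emb_add chi_emb[OF hc] in auto)
next
  case True
  note hc = GLO_carrier[OF h]
  let ?h11 = "blk h 0 0 b a" and ?h22 = "blk h b a b' a'"
  obtain g where g: "g \<in> GLO n" "h * g = 1\<^sub>m n" "g * h = 1\<^sub>m n" using h by (rule GLO_obtain_inverse)
  note inv11 = inverse_blocks(1)[OF hc GLO_carrier[OF g(1)] g(2,3) True]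
    and inv22 = inverse_blocks(2)[OF hc GLO_carrier[OF g(1)] g(2,3) True]
  have "b \<le> a" using rank_of_right_invertible[OF blk_carrier blk_carrier inv11] by blast
  have \<rho>1': "smooth_rep absv (a' + b') \<rho>1" and \<rho>2': "smooth_rep absv (a + b) \<rho>2"
    using \<rho>1 \<rho>2 by (simp_all flip: r_eq m_eq)
  have G1: "unip a' b' y \<in> carrier (GL r)" if "y \<in> carrier_mat a' b'" for y unfolding r_eq using that by (rule unip_GL)
  have G2: "unip a b y \<in> carrier (GL m)" if "y \<in> carrier_mat a b" for y unfolding m_eq using that by (rule unip_GL)
  have one1: "\<rho>1 (1\<^sub>m (a' + b')) v = v" for v using smooth_rep_one[OF \<rho>1'] .
  have one2: "\<rho>2 (1\<^sub>m (a + b)) v = v" for v using smooth_rep_one[OF \<rho>2'] .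
  have O: "1\<^sub>m (a' + b') \<in> carrier (GL r)" "1\<^sub>m (a + b) \<in> carrier (GL m)" by (simp_all add: r_eq m_eq GL_one)
  consider "unip_kernel \<rho>1 a' b' ?h22 = UNIV" | "unip_kernel \<rho>2 a b ?h11 = UNIV"
    using no_jacquet[OF \<open>b \<le> a\<close>] unip_kernel_left_invertible[OF \<rho>1' blk_carrier blk_carrier inv22]
      unip_kernel_right_invertible[OF \<rho>2' blk_carrier blk_carrier inv11] by blast
  then show ?thesis
  proof cases
    case 1
    show ?thesis
    proof (rule averages_vanish_on_orbit[where e = e and \<iota> = emb22 and H = ?h22 and p = a' and q = b', OF fI van f e hh])
      let ?B = "{\<sigma> (unip a' b' (x22 (emb22 y))) (unip a b (x11 (emb22 y))) s - chi ?h22 y *\<^sub>C s | y s. y \<in> carrier_mat a' b'}"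
      have pure: "v \<otimes>\<^sub>t u \<in> complex_vector.span ?B" for v u
      proof -
        have "v \<in> complex_vector.span {\<rho>1 (unip a' b' y) v - chi ?h22 y *\<^sub>C v | y v. y \<in> carrier_mat a' b'}"
          using 1 by (simp add: unip_kernel_def)
        then show ?thesis
        proof (induction rule: complex_vector.span_induct_alt)
          case base
          have "(0::'v) \<otimes>\<^sub>t u = 0" using tensor_bilinear(1)[of 0 0 u] by simp
          then show ?case by (simp add: complex_vector.span_zero)
        next
          case (step c x z)
          then obtain y s where y: "y \<in> carrier_mat a' b'" and x: "x = \<rho>1 (unip a' b' y) s - chi ?h22 y *\<^sub>C s" by blast
          have "x \<otimes>\<^sub>t u = \<sigma> (unip a' b' (x22 (emb22 y))) (unip a b (x11 (emb22 y))) (s \<otimes>\<^sub>t u) - chi ?h22 y *\<^sub>C (s \<otimes>\<^sub>t u)"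
          proof -
            have "x \<otimes>\<^sub>t u + (chi ?h22 y *\<^sub>C s) \<otimes>\<^sub>t u = \<rho>1 (unip a' b' y) s \<otimes>\<^sub>t u"
              unfolding tensor_bilinear(1)[symmetric] x by simp
            then have "x \<otimes>\<^sub>t u = \<rho>1 (unip a' b' y) s \<otimes>\<^sub>t u - chi ?h22 y *\<^sub>C (s \<otimes>\<^sub>t u)"
              unfolding tensor_bilinear(3) by (simp add: eq_diff_eq)
            then show ?thesis by (simp add: emb22[OF y] unip_zero \<sigma>_pure[OF G1[OF y] O(2)] one2)
          qed
          then have "x \<otimes>\<^sub>t u \<in> ?B" using y by blast
          then show ?case unfolding tensor_bilinear(1,3)
            by (intro complex_vector.span_add complex_vector.span_scale step.IH complex_vector.span_base)
        qed
      qed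
      show "t \<in> complex_vector.span ?B" for t
        using span_eq_UNIV_if_contains_pure_tensors[OF pure] by blast
    next
      show "inj_on emb22 (carrier_mat a' b')" by (rule inj_onI) (metis emb22(5))
    qed (use emb22 emb_matball emb_add chi_emb[OF hc] in auto)
  next
    case 2
    show ?thesis
    proof (rule averages_vanish_on_orbit[where e = e and \<iota> = emb11 and H = ?h11 and p = a and q = b, OF fI van f e hh])
      let ?B = "{\<sigma> (unip a' b' (x22 (emb11 y))) (unip a b (x11 (emb11 y))) s - chi ?h11 y *\<^sub>C s | y s. y \<in> carrier_mat a b}"
      have pure: "v \<otimes>\<^sub>t u \<in> complex_vector.span ?B" for v u
      proof -
        have "u \<in> complex_vector.span {\<rho>2 (unip a b y) v - chi ?h11 y *\<^sub>C v | y v. y \<in> carrier_mat a b}"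
          using 2 by (simp add: unip_kernel_def)
        then show ?thesis
        proof (induction rule: complex_vector.span_induct_alt)
          case base
          have "v \<otimes>\<^sub>t (0::'w) = 0" using tensor_bilinear(2)[of v 0 0] by simp
          then show ?case by (simp add: complex_vector.span_zero)
        next
          case (step c x z)
          then obtain y s where y: "y \<in> carrier_mat a b" and x: "x = \<rho>2 (unip a b y) s - chi ?h11 y *\<^sub>C s" by blast
          have "v \<otimes>\<^sub>t x = \<sigma> (unip a' b' (x22 (emb11 y))) (unip a b (x11 (emb11 y))) (v \<otimes>\<^sub>t s) - chi ?h11 y *\<^sub>C (v \<otimes>\<^sub>t s)"
          proof -
            have "v \<otimes>\<^sub>t x + v \<otimes>\<^sub>t (chi ?h11 y *\<^sub>C s) = v \<otimes>\<^sub>t \<rho>2 (unip a b y) s"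
              unfolding tensor_bilinear(2)[symmetric] x by simp
            then have "v \<otimes>\<^sub>t x = v \<otimes>\<^sub>t \<rho>2 (unip a b y) s - chi ?h11 y *\<^sub>C (v \<otimes>\<^sub>t s)"
              unfolding tensor_bilinear(4) by (simp add: eq_diff_eq)
            then show ?thesis by (simp add: emb11[OF y] unip_zero \<sigma>_pure[OF O(1) G2[OF y]] one1)
          qed
          then have "v \<otimes>\<^sub>t x \<in> ?B" using y by blast
          then show ?case unfolding tensor_bilinear(2,4)
            by (intro complex_vector.span_add complex_vector.span_scale step.IH complex_vector.span_base)
        qed
      qed
      show "t \<in> complex_vector.span ?B" for t
        using span_eq_UNIV_if_contains_pure_tensors[OF pure] by blast
    next
      show "inj_on emb11 (carrier_mat a b)" by (rule inj_onI) (metis emb11(2))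
    qed (use emb11 emb_matball emb_add chi_emb[OF hc] in auto)
  qed
qed

text \<open>Here \<open>h1'\<close> is the inverse of \<open>h1\<close>. Moving \<open>u(t)\<close> to the left across \<open>diag(h1, h2)\<close> turns \<open>t\<close> into
  \<open>y = h1 t h2\<^sup>-\<^sup>1\<close>, and \<open>tr(t) = tr(y h2 h1\<^sup>-\<^sup>1)\<close>. The radius \<open>c\<close> is recorded because a bound that is uniform in
  \<open>h1\<close> and \<open>h2\<close> is wanted.\<close>

definition averages_vanish :: "('a mat \<Rightarrow> ('v, 'w) tensor) \<Rightarrow> real \<Rightarrow> 'a mat \<Rightarrow> 'a mat \<Rightarrow> bool" where
  "averages_vanish f c h1 h2 \<longleftrightarrow> (\<exists>h1'\<in>GLO n. h1 * h1' = 1\<^sub>m n \<and> (\<exists>D. finite D \<and> D \<noteq> {} \<and> D \<subseteq> matball n n c \<and>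
    (\<forall>z\<in>carrier_mat n n.
      (\<Sum>y\<in>D. inverse (chi (h2 * h1') y) *\<^sub>C f (w * (unip n n (z + y) * levi n h1 h2))) = 0)))"

lemma averages_vanish_mono: "averages_vanish f c h1 h2 \<Longrightarrow> c \<le> d \<Longrightarrow> averages_vanish f d h1 h2"
  unfolding averages_vanish_def
  by (elim bexE conjE exE, intro bexI conjI exI, assumption+) (auto intro: matball_mono)

text \<open>The same set \<open>D\<close> serves for all nearby pairs: \<open>f\<close> is invariant under small translations, and the
  character changes little because \<open>D\<close> is bounded.\<close>

lemma averages_vanish_nearby:
  assumes fI: "f \<in> Ind" and van: "vanishes_below a f"
    and f: "\<And>g k. g \<in> carrier (GL (n + n)) \<Longrightarrow> k \<in> congruence_group (n + n) e \<Longrightarrow> f (g * k) = f g"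
    and e: "0 < e" "e < 1" and hh: "h1 \<in> GLO n" "h2 \<in> GLO n"
    and no_jacquet: "b \<le> a \<Longrightarrow> unip_kernel \<rho>1 a' b' (rank_form b' a' a') = UNIV \<or> unip_kernel \<rho>2 a b (rank_form b a b) = UNIV"
  shows "\<exists>c d. 0 < d \<and> (\<forall>k1\<in>GLO n. \<forall>k2\<in>GLO n. k1 - h1 \<in> matball n n d \<longrightarrow> k2 - h2 \<in> matball n n d \<longrightarrow>
    averages_vanish f c k1 k2)"
proof -
  obtain h1' where h1': "h1' \<in> GLO n" "h1 * h1' = 1\<^sub>m n" "h1' * h1 = 1\<^sub>m n" using hh(1) by (rule GLO_obtain_inverse)
  obtain h2' where h2': "h2' \<in> GLO n" "h2 * h2' = 1\<^sub>m n" "h2' * h2 = 1\<^sub>m n" using hh(2) by (rule GLO_obtain_inverse)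
  note hc = hh[THEN GLO_carrier] h1'(1)[THEN GLO_carrier] h2'(1)[THEN GLO_carrier]
  let ?h = "h2 * h1'"
  have hG: "?h \<in> GLO n" by (rule GLO_mult[OF hh(2) h1'(1)])
  obtain c D where D: "finite D" "D \<noteq> {}" "D \<subseteq> matball n n c" and zero: "\<And>z. z \<in> carrier_mat n n \<Longrightarrow>
      (\<Sum>y\<in>D. inverse (chi ?h y) *\<^sub>C f (w * (unip n n (z + y) * levi n h1 h2))) = 0"
    using averages_vanish_pointwise[where e = e, OF fI van f e hh hG no_jacquet] by blast
  obtain e0 where e0: "0 < e0" "\<And>x. absv x \<le> e0 \<Longrightarrow> \<psi> x = 1" using psi_locally_constant by blast
  define C where "C = max c 1"
  have C: "1 \<le> C" "c \<le> C" by (auto simp: C_def)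
  define d where "d = min e (e0 / C)"
  have d: "0 < d" "d \<le> e" "C * d \<le> e0" using e e0 C by (auto simp: d_def min_def field_simps)
  have "averages_vanish f c k1 k2"
    if k: "k1 \<in> GLO n" "k2 \<in> GLO n" and near: "k1 - h1 \<in> matball n n d" "k2 - h2 \<in> matball n n d" for k1 k2
  proof -
    obtain k1' where k1': "k1' \<in> GLO n" "k1 * k1' = 1\<^sub>m n" "k1' * k1 = 1\<^sub>m n" using k(1) by (rule GLO_obtain_inverse)
    note kc = k[THEN GLO_carrier] k1'(1)[THEN GLO_carrier]
    have small: "k2 * k1' - ?h \<in> matball n n d"
    proof -
      have 1: "(k2 - h2) * k1' \<in> matball n n d"
        using matball_mult[OF near(2) GLO_matball[OF k1'(1)]] d by simp
      have "h1 - k1 \<in> matball n n d" by (rule matball_diff_commute[OF kc(1) hc(1) near(1)])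
      then have "(h1 - k1) * h1' \<in> matball n n d"
        using matball_mult[of "h1 - k1" n n d h1' n 1] GLO_matball[OF h1'(1)] d by simp
      then have "k1' * ((h1 - k1) * h1') \<in> matball n n d"
        using matball_mult[of k1' n n 1 "(h1 - k1) * h1'" n d] GLO_matball[OF k1'(1)] d by simp
      then have 2: "h2 * (k1' * ((h1 - k1) * h1')) \<in> matball n n d"
        using matball_mult[of h2 n n 1 "k1' * ((h1 - k1) * h1')" n d] GLO_matball[OF hh(2)] d by simp
      have "(h1 - k1) * h1' = 1\<^sub>m n - k1 * h1'" using minus_mult_distrib_mat[OF hc(1) kc(1) hc(3)] h1' by simp
      then have "k1' * ((h1 - k1) * h1') = k1' - k1' * (k1 * h1')"
        using mult_minus_distrib_mat[of k1' n n "1\<^sub>m n" n "k1 * h1'"] kc hc by simp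
      also have "k1' * (k1 * h1') = h1'"
        unfolding assoc_mult_mat[OF kc(3,1) hc(3), symmetric] k1'(3) using hc by simp
      finally have "h2 * (k1' * ((h1 - k1) * h1')) = h2 * k1' - ?h"
        using mult_minus_distrib_mat[OF hc(2) kc(3) hc(3)] by simp
      moreover have "(k2 - h2) * k1' = k2 * k1' - h2 * k1'" by (rule minus_mult_distrib_mat[OF kc(2) hc(2) kc(3)])
      ultimately have "k2 * k1' - ?h = (k2 - h2) * k1' + h2 * (k1' * ((h1 - k1) * h1'))"
        using kc hc by (intro eq_matI) auto
      then show ?thesis using matball_add[OF 1 2] by simp
    qed
    have chi_eq: "chi (k2 * k1') y = chi ?h y" if y: "y \<in> D" for y
    proof -
      have yb: "y \<in> matball n n C" using D(3) y C by (auto intro: matball_mono)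
      note yc = matball_carrier[OF yb]
      have hc': "?h \<in> carrier_mat n n" "k2 * k1' - ?h \<in> carrier_mat n n" using hc kc by auto
      have "y * (k2 * k1') = y * ?h + y * (k2 * k1' - ?h)"
      proof -
        have "k2 * k1' = ?h + (k2 * k1' - ?h)" using hc kc by (intro eq_matI) auto
        then show ?thesis using mult_add_distrib_mat[OF yc hc'] by simp
      qed
      then have "mat_trace (y * (k2 * k1')) = mat_trace (y * ?h) + mat_trace (y * (k2 * k1' - ?h))"
        using mat_trace_add[of "y * ?h" n "y * (k2 * k1' - ?h)"] yc hc' by simp
      moreover have "absv (mat_trace (y * (k2 * k1' - ?h))) \<le> e0"
      proof -
        have "y * (k2 * k1' - ?h) \<in> matball n n (C * d)" by (rule matball_mult[OF yb small]) (use C d in auto)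
        then have "absv (mat_trace (y * (k2 * k1' - ?h))) \<le> C * d" by (rule mat_trace_matball) (use C d in auto)
        then show ?thesis using d(3) by simp
      qed
      ultimately show ?thesis using e0(2) by (simp add: chi_def psi_add)
    qed
    have f_eq: "f (w * (unip n n x * levi n k1 k2)) = f (w * (unip n n x * levi n h1 h2))" if x: "x \<in> carrier_mat n n" for x
    proof -
      let ?\<kappa> = "levi n (h1' * k1) (h2' * k2)"
      have diff: "h' * kk - 1\<^sub>m n \<in> matball n n d"
        if "h' \<in> GLO n" "h' * hx = 1\<^sub>m n" "hx \<in> carrier_mat n n" "kk \<in> carrier_mat n n" "kk - hx \<in> matball n n d" for h' hx kk
      proof -
        have "h' * (kk - hx) \<in> matball n n d"
          using matball_mult[OF GLO_matball[OF that(1)] that(5)] d by simp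
        then show ?thesis using mult_minus_distrib_mat[OF GLO_carrier[OF that(1)] that(4,3)] that(2) by simp
      qed
      have "?\<kappa> - 1\<^sub>m (n + n) = four_block_mat (h1' * k1 - 1\<^sub>m n) (0\<^sub>m n n) (0\<^sub>m n n) (h2' * k2 - 1\<^sub>m n)"
        unfolding levi_def using hc kc by (intro eq_matI) auto
      also have "\<dots> \<in> matball (n + n) (n + n) d"
        using diff[OF h1'(1,3) hc(1) kc(1) near(1)] diff[OF h2'(1,3) hc(2) kc(2) near(2)] d
        by (intro four_block_matball matball_zero) auto
      finally have \<kappa>: "?\<kappa> \<in> congruence_group (n + n) e"
        unfolding congruence_group_def using matball_mono[of _ "n + n" "n + n" d e] d hc kc by (auto intro: levi_carrier)
      have "h1 * (h1' * k1) = k1" unfolding assoc_mult_mat[OF hc(1,3) kc(1), symmetric] h1'(2) using kc by simp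
      moreover have "h2 * (h2' * k2) = k2" unfolding assoc_mult_mat[OF hc(2,4) kc(2), symmetric] h2'(2) using kc by simp
      ultimately have l: "levi n k1 k2 = levi n h1 h2 * ?\<kappa>"
        using levi_mult[OF hc(1,2), of "h1' * k1" "h2' * k2"] hc kc by simp
      have lc: "levi n h1 h2 \<in> carrier_mat (n + n) (n + n)" using hc by (auto intro: levi_carrier)
      note \<kappa>c = congruence_group_carrier[OF \<kappa>]
      have xl: "unip n n x * levi n h1 h2 \<in> carrier_mat (n + n) (n + n)" by (rule mult_carrier_mat[OF unip_carrier lc])
      have "w * (unip n n x * levi n k1 k2) = w * (unip n n x * levi n h1 h2) * ?\<kappa>"
        unfolding l by (simp only: assoc_mult_mat[OF w_carrier xl \<kappa>c] assoc_mult_mat[OF unip_carrier lc \<kappa>c])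
      then show ?thesis using f[OF w_unip_GL[OF x GLO_subset_GL[OF levi_GLO[OF hh]]] \<kappa>] by simp
    qed
    have "(\<Sum>y\<in>D. inverse (chi (k2 * k1') y) *\<^sub>C f (w * (unip n n (z + y) * levi n k1 k2))) = 0"
      if z: "z \<in> carrier_mat n n" for z
    proof -
      have "(\<Sum>y\<in>D. inverse (chi (k2 * k1') y) *\<^sub>C f (w * (unip n n (z + y) * levi n k1 k2))) =
          (\<Sum>y\<in>D. inverse (chi ?h y) *\<^sub>C f (w * (unip n n (z + y) * levi n h1 h2)))"
      proof (rule sum.cong[OF refl])
        fix y assume y: "y \<in> D"
        then have "z + y \<in> carrier_mat n n" using z D(3) matball_carrier by auto
        then show "inverse (chi (k2 * k1') y) *\<^sub>C f (w * (unip n n (z + y) * levi n k1 k2)) =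
            inverse (chi ?h y) *\<^sub>C f (w * (unip n n (z + y) * levi n h1 h2))"
          using chi_eq[OF y] f_eq by simp
      qed
      then show ?thesis using zero[OF z] by simp
    qed
    then show ?thesis unfolding averages_vanish_def using k1' D by blast
  qed
  then show ?thesis using d(1) by blast
qed

text \<open>Compactness of \<open>GL\<^sub>n(O) \<times> GL\<^sub>n(O)\<close>: a pair is encoded as one integral \<open>n \<times> 2n\<close> matrix, and the pairs of
  invertible integral matrices are both open and closed among these.\<close>

lemma averages_vanish_uniformly:
  assumes fI: "f \<in> Ind" and van: "vanishes_below a f"
    and f: "\<And>g k. g \<in> carrier (GL (n + n)) \<Longrightarrow> k \<in> congruence_group (n + n) e \<Longrightarrow> f (g * k) = f g"
    and e: "0 < e" "e < 1"
    and no_jacquet: "b \<le> a \<Longrightarrow> unip_kernel \<rho>1 a' b' (rank_form b' a' a') = UNIV \<or> unip_kernel \<rho>2 a b (rank_form b a b) = UNIV"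
  shows "\<exists>c. \<forall>h1\<in>GLO n. \<forall>h2\<in>GLO n. averages_vanish f c h1 h2"
proof -
  define fst' where "fst' Y = blk Y 0 0 n n" for Y :: "'a mat"
  define snd' where "snd' Y = blk Y 0 n n n" for Y :: "'a mat"
  define Q where "Q c Y \<longleftrightarrow> (fst' Y \<in> GLO n \<longrightarrow> snd' Y \<in> GLO n \<longrightarrow> averages_vanish f c (fst' Y) (snd' Y))" for c Y
  have diff: "fst' Y - fst' X \<in> matball n n d" "snd' Y - snd' X \<in> matball n n d"
    if "X \<in> carrier_mat n (n + n)" "Y \<in> carrier_mat n (n + n)" "Y - X \<in> matball n (n + n) d" for X Y d
    using blk_diff[OF that(2,1), of 0 n 0 n] blk_diff[OF that(2,1), of 0 n n n]
      blk_matball[OF that(3), of 0 n 0 n] blk_matball[OF that(3), of 0 n n n]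
    by (simp_all add: fst'_def snd'_def)
  have c': "fst' Y \<in> carrier_mat n n" "snd' Y \<in> carrier_mat n n" for Y by (simp_all add: fst'_def snd'_def)
  have "\<exists>c. \<forall>Y\<in>matball n (n + n) 1. Q c Y"
  proof (rule locally_bounded_imp_bounded)
    show "Q d Y" if "Q c Y" "c \<le> d" for c d Y
      using that averages_vanish_mono by (auto simp: Q_def)
    fix X assume X: "X \<in> matball n (n + n) 1"
    note Xc = matball_carrier[OF X]
    show "\<exists>c e. 0 < e \<and> (\<forall>Y\<in>matball n (n + n) 1. Y - X \<in> matball n (n + n) e \<longrightarrow> Q c Y)"
    proof (cases "fst' X \<in> GLO n \<and> snd' X \<in> GLO n")
      case True
      obtain c d where d: "0 < d" "\<And>k1 k2. k1 \<in> GLO n \<Longrightarrow> k2 \<in> GLO n \<Longrightarrow> k1 - fst' X \<in> matball n n d \<Longrightarrow>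
          k2 - snd' X \<in> matball n n d \<Longrightarrow> averages_vanish f c k1 k2"
        using averages_vanish_nearby[where e = e, OF fI van f e _ _ no_jacquet, of "fst' X" "snd' X"] True by blast
      have "Q c Y" if "Y \<in> matball n (n + n) 1" "Y - X \<in> matball n (n + n) d" for Y
        unfolding Q_def using d(2) diff[OF Xc matball_carrier[OF that(1)] that(2)] by blast
      then show ?thesis using d(1) by blast
    next
      case False
      have "Q 0 Y" if Y: "Y \<in> matball n (n + n) 1" and near: "Y - X \<in> matball n (n + n) (1/2)" for Y
      proof -
        have "fst' X - fst' Y \<in> matball n n (1/2)" "snd' X - snd' Y \<in> matball n n (1/2)"
          using diff[OF Xc matball_carrier[OF Y] near] matball_diff_commute[OF c'(1) c'(1)] matball_diff_commute[OF c'(2) c'(2)]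
          by blast+
        then show ?thesis using False GLO_open c' unfolding Q_def by blast
      qed
      then show ?thesis by (intro exI[of _ 0] exI[of _ "1/2"]) auto
    qed
  qed
  then obtain c where c: "\<And>Y. Y \<in> matball n (n + n) 1 \<Longrightarrow> Q c Y" by blast
  have "averages_vanish f c h1 h2" if h: "h1 \<in> GLO n" "h2 \<in> GLO n" for h1 h2
  proof -
    define Y where "Y = mat n (n + n) (\<lambda>(i, j). if j < n then h1 $$ (i, j) else h2 $$ (i, j - n))"
    have "Y \<in> matball n (n + n) 1"
      by (rule matballI) (use GLO_matball[OF h(1)] GLO_matball[OF h(2)] in \<open>auto simp: Y_def intro: matball_entry\<close>)
    moreover have "fst' Y = h1" "snd' Y = h2"
      using GLO_carrier[OF h(1)] GLO_carrier[OF h(2)] by (auto intro!: eq_matI simp: fst'_def snd'_def Y_def)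
    ultimately show ?thesis using c[of Y] h by (simp add: Q_def)
  qed
  then show ?thesis by blast
qed

text \<open>The substitution \<open>t \<mapsto> h1 t h2\<^sup>-\<^sup>1\<close> permutes the classes, because \<open>h1\<close> and \<open>h2\<close> are integral with integral
  inverses, and turns the average into one along the orbit, to which the sums over \<open>D\<close> apply.\<close>

lemma average_vanishes_on_cell:
  assumes fI: "f \<in> Ind"
    and f: "\<And>g k. g \<in> carrier (GL (n + n)) \<Longrightarrow> k \<in> congruence_group (n + n) e \<Longrightarrow> f (g * k) = f g"
    and e: "0 < e" "e < 1" and psi_e: "\<And>x. absv x \<le> e \<Longrightarrow> \<psi> x = 1"
    and all: "\<And>h1 h2. h1 \<in> GLO n \<Longrightarrow> h2 \<in> GLO n \<Longrightarrow> averages_vanish f c h1 h2"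
    and g: "g \<in> cell"
  shows "(\<Sum>t\<in>reps n n c e. inverse (chi (1\<^sub>m n) t) *\<^sub>C f (g * unip n n t)) = 0"
proof -
  obtain A X D x h1 h2 where h: "A \<in> carrier (GL (a' + b'))" "X \<in> carrier_mat (a' + b') (a + b)"
    "D \<in> carrier (GL (a + b))" "x \<in> carrier_mat n n" "h1 \<in> GLO n" "h2 \<in> GLO n"
    and g_eq: "g = para (a' + b') (a + b) A X D * (w * (unip n n x * levi n h1 h2))"
    using g unfolding cell_def by blast
  have A: "A \<in> carrier (GL r)" and X: "X \<in> carrier_mat r m" and D: "D \<in> carrier (GL m)"
    using h by (simp_all add: r_eq m_eq)
  from all[OF h(5,6), unfolded averages_vanish_def] obtain h1' S where
    h1': "h1' \<in> GLO n" "h1 * h1' = 1\<^sub>m n" and S: "finite S" "S \<noteq> {}" "S \<subseteq> matball n n c"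
    and zero': "\<forall>z\<in>carrier_mat n n.
      (\<Sum>y\<in>S. inverse (chi (h2 * h1') y) *\<^sub>C f (w * (unip n n (z + y) * levi n h1 h2))) = 0"
    by (elim bexE conjE exE) (rule that)
  note zero = bspec[OF zero']
  have h1'2: "h1' * h1 = 1\<^sub>m n"
    by (rule mat_mult_left_right_inverse[OF GLO_carrier[OF h(5)] GLO_carrier[OF h1'(1)] h1'(2)])
  obtain h2' where h2': "h2' \<in> GLO n" "h2 * h2' = 1\<^sub>m n" "h2' * h2 = 1\<^sub>m n" using h(6) by (rule GLO_obtain_inverse)
  note hc = h(5,6)[THEN GLO_carrier] h1'(1)[THEN GLO_carrier] h2'(1)[THEN GLO_carrier]
  let ?l = "levi n h1 h2" and ?h = "h2 * h1'"
  have hG: "?h \<in> GLO n" by (rule GLO_mult[OF h(6) h1'(1)])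
  note hGc = GLO_carrier[OF hG]
  have lG: "?l \<in> carrier (GL (n + n))" by (rule GLO_subset_GL[OF levi_GLO[OF h(5,6)]])
  define \<phi> where "\<phi> y = f (w * (unip n n y * ?l))" for y
  define F where "F y = inverse (chi ?h y) *\<^sub>C \<phi> (x + y)" for y
  have F_const: "F y = F y'" if y: "y \<in> matball n n c" "y' \<in> matball n n c" and d: "y - y' \<in> matball n n e" for y y'
  proof -
    note yc = matball_carrier[OF y(1)] matball_carrier[OF y(2)] matball_carrier[OF d]
    have dec: "y = y' + (y - y')" using yc by (intro eq_matI) auto
    have "chi ?h (y - y') = 1"
    proof -
      have "(y - y') * ?h \<in> matball n n (e * 1)" by (rule matball_mult[OF d GLO_matball[OF hG]]) (use e in auto)
      then have "absv (mat_trace ((y - y') * ?h)) \<le> e" using e by (intro mat_trace_matball[of _ n]) auto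
      then show ?thesis using psi_e by (simp add: chi_def)
    qed
    then have 1: "chi ?h y = chi ?h y'" using chi_add[OF hGc yc(2,3)] dec by simp
    have "x + y = (x + y') + (y - y')" using yc h(4) by (intro eq_matI) auto
    then have 2: "\<phi> (x + y) = \<phi> (x + y')"
      unfolding \<phi>_def using value_translate_small[where e = e and f = f, OF f e(1) h(5,6) _ d, of "x + y'"] yc h(4) by simp
    show ?thesis using 1 2 by (simp add: F_def)
  qed
  let ?\<alpha> = "\<lambda>t. h1 * t * h2'"
  have \<alpha>: "?\<alpha> t \<in> matball n n c'" if t: "t \<in> matball n n c'" and "0 \<le> c'" for t c'
  proof -
    have "h1 * t \<in> matball n n c'" using matball_mult[OF GLO_matball[OF h(5)] t] that(2) by simp
    then show ?thesis using matball_mult[of "h1 * t" n n c' h2' n 1] GLO_matball[OF h2'(1)] that(2) by simp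
  qed
  have inv: "h1' * (?\<alpha> t) * h2 = t" if t: "t \<in> carrier_mat n n" for t
  proof -
    have th: "t * h2' \<in> carrier_mat n n" "h1 * t \<in> carrier_mat n n" using t hc by auto
    have "h1' * (h1 * t * h2') = t * h2'"
      unfolding assoc_mult_mat[OF hc(1) t hc(4)] assoc_mult_mat[OF hc(3,1) th(1), symmetric] h1'2
      by (rule left_mult_one_mat[OF th(1)])
    then have "h1' * (?\<alpha> t) * h2 = t * h2' * h2" by simp
    also have "\<dots> = t * 1\<^sub>m n" unfolding assoc_mult_mat[OF t hc(4,2)] h2'(3) ..
    finally show ?thesis using right_mult_one_mat[OF t] by simp
  qed
  have \<alpha>R: "y - y' \<in> matball n n e"
    if y: "y \<in> matball n n c" "y' \<in> matball n n c" and d: "?\<alpha> y - ?\<alpha> y' \<in> matball n n e" for y y'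
  proof -
    note yc = matball_carrier[OF y(1)] matball_carrier[OF y(2)]
    have yd: "y - y' \<in> carrier_mat n n" by (rule minus_carrier_mat[OF yc(2)])
    have "?\<alpha> (y - y') = ?\<alpha> y - ?\<alpha> y'"
      using mult_minus_distrib_mat[OF hc(1) yc] minus_mult_distrib_mat[of "h1 * y" n n "h1 * y'" h2' n] yc hc by simp
    then have "?\<alpha> (y - y') \<in> matball n n e" using d by simp
    then have "h1' * (?\<alpha> (y - y')) \<in> matball n n e"
      using matball_mult[OF GLO_matball[OF h1'(1)], of "?\<alpha> (y - y')" n e] e by simp
    then have "h1' * (?\<alpha> (y - y')) * h2 \<in> matball n n e"
      using matball_mult[of "h1' * (?\<alpha> (y - y'))" n n e h2 n 1] GLO_matball[OF h(6)] e by simp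
    then show ?thesis unfolding inv[OF yd] .
  qed
  have c0: "0 \<le> c" if "t \<in> matball n n c" "0 < n" for t
    using matball_entry[OF that(1) that(2) that(2)] absv_nonneg[of "t $$ (0, 0)"] by linarith
  have \<alpha>c: "?\<alpha> t \<in> matball n n c" if t: "t \<in> matball n n c" for t
  proof (cases "n = 0")
    case True
    then show ?thesis using matball_carrier[OF t] hc by (intro matballI) auto
  qed (use \<alpha>[OF t] c0[OF t] in simp)
  have chi_\<alpha>: "chi ?h (?\<alpha> t) = chi (1\<^sub>m n) t" if t: "t \<in> carrier_mat n n" for t
  proof -
    have ht: "h1 * t \<in> carrier_mat n n" "h1 * t * h2' \<in> carrier_mat n n" using t hc by auto
    have "?\<alpha> t * ?h = h1 * t * (h2' * (h2 * h1'))" by (rule assoc_mult_mat[OF ht(1) hc(4) hGc])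
    also have "h2' * (h2 * h1') = h1'" unfolding assoc_mult_mat[OF hc(4,2,3), symmetric] h2'(3)
      by (rule left_mult_one_mat[OF hc(3)])
    finally have "mat_trace (?\<alpha> t * ?h) = mat_trace (h1' * (h1 * t))"
      using mat_trace_commute[OF ht(1) hc(3)] by simp
    also have "h1' * (h1 * t) = t * 1\<^sub>m n" unfolding assoc_mult_mat[OF hc(3,1) t, symmetric] h1'2
      unfolding left_mult_one_mat[OF t] right_mult_one_mat[OF t] ..
    finally show ?thesis by (simp add: chi_def)
  qed
  have Tb: "t \<in> matball n n c" "t \<in> carrier_mat n n" if "t \<in> reps n n c e" for t
    using reps_subset[OF e(1) that] matball_carrier by blast+
  have term_eq: "inverse (chi (1\<^sub>m n) t) *\<^sub>C f (g * unip n n t) = coef A D *\<^sub>C \<sigma> A D (F (?\<alpha> t))"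
    if t: "t \<in> reps n n c e" for t
  proof -
    have xc: "x + ?\<alpha> t \<in> carrier_mat n n" using h(4) hc Tb[OF t] by auto
    have "g * unip n n t = para r m A X D * (w * (unip n n (x + ?\<alpha> t) * ?l))"
      unfolding g_eq r_eq m_eq
      by (rule cell_element_mult_unip[OF h(1,3,4,5,6) hc(4) h2'(3) Tb(2)[OF t]])
    then have "f (g * unip n n t) = coef A D *\<^sub>C \<sigma> A D (\<phi> (x + ?\<alpha> t))"
      using Ind_equivariant[OF fI A X D w_unip_GL[OF xc lG]] by (simp add: \<phi>_def)
    then show ?thesis
      by (simp add: F_def chi_\<alpha>[OF Tb(2)[OF t]] clinear_scaleC[OF \<sigma>_linear[OF A D]] scaleC_scaleC mult.commute)
  qed
  have "(\<Sum>t\<in>reps n n c e. F (?\<alpha> t)) = (\<Sum>t\<in>reps n n c e. F t)"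
    by (rule reps_sum_reindex[where \<alpha> = ?\<alpha> and \<phi> = F, OF e(1) \<alpha>c \<alpha>R F_const])
  also have "\<dots> = 0"
  proof (rule reps_sum_eq_0_if_subsums_eq_0[OF e(1) S F_const])
    fix z assume z: "z \<in> matball n n c"
    note zc = matball_carrier[OF z]
    have "(\<Sum>y\<in>S. F (z + y)) = (\<Sum>y\<in>S. inverse (chi ?h z) *\<^sub>C inverse (chi ?h y) *\<^sub>C \<phi> (x + z + y))"
    proof (rule sum.cong[OF refl])
      fix y assume "y \<in> S"
      then have yc: "y \<in> carrier_mat n n" using S(3) matball_carrier by blast
      have "x + (z + y) = x + z + y" using h(4) zc yc by (intro eq_matI) auto
      then show "F (z + y) = inverse (chi ?h z) *\<^sub>C inverse (chi ?h y) *\<^sub>C \<phi> (x + z + y)"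
        by (simp add: F_def chi_add[OF hGc zc yc] scaleC_scaleC)
    qed
    also have "\<dots> = inverse (chi ?h z) *\<^sub>C (\<Sum>y\<in>S. inverse (chi ?h y) *\<^sub>C \<phi> (x + z + y))"
      by (simp only: complex_vector.scale_sum_right)
    also have "\<dots> = 0" using zero[of "x + z"] h(4) zc by (simp add: \<phi>_def)
    finally show "(\<Sum>y\<in>S. F (z + y)) = 0" .
  qed
  finally have F0: "(\<Sum>t\<in>reps n n c e. F (?\<alpha> t)) = 0" .
  have "(\<Sum>t\<in>reps n n c e. inverse (chi (1\<^sub>m n) t) *\<^sub>C f (g * unip n n t)) =
      (\<Sum>t\<in>reps n n c e. coef A D *\<^sub>C \<sigma> A D (F (?\<alpha> t)))"
    by (rule sum.cong[OF refl term_eq])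
  also have "\<dots> = coef A D *\<^sub>C \<sigma> A D (\<Sum>t\<in>reps n n c e. F (?\<alpha> t))"
    by (simp only: clinear_sum[OF \<sigma>_linear[OF A D]] complex_vector.scale_sum_right)
  also have "\<dots> = 0" unfolding F0 by (simp add: clinear_zero[OF \<sigma>_linear[OF A D]])
  finally show ?thesis .
qed

text \<open>The twisted average of \<open>f\<close> over a large ball in \<open>N\<close> is congruent to \<open>f\<close> modulo the kernel. It vanishes on
  the cell of rank \<open>a\<close> by the choice of the ball, and still vanishes on the smaller cells, as these are stable under \<open>N\<close>.\<close>

lemma exists_representative_vanishing_on_cell:
  assumes fI: "f \<in> Ind" and van: "vanishes_below a f"
    and no_jacquet: "b \<le> a \<Longrightarrow> unip_kernel \<rho>1 a' b' (rank_form b' a' a') = UNIV \<or> unip_kernel \<rho>2 a b (rank_form b a b) = UNIV"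
  shows "\<exists>f'\<in>Ind. f - f' \<in> Ker \<and> vanishes_below (Suc a) f'"
proof -
  obtain e1 where e1: "0 < e1" "e1 < 1" "\<And>g k. g \<in> carrier (GL (n + n)) \<Longrightarrow> k \<in> congruence_group (n + n) e1 \<Longrightarrow> f (g * k) = f g"
    using Ind_smooth[OF fI] by blast
  obtain e2 where e2: "0 < e2" "\<And>x. absv x \<le> e2 \<Longrightarrow> \<psi> x = 1" using psi_locally_constant by blast
  define e where "e = min e1 e2"
  have e: "0 < e" "e < 1" using e1 e2 by (auto simp: e_def)
  have f: "f (g * k) = f g" if "g \<in> carrier (GL (n + n))" "k \<in> congruence_group (n + n) e" for g k
    by (rule e1(3)[OF that(1) congruence_group_mono[OF that(2)]]) (simp add: e_def)
  have psi_e: "\<psi> x = 1" if "absv x \<le> e" for x using e2(2) that by (simp add: e_def)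
  obtain c0 where c0: "\<And>h1 h2. h1 \<in> GLO n \<Longrightarrow> h2 \<in> GLO n \<Longrightarrow> averages_vanish f c0 h1 h2"
    using averages_vanish_uniformly[where e = e, OF fI van f e no_jacquet] by blast
  define c where "c = max 0 c0"
  have c: "0 \<le> c" by (simp add: c_def)
  have all: "averages_vanish f c h1 h2" if "h1 \<in> GLO n" "h2 \<in> GLO n" for h1 h2
    by (rule averages_vanish_mono[OF c0[OF that]]) (simp add: c_def)
  let ?T = "reps n n c e"
  define N where "N = (of_nat (card ?T) :: complex)"
  have N: "N \<noteq> 0" using reps_finite[OF e(1)] reps_nonempty[OF e(1) c] by (simp add: N_def)
  have Tc: "t \<in> carrier_mat n n" if "t \<in> ?T" for t using reps_subset[OF e(1) that] matball_carrier by blast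
  define f' where "f' = inverse N *\<^sub>C (\<Sum>t\<in>?T. inverse (chi (1\<^sub>m n) t) *\<^sub>C \<pi> (unip n n t) f)"
  have "f' \<in> Ind" unfolding f'_def
    by (intro complex_vector.subspace_scale[OF Ind_subspace] complex_vector.subspace_sum[OF Ind_subspace]
        Ind_translate[OF fI] unip_GL Tc)
  moreover have "f - f' \<in> Ker"
  proof -
    have fN: "inverse N *\<^sub>C (\<Sum>t\<in>?T. f) = f"
      using N by (simp add: complex_vector.sum_constant_scale scaleC_scaleC scaleC_one flip: N_def)
    have term_eq: "f - inverse (chi (1\<^sub>m n) t) *\<^sub>C \<pi> (unip n n t) f =
        (- inverse (chi (1\<^sub>m n) t)) *\<^sub>C (\<pi> (unip n n t) f - chi (1\<^sub>m n) t *\<^sub>C f)" for t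
      by (simp add: complex_vector.scale_right_diff_distrib complex_vector.scale_minus_left scaleC_scaleC scaleC_one)
    have "f - f' = inverse N *\<^sub>C (\<Sum>t\<in>?T. f)
        - inverse N *\<^sub>C (\<Sum>t\<in>?T. inverse (chi (1\<^sub>m n) t) *\<^sub>C \<pi> (unip n n t) f)"
      by (simp only: fN f'_def)
    also have "\<dots> = inverse N *\<^sub>C ((\<Sum>t\<in>?T. f) - (\<Sum>t\<in>?T. inverse (chi (1\<^sub>m n) t) *\<^sub>C \<pi> (unip n n t) f))"
      by (rule complex_vector.scale_right_diff_distrib[symmetric])
    also have "(\<Sum>t\<in>?T. f) - (\<Sum>t\<in>?T. inverse (chi (1\<^sub>m n) t) *\<^sub>C \<pi> (unip n n t) f) =
        (\<Sum>t\<in>?T. (- inverse (chi (1\<^sub>m n) t)) *\<^sub>C (\<pi> (unip n n t) f - chi (1\<^sub>m n) t *\<^sub>C f))"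
      unfolding sum_subtractf[symmetric] term_eq ..
    also have "inverse N *\<^sub>C \<dots> \<in> Ker"
      unfolding Ker_def
      by (intro complex_vector.span_scale complex_vector.span_sum complex_vector.span_base) (use Tc fI in blast)
    finally show ?thesis .
  qed
  moreover have "vanishes_below (Suc a) f'"
    unfolding vanishes_below_def
  proof (intro allI impI ballI)
    fix c' g assume c': "c' < Suc a" "c' \<le> m" "c' \<le> n" "m - c' \<le> n" and g: "g \<in> cell_of c'"
    interpret C: bruhat_cell absv n c' "n - c'" "m - c'" "n - (m - c')"
      by unfold_locales (use c' in auto)
    have "(\<Sum>t\<in>?T. inverse (chi (1\<^sub>m n) t) *\<^sub>C f (g * unip n n t)) = 0"
    proof (cases "c' = a")
      case True
      have "n - c' = a'" "m - c' = b" "n - (m - c') = b'" using True na nb m_eq by auto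
      then have g': "g \<in> cell" using g True by simp
      show ?thesis using average_vanishes_on_cell[where e = e and f = f and c = c and g = g, OF fI f e psi_e all g'] by blast
    next
      case False
      have "f (g * unip n n t) = 0" if "t \<in> ?T" for t
      proof -
        have "c' < a" using c'(1) False by simp
        then show ?thesis
          using van C.cell_mult_unip[OF g Tc[OF that]] c'(2-) unfolding vanishes_below_def by blast
      qed
      then show ?thesis by simp
    qed
    then show "f' g = 0"
      unfolding f'_def by (cases "g \<in> carrier (GL (n + n))")
        (simp_all add: scaleC_fun_def sum_fun_apply right_translation_def)
  qed
  ultimately show ?thesis by blast
qed

end

context induced_rep
begin

text \<open>The cells are removed in the order of increasing rank; a function that vanishes on all of them is zero.\<close>

lemma Ind_subset_Ker:
  assumes no_jacquet: "\<And>a. a \<le> m \<Longrightarrow> a \<le> n \<Longrightarrow> m - a \<le> n \<Longrightarrow> m - a \<le> a \<Longrightarrow>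
      unip_kernel \<rho>1 (n - a) (n - (m - a)) (rank_form (n - (m - a)) (n - a) (n - a)) = UNIV \<or>
      unip_kernel \<rho>2 a (m - a) (rank_form (m - a) a (m - a)) = UNIV"
  shows "Ind \<subseteq> Ker"
proof
  fix f assume f: "f \<in> Ind"
  have "\<exists>f'\<in>Ind. f - f' \<in> Ker \<and> vanishes_below a f'" for a
  proof (induction a)
    case 0
    have "f - f \<in> Ker" unfolding diff_self Ker_def by (rule complex_vector.span_zero)
    moreover have "vanishes_below 0 f" by (simp add: vanishes_below_def)
    ultimately show ?case using f by blast
  next
    case (Suc a)
    then obtain f1 where f1: "f1 \<in> Ind" "f - f1 \<in> Ker" "vanishes_below a f1" by blast
    show ?case
    proof (cases "a \<le> m \<and> a \<le> n \<and> m - a \<le> n")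
      case True
      interpret C: induced_cell absv \<psi> n r m \<rho>1 \<rho>2 a "n - a" "m - a" "n - (m - a)"
        by unfold_locales (use True rm in auto)
      obtain f2 where f2: "f2 \<in> Ind" "f1 - f2 \<in> Ker" "vanishes_below (Suc a) f2"
        using C.exists_representative_vanishing_on_cell[OF f1(1,3)] no_jacquet[of a] True by blast
      have "f - f2 = (f - f1) + (f1 - f2)" by simp
      also have "\<dots> \<in> Ker" using f1(2) f2(2) unfolding Ker_def by (rule complex_vector.span_add)
      finally show ?thesis using f2 by blast
    next
      case False
      have "vanishes_below (Suc a) f1"
        using f1(3) False unfolding vanishes_below_def by (metis less_Suc_eq)
      then show ?thesis using f1 by blast
    qed
  qed
  then obtain f' where f': "f' \<in> Ind" "f - f' \<in> Ker" "vanishes_below (Suc m) f'" by blast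
  have "f' g = 0" for g
  proof (cases "g \<in> carrier (GL (n + n))")
    case True
    then have g: "g \<in> carrier (GL (r + m))" using rm by simp
    obtain X Y a where XY: "X \<in> carrier (GL m)" "Y \<in> GLO n" "a \<le> m" "a \<le> n"
      and eq: "X * blk g r 0 m n * Y = rank_form m n a"
      using rank_normal_form[OF blk_carrier] by blast
    show ?thesis
      using f'(3)[unfolded vanishes_below_def] bruhat_decomposition[OF g rm XY eq] XY(3,4) le_imp_less_Suc by blast
  qed (rule Ind_zero_outside[OF f'(1)])
  then have "f' = 0" by (simp add: fun_eq_iff)
  then show "f \<in> Ker" using f'(2) by simp
qed

end

context additive_character
begin

lemma exists_unip_functional:
  assumes "unip_kernel \<rho> p q H \<noteq> UNIV"
  shows "\<exists>f v. clinear f \<and> f v = (1::complex) \<and> (\<forall>y u. y \<in> carrier_mat p q \<longrightarrow> f (\<rho> (unip p q y) u) = chi H y * f u)"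
proof -
  obtain v where v: "v \<notin> unip_kernel \<rho> p q H" using assms by blast
  from exists_separating_functional[OF v[unfolded unip_kernel_def]] obtain f where f: "clinear f" "f v = (1::complex)"
    "\<And>x. x \<in> {\<rho> (unip p q y) v - chi H y *\<^sub>C v | y v. y \<in> carrier_mat p q} \<Longrightarrow> f x = 0" by blast
  have "f (\<rho> (unip p q y) u) = chi H y * f u" if "y \<in> carrier_mat p q" for y u
  proof -
    have "f (\<rho> (unip p q y) u - chi H y *\<^sub>C u) = 0" by (rule f(3)) (use that in blast)
    then show ?thesis by (simp add: clinear_diff[OF f(1)] clinear_functional_scaleC[OF f(1)])
  qed
  then show ?thesis using f(1,2) by blast
qed

end

context induced_cell
begin

text \<open>For \<open>b \<le> a\<close> the two blocks of the identity matrix have full rank, so their characters are equivalent to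
  those of the normal forms.\<close>

lemma not_Ind_subset_Ker_if:
  assumes ba: "b \<le> a"
    and 1: "unip_kernel \<rho>1 a' b' (rank_form b' a' a') \<noteq> UNIV" and 2: "unip_kernel \<rho>2 a b (rank_form b a b) \<noteq> UNIV"
  shows "\<not> Ind \<subseteq> Ker"
proof -
  have zero: "blk (1\<^sub>m n) 0 a b a' = (0\<^sub>m b a' :: 'a mat)" using ba na nb by (intro eq_matI) auto
  have one: "1\<^sub>m n * 1\<^sub>m n = (1\<^sub>m n :: 'a mat)" by simp
  note inv = inverse_blocks[OF one_carrier_mat one_carrier_mat one one zero]
  have \<rho>1': "smooth_rep absv (a' + b') \<rho>1" and \<rho>2': "smooth_rep absv (a + b) \<rho>2"
    using \<rho>1 \<rho>2 by (simp_all flip: r_eq m_eq)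
  have "unip_kernel \<rho>1 a' b' (blk (1\<^sub>m n) b a b' a') \<noteq> UNIV"
    using 1 unip_kernel_left_invertible[OF \<rho>1' blk_carrier blk_carrier inv(2)] by blast
  from exists_unip_functional[OF this] obtain L1 v0 where L1: "clinear L1" "L1 v0 = (1::complex)"
    "\<And>y u. y \<in> carrier_mat a' b' \<Longrightarrow> L1 (\<rho>1 (unip a' b' y) u) = chi (blk (1\<^sub>m n) b a b' a') y * L1 u" by blast
  have "unip_kernel \<rho>2 a b (blk (1\<^sub>m n) 0 0 b a) \<noteq> UNIV"
    using 2 unip_kernel_right_invertible[OF \<rho>2' blk_carrier blk_carrier inv(1)] by blast
  from exists_unip_functional[OF this] obtain L2 w0 where L2: "clinear L2" "L2 w0 = (1::complex)"
    "\<And>y u. y \<in> carrier_mat a b \<Longrightarrow> L2 (\<rho>2 (unip a b y) u) = chi (blk (1\<^sub>m n) 0 0 b a) y * L2 u" by blast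
  show ?thesis by (rule not_Ind_subset_Ker[OF ba L1 L2])
qed

end

theorem corollary4p13:
  fixes absv :: "'a::field \<Rightarrow> real"
    and \<psi>\<^sub>0 :: "'a \<Rightarrow> complex"
    and n r :: nat
    and \<rho>\<^sub>1 :: "'a mat \<Rightarrow> 'v::complex_vector \<Rightarrow> 'v"
    and \<rho>\<^sub>2 :: "'a mat \<Rightarrow> 'w::complex_vector \<Rightarrow> 'w"
  assumes "nonarchimedean_local_field absv"
    and "nontrivial_additive_character absv \<psi>\<^sub>0"
    and "1 \<le> r" and "r < 2 * n"
    and "smooth_rep absv r \<rho>\<^sub>1"
    and "smooth_rep absv (2 * n - r) \<rho>\<^sub>2"
  shows "twisted_jacquet_nonzero
           (parabolic_induction_space absv r (2 * n - r) \<rho>\<^sub>1 \<rho>\<^sub>2) (right_translation (2 * n))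
           (N_group n) (N_char \<psi>\<^sub>0 n)
         \<longleftrightarrow>
         (\<exists>k::nat. max 0 (int r - int n) \<le> int k \<and> int k \<le> \<lfloor>real r / 2\<rfloor> \<and>
            twisted_jacquet_nonzero UNIV \<rho>\<^sub>1 (N1_group r k) (N1_char \<psi>\<^sub>0 k) \<and>
            twisted_jacquet_nonzero UNIV \<rho>\<^sub>2 (N2_group n r k) (N2_char \<psi>\<^sub>0 n r k))"
proof -
  define m where "m = 2 * n - r"
  have rm: "r + m = n + n" using assms(4) by (simp add: m_def)
  interpret additive_character absv \<psi>\<^sub>0
    using assms(1,2) by (intro additive_character.intro additive_character_axioms.intro)
  interpret induced_rep absv \<psi>\<^sub>0 n r m \<rho>\<^sub>1 \<rho>\<^sub>2
    by unfold_locales (use rm assms(5,6) in \<open>simp_all add: m_def\<close>)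
  have lhs: "twisted_jacquet_nonzero (parabolic_induction_space absv r (2 * n - r) \<rho>\<^sub>1 \<rho>\<^sub>2) (right_translation (2 * n))
       (N_group n) (N_char \<psi>\<^sub>0 n) \<longleftrightarrow> \<not> Ind \<subseteq> Ker"
  proof -
    have I: "parabolic_induction_space absv r (2 * n - r) \<rho>\<^sub>1 \<rho>\<^sub>2 = Ind" using Ind_def by (simp only: m_def)
    have R: "right_translation (2 * n) = \<pi>" by (simp add: mult_2)
    show ?thesis unfolding I R
      using twisted_jacquet_nonzero_iff[OF Ind_subspace, of \<pi> "N_group n" "N_char \<psi>\<^sub>0 n"] Ker_subset_Ind
      unfolding jacquet_kernel_N by blast
  qed
  have univ: "twisted_jacquet_nonzero UNIV \<rho> U \<theta> \<longleftrightarrow> jacquet_kernel UNIV \<rho> U \<theta> \<noteq> UNIV"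
    for \<rho> :: "'a mat \<Rightarrow> 'x::complex_vector \<Rightarrow> 'x" and U \<theta>
    using twisted_jacquet_nonzero_iff[OF complex_vector.subspace_UNIV, of \<rho> U \<theta>] by blast
  have rhs: "twisted_jacquet_nonzero UNIV \<rho>\<^sub>1 (N1_group r k) (N1_char \<psi>\<^sub>0 k) \<longleftrightarrow>
        unip_kernel \<rho>\<^sub>1 k (r - k) (rank_form (r - k) k k) \<noteq> UNIV"
      "twisted_jacquet_nonzero UNIV \<rho>\<^sub>2 (N2_group n r k) (N2_char \<psi>\<^sub>0 n r k) \<longleftrightarrow>
        unip_kernel \<rho>\<^sub>2 (n - k) (n + k - r) (rank_form (n + k - r) (n - k) (n + k - r)) \<noteq> UNIV"
    if k: "2 * k \<le> r" "r \<le> n + k" for k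
  proof -
    show "twisted_jacquet_nonzero UNIV \<rho>\<^sub>1 (N1_group r k) (N1_char \<psi>\<^sub>0 k) \<longleftrightarrow>
        unip_kernel \<rho>\<^sub>1 k (r - k) (rank_form (r - k) k k) \<noteq> UNIV"
      unfolding univ jacquet_kernel_N1[OF k(1)] ..
    \<comment> \<open>The character \<open>\<psi>\<^bsub>k,2\<^esub>\<close> is given by a matrix of full rank, which may be replaced by the normal form.\<close>
    have dims: "n - k = (r - 2 * k) + (n + k - r)" "n - k + (n + k - r) = m" using k rm by auto
    have "smooth_rep absv (n - k + (n + k - r)) \<rho>\<^sub>2" using \<rho>2 dims(2) by simp
    then have "unip_kernel \<rho>\<^sub>2 (n - k) (n + k - r) (bottom_form (r - 2 * k) (n + k - r)) = UNIV \<longleftrightarrow>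
        unip_kernel \<rho>\<^sub>2 (n - k) (n + k - r) (rank_form (n + k - r) (n - k) (n + k - r)) = UNIV"
      by (rule unip_kernel_right_invertible[OF _ _ _ bottom_form_right_invertible])
        (use dims(1) in \<open>simp_all add: bottom_form_def\<close>)
    then show "twisted_jacquet_nonzero UNIV \<rho>\<^sub>2 (N2_group n r k) (N2_char \<psi>\<^sub>0 n r k) \<longleftrightarrow>
        unip_kernel \<rho>\<^sub>2 (n - k) (n + k - r) (rank_form (n + k - r) (n - k) (n + k - r)) \<noteq> UNIV"
      unfolding univ jacquet_kernel_N2[OF k] by simp
  qed
  have range: "max 0 (int r - int n) \<le> int k \<and> int k \<le> \<lfloor>real r / 2\<rfloor> \<longleftrightarrow> 2 * k \<le> r \<and> r \<le> n + k" for k :: nat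
  proof -
    have "int k \<le> \<lfloor>real r / 2\<rfloor> \<longleftrightarrow> 2 * k \<le> r" by (simp add: le_floor_iff) linarith
    then show ?thesis by auto
  qed
  have "\<not> Ind \<subseteq> Ker \<longleftrightarrow> (\<exists>k. 2 * k \<le> r \<and> r \<le> n + k \<and>
      unip_kernel \<rho>\<^sub>1 k (r - k) (rank_form (r - k) k k) \<noteq> UNIV \<and>
      unip_kernel \<rho>\<^sub>2 (n - k) (n + k - r) (rank_form (n + k - r) (n - k) (n + k - r)) \<noteq> UNIV)"
    (is "_ \<longleftrightarrow> (\<exists>k. ?P k)")
  proof
    assume "\<not> Ind \<subseteq> Ker"
    then obtain a where a: "a \<le> m" "a \<le> n" "m - a \<le> n" "m - a \<le> a"
      "unip_kernel \<rho>\<^sub>1 (n - a) (n - (m - a)) (rank_form (n - (m - a)) (n - a) (n - a)) \<noteq> UNIV"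
      "unip_kernel \<rho>\<^sub>2 a (m - a) (rank_form (m - a) a (m - a)) \<noteq> UNIV"
      using Ind_subset_Ker by blast
    have "n - (m - a) = r - (n - a)" "n - (n - a) = a" "n + (n - a) - r = m - a" "2 * (n - a) \<le> r" "r \<le> n + (n - a)"
      using a rm by auto
    then have "?P (n - a)" using a by simp
    then show "\<exists>k. ?P k" ..
  next
    assume "\<exists>k. ?P k"
    then obtain k where k: "?P k" ..
    \<comment> \<open>The stratum with \<open>dim A = n - k\<close> and \<open>dim B = n + k - r\<close>.\<close>
    interpret C: induced_cell absv \<psi>\<^sub>0 n r m \<rho>\<^sub>1 \<rho>\<^sub>2 "n - k" k "n + k - r" "r - k"
      by unfold_locales (use k rm assms(4) in auto)
    show "\<not> Ind \<subseteq> Ker" by (rule C.not_Ind_subset_Ker_if) (use k in auto)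
  qed
  then show ?thesis unfolding lhs using range rhs by metis
qed

end
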